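(* Assume that the damping, source and parameter conditions (A) and the homogeneity conditions (B) listed in the context hold, and let $1<p<5$ and $q>1$. Let $(u_0,u_1)\in H^1_{\Gamma_0}(\Omega)\times L^2(\Omega)$ with $u_0\in L^{m+1}(\Omega)$, and $(w_0,w_1)\in H^2_0(\Gamma)\times L^2(\Gamma)$. Assume $(u_0,w_0)\in\tilde{\mathcal{W}}_1^\delta$ and $\mathcal{E}(0)\le\Lambda(s^*-\delta)$ for a sufficiently small $\delta>0$. Let $(u,w)$ be the global potential well solution of system (P) (see context), and, if $m>5$, suppose in addition that $u\in L^\infty(\mathbb{R}^+;L^{\frac32(m-1)}(\Omega))$. Then for all $T\ge T_0$, $$\mathcal{E}(T)\le\tilde C\,\Phi(D(T)),$$ where $D(T)=\int_0^T\int_\Omega g_1(u_t)u_t\,dxd\tau+\int_0^T\int_\Gamma g_2(w_t)w_t\,d\Gamma d\tau$; $\Phi$, $T_0$ and the constant $\tilde C>0$ are defined in the context, and $\tilde C$ is independent of $T$.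
   Context: **Domain and notation.** $\Omega\subset\mathbb{R}^3$ is a bounded, open, connected set with smooth boundary $\partial\Omega=\overline{\Gamma_0\cup\Gamma}$, where $\Gamma_0,\Gamma$ are disjoint, open, connected subsets of $\partial\Omega$ of positive measure, and $\Gamma$ is flat. $|\Omega|$, $|\Gamma|$ denote their measures. $\nu$ and $\nu_\Gamma$ are the outer normals to $\Gamma$ and $\partial\Gamma$. $\|\cdot\|_s$ is the norm of $L^s(\Omega)$, $|\cdot|_s$ the norm of $L^s(\Gamma)$; $(\cdot,\cdot)_\Omega$, $(\cdot,\cdot)_\Gamma$ are the $L^2$ inner products; $\gamma u=u|_\Gamma$ is the trace on $\Gamma$. $H^1_{\Gamma_0}(\Omega)=\{u\in H^1(\Omega):u|_{\Gamma_0}=0\}$ with norm $\|\nabla u\|_2$; $H^2_0(\Gamma)$ has norm $|\Delta w|_2$. $X=H^1_{\Gamma_0}(\Omega)\times H^2_0(\Gamma)$ with norm $\|(u,w)\|_X=(\|\nabla u\|_2^2+|\Delta w|_2^2)^{1/2}$. **System (P).** $$\begin{cases}u_{tt}-\Delta u+g_1(u_t)=f(u)&\text{in }\Omega\times(0,T),\\ w_{tt}+\Delta^2w+g_2(w_t)+u_t|_\Gamma=h(w)&\text{in }\Gamma\times(0,T),\\ u=0&\text{on }\Gamma_0\times(0,T),\\ \partial_\nu u=w_t&\text{on }\Gamma\times(0,T),\\ w=\partial_{\nu_\Gamma}w=0&\text{on }\partial\Gamma\times(0,T),\\ (u(0),u_t(0))=(u_0,u_1),\quad (w(0),w_t(0))=(w_0,w_1).\end{cases}$$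 **Conditions (A).** $g_1,g_2:\mathbb{R}\to\mathbb{R}$ are continuous, monotone increasing, $g_1(0)=g_2(0)=0$, and there are constants $\alpha,\beta>0$ such that for $|s|\ge1$: $\alpha|s|^{m+1}\le g_1(s)s\le\beta|s|^{m+1}$ with $m\ge1$, and $\alpha|s|^{r+1}\le g_2(s)s\le\beta|s|^{r+1}$ with $r\ge1$. $f,h\in C^1(\mathbb{R})$ with $|f'(s)|\le C(|s|^{p-1}+1)$, $1\le p<6$, and $|h'(s)|\le C(|s|^{q-1}+1)$, $1\le q<\infty$. Moreover $p\frac{m+1}{m}<6$. **Conditions (B).** There are nonnegative $F,H\in C^1(\mathbb{R})$ with $F'=f$, $H'=h$, $F(\lambda s)=\lambda^{p+1}F(s)$ and $H(\lambda s)=\lambda^{q+1}H(s)$ for all $\lambda>0$, $s\in\mathbb{R}$. Consequently there is a constant $M>0$, fixed throughout, with $F(s)\le M|s|^{p+1}$ and $H(s)\le M|s|^{q+1}$ for all $s\in\mathbb{R}$. **Weak solution on $[0,T]$.** A pair $(u,w)$ with: $u\in C([0,T];H^1_{\Gamma_0}(\Omega))$, $u_t\in C([0,T];L^2(\Omega))\cap L^{m+1}(\Omega\times(0,T))$; $w\in C([0,T];H^2_0(\Gamma))$, $w_t\in C([0,T];L^2(\Gamma))\cap L^{r+1}(\Gamma\times(0,T))$; the initial conditions $(u(0),u_t(0))=(u_0,u_1)$, $(w(0),w_t(0))=(w_0,w_1)$ hold; and for all $t\in[0,T]$ $$(u_t(t),\phi(t))_\Omega-(u_1,\phi(0))_\Omega-\int_0^t(u_t,\phi_t)_\Omega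 d\tau+\int_0^t(\nabla u,\nabla\phi)_\Omega d\tau-\int_0^t(w_t,\gamma\phi)_\Gamma d\tau+\int_0^t\!\int_\Omega g_1(u_t)\phi\,dxd\tau=\int_0^t\!\int_\Omega f(u)\phi\,dxd\tau,$$ $$(w_t(t)+\gamma u(t),\psi(t))_\Gamma-(w_1+\gamma u(0),\psi(0))_\Gamma-\int_0^t(w_t,\psi_t)_\Gamma d\tau-\int_0^t(\gamma u,\psi_t)_\Gamma d\tau+\int_0^t(\Delta w,\Delta\psi)_\Gamma d\tau+\int_0^t\!\int_\Gamma g_2(w_t)\psi\,d\Gamma d\tau=\int_0^t\!\int_\Gamma h(w)\psi\,d\Gamma d\tau,$$ for all $\phi\in C([0,T];H^1_{\Gamma_0}(\Omega))\cap L^{m+1}(\Omega\times(0,T))$ with $\phi_t\in L^1(0,T;L^2(\Omega))$ and all $\psi\in C([0,T];H^2_0(\Gamma))$ with $\psi_t\in L^1(0,T;L^2(\Gamma))$. A global weak solution is a pair defined on $[0,\infty)$ that is a weak solution on $[0,T]$ for every $T>0$. **Energies and potential well.** Quadratic energy: $E(t)=\frac12(\|u_t(t)\|_2^2+|w_t(t)|_2^2+\|\nabla u(t)\|_2^2+|\Delta w(t)|_2^2)$. Potential energy functional on $X$: $\mathcal{J}(u,w)=\frac12(\|\nabla u\|_2^2+|\Delta w|_2^2)-\int_\Omega F(u)dx-\int_\Gamma H(w)d\Gamma$. Total energy: $\mathcal{E}(t)=\frac12(\|u_t(t)\|_2^2+|w_t(t)|_2^2)+\mathcal{J}(u(t),w(t))$.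 Nehari manifold: $\mathcal{N}=\{(u,w)\in X\setminus\{(0,0)\}:\|\nabla u\|_2^2+|\Delta w|_2^2=(p+1)\int_\Omega F(u)dx+(q+1)\int_\Gamma H(w)d\Gamma\}$; $d=\inf_{\mathcal{N}}\mathcal{J}$; $\mathcal{W}=\{(u,w)\in X:\mathcal{J}(u,w)<d\}$; $\mathcal{W}_1=\{(u,w)\in\mathcal{W}:\|\nabla u\|_2^2+|\Delta w|_2^2>(p+1)\int_\Omega F(u)dx+(q+1)\int_\Gamma H(w)d\Gamma\}\cup\{(0,0)\}$. **The function $\Lambda$, the number $s^*$, and the set $\tilde{\mathcal{W}}_1^\delta$.** Let $K_1=\sup_{u\in H^1_{\Gamma_0}(\Omega)\setminus\{0\}}\|u\|_{p+1}^{p+1}/\|\nabla u\|_2^{p+1}$ and $K_2=\sup_{w\in H^2_0(\Gamma)\setminus\{0\}}|w|_{q+1}^{q+1}/|\Delta w|_2^{q+1}$ (finite). $\Lambda(s)=\frac12s^2-MK_1s^{p+1}-MK_2s^{q+1}$, and $s^*>0$ is the unique positive number with $MK_1(p+1)(s^* )^{p-1}+MK_2(q+1)(s^* )^{q-1}=1$ (the point where $\Lambda$ attains its maximum on $[0,\infty)$). For sufficiently small $\delta>0$, $\tilde{\mathcal{W}}_1^\delta=\{(u,w)\in X:\|(u,w)\|_X\le s^*-\delta,\ \mathcal{J}(u,w)\le\Lambda(s^*-\delta)\}$; it is contained in $\mathcal{W}_1$. **Global potential well solution.** With $c=\min\{p+1,q+1\}>2$, for such data a global weak solution $(u,w)$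 exists which satisfies the energy identity $\mathcal{E}(t)+\int_0^t\int_\Omega g_1(u_t)u_t\,dxd\tau+\int_0^t\int_\Gamma g_2(w_t)w_t\,d\Gamma d\tau=\mathcal{E}(0)$ for all $t\ge0$, together with $\mathcal{J}(u(t),w(t))\le\mathcal{E}(t)\le\mathcal{E}(0)<d$, $(u(t),w(t))\in\mathcal{W}_1$, $E(t)<\frac{cd}{c-2}$ and $\frac{c-2}{c}E(t)\le\mathcal{E}(t)\le E(t)$ for all $t\ge0$; "the global potential well solution" refers to this solution. **The function $\Phi$.** For $i=1,2$, $\phi_i:[0,\infty)\to[0,\infty)$ is a concave, increasing, continuous function vanishing at $0$ such that $\phi_i(g_i(s)s)\ge|g_i(s)|^2+s^2$ for $|s|<1$. $\Phi(s)=\phi_1(s)+\phi_2(s)+s$ for $s\ge0$. **The time $T_0$.** Let $c_1^*,c_2^*,c_*>0$ be embedding constants with $\|u\|_2^2\le c_1^*\|\nabla u\|_2^2$ and $|\gamma u|_2^2\le c_*\|\nabla u\|_2^2$ for $u\in H^1_{\Gamma_0}(\Omega)$, and $|w|_2^2\le c_2^*|\Delta w|_2^2$ for $w\in H^2_0(\Gamma)$. Put $c_0=\max\{1,c_1^*+c_*,2c_2^*\}$ and $$T_0=\max\left\{1,\frac1{|\Omega|},\frac1{|\Gamma|},\frac{8cc_0}{c-2}\right\}.$$ **The constant $\tilde C$.** Put $\xi=M(p+1)K_1(s^*-\delta)^{p-1}+M(q+1)K_2(s^*-\delta)^{q-1}$, so that $\xi<1$. Then $$\tilde C=\frac{4}{1-\xi}\left[\frac{cc_0}{c-2}+C(\varepsilon,\alpha)\,(|\Omega|+|\Gamma|)\right],$$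 where $C(\varepsilon,\alpha)>0$ is a constant, not made explicit and independent of $T$, arising from Young's inequality with a fixed sufficiently small $\varepsilon>0$. *)

theory Defs
  imports "HOL-Analysis.Analysis"
begin

section \<open>Lebesgue spaces\<close>

text \<open>Functions are representatives; equality in a Lebesgue or Sobolev space is equality
  almost everywhere.\<close>

definition Lp :: "real \<Rightarrow> 'a measure \<Rightarrow> ('a \<Rightarrow> real) set" where
  "Lp s N = {u \<in> borel_measurable N. integrable N (\<lambda>x. \<bar>u x\<bar> powr s)}"

definition Lp_norm :: "real \<Rightarrow> 'a measure \<Rightarrow> ('a \<Rightarrow> real) \<Rightarrow> real" where
  "Lp_norm s N u = (\<integral>x. \<bar>u x\<bar> powr s \<partial>N) powr (1 / s)"

definition L2_inner :: "'a measure \<Rightarrow> ('a \<Rightarrow> real) \<Rightarrow> ('a \<Rightarrow> real) \<Rightarrow> real" where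
  "L2_inner N u v = (\<integral>x. u x * v x \<partial>N)"

section \<open>Smooth functions and smooth boundaries\<close>

primrec Ck_on :: "nat \<Rightarrow> 'a::euclidean_space set \<Rightarrow> ('a \<Rightarrow> real) \<Rightarrow> bool" where
  "Ck_on 0 U f \<longleftrightarrow> continuous_on U f"
| "Ck_on (Suc k) U f \<longleftrightarrow> (\<forall>x\<in>U. f differentiable at x) \<and>
     (\<forall>b\<in>Basis. Ck_on k U (\<lambda>x. frechet_derivative f (at x) b))"

definition smooth_on :: "'a::euclidean_space set \<Rightarrow> ('a \<Rightarrow> real) \<Rightarrow> bool" where
  "smooth_on U f \<longleftrightarrow> (\<forall>k. Ck_on k U f)"

definition test_functions :: "'a::euclidean_space set \<Rightarrow> ('a \<Rightarrow> real) set" where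
  "test_functions U = {\<phi>. smooth_on UNIV \<phi> \<and>
     (\<exists>K. compact K \<and> K \<subseteq> U \<and> (\<forall>x. x \<notin> K \<longrightarrow> \<phi> x = 0))}"

definition smooth_boundary :: "'a::euclidean_space set \<Rightarrow> bool" where
  "smooth_boundary U \<longleftrightarrow> (\<forall>x\<in>frontier U. \<exists>V \<rho>. open V \<and> x \<in> V \<and> smooth_on V \<rho> \<and>
     (\<forall>y\<in>V. frechet_derivative \<rho> (at y) \<noteq> (\<lambda>_. 0)) \<and> U \<inter> V = {y \<in> V. \<rho> y < 0})"

section \<open>Sobolev spaces\<close>

definition is_weak_partial ::
    "'a::euclidean_space set \<Rightarrow> 'a \<Rightarrow> ('a \<Rightarrow> real) \<Rightarrow> ('a \<Rightarrow> real) \<Rightarrow> bool" where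
  "is_weak_partial U b u v \<longleftrightarrow> v \<in> Lp 2 (lebesgue_on U) \<and>
     (\<forall>\<phi>\<in>test_functions U. (\<integral>x. u x * frechet_derivative \<phi> (at x) b \<partial>lebesgue_on U)
        = - (\<integral>x. v x * \<phi> x \<partial>lebesgue_on U))"

definition H1 :: "'a::euclidean_space set \<Rightarrow> ('a \<Rightarrow> real) set" where
  "H1 U = {u \<in> Lp 2 (lebesgue_on U). \<forall>b\<in>Basis. \<exists>v. is_weak_partial U b u v}"

definition weak_partial ::
    "'a::euclidean_space set \<Rightarrow> 'a \<Rightarrow> ('a \<Rightarrow> real) \<Rightarrow> 'a \<Rightarrow> real" where
  "weak_partial U b u = (SOME v. is_weak_partial U b u v)"

definition weak_grad :: "'a::euclidean_space set \<Rightarrow> ('a \<Rightarrow> real) \<Rightarrow> 'a \<Rightarrow> 'a" where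
  "weak_grad U u x = (\<Sum>b\<in>Basis. weak_partial U b u x *\<^sub>R b)"

definition grad_norm :: "'a::euclidean_space set \<Rightarrow> ('a \<Rightarrow> real) \<Rightarrow> real" where
  "grad_norm U u = Lp_norm 2 (lebesgue_on U) (\<lambda>x. norm (weak_grad U u x))"

definition H1_norm :: "'a::euclidean_space set \<Rightarrow> ('a \<Rightarrow> real) \<Rightarrow> real" where
  "H1_norm U u = sqrt ((Lp_norm 2 (lebesgue_on U) u)\<^sup>2 + (grad_norm U u)\<^sup>2)"

definition H2 :: "'a::euclidean_space set \<Rightarrow> ('a \<Rightarrow> real) set" where
  "H2 U = {w \<in> H1 U. \<forall>b\<in>Basis. weak_partial U b w \<in> H1 U}"

definition H2_norm :: "'a::euclidean_space set \<Rightarrow> ('a \<Rightarrow> real) \<Rightarrow> real" where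
  "H2_norm U w = sqrt ((H1_norm U w)\<^sup>2 + (\<Sum>b\<in>Basis. (grad_norm U (weak_partial U b w))\<^sup>2))"

definition weak_laplacian :: "'a::euclidean_space set \<Rightarrow> ('a \<Rightarrow> real) \<Rightarrow> 'a \<Rightarrow> real" where
  "weak_laplacian U w x = (\<Sum>b\<in>Basis. weak_partial U b (weak_partial U b w) x)"

definition lap_norm :: "'a::euclidean_space set \<Rightarrow> ('a \<Rightarrow> real) \<Rightarrow> real" where
  "lap_norm U w = Lp_norm 2 (lebesgue_on U) (weak_laplacian U w)"

definition H20 :: "'a::euclidean_space set \<Rightarrow> ('a \<Rightarrow> real) set" where
  "H20 U = {w \<in> H2 U. \<exists>\<phi>::nat \<Rightarrow> 'a \<Rightarrow> real. (\<forall>n. \<phi> n \<in> test_functions U) \<and>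
     (\<lambda>n. H2_norm U (\<lambda>x. \<phi> n x - w x)) \<longlonglongrightarrow> 0}"

section \<open>Surface measure and traces\<close>

text \<open>Two-dimensional Hausdorff measure, normalised so that it is the surface area on smooth
  surfaces.  The measure is the restriction of the outer measure to the Borel sets.\<close>

definition hausdorff2_outer :: "'a::euclidean_space set \<Rightarrow> ennreal" where
  "hausdorff2_outer A = (SUP \<delta>\<in>{0<..}.
     INF C\<in>{C :: nat \<Rightarrow> 'a set. A \<subseteq> (\<Union>i. C i) \<and> (\<forall>i. bounded (C i) \<and> diameter (C i) \<le> \<delta>)}.
       (\<Sum>i. ennreal (pi / 4 * (diameter (C i))\<^sup>2)))"

definition hausdorff2 :: "'a::euclidean_space measure" where
  "hausdorff2 = measure_of UNIV (sets borel) hausdorff2_outer"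

text \<open>A piece of the boundary of \<open>U\<close> is given by a map \<open>j\<close> from a measure space \<open>N\<close>.  The trace
  operator is the \<open>H\<^sup>1\<close>-to-\<open>L\<^sup>2\<close> continuous extension of the restriction of functions that are
  smooth up to the boundary: \<open>g\<close> is the trace of \<open>u\<close> along \<open>j\<close>.\<close>

definition is_trace :: "'a::euclidean_space set \<Rightarrow> 'b measure \<Rightarrow> ('b \<Rightarrow> 'a) \<Rightarrow>
    ('a \<Rightarrow> real) \<Rightarrow> ('b \<Rightarrow> real) \<Rightarrow> bool" where
  "is_trace U N j u g \<longleftrightarrow> g \<in> Lp 2 N \<and>
     (\<exists>\<phi>::nat \<Rightarrow> 'a \<Rightarrow> real. (\<forall>n. smooth_on UNIV (\<phi> n) \<and> (\<lambda>y. \<phi> n (j y)) \<in> Lp 2 N) \<and>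
        (\<lambda>n. H1_norm U (\<lambda>x. \<phi> n x - u x)) \<longlonglongrightarrow> 0 \<and>
        (\<lambda>n. Lp_norm 2 N (\<lambda>y. \<phi> n (j y) - g y)) \<longlonglongrightarrow> 0)"

section \<open>Functions of time with values in function spaces\<close>

definition cont_into :: "real set \<Rightarrow> ('a \<Rightarrow> real) set \<Rightarrow> (('a \<Rightarrow> real) \<Rightarrow> real) \<Rightarrow>
    (real \<Rightarrow> 'a \<Rightarrow> real) \<Rightarrow> bool" where
  "cont_into I V nrm v \<longleftrightarrow> (\<forall>t\<in>I. v t \<in> V) \<and>
     (\<forall>s\<in>I. ((\<lambda>t. nrm (\<lambda>x. v t x - v s x)) \<longlongrightarrow> 0) (at s within I))"

text \<open>Since \<open>v t\<close> is only a representative for each \<open>t\<close>, membership in a space of functions on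
  the cylinder means that \<open>v\<close> agrees with a jointly measurable function at almost every time,
  almost everywhere in space.\<close>

definition Lp_cyl :: "real \<Rightarrow> real set \<Rightarrow> 'a measure \<Rightarrow> (real \<Rightarrow> 'a \<Rightarrow> real) set" where
  "Lp_cyl s I N = {v. \<exists>V\<in>Lp s (lebesgue_on I \<Otimes>\<^sub>M N).
     AE t in lebesgue_on I. AE x in N. v t x = V (t, x)}"

definition L1_L2 :: "real set \<Rightarrow> 'a measure \<Rightarrow> (real \<Rightarrow> 'a \<Rightarrow> real) set" where
  "L1_L2 I N = {v.
     (\<exists>V\<in>borel_measurable (lebesgue_on I \<Otimes>\<^sub>M N).
        AE t in lebesgue_on I. AE x in N. v t x = V (t, x)) \<and>
     (AE t in lebesgue_on I. v t \<in> Lp 2 N) \<and>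
     integrable (lebesgue_on I) (\<lambda>t. Lp_norm 2 N (v t))}"

text \<open>\<open>vt\<close> is the time derivative of \<open>v\<close>, as a function with values in \<open>L\<^sup>2\<close>:
  \<open>v(t) - v(0)\<close> is the integral of \<open>vt\<close> over \<open>[0,t]\<close>, tested against every element of \<open>L\<^sup>2\<close>.\<close>

definition time_deriv :: "real \<Rightarrow> 'a measure \<Rightarrow> (real \<Rightarrow> 'a \<Rightarrow> real) \<Rightarrow> (real \<Rightarrow> 'a \<Rightarrow> real) \<Rightarrow> bool"
  where
  "time_deriv T N v vt \<longleftrightarrow> vt \<in> L1_L2 {0..T} N \<and>
     (\<forall>z\<in>Lp 2 N. \<forall>t\<in>{0..T}. L2_inner N (v t) z - L2_inner N (v 0) z
        = (\<integral>\<tau>. L2_inner N (vt \<tau>) z \<partial>lebesgue_on {0..t}))"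

section \<open>The data of the structure acoustics model\<close>

text \<open>\<open>chart\<close> is an isometric embedding of the plane whose range contains the flat part
  \<open>Gamma\<close> of the boundary.  Functions on \<open>Gamma\<close> are written in the coordinates of \<open>chart\<close>,
  in which the surface measure is planar Lebesgue measure and the Laplacian is the usual one.\<close>

record acoustic =
  Omega :: "(real^3) set"
  Gamma0 :: "(real^3) set"
  Gamma :: "(real^3) set"
  chart :: "real^2 \<Rightarrow> real^3"
  damp_g1 :: "real \<Rightarrow> real"
  damp_g2 :: "real \<Rightarrow> real"
  src_f :: "real \<Rightarrow> real"
  src_h :: "real \<Rightarrow> real"
  pot_F :: "real \<Rightarrow> real"
  pot_H :: "real \<Rightarrow> real"
  exp_m :: real
  exp_r :: real
  exp_p :: real
  exp_q :: real
  coef_alpha :: real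
  coef_beta :: real
  bound_M :: real
  conc_phi1 :: "real \<Rightarrow> real"
  conc_phi2 :: "real \<Rightarrow> real"
  emb_c1 :: real
  emb_c2 :: real
  emb_tr :: real

definition Gamma_plane :: "acoustic \<Rightarrow> (real^2) set" where
  "Gamma_plane S = chart S -` Gamma S"

abbreviation mO :: "acoustic \<Rightarrow> (real^3) measure" where
  "mO S \<equiv> lebesgue_on (Omega S)"

abbreviation mG :: "acoustic \<Rightarrow> (real^2) measure" where
  "mG S \<equiv> lebesgue_on (Gamma_plane S)"

definition admissible_domain :: "acoustic \<Rightarrow> bool" where
  "admissible_domain S \<longleftrightarrow>
     bounded (Omega S) \<and> open (Omega S) \<and> connected (Omega S) \<and> smooth_boundary (Omega S) \<and>
     frontier (Omega S) = closure (Gamma0 S \<union> Gamma S) \<and> Gamma0 S \<inter> Gamma S = {} \<and>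
     openin (top_of_set (frontier (Omega S))) (Gamma0 S) \<and>
     openin (top_of_set (frontier (Omega S))) (Gamma S) \<and>
     connected (Gamma0 S) \<and> connected (Gamma S) \<and>
     emeasure hausdorff2 (Gamma0 S) > 0 \<and> emeasure hausdorff2 (Gamma S) > 0 \<and>
     (\<forall>x y. dist (chart S x) (chart S y) = dist x y) \<and> Gamma S \<subseteq> range (chart S)"

definition H1_Gamma0 :: "acoustic \<Rightarrow> (real^3 \<Rightarrow> real) set" where
  "H1_Gamma0 S = {u \<in> H1 (Omega S).
     is_trace (Omega S) (restrict_space hausdorff2 (Gamma0 S)) (\<lambda>x. x) u (\<lambda>_. 0)}"

abbreviation H20_Gamma :: "acoustic \<Rightarrow> (real^2 \<Rightarrow> real) set" where
  "H20_Gamma S \<equiv> H20 (Gamma_plane S)"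

definition Gamma_trace :: "acoustic \<Rightarrow> (real^3 \<Rightarrow> real) \<Rightarrow> real^2 \<Rightarrow> real" where
  "Gamma_trace S u = (SOME g. is_trace (Omega S) (mG S) (chart S) u g)"

definition C1_function :: "(real \<Rightarrow> real) \<Rightarrow> bool" where
  "C1_function f \<longleftrightarrow> (\<forall>s. f differentiable at s) \<and> continuous_on UNIV (deriv f)"

definition damping_condition :: "(real \<Rightarrow> real) \<Rightarrow> real \<Rightarrow> real \<Rightarrow> real \<Rightarrow> bool" where
  "damping_condition g \<alpha> \<beta> k \<longleftrightarrow> continuous_on UNIV g \<and> mono g \<and> g 0 = 0 \<and> 1 \<le> k \<and>
     (\<forall>s. \<bar>s\<bar> \<ge> 1 \<longrightarrow> \<alpha> * \<bar>s\<bar> powr (k + 1) \<le> g s * s \<and> g s * s \<le> \<beta> * \<bar>s\<bar> powr (k + 1))"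

definition growth_condition :: "(real \<Rightarrow> real) \<Rightarrow> real \<Rightarrow> bool" where
  "growth_condition f k \<longleftrightarrow> C1_function f \<and> 1 \<le> k \<and>
     (\<exists>C. \<forall>s. \<bar>deriv f s\<bar> \<le> C * (\<bar>s\<bar> powr (k - 1) + 1))"

definition conditions_A :: "acoustic \<Rightarrow> bool" where
  "conditions_A S \<longleftrightarrow> 0 < coef_alpha S \<and> 0 < coef_beta S \<and>
     damping_condition (damp_g1 S) (coef_alpha S) (coef_beta S) (exp_m S) \<and>
     damping_condition (damp_g2 S) (coef_alpha S) (coef_beta S) (exp_r S) \<and>
     growth_condition (src_f S) (exp_p S) \<and> exp_p S < 6 \<and>
     growth_condition (src_h S) (exp_q S) \<and>
     exp_p S * ((exp_m S + 1) / exp_m S) < 6"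

definition homogeneous_potential :: "(real \<Rightarrow> real) \<Rightarrow> (real \<Rightarrow> real) \<Rightarrow> real \<Rightarrow> bool" where
  "homogeneous_potential F f k \<longleftrightarrow> C1_function F \<and> (\<forall>s. 0 \<le> F s) \<and>
     (\<forall>s. (F has_real_derivative f s) (at s)) \<and>
     (\<forall>c>0. \<forall>s. F (c * s) = c powr (k + 1) * F s)"

definition conditions_B :: "acoustic \<Rightarrow> bool" where
  "conditions_B S \<longleftrightarrow>
     homogeneous_potential (pot_F S) (src_f S) (exp_p S) \<and>
     homogeneous_potential (pot_H S) (src_h S) (exp_q S) \<and>
     0 < bound_M S \<and>
     (\<forall>s. pot_F S s \<le> bound_M S * \<bar>s\<bar> powr (exp_p S + 1)) \<and>
     (\<forall>s. pot_H S s \<le> bound_M S * \<bar>s\<bar> powr (exp_q S + 1))"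

definition embedding_constants :: "acoustic \<Rightarrow> bool" where
  "embedding_constants S \<longleftrightarrow> 0 < emb_c1 S \<and> 0 < emb_c2 S \<and> 0 < emb_tr S \<and>
     (\<forall>u\<in>H1_Gamma0 S. (Lp_norm 2 (mO S) u)\<^sup>2 \<le> emb_c1 S * (grad_norm (Omega S) u)\<^sup>2 \<and>
        (Lp_norm 2 (mG S) (Gamma_trace S u))\<^sup>2 \<le> emb_tr S * (grad_norm (Omega S) u)\<^sup>2) \<and>
     (\<forall>w\<in>H20_Gamma S.
        (Lp_norm 2 (mG S) w)\<^sup>2 \<le> emb_c2 S * (lap_norm (Gamma_plane S) w)\<^sup>2)"

definition concave_majorant :: "(real \<Rightarrow> real) \<Rightarrow> (real \<Rightarrow> real) \<Rightarrow> bool" where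
  "concave_majorant \<phi> g \<longleftrightarrow> (\<forall>s\<ge>0. 0 \<le> \<phi> s) \<and> concave_on {0..} \<phi> \<and> mono_on {0..} \<phi> \<and>
     continuous_on {0..} \<phi> \<and> \<phi> 0 = 0 \<and>
     (\<forall>s. \<bar>s\<bar> < 1 \<longrightarrow> \<phi> (g s * s) \<ge> \<bar>g s\<bar>\<^sup>2 + s\<^sup>2)"

definition Phi :: "acoustic \<Rightarrow> real \<Rightarrow> real" where
  "Phi S s = conc_phi1 S s + conc_phi2 S s + s"

section \<open>Weak solutions\<close>

definition test_phi ::
    "acoustic \<Rightarrow> real \<Rightarrow> (real \<Rightarrow> real^3 \<Rightarrow> real) \<Rightarrow> (real \<Rightarrow> real^3 \<Rightarrow> real) \<Rightarrow> bool" where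
  "test_phi S T \<phi> \<phi>t \<longleftrightarrow> cont_into {0..T} (H1_Gamma0 S) (grad_norm (Omega S)) \<phi> \<and>
     \<phi> \<in> Lp_cyl (exp_m S + 1) {0..T} (mO S) \<and> time_deriv T (mO S) \<phi> \<phi>t"

definition test_psi ::
    "acoustic \<Rightarrow> real \<Rightarrow> (real \<Rightarrow> real^2 \<Rightarrow> real) \<Rightarrow> (real \<Rightarrow> real^2 \<Rightarrow> real) \<Rightarrow> bool" where
  "test_psi S T \<psi> \<psi>t \<longleftrightarrow> cont_into {0..T} (H20_Gamma S) (lap_norm (Gamma_plane S)) \<psi> \<and>
     time_deriv T (mG S) \<psi> \<psi>t"

text \<open>Here \<open>ut\<close> and \<open>wt\<close> stand for the time derivatives of \<open>u\<close> and \<open>w\<close>.\<close>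

definition weak_solution :: "acoustic \<Rightarrow> real \<Rightarrow>
    (real^3 \<Rightarrow> real) \<Rightarrow> (real^3 \<Rightarrow> real) \<Rightarrow> (real^2 \<Rightarrow> real) \<Rightarrow> (real^2 \<Rightarrow> real) \<Rightarrow>
    (real \<Rightarrow> real^3 \<Rightarrow> real) \<Rightarrow> (real \<Rightarrow> real^3 \<Rightarrow> real) \<Rightarrow>
    (real \<Rightarrow> real^2 \<Rightarrow> real) \<Rightarrow> (real \<Rightarrow> real^2 \<Rightarrow> real) \<Rightarrow> bool" where
  "weak_solution S T u0 u1 w0 w1 u ut w wt \<longleftrightarrow>
     cont_into {0..T} (H1_Gamma0 S) (grad_norm (Omega S)) u \<and>
     cont_into {0..T} (Lp 2 (mO S)) (Lp_norm 2 (mO S)) ut \<and>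
     time_deriv T (mO S) u ut \<and> ut \<in> Lp_cyl (exp_m S + 1) {0..T} (mO S) \<and>
     cont_into {0..T} (H20_Gamma S) (lap_norm (Gamma_plane S)) w \<and>
     cont_into {0..T} (Lp 2 (mG S)) (Lp_norm 2 (mG S)) wt \<and>
     time_deriv T (mG S) w wt \<and> wt \<in> Lp_cyl (exp_r S + 1) {0..T} (mG S) \<and>
     (AE x in mO S. u 0 x = u0 x) \<and> (AE x in mO S. ut 0 x = u1 x) \<and>
     (AE y in mG S. w 0 y = w0 y) \<and> (AE y in mG S. wt 0 y = w1 y) \<and>
     (\<forall>\<phi> \<phi>t. test_phi S T \<phi> \<phi>t \<longrightarrow> (\<forall>t\<in>{0..T}.
        L2_inner (mO S) (ut t) (\<phi> t) - L2_inner (mO S) u1 (\<phi> 0)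
        - (\<integral>\<tau>. L2_inner (mO S) (ut \<tau>) (\<phi>t \<tau>) \<partial>lebesgue_on {0..t})
        + (\<integral>\<tau>. (\<integral>x. weak_grad (Omega S) (u \<tau>) x \<bullet> weak_grad (Omega S) (\<phi> \<tau>) x \<partial>mO S)
             \<partial>lebesgue_on {0..t})
        - (\<integral>\<tau>. L2_inner (mG S) (wt \<tau>) (Gamma_trace S (\<phi> \<tau>)) \<partial>lebesgue_on {0..t})
        + (\<integral>\<tau>. (\<integral>x. damp_g1 S (ut \<tau> x) * \<phi> \<tau> x \<partial>mO S) \<partial>lebesgue_on {0..t})
        = (\<integral>\<tau>. (\<integral>x. src_f S (u \<tau> x) * \<phi> \<tau> x \<partial>mO S) \<partial>lebesgue_on {0..t}))) \<and>
     (\<forall>\<psi> \<psi>t. test_psi S T \<psi> \<psi>t \<longrightarrow> (\<forall>t\<in>{0..T}.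
        L2_inner (mG S) (\<lambda>y. wt t y + Gamma_trace S (u t) y) (\<psi> t)
        - L2_inner (mG S) (\<lambda>y. w1 y + Gamma_trace S (u 0) y) (\<psi> 0)
        - (\<integral>\<tau>. L2_inner (mG S) (wt \<tau>) (\<psi>t \<tau>) \<partial>lebesgue_on {0..t})
        - (\<integral>\<tau>. L2_inner (mG S) (Gamma_trace S (u \<tau>)) (\<psi>t \<tau>) \<partial>lebesgue_on {0..t})
        + (\<integral>\<tau>. L2_inner (mG S) (weak_laplacian (Gamma_plane S) (w \<tau>))
                (weak_laplacian (Gamma_plane S) (\<psi> \<tau>)) \<partial>lebesgue_on {0..t})
        + (\<integral>\<tau>. (\<integral>y. damp_g2 S (wt \<tau> y) * \<psi> \<tau> y \<partial>mG S) \<partial>lebesgue_on {0..t})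
        = (\<integral>\<tau>. (\<integral>y. src_h S (w \<tau> y) * \<psi> \<tau> y \<partial>mG S) \<partial>lebesgue_on {0..t})))"

section \<open>Energies and the potential well\<close>

definition X_space :: "acoustic \<Rightarrow> ((real^3 \<Rightarrow> real) \<times> (real^2 \<Rightarrow> real)) set" where
  "X_space S = H1_Gamma0 S \<times> H20_Gamma S"

definition X_norm :: "acoustic \<Rightarrow> (real^3 \<Rightarrow> real) \<Rightarrow> (real^2 \<Rightarrow> real) \<Rightarrow> real" where
  "X_norm S u w = sqrt ((grad_norm (Omega S) u)\<^sup>2 + (lap_norm (Gamma_plane S) w)\<^sup>2)"

definition X_zero :: "acoustic \<Rightarrow> (real^3 \<Rightarrow> real) \<Rightarrow> (real^2 \<Rightarrow> real) \<Rightarrow> bool" where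
  "X_zero S u w \<longleftrightarrow> (AE x in mO S. u x = 0) \<and> (AE y in mG S. w y = 0)"

definition source_work :: "acoustic \<Rightarrow> (real^3 \<Rightarrow> real) \<Rightarrow> (real^2 \<Rightarrow> real) \<Rightarrow> real" where
  "source_work S u w = (exp_p S + 1) * (\<integral>x. pot_F S (u x) \<partial>mO S)
     + (exp_q S + 1) * (\<integral>y. pot_H S (w y) \<partial>mG S)"

definition potential_J :: "acoustic \<Rightarrow> (real^3 \<Rightarrow> real) \<Rightarrow> (real^2 \<Rightarrow> real) \<Rightarrow> real" where
  "potential_J S u w = 1/2 * ((grad_norm (Omega S) u)\<^sup>2 + (lap_norm (Gamma_plane S) w)\<^sup>2)
     - (\<integral>x. pot_F S (u x) \<partial>mO S) - (\<integral>y. pot_H S (w y) \<partial>mG S)"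

definition quadratic_energy :: "acoustic \<Rightarrow> (real \<Rightarrow> real^3 \<Rightarrow> real) \<Rightarrow> (real \<Rightarrow> real^3 \<Rightarrow> real) \<Rightarrow>
    (real \<Rightarrow> real^2 \<Rightarrow> real) \<Rightarrow> (real \<Rightarrow> real^2 \<Rightarrow> real) \<Rightarrow> real \<Rightarrow> real" where
  "quadratic_energy S u ut w wt t = 1/2 * ((Lp_norm 2 (mO S) (ut t))\<^sup>2
     + (Lp_norm 2 (mG S) (wt t))\<^sup>2 + (grad_norm (Omega S) (u t))\<^sup>2
     + (lap_norm (Gamma_plane S) (w t))\<^sup>2)"

definition total_energy :: "acoustic \<Rightarrow> (real \<Rightarrow> real^3 \<Rightarrow> real) \<Rightarrow> (real \<Rightarrow> real^3 \<Rightarrow> real) \<Rightarrow>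
    (real \<Rightarrow> real^2 \<Rightarrow> real) \<Rightarrow> (real \<Rightarrow> real^2 \<Rightarrow> real) \<Rightarrow> real \<Rightarrow> real" where
  "total_energy S u ut w wt t =
     1/2 * ((Lp_norm 2 (mO S) (ut t))\<^sup>2 + (Lp_norm 2 (mG S) (wt t))\<^sup>2)
     + potential_J S (u t) (w t)"

definition dissipation ::
    "acoustic \<Rightarrow> (real \<Rightarrow> real^3 \<Rightarrow> real) \<Rightarrow> (real \<Rightarrow> real^2 \<Rightarrow> real) \<Rightarrow> real \<Rightarrow> real" where
  "dissipation S ut wt T =
     (\<integral>\<tau>. (\<integral>x. damp_g1 S (ut \<tau> x) * ut \<tau> x \<partial>mO S) \<partial>lebesgue_on {0..T})
     + (\<integral>\<tau>. (\<integral>y. damp_g2 S (wt \<tau> y) * wt \<tau> y \<partial>mG S) \<partial>lebesgue_on {0..T})"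

definition Nehari :: "acoustic \<Rightarrow> ((real^3 \<Rightarrow> real) \<times> (real^2 \<Rightarrow> real)) set" where
  "Nehari S = {(u, w) \<in> X_space S. \<not> X_zero S u w \<and>
     (grad_norm (Omega S) u)\<^sup>2 + (lap_norm (Gamma_plane S) w)\<^sup>2 = source_work S u w}"

text \<open>The depth is extended-real valued because the sources may vanish identically, in which
  case the Nehari manifold is empty and the depth is infinite.\<close>

definition well_depth :: "acoustic \<Rightarrow> ereal" where
  "well_depth S = (INF (u, w)\<in>Nehari S. ereal (potential_J S u w))"

definition well_W :: "acoustic \<Rightarrow> ((real^3 \<Rightarrow> real) \<times> (real^2 \<Rightarrow> real)) set" where
  "well_W S = {(u, w) \<in> X_space S. ereal (potential_J S u w) < well_depth S}"

definition well_W1 :: "acoustic \<Rightarrow> ((real^3 \<Rightarrow> real) \<times> (real^2 \<Rightarrow> real)) set" where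
  "well_W1 S = {(u, w) \<in> well_W S.
       (grad_norm (Omega S) u)\<^sup>2 + (lap_norm (Gamma_plane S) w)\<^sup>2 > source_work S u w}
     \<union> {(u, w) \<in> X_space S. X_zero S u w}"

definition K1 :: "acoustic \<Rightarrow> real" where
  "K1 S = Sup {Lp_norm (exp_p S + 1) (mO S) u powr (exp_p S + 1)
       / grad_norm (Omega S) u powr (exp_p S + 1) | u.
     u \<in> H1_Gamma0 S \<and> \<not> (AE x in mO S. u x = 0)}"

definition K2 :: "acoustic \<Rightarrow> real" where
  "K2 S = Sup {Lp_norm (exp_q S + 1) (mG S) w powr (exp_q S + 1)
       / lap_norm (Gamma_plane S) w powr (exp_q S + 1) | w.
     w \<in> H20_Gamma S \<and> \<not> (AE y in mG S. w y = 0)}"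

definition Lambda :: "acoustic \<Rightarrow> real \<Rightarrow> real" where
  "Lambda S s = 1/2 * s\<^sup>2 - bound_M S * K1 S * s powr (exp_p S + 1)
     - bound_M S * K2 S * s powr (exp_q S + 1)"

definition s_star :: "acoustic \<Rightarrow> real" where
  "s_star S = (THE s. s > 0 \<and> bound_M S * K1 S * (exp_p S + 1) * s powr (exp_p S - 1)
     + bound_M S * K2 S * (exp_q S + 1) * s powr (exp_q S - 1) = 1)"

definition W1_tilde :: "acoustic \<Rightarrow> real \<Rightarrow> ((real^3 \<Rightarrow> real) \<times> (real^2 \<Rightarrow> real)) set" where
  "W1_tilde S \<delta> = {(u, w) \<in> X_space S. X_norm S u w \<le> s_star S - \<delta> \<and>
     potential_J S u w \<le> Lambda S (s_star S - \<delta>)}"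

definition const_c :: "acoustic \<Rightarrow> real" where
  "const_c S = min (exp_p S + 1) (exp_q S + 1)"

definition potential_well_solution :: "acoustic \<Rightarrow>
    (real^3 \<Rightarrow> real) \<Rightarrow> (real^3 \<Rightarrow> real) \<Rightarrow> (real^2 \<Rightarrow> real) \<Rightarrow> (real^2 \<Rightarrow> real) \<Rightarrow>
    (real \<Rightarrow> real^3 \<Rightarrow> real) \<Rightarrow> (real \<Rightarrow> real^3 \<Rightarrow> real) \<Rightarrow>
    (real \<Rightarrow> real^2 \<Rightarrow> real) \<Rightarrow> (real \<Rightarrow> real^2 \<Rightarrow> real) \<Rightarrow> bool" where
  "potential_well_solution S u0 u1 w0 w1 u ut w wt \<longleftrightarrow>
     (\<forall>T>0. weak_solution S T u0 u1 w0 w1 u ut w wt) \<and>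
     (\<forall>t\<ge>0. total_energy S u ut w wt t + dissipation S ut wt t = total_energy S u ut w wt 0) \<and>
     (\<forall>t\<ge>0. potential_J S (u t) (w t) \<le> total_energy S u ut w wt t \<and>
        total_energy S u ut w wt t \<le> total_energy S u ut w wt 0 \<and>
        ereal (total_energy S u ut w wt 0) < well_depth S \<and>
        (u t, w t) \<in> well_W1 S \<and>
        ereal (quadratic_energy S u ut w wt t)
          < ereal (const_c S / (const_c S - 2)) * well_depth S \<and>
        (const_c S - 2) / const_c S * quadratic_energy S u ut w wt t
          \<le> total_energy S u ut w wt t \<and>
        total_energy S u ut w wt t \<le> quadratic_energy S u ut w wt t)"

text \<open>The ball of radius \<open>R\<close> in \<open>L\<^sup>\<infinity>(\<real>\<^sup>+; L\<^sup>s)\<close>.\<close>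

definition Linf_Lp_ball :: "real \<Rightarrow> 'a measure \<Rightarrow> real \<Rightarrow> (real \<Rightarrow> 'a \<Rightarrow> real) set" where
  "Linf_Lp_ball s N R = {v.
     (\<exists>V\<in>borel_measurable (lebesgue_on {0..} \<Otimes>\<^sub>M N).
        AE t in lebesgue_on {0..}. AE x in N. v t x = V (t, x)) \<and>
     (AE t in lebesgue_on {0..}. v t \<in> Lp s N \<and> Lp_norm s N (v t) \<le> R)}"

section \<open>The constants of the estimate\<close>

definition const_c0 :: "acoustic \<Rightarrow> real" where
  "const_c0 S = Max {1, emb_c1 S + emb_tr S, 2 * emb_c2 S}"

definition time_T0 :: "acoustic \<Rightarrow> real" where
  "time_T0 S = Max {1, 1 / measure lebesgue (Omega S), 1 / measure lebesgue (Gamma_plane S),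
     8 * const_c S * const_c0 S / (const_c S - 2)}"

definition const_xi :: "acoustic \<Rightarrow> real \<Rightarrow> real" where
  "const_xi S \<delta> =
     bound_M S * (exp_p S + 1) * K1 S * (s_star S - \<delta>) powr (exp_p S - 1)
     + bound_M S * (exp_q S + 1) * K2 S * (s_star S - \<delta>) powr (exp_q S - 1)"

text \<open>\<open>Cy\<close> is the unspecified constant that comes from Young's inequality.\<close>

definition C_tilde :: "acoustic \<Rightarrow> real \<Rightarrow> real \<Rightarrow> real" where
  "C_tilde S \<delta> Cy = 4 / (1 - const_xi S \<delta>) *
     (const_c S * const_c0 S / (const_c S - 2)
      + Cy * (measure lebesgue (Omega S) + measure lebesgue (Gamma_plane S)))"

end

theory Submission
  imports Defs
begin

text \<open>By the energy identity it suffices to bound the energy at time \<open>1\<close> by the dissipation up to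
  time \<open>1\<close>.  Since \<open>\<Lambda>\<close> increases up to \<open>s*\<close>, the solution stays in the ball of radius \<open>s* - \<delta>\<close>,
  where the work of the sources is at most \<open>\<xi> < 1\<close> times the quadratic potential energy.  Testing
  the equations with the solution itself on a window \<open>[s, t]\<close> with \<open>s \<le> 1/3\<close> and \<open>t \<ge> 2/3\<close> therefore
  bounds the potential energy by the kinetic energy, the damping work and the values at \<open>s\<close> and \<open>t\<close>;
  choosing \<open>s\<close> and \<open>t\<close> by averaging controls these values by the kinetic energy up to a small multiple
  of the energy.  The kinetic and damping terms are bounded by \<open>\<Phi>\<close> of the dissipation through
  Jensen's inequality for the concave majorants, where the damping is small, and through the
  growth of the damping elsewhere.

  The embeddings behind these estimates are obtained from Gagliardo-Loomis-Whitney type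
  inequalities for smooth functions, integrating along rays into the domain near the boundary.\<close>

section \<open>Square integrable functions\<close>

text \<open>The factor \<open>Cy\<close> in \<open>C_tilde\<close> is unspecified and has a positive
  coefficient, so every constant fixed before the solution can be placed below
  \<open>C_tilde\<close>. Hence all estimates have to be uniform over the solutions; for a given
  model the constants may depend on \<open>\<delta>\<close> and \<open>R\<close>. Independence of
  \<open>T\<close> is automatic once only the time interval \<open>[0, 1]\<close> is used.

  Two obstacles shape the argument. The tested identity contains the product of the trace of
  \<open>u\<close> with \<open>w\<close> at both ends of the window, and no velocity makes it small.
  Its increment is small because the trace inequality is multiplicative, \<open>L2\<close> norm
  times \<open>H1\<close> norm, and the \<open>L2\<close> increment of \<open>u\<close> is bounded
  by the kinetic energy. Moreover \<open>u t\<close> is merely a representative for each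
  \<open>t\<close>: before \<open>u\<close> may serve as a test function, a jointly measurable
  version in \<open>L^(m+1)\<close> of the cylinder is built from \<open>u0\<close> and
  \<open>ut\<close>.

  Small multiples of the energy appear as multiples of the initial energy \<open>EE 0\<close>; they
  are absorbed through \<open>EE 0 = EE 1 + D\<close>, with \<open>D\<close> the dissipation up to
  time 1.\<close>

lemma abs_powr_2: "\<bar>x::real\<bar> powr 2 = x\<^sup>2"
  by (simp add: powr_numeral)

lemma Lp_2_iff: "u \<in> Lp 2 N \<longleftrightarrow> u \<in> borel_measurable N \<and> integrable N (\<lambda>x. (u x)\<^sup>2)"
  by (simp add: Lp_def abs_powr_2)

lemma Lp_measurable: "u \<in> Lp s N \<Longrightarrow> u \<in> borel_measurable N"
  by (simp add: Lp_def)

lemma Lp_norm_nonneg [simp]: "0 \<le> Lp_norm s N u"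
  by (simp add: Lp_norm_def)

lemma L2_norm_eq: "Lp_norm 2 N u = sqrt (\<integral>x. (u x)\<^sup>2 \<partial>N)"
proof -
  have "0 \<le> (\<integral>x. (u x)\<^sup>2 \<partial>N)" by simp
  then show ?thesis by (simp add: Lp_norm_def abs_powr_2 powr_half_sqrt)
qed

lemma L2_norm_sq: "(Lp_norm 2 N u)\<^sup>2 = (\<integral>x. (u x)\<^sup>2 \<partial>N)"
  by (simp add: L2_norm_eq)

lemma L2_inner_self: "L2_inner N u u = (Lp_norm 2 N u)\<^sup>2"
  unfolding L2_norm_sq L2_inner_def by (simp add: power2_eq_square)

lemma L2_norm_nn:
  assumes "u \<in> Lp 2 N"
  shows "(\<integral>\<^sup>+x. ennreal ((u x)\<^sup>2) \<partial>N) = ennreal ((Lp_norm 2 N u)\<^sup>2)"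
  using assms by (simp add: L2_norm_sq Lp_2_iff nn_integral_eq_integral)

lemma Lp_2I_nn:
  assumes "u \<in> borel_measurable N" "(\<integral>\<^sup>+x. ennreal ((u x)\<^sup>2) \<partial>N) \<le> ennreal C" "0 \<le> C"
  shows "u \<in> Lp 2 N" "(Lp_norm 2 N u)\<^sup>2 \<le> C"
proof -
  have i: "integrable N (\<lambda>x. (u x)\<^sup>2)"
    using assms by (intro integrableI_bounded) (auto simp: le_less_trans[OF assms(2)])
  then show "u \<in> Lp 2 N" using assms(1) by (simp add: Lp_2_iff)
  then show "(Lp_norm 2 N u)\<^sup>2 \<le> C"
    using L2_norm_nn[of u N] assms by simp
qed

lemma L2_mult_integrable:
  assumes "u \<in> Lp 2 N" "v \<in> Lp 2 N"
  shows "integrable N (\<lambda>x. u x * v x)"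
proof (rule Bochner_Integration.integrable_bound)
  show "integrable N (\<lambda>x. (u x)\<^sup>2 + (v x)\<^sup>2)" using assms by (auto simp: Lp_2_iff)
  show "(\<lambda>x. u x * v x) \<in> borel_measurable N" using assms by (auto simp: Lp_2_iff)
  have "\<bar>a * b\<bar> \<le> a\<^sup>2 + b\<^sup>2" for a b :: real
  proof -
    have "2 * (\<bar>a\<bar> * \<bar>b\<bar>) \<le> \<bar>a\<bar>\<^sup>2 + \<bar>b\<bar>\<^sup>2" using sum_squares_bound[of "\<bar>a\<bar>" "\<bar>b\<bar>"] by simp
    moreover have "0 \<le> \<bar>a\<bar> * \<bar>b\<bar>" by simp
    ultimately show ?thesis unfolding abs_mult by (simp del: abs_mult_pos' mult_nonneg_nonneg)
  qed
  then show "AE x in N. norm (u x * v x) \<le> norm ((u x)\<^sup>2 + (v x)\<^sup>2)"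
    by (auto simp: abs_mult)
qed

lemma Lp_2_add [intro]:
  assumes "u \<in> Lp 2 N" "v \<in> Lp 2 N" shows "(\<lambda>x. u x + v x) \<in> Lp 2 N"
  using assms L2_mult_integrable[OF assms] by (auto simp: Lp_2_iff power2_sum mult.assoc)

lemma Lp_2_cmult [intro]:
  assumes "u \<in> Lp 2 N" shows "(\<lambda>x. c * u x) \<in> Lp 2 N"
  using assms by (auto simp: Lp_2_iff power_mult_distrib)

lemma Lp_2_diff [intro]:
  assumes "u \<in> Lp 2 N" "v \<in> Lp 2 N" shows "(\<lambda>x. u x - v x) \<in> Lp 2 N"
  using Lp_2_add[OF assms(1) Lp_2_cmult[OF assms(2), of "-1"]] by simp

lemma Lp_2_zero [simp]: "(\<lambda>x. 0) \<in> Lp 2 N"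
  by (simp add: Lp_2_iff)

lemma Lp_2_sum [intro]:
  assumes "\<And>i. i \<in> I \<Longrightarrow> u i \<in> Lp 2 N" shows "(\<lambda>x. \<Sum>i\<in>I. u i x) \<in> Lp 2 N"
  using assms by (induction I rule: infinite_finite_induct) auto

lemma Lp_2_AE_cong:
  assumes "u \<in> Lp 2 N" "v \<in> borel_measurable N" "AE x in N. u x = v x"
  shows "v \<in> Lp 2 N"
proof -
  have "integrable N (\<lambda>x. (u x)\<^sup>2) \<longleftrightarrow> integrable N (\<lambda>x. (v x)\<^sup>2)"
    using assms by (intro integrable_cong_AE) (auto simp: Lp_2_iff)
  then show ?thesis using assms by (auto simp: Lp_2_iff)
qed

lemma Lp_norm_AE_cong:
  assumes "u \<in> borel_measurable N" "v \<in> borel_measurable N" "AE x in N. u x = v x"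
  shows "Lp_norm s N u = Lp_norm s N v"
proof -
  have "(\<integral>x. \<bar>u x\<bar> powr s \<partial>N) = (\<integral>x. \<bar>v x\<bar> powr s \<partial>N)"
    using assms by (intro integral_cong_AE) auto
  then show ?thesis by (simp add: Lp_norm_def)
qed

lemma L2_norm_cmult: "Lp_norm 2 N (\<lambda>x. c * u x) = \<bar>c\<bar> * Lp_norm 2 N u"
  by (simp add: L2_norm_eq power_mult_distrib real_sqrt_mult)

lemma L2_norm_minus_commute: "Lp_norm 2 N (\<lambda>x. u x - v x) = Lp_norm 2 N (\<lambda>x. v x - u x)"
  by (simp add: L2_norm_eq power2_commute)

lemma L2_inner_add_left:
  assumes "u \<in> Lp 2 N" "v \<in> Lp 2 N" "z \<in> Lp 2 N"
  shows "L2_inner N (\<lambda>x. u x + v x) z = L2_inner N u z + L2_inner N v z"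
  using L2_mult_integrable[OF assms(1,3)] L2_mult_integrable[OF assms(2,3)]
  by (simp add: L2_inner_def distrib_right)

lemma L2_inner_diff_left:
  assumes "u \<in> Lp 2 N" "v \<in> Lp 2 N" "z \<in> Lp 2 N"
  shows "L2_inner N (\<lambda>x. u x - v x) z = L2_inner N u z - L2_inner N v z"
  using L2_mult_integrable[OF assms(1,3)] L2_mult_integrable[OF assms(2,3)]
  by (simp add: L2_inner_def left_diff_distrib)

lemma L2_inner_commute: "L2_inner N u v = L2_inner N v u"
  by (simp add: L2_inner_def mult.commute)

lemma L2_inner_cmult: "L2_inner N (\<lambda>x. c * u x) v = c * L2_inner N u v"
  by (simp add: L2_inner_def mult.assoc)

text \<open>The squared norm of \<open>a * u - v\<close> is a nonnegative quadratic polynomial in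
  \<open>a\<close>; evaluation at its minimum point gives the inequality.\<close>

lemma L2_Cauchy_Schwarz:
  assumes "u \<in> Lp 2 N" "v \<in> Lp 2 N"
  shows "\<bar>L2_inner N u v\<bar> \<le> Lp_norm 2 N u * Lp_norm 2 N v"
proof -
  have q: "0 \<le> (Lp_norm 2 N u)\<^sup>2 * a\<^sup>2 - 2 * a * L2_inner N u v + (Lp_norm 2 N v)\<^sup>2" for a
  proof -
    have au: "(\<lambda>x. a * u x) \<in> Lp 2 N" using assms by auto
    have d: "(\<lambda>x. a * u x - v x) \<in> Lp 2 N" using assms by auto
    have "0 \<le> L2_inner N (\<lambda>x. a * u x - v x) (\<lambda>x. a * u x - v x)"
      by (simp add: L2_inner_self)
    also have "\<dots> = L2_inner N (\<lambda>x. a * u x) (\<lambda>x. a * u x - v x) - L2_inner N v (\<lambda>x. a * u x - v x)"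
      by (rule L2_inner_diff_left[OF au assms(2) d])
    also have "L2_inner N (\<lambda>x. a * u x) (\<lambda>x. a * u x - v x)
        = L2_inner N (\<lambda>x. a * u x) (\<lambda>x. a * u x) - L2_inner N v (\<lambda>x. a * u x)"
      using L2_inner_diff_left[OF au assms(2) au] by (simp add: L2_inner_commute)
    also have "L2_inner N v (\<lambda>x. a * u x - v x) = L2_inner N (\<lambda>x. a * u x) v - L2_inner N v v"
      using L2_inner_diff_left[OF au assms(2) assms(2)] by (simp add: L2_inner_commute)
    also have "L2_inner N (\<lambda>x. a * u x) (\<lambda>x. a * u x) = a\<^sup>2 * (Lp_norm 2 N u)\<^sup>2"
      by (simp add: L2_inner_self L2_norm_cmult power_mult_distrib)
    finally show ?thesis
      by (simp add: L2_inner_commute[of N v] L2_inner_cmult L2_inner_self algebra_simps)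
  qed
  have "(L2_inner N u v)\<^sup>2 \<le> (Lp_norm 2 N u)\<^sup>2 * (Lp_norm 2 N v)\<^sup>2"
  proof (cases "Lp_norm 2 N u = 0")
    case True
    have "L2_inner N u v = 0"
    proof (rule ccontr)
      assume "L2_inner N u v \<noteq> 0"
      \<comment> \<open>The leading coefficient is 0 here, and this \<open>a\<close> would give the
        polynomial the value -1.\<close>
      with q[of "((Lp_norm 2 N v)\<^sup>2 + 1) / (2 * L2_inner N u v)"] True show False by simp
    qed
    then show ?thesis using True by simp
  next
    case False
    then have pos: "(Lp_norm 2 N u)\<^sup>2 > 0" by simp
    let ?n = "(Lp_norm 2 N u)\<^sup>2" and ?i = "L2_inner N u v"
    from q[of "?i / ?n"] have "0 \<le> ?n * (?i / ?n)\<^sup>2 - 2 * (?i / ?n) * ?i + (Lp_norm 2 N v)\<^sup>2" .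
    also have "?n * (?i / ?n)\<^sup>2 = ?i\<^sup>2 / ?n" using pos by (simp add: field_simps power2_eq_square)
    also have "2 * (?i / ?n) * ?i = 2 * (?i\<^sup>2 / ?n)" by (simp add: power2_eq_square)
    finally have "?i\<^sup>2 / ?n \<le> (Lp_norm 2 N v)\<^sup>2" by simp
    then show ?thesis using pos by (simp add: field_simps)
  qed
  then have "(L2_inner N u v)\<^sup>2 \<le> (Lp_norm 2 N u * Lp_norm 2 N v)\<^sup>2" by (simp add: power_mult_distrib)
  then show ?thesis by (rule abs_le_square_iff[THEN iffD2, THEN order_trans]) simp
qed

lemma L2_norm_add:
  assumes "u \<in> Lp 2 N" "v \<in> Lp 2 N"
  shows "Lp_norm 2 N (\<lambda>x. u x + v x) \<le> Lp_norm 2 N u + Lp_norm 2 N v"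
proof (rule power2_le_imp_le)
  have s: "(\<lambda>x. u x + v x) \<in> Lp 2 N" using assms by auto
  have "(Lp_norm 2 N (\<lambda>x. u x + v x))\<^sup>2
      = L2_inner N u (\<lambda>x. u x + v x) + L2_inner N v (\<lambda>x. u x + v x)"
    by (simp only: L2_inner_self[symmetric] L2_inner_add_left[OF assms s])
  also have "L2_inner N u (\<lambda>x. u x + v x) = L2_inner N u u + L2_inner N v u"
    using L2_inner_add_left[OF assms assms(1)] by (simp add: L2_inner_commute)
  also have "L2_inner N v (\<lambda>x. u x + v x) = L2_inner N u v + L2_inner N v v"
    using L2_inner_add_left[OF assms assms(2)] by (simp add: L2_inner_commute)
  finally have "(Lp_norm 2 N (\<lambda>x. u x + v x))\<^sup>2
      = (Lp_norm 2 N u)\<^sup>2 + 2 * L2_inner N u v + (Lp_norm 2 N v)\<^sup>2"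
    by (simp add: L2_inner_self L2_inner_commute[of N v u])
  also have "\<dots> \<le> (Lp_norm 2 N u + Lp_norm 2 N v)\<^sup>2"
    using L2_Cauchy_Schwarz[OF assms] by (simp add: power2_sum)
  finally show "(Lp_norm 2 N (\<lambda>x. u x + v x))\<^sup>2 \<le> (Lp_norm 2 N u + Lp_norm 2 N v)\<^sup>2" .
qed simp

lemma L2_norm_diff:
  assumes "u \<in> Lp 2 N" "v \<in> Lp 2 N"
  shows "Lp_norm 2 N (\<lambda>x. u x - v x) \<le> Lp_norm 2 N u + Lp_norm 2 N v"
  using L2_norm_add[OF assms(1) Lp_2_cmult[OF assms(2), of "-1"]] L2_norm_cmult[of N "-1" v] by simp

lemma L2_norm_reverse:
  assumes "u \<in> Lp 2 N" "v \<in> Lp 2 N"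
  shows "\<bar>Lp_norm 2 N u - Lp_norm 2 N v\<bar> \<le> Lp_norm 2 N (\<lambda>x. u x - v x)"
  using L2_norm_add[OF Lp_2_diff[OF assms] assms(2)]
    L2_norm_add[OF Lp_2_diff[OF assms(2,1)] assms(1)]
    L2_norm_minus_commute[of N u v] by simp

lemma L2_norm_sum:
  assumes "\<And>i. i \<in> I \<Longrightarrow> u i \<in> Lp 2 N" "finite I"
  shows "Lp_norm 2 N (\<lambda>x. \<Sum>i\<in>I. u i x) \<le> (\<Sum>i\<in>I. Lp_norm 2 N (u i))"
  using assms(2,1)
proof (induction I rule: finite_induct)
  case empty then show ?case by (simp add: L2_norm_eq)
next
  case (insert i I)
  have "Lp_norm 2 N (\<lambda>x. u i x + (\<Sum>i\<in>I. u i x)) \<le> Lp_norm 2 N (u i) + Lp_norm 2 N (\<lambda>x. \<Sum>i\<in>I. u i x)"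
    using insert by (intro L2_norm_add) auto
  then show ?case using insert by auto
qed

lemma L2_norm_eq_0_iff:
  assumes "u \<in> Lp 2 N"
  shows "Lp_norm 2 N u = 0 \<longleftrightarrow> (AE x in N. u x = 0)"
  using assms by (simp add: L2_norm_eq Lp_2_iff integral_nonneg_eq_0_iff_AE)

lemma L2_norm_tendsto:
  assumes "\<And>n. u n \<in> Lp 2 N" "v \<in> Lp 2 N" "((\<lambda>n. Lp_norm 2 N (\<lambda>x. u n x - v x)) \<longlongrightarrow> 0) F"
  shows "((\<lambda>n. Lp_norm 2 N (u n)) \<longlongrightarrow> Lp_norm 2 N v) F"
proof -
  have "((\<lambda>n. Lp_norm 2 N (u n) - Lp_norm 2 N v) \<longlongrightarrow> 0) F"
    by (rule Lim_null_comparison[OF _ assms(3)])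
       (auto intro!: always_eventually L2_norm_reverse assms)
  then show ?thesis using Lim_null by blast
qed

text \<open>Convergence in \<open>L2\<close> is convergence of the squared differences to 0 in
  \<open>L1\<close>, which has an almost everywhere convergent subsequence.\<close>

lemma L2_AE_subseq:
  assumes u: "\<And>n. u n \<in> Lp 2 N" and v: "v \<in> Lp 2 N"
    and lim: "(\<lambda>n::nat. Lp_norm 2 N (\<lambda>x. u n x - v x)) \<longlonglongrightarrow> 0"
  obtains r where "strict_mono r" "AE x in N. (\<lambda>n. u (r n) x) \<longlonglongrightarrow> v x"
proof -
  have "(\<lambda>n. (Lp_norm 2 N (\<lambda>x. u n x - v x))\<^sup>2) \<longlonglongrightarrow> 0" using tendsto_power[OF lim, of 2] by simp
  moreover have "integrable N (\<lambda>x. (u n x - v x)\<^sup>2)" for n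
    using Lp_2_diff[OF u v] by (simp add: Lp_2_iff)
  ultimately obtain r where r: "strict_mono r" "AE x in N. (\<lambda>n. (u (r n) x - v x)\<^sup>2) \<longlonglongrightarrow> 0"
    using tendsto_L1_AE_subseq[of N "\<lambda>n x. (u n x - v x)\<^sup>2"] by (auto simp: L2_norm_sq)
  have "AE x in N. (\<lambda>n. u (r n) x) \<longlonglongrightarrow> v x"
    using r(2)
  proof eventually_elim
    case (elim x)
    have "(\<lambda>n. \<bar>u (r n) x - v x\<bar>) \<longlonglongrightarrow> 0" using tendsto_real_sqrt[OF elim] by simp
    then show ?case using Lim_null tendsto_rabs_zero_iff by blast
  qed
  with r(1) that show thesis by blast
qed

text \<open>Carries an inequality known for smooth approximants to their limit. Almost everywhere
  convergence alone gives no convergence of the integrals, so the conclusion is one-sided; the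
  constants may vary along the sequence.\<close>

lemma Fatou_bound:
  fixes u :: "nat \<Rightarrow> 'a \<Rightarrow> real"
  assumes [measurable]: "\<And>n. u n \<in> borel_measurable N" "G \<in> borel_measurable borel"
    and ae: "AE x in N. (\<lambda>n. u n x) \<longlonglongrightarrow> v x"
    and G: "\<And>x. isCont G x"
    and bd: "\<And>n. (\<integral>\<^sup>+x. ennreal (G (u n x)) \<partial>N) \<le> ennreal (C n)"
    and C: "C \<longlonglongrightarrow> C0"
  shows "(\<integral>\<^sup>+x. ennreal (G (v x)) \<partial>N) \<le> ennreal C0"
proof -
  have "(\<integral>\<^sup>+x. ennreal (G (v x)) \<partial>N) = (\<integral>\<^sup>+x. liminf (\<lambda>n. ennreal (G (u n x))) \<partial>N)"
  proof (rule nn_integral_cong_AE, use ae in eventually_elim)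
    case (elim x)
    have "(\<lambda>n. ennreal (G (u n x))) \<longlonglongrightarrow> ennreal (G (v x))"
      using isCont_tendsto_compose[OF G elim] by (rule tendsto_ennrealI)
    then show ?case by (simp add: lim_imp_Liminf)
  qed
  also have "\<dots> \<le> liminf (\<lambda>n. \<integral>\<^sup>+x. ennreal (G (u n x)) \<partial>N)"
    by (rule nn_integral_liminf) measurable
  also have "\<dots> \<le> liminf (\<lambda>n. ennreal (C n))"
    by (intro Liminf_mono always_eventually allI bd)
  also have "\<dots> = ennreal C0"
    using tendsto_ennrealI[OF C] by (simp add: lim_imp_Liminf)
  finally show ?thesis .
qed

text \<open>On a finite measure space an \<open>L2\<close> Cauchy sequence is \<open>L1\<close>
  Cauchy, so a subsequence converges almost everywhere; Fatou along it shows that the pointwise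
  limit is the \<open>L2\<close> limit of the whole sequence. The existence of traces rests on
  this.\<close>

lemma (in finite_measure) L2_complete:
  fixes u :: "nat \<Rightarrow> 'a \<Rightarrow> real"
  assumes u: "\<And>n. u n \<in> Lp 2 M"
    and cau: "\<And>e. 0 < e \<Longrightarrow> \<exists>K. \<forall>i\<ge>K. \<forall>j\<ge>K. Lp_norm 2 M (\<lambda>x. u i x - u j x) < e"
  obtains g where "g \<in> Lp 2 M" "(\<lambda>n. Lp_norm 2 M (\<lambda>x. u n x - g x)) \<longlonglongrightarrow> 0"
proof -
  have one: "(\<lambda>_. 1) \<in> Lp 2 M" by (simp add: Lp_2_iff)
  have L1: "integrable M v" "(\<integral>x. \<bar>v x\<bar> \<partial>M) \<le> Lp_norm 2 M v * Lp_norm 2 M (\<lambda>_. 1)" if "v \<in> Lp 2 M" for v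
  proof -
    show "integrable M v" using L2_mult_integrable[OF that one] by simp
    have "(\<lambda>x. \<bar>v x\<bar>) \<in> Lp 2 M" using that by (auto simp: Lp_2_iff)
    from L2_Cauchy_Schwarz[OF this one] show "(\<integral>x. \<bar>v x\<bar> \<partial>M) \<le> Lp_norm 2 M v * Lp_norm 2 M (\<lambda>_. 1)"
      by (simp add: L2_inner_def L2_norm_eq)
  qed
  obtain r where r: "strict_mono r" "AE x in M. Cauchy (\<lambda>i. u (r i) x)"
  proof (rule cauchy_L1_AE_cauchy_subseq[of M u])
    show "integrable M (u n)" for n using L1(1)[OF u] .
    fix e :: real assume e: "0 < e"
    \<comment> \<open>The summand 1 keeps the divisor positive even when the space is null.\<close>
    let ?c = "Lp_norm 2 M (\<lambda>_. 1) + 1"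
    have c: "?c > 0" by (simp add: add_nonneg_pos)
    from cau[of "e / ?c"] obtain K where K: "\<forall>i\<ge>K. \<forall>j\<ge>K. Lp_norm 2 M (\<lambda>x. u i x - u j x) < e / ?c"
      using e c by (auto simp: divide_pos_pos)
    show "\<exists>N. \<forall>i\<ge>N. \<forall>j\<ge>N. LINT x|M. norm (u i x - u j x) < e"
    proof (intro exI allI impI)
      fix i j assume ij: "K \<le> i" "K \<le> j"
      have "(LINT x|M. norm (u i x - u j x)) \<le> Lp_norm 2 M (\<lambda>x. u i x - u j x) * Lp_norm 2 M (\<lambda>_. 1)"
        using L1(2)[OF Lp_2_diff[OF u[of i] u[of j]]] by simp
      also have "\<dots> \<le> Lp_norm 2 M (\<lambda>x. u i x - u j x) * ?c" by (intro mult_left_mono) auto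
      also have "\<dots> < e" using K ij c by (simp add: pos_less_divide_eq)
      finally show "(LINT x|M. norm (u i x - u j x)) < e" .
    qed
  qed
  define g where "g = (\<lambda>x. lim (\<lambda>i. u (r i) x))"
  have um [measurable]: "u n \<in> borel_measurable M" for n using u by (simp add: Lp_2_iff)
  have gm [measurable]: "g \<in> borel_measurable M" unfolding g_def by measurable
  have ae: "AE x in M. (\<lambda>i. u (r i) x) \<longlonglongrightarrow> g x"
    using r(2) by eventually_elim (simp add: g_def Cauchy_convergent_iff convergent_LIMSEQ_iff)
  have main: "\<exists>K. \<forall>n\<ge>K. (\<lambda>x. u n x - g x) \<in> Lp 2 M \<and> Lp_norm 2 M (\<lambda>x. u n x - g x) \<le> e"
    if e: "0 < e" for e
  proof -
    from cau[OF e] obtain K where K: "\<forall>i\<ge>K. \<forall>j\<ge>K. Lp_norm 2 M (\<lambda>x. u i x - u j x) < e" by blast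
    have "(\<lambda>x. u n x - g x) \<in> Lp 2 M \<and> Lp_norm 2 M (\<lambda>x. u n x - g x) \<le> e" if n: "n \<ge> K" for n
    proof -
      have "(\<integral>\<^sup>+x. ennreal ((\<lambda>s. s\<^sup>2) (u n x - g x)) \<partial>M) \<le> ennreal (e\<^sup>2)"
      \<comment> \<open>Since \<open>r i \<ge> i\<close>, shifting the index by \<open>K\<close>
        puts the whole subsequence into the range of the Cauchy estimate.\<close>
      proof (rule Fatou_bound[where u="\<lambda>i x. u n x - u (r (i + K)) x" and C="\<lambda>_. e\<^sup>2"
            and G="\<lambda>s. s\<^sup>2" and v="\<lambda>x. u n x - g x"])
        show "AE x in M. (\<lambda>i. u n x - u (r (i + K)) x) \<longlonglongrightarrow> u n x - g x"
          using ae by eventually_elim (intro tendsto_intros LIMSEQ_ignore_initial_segment)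
        fix i
        have "r (i + K) \<ge> K" using seq_suble[OF r(1), of "i + K"] by simp
        then have "Lp_norm 2 M (\<lambda>x. u n x - u (r (i + K)) x) \<le> e" using K n by (auto intro: less_imp_le)
        then show "(\<integral>\<^sup>+x. ennreal ((u n x - u (r (i + K)) x)\<^sup>2) \<partial>M) \<le> ennreal (e\<^sup>2)"
          using L2_norm_nn[OF Lp_2_diff[OF u[of n] u[of "r (i + K)"]]]
          by (simp add: power_mono ennreal_leI)
      qed (auto intro!: continuous_intros)
      from Lp_2I_nn[OF _ this] e show ?thesis
        by (auto intro: power2_le_imp_le)
    qed
    then show ?thesis by blast
  qed
  from main[of 1] obtain K where "(\<lambda>x. u K x - g x) \<in> Lp 2 M" by auto
  from Lp_2_diff[OF u[of K] this] have "g \<in> Lp 2 M" by simp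
  moreover have "(\<lambda>n. Lp_norm 2 M (\<lambda>x. u n x - g x)) \<longlonglongrightarrow> 0"
  proof (rule LIMSEQ_I)
    fix e :: real assume "0 < e"
    with main[of "e / 2"] obtain K where "\<forall>n\<ge>K. Lp_norm 2 M (\<lambda>x. u n x - g x) \<le> e / 2" by auto
    with \<open>0 < e\<close> show "\<exists>K. \<forall>n\<ge>K. norm (Lp_norm 2 M (\<lambda>x. u n x - g x) - 0) < e"
      by (intro exI[of _ K]) (auto intro: le_less_trans)
  qed
  ultimately show thesis using that by blast
qed

section \<open>Smooth functions\<close>

abbreviation pd :: "'a::euclidean_space \<Rightarrow> ('a \<Rightarrow> real) \<Rightarrow> 'a \<Rightarrow> real" where
  "pd b f x \<equiv> frechet_derivative f (at x) b"

lemma pd_eq: "(f has_derivative f') (at x) \<Longrightarrow> pd b f x = f' b"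
  by (metis frechet_derivative_at)

text \<open>A derivative at a point sees the function near that point; openness of \<open>U\<close>
  makes agreement on \<open>U\<close> enough for all orders.\<close>

lemma Ck_on_cong:
  assumes "open U" "\<And>x. x \<in> U \<Longrightarrow> f x = g x" "Ck_on k U f"
  shows "Ck_on k U g"
  using assms(2,3)
proof (induction k arbitrary: f g)
  case 0
  then show ?case using continuous_on_cong by force
next
  case (Suc k)
  have 1: "(g has_derivative frechet_derivative f (at x)) (at x)" if "x \<in> U" for x
    using Suc.prems that assms(1)
    by (intro has_derivative_transform_within_open[of f _ x UNIV U g, simplified])
       (auto simp: frechet_derivative_works)
  have 2: "pd b g x = pd b f x" if "x \<in> U" for x b using pd_eq[OF 1[OF that]] .
  show ?case
    using Suc.prems 1 Suc.IH[of "pd b f" "pd b g" for b] 2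
    by (auto simp: differentiable_def)
qed

lemma Ck_on_SucD:
  assumes "Ck_on (Suc k) U f" "open U" shows "Ck_on k U f"
  using assms(1)
proof (induction k arbitrary: f)
  case 0
  then show ?case
    by (auto simp: continuous_on_eq_continuous_at[OF assms(2)] differentiable_imp_continuous_within)
next
  case (Suc k)
  have "Ck_on (Suc k) U (pd b f)" if "b \<in> Basis" for b
    using Suc.prems that by simp
  then have "Ck_on k U (pd b f)" if "b \<in> Basis" for b using Suc.IH that by blast
  then show ?case using Suc.prems by simp
qed

lemma Ck_on_const: "Ck_on k U (\<lambda>x. c)"
  by (induction k arbitrary: c) (auto simp: frechet_derivative_const)

lemma Ck_on_add:
  assumes "open U" "Ck_on k U f" "Ck_on k U g" shows "Ck_on k U (\<lambda>x. f x + g x)"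
  using assms(2,3)
proof (induction k arbitrary: f g)
  case 0 then show ?case by (auto intro: continuous_intros)
next
  case (Suc k)
  have eq: "pd b (\<lambda>x. f x + g x) x = pd b f x + pd b g x" if "x \<in> U" for x b
    by (rule pd_eq[OF has_derivative_add]) (use Suc.prems that in \<open>auto simp: frechet_derivative_works\<close>)
  have "Ck_on k U (pd b (\<lambda>x. f x + g x))" if "b \<in> Basis" for b
  proof (rule Ck_on_cong[OF assms(1)])
    show "Ck_on k U (\<lambda>x. pd b f x + pd b g x)" using Suc.prems that by (intro Suc.IH) auto
  qed (simp add: eq)
  then show ?case using Suc.prems by (auto intro: differentiable_add)
qed

lemma Ck_on_mult:
  assumes "open U" "Ck_on k U f" "Ck_on k U g" shows "Ck_on k U (\<lambda>x. f x * g x)"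
  using assms(2,3)
proof (induction k arbitrary: f g)
  case 0 then show ?case by (auto intro: continuous_intros)
next
  case (Suc k)
  have eq: "pd b (\<lambda>x. f x * g x) x = f x * pd b g x + pd b f x * g x" if "x \<in> U" for x b
    by (rule pd_eq[OF has_derivative_mult]) (use Suc.prems that in \<open>auto simp: frechet_derivative_works\<close>)
  \<comment> \<open>The product rule multiplies derivatives by undifferentiated factors, which are
    therefore lowered from order \<open>Suc k\<close> to \<open>k\<close>.\<close>
  have 1: "Ck_on k U (\<lambda>x. f x * pd b g x + pd b f x * g x)" if "b \<in> Basis" for b
    using that Suc.prems Suc.prems[THEN Ck_on_SucD[OF _ assms(1)]]
    by (intro Ck_on_add Suc.IH assms(1)) simp_all
  have "Ck_on k U (pd b (\<lambda>x. f x * g x))" if "b \<in> Basis" for b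
    by (rule Ck_on_cong[OF assms(1) _ 1[OF that]]) (simp add: eq)
  then show ?case using Suc.prems by (auto intro: differentiable_mult)
qed

lemma smooth_on_const [simp]: "smooth_on U (\<lambda>x. c)"
  by (simp add: smooth_on_def Ck_on_const)

lemma smooth_on_add: "open U \<Longrightarrow> smooth_on U f \<Longrightarrow> smooth_on U g \<Longrightarrow> smooth_on U (\<lambda>x. f x + g x)"
  by (simp add: smooth_on_def Ck_on_add)

lemma smooth_on_mult: "open U \<Longrightarrow> smooth_on U f \<Longrightarrow> smooth_on U g \<Longrightarrow> smooth_on U (\<lambda>x. f x * g x)"
  by (simp add: smooth_on_def Ck_on_mult)

lemma smooth_on_diff:
  assumes "open U" "smooth_on U f" "smooth_on U g" shows "smooth_on U (\<lambda>x. f x - g x)"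
  using smooth_on_add[OF assms(1,2) smooth_on_mult[OF assms(1) smooth_on_const[of U "-1"] assms(3)]]
  by simp

lemma smooth_on_prod:
  "finite I \<Longrightarrow> open U \<Longrightarrow> (\<And>i. i \<in> I \<Longrightarrow> smooth_on U (f i)) \<Longrightarrow> smooth_on U (\<lambda>x. \<Prod>i\<in>I. f i x)"
  by (induction I rule: finite_induct) (auto intro: smooth_on_mult)

lemma smooth_on_differentiable: "smooth_on U f \<Longrightarrow> x \<in> U \<Longrightarrow> f differentiable at x"
  unfolding smooth_on_def using Ck_on.simps(2) by blast

lemma smooth_on_has_derivative:
  "smooth_on U f \<Longrightarrow> x \<in> U \<Longrightarrow> (f has_derivative frechet_derivative f (at x)) (at x)"
  using smooth_on_differentiable frechet_derivative_works by blast

lemma smooth_on_continuous: "smooth_on U f \<Longrightarrow> continuous_on U f"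
  unfolding smooth_on_def using Ck_on.simps(1) by blast

lemma smooth_on_pd: "smooth_on U f \<Longrightarrow> b \<in> Basis \<Longrightarrow> smooth_on U (pd b f)"
  unfolding smooth_on_def using Ck_on.simps(2) by blast

lemma pd_expand:
  assumes "f differentiable at x"
  shows "frechet_derivative f (at x) h = (\<Sum>b\<in>Basis. (h \<bullet> b) * pd b f x)"
proof -
  interpret L: linear "frechet_derivative f (at x)"
    using assms frechet_derivative_works has_derivative_linear by blast
  have "frechet_derivative f (at x) h = frechet_derivative f (at x) (\<Sum>b\<in>Basis. (h \<bullet> b) *\<^sub>R b)"
    by (simp add: euclidean_representation)
  also have "\<dots> = (\<Sum>b\<in>Basis. (h \<bullet> b) * pd b f x)"
    by (simp add: L.sum L.scaleR)
  finally show ?thesis .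
qed

lemma pd_mult:
  assumes "f differentiable at x" "g differentiable at x"
  shows "pd b (\<lambda>x. f x * g x) x = f x * pd b g x + pd b f x * g x"
  by (rule pd_eq[OF has_derivative_mult]) (use assms in \<open>auto simp: frechet_derivative_works\<close>)

subsection \<open>Bump functions\<close>

text \<open>Differentiation maps this family into its own span and raises \<open>j\<close>, so one
  induction yields smoothness of all orders. The member \<open>j = 0\<close> is the classical
  function that is flat at 0.\<close>

definition flat_exp :: "real \<Rightarrow> nat \<Rightarrow> real \<Rightarrow> real" where
  "flat_exp c j t = (if 0 < t then exp (- c / t) / t ^ j else 0)"

text \<open>From the right, with \<open>y = c / t\<close>, the function is a constant multiple of
  \<open>y ^ j / exp y\<close>, and \<open>y\<close> tends to infinity; from the left it is
  0.\<close>

lemma flat_exp_tendsto_0: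
  assumes "0 < c" shows "(flat_exp c j \<longlongrightarrow> 0) (at 0)"
proof -
  have r: "((\<lambda>t. (c / t) ^ j / exp (c / t) / c ^ j) \<longlongrightarrow> 0) (at_right 0)"
  proof -
    have "LIM t at_right 0. c * inverse t :> at_top"
      by (rule filterlim_tendsto_pos_mult_at_top[OF tendsto_const assms filterlim_inverse_at_top_right])
    then have "((\<lambda>t. (c / t) ^ j / exp (c / t)) \<longlongrightarrow> 0) (at_right 0)"
      using filterlim_compose[OF tendsto_power_div_exp_0] by (simp add: divide_inverse)
    from tendsto_divide[OF this tendsto_const, of "c ^ j"] show ?thesis using assms by simp
  qed
  have "((\<lambda>t. flat_exp c j t) \<longlongrightarrow> 0) (at_right 0)"
  proof (rule Lim_transform_eventually[OF r])
    show "\<forall>\<^sub>F t in at_right 0. (c / t) ^ j / exp (c / t) / c ^ j = flat_exp c j t"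
      unfolding eventually_at_right_field
      using assms by (intro exI[of _ 1]) (auto simp: flat_exp_def exp_minus field_simps)
  qed
  moreover have "((\<lambda>t. flat_exp c j t) \<longlongrightarrow> 0) (at_left 0)"
    by (rule tendsto_eventually) (auto simp: eventually_at_left_field flat_exp_def intro!: exI[of _ "-1"])
  ultimately show ?thesis using filterlim_at_split by blast
qed

lemma flat_exp_deriv:
  assumes "0 < c"
  shows "(flat_exp c j has_real_derivative c * flat_exp c (j + 2) t - real j * flat_exp c (j + 1) t) (at t)"
proof -
  consider "t > 0" | "t < 0" | "t = 0" by linarith
  then show ?thesis
  proof cases
    case 1
    have "((\<lambda>t. exp (- c / t) / t ^ j) has_real_derivative
        c * (exp (- c / t) / t ^ (j + 2)) - real j * (exp (- c / t) / t ^ (j + 1))) (at t)"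
    proof (cases j)
      case 0
      then show ?thesis using 1
        by (auto intro!: derivative_eq_intros simp: field_simps power2_eq_square)
    next
      case (Suc i)
      then show ?thesis using 1
        by (auto intro!: derivative_eq_intros simp: field_simps power2_eq_square) (cases i; simp)
    qed
    moreover have "\<forall>\<^sub>F s in nhds t. exp (- c / s) / s ^ j = flat_exp c j s"
      using eventually_nhds_in_open[of "{0<..}" t] 1
      by (auto elim!: eventually_mono simp: flat_exp_def)
    ultimately show ?thesis
      using 1 by (subst DERIV_cong_ev[OF refl _ refl, of _ "\<lambda>t. exp (- c / t) / t ^ j"])
        (auto simp: flat_exp_def eq_commute elim: eventually_mono)
  next
    case 2
    have "\<forall>\<^sub>F s in nhds t. flat_exp c j s = 0"
      using eventually_nhds_in_open[of "{..<0}" t] 2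
      by (auto elim!: eventually_mono simp: flat_exp_def)
    then show ?thesis
      using 2 by (subst DERIV_cong_ev[OF refl _ refl, of _ "\<lambda>t. 0"]) (auto simp: flat_exp_def)
  next
    case 3
    have "((\<lambda>h. flat_exp c (Suc j) h) \<longlongrightarrow> 0) (at 0)" by (rule flat_exp_tendsto_0[OF assms])
    \<comment> \<open>At 0 the difference quotient is itself the next member of the family, whose
      limit is 0.\<close>
    moreover have "flat_exp c (Suc j) h = (flat_exp c j (0 + h) - flat_exp c j 0) / h" for h
      by (auto simp: flat_exp_def)
    ultimately show ?thesis
      unfolding 3 DERIV_def by (simp add: flat_exp_def)
  qed
qed

text \<open>The induction on the order runs with \<open>j\<close> arbitrary, because each derivative
  raises it. The affine argument serves both faces of a box, with \<open>s = 1\<close> and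
  \<open>s = -1\<close>.\<close>

lemma flat_exp_smooth:
  fixes a :: "'a::euclidean_space"
  assumes "0 < c" shows "smooth_on UNIV (\<lambda>x. flat_exp c j (s * (x \<bullet> a) + d))"
proof -
  have der: "((\<lambda>x. flat_exp c j (s * (x \<bullet> a) + d)) has_derivative
     (\<lambda>h. (c * flat_exp c (j + 2) (s * (x \<bullet> a) + d) - real j * flat_exp c (j + 1) (s * (x \<bullet> a) + d))
        * (s * (h \<bullet> a)))) (at x)" for j and x :: 'a
  proof -
    have "((\<lambda>x. s * (x \<bullet> a) + d) has_derivative (\<lambda>h. s * (h \<bullet> a))) (at x)"
      by (auto intro!: derivative_eq_intros)
    from DERIV_compose_FDERIV[OF flat_exp_deriv[OF assms] this] show ?thesis
      by (simp add: mult.commute)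
  qed
  have "Ck_on k UNIV (\<lambda>x. flat_exp c j (s * (x \<bullet> a) + d))" for k j
  proof (induction k arbitrary: j)
    case 0
    show ?case using has_derivative_continuous[OF der] by (auto simp: continuous_on_eq_continuous_at)
  next
    case (Suc k)
    let ?D = "\<lambda>b x. (c * flat_exp c (j + 2) (s * (x \<bullet> a) + d)
        + (- real j) * flat_exp c (j + 1) (s * (x \<bullet> a) + d)) * (s * (b \<bullet> a))"
    have "pd b (\<lambda>x. flat_exp c j (s * (x \<bullet> a) + d)) = ?D b" for b
      using pd_eq[OF der] by (simp add: fun_eq_iff)
    moreover have "Ck_on k UNIV (?D b)" for b
      by (intro Ck_on_mult Ck_on_add Ck_on_const Suc.IH open_UNIV)
    moreover have "(\<lambda>x. flat_exp c j (s * (x \<bullet> a) + d)) differentiable at x" for x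
      using der[of j x] unfolding differentiable_def by blast
    ultimately show ?case by simp
  qed
  then show ?thesis by (simp add: smooth_on_def)
qed

text \<open>The parameter \<open>c\<close> is sent to 0: each factor then tends to 1 inside the box,
  so these smooth functions converge to the indicator of the open box. The factors \<open>1\<close>
  and \<open>-1\<close> bring the arguments into the affine form of
  \<open>flat_exp_smooth\<close>.\<close>

definition box_bump :: "real \<Rightarrow> 'a::euclidean_space \<Rightarrow> 'a \<Rightarrow> 'a \<Rightarrow> real" where
  "box_bump c l u x = (\<Prod>b\<in>Basis. flat_exp c 0 (1 * (x \<bullet> b) + - (l \<bullet> b)) * flat_exp c 0 (-1 * (x \<bullet> b) + u \<bullet> b))"

lemma box_bump_smooth: "0 < c \<Longrightarrow> smooth_on UNIV (box_bump c l u)"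
  unfolding box_bump_def[abs_def] by (intro smooth_on_prod smooth_on_mult flat_exp_smooth) auto

lemma box_bump_pos: "x \<in> box l u \<Longrightarrow> 0 < box_bump c l u x"
  by (auto simp: box_bump_def flat_exp_def mem_box intro!: prod_pos)

lemma box_bump_zero:
  assumes "x \<notin> box l u" shows "box_bump c l u x = 0"
proof -
  from assms obtain i where "i \<in> Basis" "\<not> (l \<bullet> i < x \<bullet> i \<and> x \<bullet> i < u \<bullet> i)" by (auto simp: mem_box)
  then show ?thesis unfolding box_bump_def
    by (intro prod_zero bexI[of _ i]) (auto simp: flat_exp_def)
qed

lemma box_bump_le_1: "0 < c \<Longrightarrow> \<bar>box_bump c l u x\<bar> \<le> 1"
  unfolding box_bump_def abs_prod
  by (intro prod_le_1) (auto simp: flat_exp_def abs_mult mult_le_one)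

lemma box_bump_tendsto: "(\<lambda>n. box_bump (1 / real (Suc n)) l u x) \<longlonglongrightarrow> indicator (box l u) x"
proof (cases "x \<in> box l u")
  case True
  have e: "(\<lambda>n. flat_exp (1 / real (Suc n)) 0 t) \<longlonglongrightarrow> 1" if "t > 0" for t
  proof -
    have "(\<lambda>n. exp (- (1 / real (Suc n)) / t)) \<longlonglongrightarrow> exp (- 0 / t)"
      using that by (intro tendsto_intros lim_1_over_n LIMSEQ_Suc[of "\<lambda>n. 1 / real n"]) auto
    then show ?thesis using that by (simp add: flat_exp_def)
  qed
  have "(\<lambda>n. box_bump (1 / real (Suc n)) l u x) \<longlonglongrightarrow> (\<Prod>b\<in>(Basis :: 'a set). 1 * 1)"
    unfolding box_bump_def using True by (intro tendsto_intros e) (auto simp: mem_box)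
  then show ?thesis using True by simp
next
  case False then show ?thesis by (simp add: box_bump_zero)
qed

lemma box_bump_test:
  assumes "0 < c" "cbox l u \<subseteq> U" shows "box_bump c l u \<in> test_functions U"
  unfolding test_functions_def
proof (intro CollectI conjI exI[of _ "cbox l u"] allI impI)
  fix x assume "x \<notin> cbox l u"
  then have "x \<notin> box l u" using box_subset_cbox by blast
  then show "box_bump c l u x = 0" by (rule box_bump_zero)
qed (use assms box_bump_smooth in auto)

subsection \<open>Test functions\<close>

lemma test_smooth: "\<phi> \<in> test_functions U \<Longrightarrow> smooth_on UNIV \<phi>"
  by (simp add: test_functions_def)

lemma test_zero_outside: "\<phi> \<in> test_functions U \<Longrightarrow> x \<notin> U \<Longrightarrow> \<phi> x = 0"
  by (auto simp: test_functions_def)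

lemma pd_zero_off_compact:
  assumes "compact K" "\<forall>x. x \<notin> K \<longrightarrow> f x = 0" "x \<notin> K" shows "pd b f x = 0"
proof -
  have "(f has_derivative (\<lambda>_. 0)) (at x)"
  proof (rule has_derivative_transform_within_open)
    show "((\<lambda>_. 0) has_derivative (\<lambda>_. 0)) (at x)" by (rule has_derivative_const)
    show "open (- K)" using compact_imp_closed[OF assms(1)] by blast
  qed (use assms in auto)
  then show ?thesis by (rule pd_eq)
qed

lemma test_pd:
  assumes "\<phi> \<in> test_functions U" "b \<in> Basis" shows "pd b \<phi> \<in> test_functions U"
  using assms smooth_on_pd pd_zero_off_compact[where f = \<phi> and b = b]
  unfolding test_functions_def by blast

lemma test_mult:
  assumes "\<phi> \<in> test_functions U" "smooth_on UNIV f" shows "(\<lambda>x. f x * \<phi> x) \<in> test_functions U"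
  using assms unfolding test_functions_def by (auto intro!: smooth_on_mult)

lemma test_bounded:
  assumes "\<phi> \<in> test_functions U" obtains B where "0 \<le> B" "\<And>x. \<bar>\<phi> x\<bar> \<le> B"
proof -
  from assms obtain K where K: "compact K" "\<forall>x. x \<notin> K \<longrightarrow> \<phi> x = 0" by (auto simp: test_functions_def)
  have "continuous_on K \<phi>"
    using smooth_on_continuous[OF test_smooth[OF assms]] continuous_on_subset by blast
  from compact_continuous_image[OF this K(1)] obtain B where "\<forall>y\<in>\<phi> ` K. \<bar>y\<bar> \<le> B"
    by (meson bounded_real compact_imp_bounded)
  then have "\<bar>\<phi> x\<bar> \<le> max B 0" for x using K(2) by (cases "x \<in> K") force+
  then show thesis using that[of "max B 0"] by auto
qed

lemma test_measurable: "\<phi> \<in> test_functions U \<Longrightarrow> \<phi> \<in> borel_measurable borel"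
  using smooth_on_continuous[OF test_smooth] borel_measurable_continuous_onI by blast

lemma test_power_integrable:
  assumes "\<phi> \<in> test_functions U" shows "integrable lborel (\<lambda>x. \<bar>\<phi> x\<bar> ^ Suc k)"
proof -
  from assms obtain K where K: "compact K" "\<forall>x. x \<notin> K \<longrightarrow> \<phi> x = 0" by (auto simp: test_functions_def)
  from test_bounded[OF assms] obtain B where B: "0 \<le> B" "\<And>x. \<bar>\<phi> x\<bar> \<le> B" by blast
  note [measurable] = test_measurable[OF assms]
  have [measurable]: "K \<in> sets borel" using K(1) by (simp add: borel_compact)
  show ?thesis
  proof (rule Bochner_Integration.integrable_bound)
    show "integrable lborel (\<lambda>x. B ^ Suc k * indicator K x)"
      using emeasure_bounded_finite[OF compact_imp_bounded[OF K(1)]]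
      by (intro integrable_mult_right integrable_real_indicator) auto
    show "AE x in lborel. norm (\<bar>\<phi> x\<bar> ^ Suc k) \<le> norm (B ^ Suc k * indicator K x)"
    proof (rule AE_I2)
      fix x
      show "norm (\<bar>\<phi> x\<bar> ^ Suc k) \<le> norm (B ^ Suc k * indicator K x)"
        using B(1) K(2) power_mono[OF B(2)[of x], of "Suc k"]
        by (cases "x \<in> K") (auto simp: abs_mult)
    qed
  qed measurable
qed

lemma test_Lp_2:
  assumes "\<phi> \<in> test_functions U" "S \<in> sets lebesgue" shows "\<phi> \<in> Lp 2 (lebesgue_on S)"
proof -
  have m: "\<phi> \<in> borel_measurable lebesgue"
    using test_measurable[OF assms(1)] by (simp add: measurable_completion)
  have "integrable lborel (\<lambda>x. (\<phi> x)\<^sup>2)"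
    using test_power_integrable[OF assms(1), of 1] by (simp add: power2_eq_square)
  then have i: "integrable lebesgue (\<lambda>x. (\<phi> x)\<^sup>2)"
    using test_measurable[OF assms(1)] by (simp add: integrable_completion)
  have "integrable (lebesgue_on S) (\<lambda>x. (\<phi> x)\<^sup>2)"
    using integrable_mult_indicator[OF assms(2) i] assms(2) by (simp add: integrable_restrict_space)
  moreover have "\<phi> \<in> borel_measurable (lebesgue_on S)" using m by (rule measurable_restrict_space1)
  ultimately show ?thesis by (simp add: Lp_2_iff)
qed

lemma integral_translate:
  fixes f :: "'a::euclidean_space \<Rightarrow> real"
  assumes [measurable]: "f \<in> borel_measurable borel"
  shows "(\<integral>x. f (c + x) \<partial>lborel) = (\<integral>x. f x \<partial>lborel)"
proof -
  have "(\<integral>x. f x \<partial>lborel) = (\<integral>x. f x \<partial>distr lborel borel ((+) c))" by (simp add: lborel_distr_plus)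
  also have "\<dots> = (\<integral>x. f (c + x) \<partial>lborel)" by (subst integral_distr) auto
  finally show ?thesis ..
qed

text \<open>The difference quotients have integral zero by translation invariance.\<close>

lemma integral_pd_zero:
  fixes f :: "'a::euclidean_space \<Rightarrow> real"
  assumes f: "f \<in> test_functions U" and b: "b \<in> Basis"
  shows "(\<integral>x. pd b f x \<partial>lborel) = 0"
proof -
  from f obtain K where K: "compact K" "\<forall>x. x \<notin> K \<longrightarrow> f x = 0" by (auto simp: test_functions_def)
  from compact_imp_bounded[OF K(1)] obtain R where R: "\<And>x. x \<in> K \<Longrightarrow> norm x \<le> R"
    by (auto simp: bounded_iff)
  from test_bounded[OF test_pd[OF f b]] obtain B where B: "0 \<le> B" "\<And>x. \<bar>pd b f x\<bar> \<le> B" by blast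
  have [measurable]: "f \<in> borel_measurable borel" "pd b f \<in> borel_measurable borel"
    using test_measurable f test_pd[OF f b] by auto
  have fi: "integrable lborel f"
    using test_power_integrable[OF f, of 0] by (simp add: integrable_abs_iff)
  have der: "((\<lambda>t. f (t *\<^sub>R b + x)) has_real_derivative pd b f (t *\<^sub>R b + x)) (at t)" for t x
  proof -
    have "((\<lambda>t. t *\<^sub>R b + x) has_derivative (\<lambda>h. h *\<^sub>R b)) (at t)" by (auto intro!: derivative_eq_intros)
    from has_derivative_compose[OF this smooth_on_has_derivative[OF test_smooth[OF f], of "t *\<^sub>R b + x"]]
    have "((\<lambda>t. f (t *\<^sub>R b + x)) has_derivative
        (\<lambda>h. frechet_derivative f (at (t *\<^sub>R b + x)) (h *\<^sub>R b))) (at t)" by simp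
    moreover have "linear (frechet_derivative f (at (t *\<^sub>R b + x)))"
      using smooth_on_has_derivative[OF test_smooth[OF f], of "t *\<^sub>R b + x"] has_derivative_linear by blast
    moreover have "(*) (pd b f (t *\<^sub>R b + x)) = (\<lambda>h. h * pd b f (t *\<^sub>R b + x))"
      by (simp add: fun_eq_iff mult.commute)
    ultimately show ?thesis
      by (simp add: has_field_derivative_def linear.scaleR)
  qed
  define t where "t = (\<lambda>n::nat. 1 / real (Suc n))"
  have t: "0 < t n" "t n \<le> 1" for n by (auto simp: t_def)
  define q where "q = (\<lambda>n x. (f (t n *\<^sub>R b + x) - f x) / t n)"
  have "(\<lambda>n. \<integral>x. q n x \<partial>lborel) \<longlonglongrightarrow> (\<integral>x. pd b f x \<partial>lborel)"
  \<comment> \<open>By the mean value theorem the quotients are bounded by \<open>B\<close>; steps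
    of length at most 1 keep their supports in the ball of radius \<open>R + 1\<close>.\<close>
  proof (rule integral_dominated_convergence[where w="\<lambda>x. B * indicator (cball 0 (R + 1)) x"])
    show "q n \<in> borel_measurable lborel" for n unfolding q_def by measurable
    show "integrable lborel (\<lambda>x :: 'a. B * indicator (cball 0 (R + 1)) x)"
      using emeasure_bounded_finite[of "cball 0 (R + 1) :: 'a set"]
      by (intro integrable_mult_right integrable_real_indicator) auto
    show "AE x in lborel. (\<lambda>n. q n x) \<longlonglongrightarrow> pd b f x"
    proof (rule AE_I2)
      fix x
      have "((\<lambda>h. (f (h *\<^sub>R b + x) - f x) / h) \<longlongrightarrow> pd b f x) (at 0)"
        using der[where x=x and t=0] by (simp add: DERIV_def)
      moreover have "filterlim t (at 0) sequentially"
        unfolding t_def filterlim_at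
        using LIMSEQ_Suc[OF lim_1_over_n[where 'a=real]] by auto
      ultimately show "(\<lambda>n. q n x) \<longlonglongrightarrow> pd b f x"
        unfolding q_def by (rule filterlim_compose)
    qed
    fix n
    show "AE x in lborel. norm (q n x) \<le> B * indicator (cball 0 (R + 1)) x"
    proof (rule AE_I2)
      fix x
      show "norm (q n x) \<le> B * indicator (cball 0 (R + 1)) x"
      proof (cases "x \<in> cball 0 (R + 1)")
        case True
        obtain s where "f (t n *\<^sub>R b + x) - f (0 *\<^sub>R b + x) = (t n - 0) * pd b f (s *\<^sub>R b + x)"
          using MVT2[of 0 "t n" "\<lambda>t. f (t *\<^sub>R b + x)" "\<lambda>t. pd b f (t *\<^sub>R b + x)"] t[of n] der by blast
        then have "q n x = pd b f (s *\<^sub>R b + x)" using t(1)[of n] by (simp add: q_def)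
        then show ?thesis using True B by simp
      next
        case False
        have "norm x \<le> norm (t n *\<^sub>R b + x) + norm (t n *\<^sub>R b)"
          using norm_triangle_ineq4[of "t n *\<^sub>R b + x" "t n *\<^sub>R b"] by simp
        also have "norm (t n *\<^sub>R b) \<le> 1" using t[of n] b by simp
        finally have "t n *\<^sub>R b + x \<notin> K" using False R[of "t n *\<^sub>R b + x"] by auto
        moreover have "x \<notin> K" using False R[of x] by auto
        ultimately show ?thesis using K(2) False by (simp add: q_def)
      qed
    qed
  qed measurable
  moreover have "(\<integral>x. q n x \<partial>lborel) = 0" for n
  proof -
    have i2: "integrable lborel (\<lambda>x. f (t n *\<^sub>R b + x))"
    proof -
      have "integrable (distr lborel borel ((+) (t n *\<^sub>R b))) f" using fi by (simp add: lborel_distr_plus)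
      then show ?thesis by (subst (asm) integrable_distr_eq) auto
    qed
    show ?thesis unfolding q_def using i2 fi integral_translate[of f "t n *\<^sub>R b"] by simp
  qed
  ultimately show ?thesis by (simp add: LIMSEQ_const_iff)
qed

text \<open>The product of \<open>f\<close> and \<open>\<phi>\<close> is again a test function, so
  the integral of its partial derivative vanishes; the product rule splits it.\<close>

lemma test_ibp_lborel:
  assumes \<phi>: "\<phi> \<in> test_functions U" and f: "smooth_on UNIV f" and b: "b \<in> Basis"
  shows "(\<integral>x. f x * pd b \<phi> x \<partial>lborel) = - (\<integral>x. pd b f x * \<phi> x \<partial>lborel)"
proof -
  have t: "(\<lambda>x. f x * \<phi> x) \<in> test_functions U" by (rule test_mult[OF \<phi> f])
  have t1: "(\<lambda>x. f x * pd b \<phi> x) \<in> test_functions U" by (rule test_mult[OF test_pd[OF \<phi> b] f])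
  have t2: "(\<lambda>x. pd b f x * \<phi> x) \<in> test_functions U" by (rule test_mult[OF \<phi> smooth_on_pd[OF f b]])
  have i: "integrable lborel (\<lambda>x. f x * pd b \<phi> x)" "integrable lborel (\<lambda>x. pd b f x * \<phi> x)"
    using test_power_integrable[OF t1, of 0] test_power_integrable[OF t2, of 0]
      test_measurable[OF t1] test_measurable[OF t2] by (auto simp: integrable_abs_iff)
  have "pd b (\<lambda>x. f x * \<phi> x) x = f x * pd b \<phi> x + pd b f x * \<phi> x" for x
    using smooth_on_differentiable[OF f] smooth_on_differentiable[OF test_smooth[OF \<phi>]] by (intro pd_mult) auto
  with integral_pd_zero[OF t b] i show ?thesis by simp
qed

section \<open>Weak derivatives\<close>

text \<open>Boxes form an intersection-stable generator of the Borel sets, so vanishing integrals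
  spread to all Borel sets by a Dynkin argument; an integrable function with this property is 0
  almost everywhere.\<close>

lemma AE_zero_if_box_integrals_zero:
  fixes h :: "'a::euclidean_space \<Rightarrow> real"
  assumes h: "integrable lborel h"
    and z: "\<And>l u. (\<integral>x. indicator (box l u) x * h x \<partial>lborel) = 0"
  shows "AE x in lborel. h x = 0"
proof -
  \<comment> \<open>The integral over the whole space, exhausted by boxes, is what the complement
    step of the induction requires.\<close>
  have tot: "(\<integral>x. h x \<partial>lborel) = 0"
  proof -
    define B where "B n = box (\<Sum>b\<in>Basis. - real n *\<^sub>R b) (\<Sum>b\<in>Basis. real n *\<^sub>R b :: 'a)" for n :: nat
    have "(\<lambda>n. \<integral>x. indicator (B n) x * h x \<partial>lborel) \<longlonglongrightarrow> (\<integral>x. h x \<partial>lborel)"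
    proof (rule integral_dominated_convergence[where w="\<lambda>x. \<bar>h x\<bar>"])
      show "AE x in lborel. (\<lambda>n. indicator (B n) x * h x) \<longlonglongrightarrow> h x"
      proof (rule AE_I2)
        fix x :: 'a
        obtain K :: nat where K: "norm x < real K" using reals_Archimedean2 by blast
        have "x \<in> B n" if "K \<le> n" for n
        proof -
          have "\<bar>x \<bullet> b\<bar> < real n" if "b \<in> Basis" for b
            using Basis_le_norm[OF that, of x] K \<open>K \<le> n\<close> by linarith
          then show ?thesis by (force simp: B_def mem_box inner_sum_left inner_Basis if_distrib cong: if_cong)
        qed
        then have "\<forall>n\<ge>K. indicator (B n) x * h x = h x" by auto
        then show "(\<lambda>n. indicator (B n) x * h x) \<longlonglongrightarrow> h x"
          by (intro tendsto_eventually) (auto simp: eventually_sequentially)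
      qed
    qed (use h in \<open>auto simp: B_def split: split_indicator\<close>)
    then show ?thesis using z by (simp add: B_def LIMSEQ_const_iff)
  qed
  have i: "integrable lborel (\<lambda>x. indicator A x * h x)" if "A \<in> sets borel" for A
    using integrable_mult_indicator[of A lborel h] that h by simp
  have "(\<integral>x. indicator A x * h x \<partial>lborel) = 0" if "A \<in> sets borel" for A
  proof -
    have "Int_stable (range (\<lambda>(a, b). box a b :: 'a set))"
      by (auto simp: Int_stable_def box_Int_box)
    moreover have "range (\<lambda>(a, b). box a b :: 'a set) \<subseteq> Pow UNIV" by simp
    moreover have "A \<in> sigma_sets UNIV (range (\<lambda>(a, b). box a b))"
      using that by (simp add: borel_eq_box sets_measure_of[of _ UNIV])
    ultimately show ?thesis
    proof (induction rule: sigma_sets_induct_disjoint)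
      case (basic A) then show ?case using z by auto
    next
      case empty then show ?case by simp
    next
      case (compl A)
      then have A: "A \<in> sets borel"
        by (simp add: borel_eq_box sets_measure_of[of _ UNIV])
      have "(\<lambda>x. indicator (UNIV - A) x * h x) = (\<lambda>x. h x - indicator A x * h x)"
        by (auto split: split_indicator)
      then show ?case using compl tot h i[OF A] by simp
    next
      case (union A)
      then have A: "A n \<in> sets borel" for n
        by (simp add: borel_eq_box sets_measure_of[of _ UNIV] image_subset_iff)
      have "(\<lambda>n. \<integral>x. indicator (\<Union>i<n. A i) x * h x \<partial>lborel)
          \<longlonglongrightarrow> (\<integral>x. indicator (\<Union>i. A i) x * h x \<partial>lborel)"
      proof (rule integral_dominated_convergence[where w="\<lambda>x. \<bar>h x\<bar>"])
        show "AE x in lborel. (\<lambda>n. indicator (\<Union>i<n. A i) x * h x) \<longlonglongrightarrow> indicator (\<Union>i. A i) x * h x"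
          by (rule AE_I2) (intro tendsto_intros LIMSEQ_indicator_UN)
      qed (use h A in \<open>auto split: split_indicator\<close>)
      moreover have "(\<integral>x. indicator (\<Union>i<n. A i) x * h x \<partial>lborel) = 0" for n
      proof -
        have "indicator (\<Union>i<n. A i) x = (\<Sum>i<n. indicator (A i) x :: real)" for x
          using union(1) by (intro indicator_UN_disjoint) (auto simp: disjoint_family_on_def)
        then have "(\<integral>x. indicator (\<Union>i<n. A i) x * h x \<partial>lborel) = (\<Sum>i<n. \<integral>x. indicator (A i) x * h x \<partial>lborel)"
          using i[OF A] by (simp only: sum_distrib_right Bochner_Integration.integral_sum)
        then show ?thesis using union by simp
      qed
      ultimately show ?case by (simp add: LIMSEQ_const_iff)
    qed
  qed
  then show ?thesis
    using density_unique_real[OF h, of "\<lambda>_. 0"] by (simp add: set_lebesgue_integral_def)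
qed

text \<open>Lebesgue measure on \<open>S\<close> is complete, so a change on a null set preserves
  measurability. In this way functions of time that are known up to null sets become
  measurable.\<close>

lemma lebesgue_on_complete:
  assumes "S \<in> sets lebesgue" "f \<in> borel_measurable (lebesgue_on S)" "AE x in lebesgue_on S. f x = g x"
  shows "g \<in> borel_measurable (lebesgue_on S :: 'a::euclidean_space measure)"
proof -
  interpret complete_measure "lebesgue_on S"
  proof
    fix A B assume AB: "B \<subseteq> A" "A \<in> null_sets (lebesgue_on S)"
    have "A \<in> null_sets lebesgue" using AB(2) assms(1) null_sets_restrict_space by blast
    moreover have "A \<subseteq> S" using AB(2) null_setsD2 sets.sets_into_space by fastforce
    ultimately have "B \<in> sets lebesgue" "B \<subseteq> S" using AB(1) null_sets_completion_subset by blast+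
    then show "B \<in> sets (lebesgue_on S)" using assms(1) by (simp add: sets_restrict_space_iff)
  qed
  obtain N where N: "\<And>x. x \<in> space (lebesgue_on S) - N \<Longrightarrow> f x = g x" "N \<in> null_sets (lebesgue_on S)"
    using AE_E3[OF assms(3)] by blast
  show ?thesis
  proof (rule measurableI)
    fix A :: "'b set" assume A: "A \<in> sets borel"
    let ?P = "f -` A \<inter> space (lebesgue_on S)" and ?Q = "g -` A \<inter> space (lebesgue_on S)"
    have P: "?P \<in> sets (lebesgue_on S)" using assms(2) A by (rule measurable_sets)
    have "?Q \<inter> N \<in> sets (lebesgue_on S)" by (rule complete[OF _ N(2)]) auto
    moreover have "?Q = (?P - N) \<union> (?Q \<inter> N)" using N(1) by auto
    ultimately show "?Q \<in> sets (lebesgue_on S)" using P N(2) by (metis sets.Diff sets.Un null_setsD2)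
  qed simp
qed

lemma lebesgue_box_borel_rep:
  assumes "h \<in> borel_measurable lebesgue"
  obtains h' :: "'a::euclidean_space \<Rightarrow> real"
    where "h' \<in> borel_measurable borel" "AE x in lebesgue. h x = h' x"
proof -
  from completion_ex_borel_measurable_real[OF assms]
  obtain h' where "h' \<in> borel_measurable lborel" "AE x in lborel. h x = h' x" by blast
  then show thesis using that[of h'] by (auto intro: AE_completion)
qed

text \<open>Box bumps are test functions converging to indicators, so \<open>v\<close> has integral
  0 over every open box whose closure lies in \<open>U\<close>. Hence \<open>v\<close> vanishes
  almost everywhere on each closed box in \<open>U\<close>, and countably many of them cover
  \<open>U\<close>.\<close>

lemma fundamental_lemma:
  assumes U: "open U" and v: "v \<in> Lp 2 (lebesgue_on U)"
    and z: "\<And>\<phi>. \<phi> \<in> test_functions U \<Longrightarrow> (\<integral>x. v x * \<phi> x \<partial>lebesgue_on U) = 0"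
  shows "AE x in lebesgue_on U. v x = (0::real)"
proof -
  have Us [simp]: "U \<in> sets lebesgue" "U \<inter> space lebesgue \<in> sets lebesgue" using U by auto
  define V where "V = (\<lambda>x. indicator U x * v x)"
  have Vm: "V \<in> borel_measurable lebesgue"
    using v by (simp add: V_def Lp_2_iff borel_measurable_restrict_space_iff)
  have "(\<lambda>x. (V x)\<^sup>2) = (\<lambda>x. indicator U x * (v x)\<^sup>2)" by (auto simp: V_def split: split_indicator)
  then have V2: "integrable lebesgue (\<lambda>x. (V x)\<^sup>2)"
    using v by (simp add: Lp_2_iff integrable_restrict_space)
  \<comment> \<open>Square integrable functions are integrable on bounded sets, by
    \<open>|s| <= 1 + s^2\<close>.\<close>
  have loc: "integrable lebesgue (\<lambda>x. indicator A x * V x)" if "bounded A" "A \<in> sets lebesgue" for A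
  proof (rule Bochner_Integration.integrable_bound)
    show "integrable lebesgue (\<lambda>x. indicator A x + (V x)\<^sup>2)"
      using bounded_set_imp_lmeasurable[OF that] V2
      by (intro Bochner_Integration.integrable_add) (simp_all only: lmeasurable_iff_integrable)
    have "\<bar>s\<bar> \<le> 1 + s\<^sup>2" for s :: real
      using sum_squares_bound[of 1 "\<bar>s\<bar>"] by simp
    then show "AE x in lebesgue. norm (indicator A x * V x) \<le> norm (indicator A x + (V x)\<^sup>2)"
      by (auto split: split_indicator)
  qed (use Vm that in measurable)
  have box0: "(\<integral>x. indicator (box l u) x * V x \<partial>lebesgue) = 0" if lu: "cbox l u \<subseteq> U" for l u
  proof -
    let ?\<beta> = "\<lambda>n. box_bump (1 / real (Suc n)) l u"
    have t: "?\<beta> n \<in> test_functions U" for n using lu by (intro box_bump_test) auto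
    note Vm [measurable]
    have bm [measurable]: "?\<beta> n \<in> borel_measurable lebesgue" for n
      using test_measurable[OF t] by (simp add: measurable_completion)
    have "(\<lambda>n. \<integral>x. ?\<beta> n x * V x \<partial>lebesgue) \<longlonglongrightarrow> (\<integral>x. indicator (box l u) x * V x \<partial>lebesgue)"
    proof (rule integral_dominated_convergence[where w="\<lambda>x. \<bar>indicator (box l u) x * V x\<bar>"])
      show "integrable lebesgue (\<lambda>x. \<bar>indicator (box l u) x * V x\<bar>)"
        by (intro integrable_abs loc) auto
      show "AE x in lebesgue. (\<lambda>n. ?\<beta> n x * V x) \<longlonglongrightarrow> indicator (box l u) x * V x"
        by (rule AE_I2) (intro tendsto_intros box_bump_tendsto)
      fix n
      have "\<bar>?\<beta> n x\<bar> \<le> indicator (box l u) x" for x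
        using box_bump_le_1[of "1 / real (Suc n)" l u x] box_bump_zero[of x l u]
        by (cases "x \<in> box l u") auto
      then show "AE x in lebesgue. norm (?\<beta> n x * V x) \<le> \<bar>indicator (box l u) x * V x\<bar>"
        by (auto simp: abs_mult intro!: mult_right_mono)
    qed (use Vm bm in \<open>auto intro!: borel_measurable_times borel_measurable_indicator\<close>)
    moreover have "(\<integral>x. ?\<beta> n x * V x \<partial>lebesgue) = 0" for n
      using z[OF t] by (simp add: integral_restrict_space V_def mult_ac)
    ultimately show ?thesis by (simp add: LIMSEQ_const_iff)
  qed
  have cb: "AE x in lebesgue. x \<in> cbox l u \<longrightarrow> v x = 0" if lu: "cbox l u \<subseteq> U" for l u
  proof -
    define h where "h = (\<lambda>x. indicator (box l u) x * V x)"
    have hi: "integrable lebesgue h" unfolding h_def by (intro loc) auto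
    obtain h' where h': "h' \<in> borel_measurable borel" "AE x in lebesgue. h x = h' x"
      using lebesgue_box_borel_rep[of h] hi by blast
    have h'l: "h' \<in> borel_measurable lebesgue" using h'(1) by (simp add: measurable_completion)
    have "integrable lebesgue h'"
      using integrable_cong_AE[OF _ h'l h'(2)] hi by auto
    then have hi': "integrable lborel h'" using h'(1) by (simp add: integrable_completion)
    have "AE x in lborel. h' x = 0"
    proof (rule AE_zero_if_box_integrals_zero[OF hi'])
      fix c d :: 'a
      have "(\<integral>x. indicator (box c d) x * h' x \<partial>lborel) = (\<integral>x. indicator (box c d) x * h' x \<partial>lebesgue)"
        using h'(1) by (intro integral_completion[symmetric]) measurable
      also have "\<dots> = (\<integral>x. indicator (box c d) x * h x \<partial>lebesgue)"
        using h'(2) h'l hi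
        by (intro integral_cong_AE) (auto intro!: borel_measurable_times borel_measurable_indicator)
      \<comment> \<open>An arbitrary box is cut down to its intersection with
        \<open>box l u\<close>; that is again a box, and its closure stays inside
        \<open>cbox l u\<close> and hence in \<open>U\<close>.\<close>
      also have "(\<lambda>x. indicator (box c d) x * h x) = (\<lambda>x. indicator (box c d \<inter> box l u) x * V x)"
        by (auto simp: h_def split: split_indicator)
      also obtain c' d' where cd: "box c d \<inter> box l u = box c' d'" using box_Int_box by blast
      also have "(\<integral>x. indicator (box c' d') x * V x \<partial>lebesgue) = 0"
      proof (cases "box c' d' = {}")
        case False
        have "cbox c' d' = closure (box c' d')" using False by (simp add: closure_box)
        also have "\<dots> \<subseteq> cbox l u" using cd box_subset_cbox[of l u] by (intro closure_minimal) auto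
        finally show ?thesis using lu box0 by blast
      qed simp
      finally show "(\<integral>x. indicator (box c d) x * h' x \<partial>lborel) = 0" .
    qed
    then have "AE x in lebesgue. h' x = 0" by (rule AE_completion)
    moreover have "AE x in lebesgue. x \<notin> cbox l u - box l u"
    proof -
      have "negligible (cbox l u - box l u)" by (rule negligible_frontier_interval)
      then show ?thesis using AE_not_in negligible_iff_null_sets by blast
    qed
    ultimately show ?thesis using h'(2)
    proof eventually_elim
      case (elim x)
      then show ?case using lu box_subset_cbox[of l u] by (auto simp: h_def V_def)
    qed
  qed
  obtain \<D> where \<D>: "countable \<D>" "\<D> \<subseteq> Pow U" "\<And>X. X \<in> \<D> \<Longrightarrow> \<exists>a b. X = cbox a b" "\<Union>\<D> = U"
    using open_countable_Union_open_cbox[OF U] by metis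
  have "AE x in lebesgue. \<forall>X\<in>\<D>. x \<in> X \<longrightarrow> v x = 0"
  proof (subst AE_ball_countable[OF \<D>(1)], intro ballI)
    fix X assume X: "X \<in> \<D>"
    then obtain a b where "X = cbox a b" using \<D>(3) by blast
    then show "AE x in lebesgue. x \<in> X \<longrightarrow> v x = 0" using cb[of a b] \<D>(2) X by auto
  qed
  then have "AE x in lebesgue. x \<in> U \<longrightarrow> v x = 0" using \<D>(4) by (auto elim!: eventually_mono)
  then show ?thesis by (simp add: AE_restrict_space_iff)
qed

lemma Lp_2_integrable_test:
  assumes "open U" "u \<in> Lp 2 (lebesgue_on U)" "\<phi> \<in> test_functions U"
  shows "integrable (lebesgue_on U) (\<lambda>x. u x * \<phi> x)"
  using assms L2_mult_integrable test_Lp_2[of \<phi> U U] by auto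

text \<open>\<open>weak_partial\<close> is chosen by \<open>SOME\<close>; this uniqueness is what
  determines it almost everywhere and lets it be computed.\<close>

lemma weak_partial_unique:
  assumes U: "open U" and "is_weak_partial U b u v" "is_weak_partial U b u v'"
  shows "AE x in lebesgue_on U. v x = v' x"
proof -
  have v: "v \<in> Lp 2 (lebesgue_on U)" "v' \<in> Lp 2 (lebesgue_on U)"
    using assms by (auto simp: is_weak_partial_def)
  have "AE x in lebesgue_on U. v x - v' x = 0"
  proof (rule fundamental_lemma[OF U])
    show "(\<lambda>x. v x - v' x) \<in> Lp 2 (lebesgue_on U)" using v by auto
    fix \<phi> assume p: "\<phi> \<in> test_functions U"
    have "(\<integral>x. (v x - v' x) * \<phi> x \<partial>lebesgue_on U)
        = (\<integral>x. v x * \<phi> x \<partial>lebesgue_on U) - (\<integral>x. v' x * \<phi> x \<partial>lebesgue_on U)"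
      using Lp_2_integrable_test[OF U _ p] v by (simp add: left_diff_distrib)
    also have "\<dots> = 0" using assms(2,3) p by (fastforce simp: is_weak_partial_def)
    finally show "(\<integral>x. (v x - v' x) * \<phi> x \<partial>lebesgue_on U) = 0" .
  qed
  then show ?thesis by simp
qed

lemma is_weak_partial_diff:
  assumes U: "open U" and b: "b \<in> Basis" and u: "u \<in> Lp 2 (lebesgue_on U)" "u' \<in> Lp 2 (lebesgue_on U)"
    and w: "is_weak_partial U b u v" "is_weak_partial U b u' v'"
  shows "is_weak_partial U b (\<lambda>x. u x - u' x) (\<lambda>x. v x - v' x)"
proof -
  have v: "v \<in> Lp 2 (lebesgue_on U)" "v' \<in> Lp 2 (lebesgue_on U)"
    using w by (auto simp: is_weak_partial_def)
  show ?thesis unfolding is_weak_partial_def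
  proof (intro conjI ballI)
    show "(\<lambda>x. v x - v' x) \<in> Lp 2 (lebesgue_on U)" using v by auto
    fix \<phi> assume p: "\<phi> \<in> test_functions U"
    have "(\<integral>x. (u x - u' x) * pd b \<phi> x \<partial>lebesgue_on U)
        = (\<integral>x. u x * pd b \<phi> x \<partial>lebesgue_on U) - (\<integral>x. u' x * pd b \<phi> x \<partial>lebesgue_on U)"
      using Lp_2_integrable_test[OF U _ test_pd[OF p b]] u by (simp add: left_diff_distrib)
    also have "\<dots> = - ((\<integral>x. v x * \<phi> x \<partial>lebesgue_on U) - (\<integral>x. v' x * \<phi> x \<partial>lebesgue_on U))"
      using w p by (auto simp: is_weak_partial_def)
    also have "\<dots> = - (\<integral>x. (v x - v' x) * \<phi> x \<partial>lebesgue_on U)"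
      using Lp_2_integrable_test[OF U _ p] v by (simp add: left_diff_distrib)
    finally show "(\<integral>x. (u x - u' x) * pd b \<phi> x \<partial>lebesgue_on U)
      = - (\<integral>x. (v x - v' x) * \<phi> x \<partial>lebesgue_on U)" .
  qed
qed

text \<open>The conclusion is equality of functions, not just almost everywhere: the predicates
  behind \<open>SOME\<close> depend on \<open>u\<close> through integrals alone, hence coincide, and
  so do the chosen values.\<close>

lemma weak_partial_AE_cong:
  assumes "open U" "b \<in> Basis" "u \<in> borel_measurable (lebesgue_on U)" "u' \<in> borel_measurable (lebesgue_on U)"
    and ae: "AE x in lebesgue_on U. u x = u' x"
  shows "weak_partial U b u = weak_partial U b u'"
proof -
  have "(\<integral>x. u x * pd b \<phi> x \<partial>lebesgue_on U) = (\<integral>x. u' x * pd b \<phi> x \<partial>lebesgue_on U)"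
    if "\<phi> \<in> test_functions U" for \<phi>
  proof (rule integral_cong_AE)
    have "pd b \<phi> \<in> borel_measurable (lebesgue_on U)"
      using test_measurable[OF test_pd[OF that assms(2)]]
      by (intro measurable_restrict_space1) (simp add: measurable_completion)
    then show "(\<lambda>x. u x * pd b \<phi> x) \<in> borel_measurable (lebesgue_on U)"
      "(\<lambda>x. u' x * pd b \<phi> x) \<in> borel_measurable (lebesgue_on U)" using assms by auto
    show "AE x in lebesgue_on U. u x * pd b \<phi> x = u' x * pd b \<phi> x"
      using ae by eventually_elim simp
  qed
  then have "is_weak_partial U b u = is_weak_partial U b u'"
    by (auto simp: is_weak_partial_def fun_eq_iff)
  then show ?thesis by (simp add: weak_partial_def)
qed

lemma H1_Lp_2: "u \<in> H1 U \<Longrightarrow> u \<in> Lp 2 (lebesgue_on U)"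
  by (simp add: H1_def)

lemma weak_partial_spec:
  assumes "u \<in> H1 U" "b \<in> Basis" shows "is_weak_partial U b u (weak_partial U b u)"
proof -
  obtain v where "is_weak_partial U b u v" using assms by (auto simp: H1_def)
  then show ?thesis unfolding weak_partial_def by (rule someI[where P="is_weak_partial U b u"])
qed

lemma weak_partial_Lp_2: "u \<in> H1 U \<Longrightarrow> b \<in> Basis \<Longrightarrow> weak_partial U b u \<in> Lp 2 (lebesgue_on U)"
  using weak_partial_spec is_weak_partial_def by blast

lemma H1_diff:
  assumes "open U" "u \<in> H1 U" "v \<in> H1 U" shows "(\<lambda>x. u x - v x) \<in> H1 U"
proof -
  have "\<exists>w. is_weak_partial U b (\<lambda>x. u x - v x) w" if "b \<in> Basis" for b
    using is_weak_partial_diff[OF assms(1) that H1_Lp_2[OF assms(2)] H1_Lp_2[OF assms(3)]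
       weak_partial_spec[OF assms(2) that] weak_partial_spec[OF assms(3) that]] by blast
  then show ?thesis using H1_Lp_2[OF assms(2)] H1_Lp_2[OF assms(3)] by (auto simp: H1_def)
qed

lemma weak_partial_diff:
  assumes "open U" "u \<in> H1 U" "v \<in> H1 U" "b \<in> Basis"
  shows "AE x in lebesgue_on U. weak_partial U b (\<lambda>x. u x - v x) x = weak_partial U b u x - weak_partial U b v x"
  using weak_partial_unique[OF assms(1) weak_partial_spec[OF H1_diff[OF assms(1-3)] assms(4)]
    is_weak_partial_diff[OF assms(1,4) H1_Lp_2[OF assms(2)] H1_Lp_2[OF assms(3)]
       weak_partial_spec[OF assms(2,4)] weak_partial_spec[OF assms(3,4)]]] .

lemma H1_AE_cong:
  assumes "open U" "u \<in> H1 U" "v \<in> borel_measurable (lebesgue_on U)" "AE x in lebesgue_on U. u x = v x"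
  shows "v \<in> H1 U" "weak_partial U b u = weak_partial U b v \<or> b \<notin> Basis" "grad_norm U u = grad_norm U v"
proof -
  have um: "u \<in> borel_measurable (lebesgue_on U)" using assms(2) by (auto dest!: H1_Lp_2 Lp_measurable)
  have eq: "weak_partial U b u = weak_partial U b v" if "b \<in> Basis" for b
    by (rule weak_partial_AE_cong[OF assms(1) that um assms(3,4)])
  then show "weak_partial U b u = weak_partial U b v \<or> b \<notin> Basis" by blast
  show "grad_norm U u = grad_norm U v" using eq by (simp add: grad_norm_def weak_grad_def)
  have "is_weak_partial U b v (weak_partial U b u)" if b: "b \<in> Basis" for b
    unfolding is_weak_partial_def
  proof (intro conjI ballI)
    show "weak_partial U b u \<in> Lp 2 (lebesgue_on U)" by (rule weak_partial_Lp_2[OF assms(2) b])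
    fix \<phi> assume p: "\<phi> \<in> test_functions U"
    have "pd b \<phi> \<in> borel_measurable (lebesgue_on U)"
      using test_measurable[OF test_pd[OF p b]]
      by (intro measurable_restrict_space1) (simp add: measurable_completion)
    then have "(\<integral>x. v x * pd b \<phi> x \<partial>lebesgue_on U) = (\<integral>x. u x * pd b \<phi> x \<partial>lebesgue_on U)"
      using um assms(3,4) by (intro integral_cong_AE) auto
    then show "(\<integral>x. v x * pd b \<phi> x \<partial>lebesgue_on U) = - (\<integral>x. weak_partial U b u x * \<phi> x \<partial>lebesgue_on U)"
      using weak_partial_spec[OF assms(2) b] p by (simp add: is_weak_partial_def)
  qed
  then show "v \<in> H1 U" using Lp_2_AE_cong[OF H1_Lp_2[OF assms(2)] assms(3,4)] by (auto simp: H1_def)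
qed

lemma norm_weak_grad: "(norm (weak_grad U u x))\<^sup>2 = (\<Sum>b\<in>Basis. (weak_partial U b u x)\<^sup>2)"
proof -
  have "weak_grad U u x \<bullet> b = weak_partial U b u x" if "b \<in> Basis" for b
    using that by (simp add: weak_grad_def inner_sum_left inner_Basis if_distrib cong: if_cong)
  then show ?thesis
    by (subst power2_norm_eq_inner, subst euclidean_inner) (simp add: power2_eq_square)
qed

lemma weak_grad_Lp_2:
  assumes "u \<in> H1 U" shows "(\<lambda>x. norm (weak_grad U u x)) \<in> Lp 2 (lebesgue_on U)"
proof -
  have [measurable]: "weak_partial U b u \<in> borel_measurable (lebesgue_on U)" if "b \<in> Basis" for b
    using weak_partial_Lp_2[OF assms that] by (simp add: Lp_2_iff)
  have "weak_grad U u \<in> borel_measurable (lebesgue_on U)"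
    unfolding weak_grad_def[abs_def] by measurable
  moreover have "integrable (lebesgue_on U) (\<lambda>x. \<Sum>b\<in>Basis. (weak_partial U b u x)\<^sup>2)"
    using weak_partial_Lp_2[OF assms] by (intro Bochner_Integration.integrable_sum) (auto simp: Lp_2_iff)
  ultimately show ?thesis by (simp add: Lp_2_iff norm_weak_grad)
qed

lemma grad_norm_sq:
  assumes "u \<in> H1 U"
  shows "(grad_norm U u)\<^sup>2 = (\<Sum>b\<in>Basis. (Lp_norm 2 (lebesgue_on U) (weak_partial U b u))\<^sup>2)"
  using weak_partial_Lp_2[OF assms]
  by (simp add: grad_norm_def L2_norm_sq norm_weak_grad Lp_2_iff Bochner_Integration.integral_sum)

lemma weak_grad_inner_self:
  "(\<integral>x. weak_grad U u x \<bullet> weak_grad U u x \<partial>lebesgue_on U) = (grad_norm U u)\<^sup>2"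
  by (simp add: grad_norm_def L2_norm_sq power2_norm_eq_inner)

lemma grad_norm_nonneg [simp]: "0 \<le> grad_norm U u" by (simp add: grad_norm_def)

lemma L2_norm_mono:
  assumes "u \<in> borel_measurable N" "v \<in> Lp 2 N" "AE x in N. \<bar>u x\<bar> \<le> \<bar>v x\<bar>"
  shows "Lp_norm 2 N u \<le> Lp_norm 2 N v"
proof -
  have ae: "AE x in N. (u x)\<^sup>2 \<le> (v x)\<^sup>2" using assms(3) by (simp add: abs_le_square_iff)
  have "(\<integral>x. (u x)\<^sup>2 \<partial>N) \<le> (\<integral>x. (v x)\<^sup>2 \<partial>N)"
    using assms ae by (intro integral_mono_AE') (auto simp: Lp_2_iff)
  then show ?thesis by (simp add: L2_norm_eq)
qed

text \<open>Weak gradients are additive almost everywhere; the triangle inequality for vectors,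
  applied pointwise, is followed by the one in \<open>L2\<close>.\<close>

lemma grad_norm_diff_ge:
  assumes U: "open U" and u: "u \<in> H1 U" "v \<in> H1 U"
  shows "grad_norm U u \<le> grad_norm U v + grad_norm U (\<lambda>x. u x - v x)"
proof -
  have "AE x in lebesgue_on U. \<forall>b\<in>Basis. weak_partial U b (\<lambda>x. u x - v x) x = weak_partial U b u x - weak_partial U b v x"
    using weak_partial_diff[OF U u] by (subst AE_ball_countable) (auto intro: countable_finite)
  then have "AE x in lebesgue_on U. weak_grad U u x = weak_grad U v x + weak_grad U (\<lambda>x. u x - v x) x"
    by eventually_elim (simp add: weak_grad_def sum.distrib[symmetric] scaleR_add_left[symmetric])
  then have ae: "AE x in lebesgue_on U. \<bar>norm (weak_grad U u x)\<bar> \<le> \<bar>norm (weak_grad U v x) + norm (weak_grad U (\<lambda>x. u x - v x) x)\<bar>"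
    by eventually_elim (simp add: norm_triangle_ineq)
  have g: "(\<lambda>x. norm (weak_grad U v x)) \<in> Lp 2 (lebesgue_on U)"
     "(\<lambda>x. norm (weak_grad U (\<lambda>x. u x - v x) x)) \<in> Lp 2 (lebesgue_on U)"
    using weak_grad_Lp_2 H1_diff[OF U u] u by auto
  have "grad_norm U u \<le> Lp_norm 2 (lebesgue_on U) (\<lambda>x. norm (weak_grad U v x) + norm (weak_grad U (\<lambda>x. u x - v x) x))"
    unfolding grad_norm_def
    using L2_norm_mono[OF Lp_measurable[OF weak_grad_Lp_2[OF u(1)]] Lp_2_add[OF g] ae] .
  also have "\<dots> \<le> grad_norm U v + grad_norm U (\<lambda>x. u x - v x)"
    unfolding grad_norm_def by (rule L2_norm_add[OF g])
  finally show ?thesis .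
qed

lemma grad_norm_minus_commute:
  assumes U: "open U" and u: "u \<in> H1 U" "v \<in> H1 U"
  shows "grad_norm U (\<lambda>x. u x - v x) = grad_norm U (\<lambda>x. v x - u x)"
proof -
  have "Lp_norm 2 (lebesgue_on U) (weak_partial U b (\<lambda>x. u x - v x))
      = Lp_norm 2 (lebesgue_on U) (weak_partial U b (\<lambda>x. v x - u x))" if b: "b \<in> Basis" for b
  proof -
    have "AE x in lebesgue_on U. weak_partial U b (\<lambda>x. u x - v x) x = - 1 * weak_partial U b (\<lambda>x. v x - u x) x"
      using weak_partial_diff[OF U u b] weak_partial_diff[OF U u(2,1) b] by eventually_elim simp
    then have "Lp_norm 2 (lebesgue_on U) (weak_partial U b (\<lambda>x. u x - v x))
        = Lp_norm 2 (lebesgue_on U) (\<lambda>x. - 1 * weak_partial U b (\<lambda>x. v x - u x) x)"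
      using weak_partial_Lp_2[OF H1_diff[OF U u] b] weak_partial_Lp_2[OF H1_diff[OF U u(2,1)] b]
      by (intro Lp_norm_AE_cong) (auto simp: Lp_2_iff)
    then show ?thesis using L2_norm_cmult[of "lebesgue_on U" "-1"] by simp
  qed
  then have "(grad_norm U (\<lambda>x. u x - v x))\<^sup>2 = (grad_norm U (\<lambda>x. v x - u x))\<^sup>2"
    by (simp add: grad_norm_sq H1_diff[OF U u] H1_diff[OF U u(2,1)])
  then show ?thesis by (simp add: power2_eq_iff_nonneg)
qed

lemma grad_norm_reverse:
  assumes U: "open U" and u: "u \<in> H1 U" "v \<in> H1 U"
  shows "\<bar>grad_norm U u - grad_norm U v\<bar> \<le> grad_norm U (\<lambda>x. u x - v x)"
  using grad_norm_diff_ge[OF U u] grad_norm_diff_ge[OF U u(2,1)] grad_norm_minus_commute[OF U u] by simp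

lemma grad_norm_triangle_diff:
  assumes U: "open U" and u: "u \<in> H1 U" "v \<in> H1 U"
  shows "grad_norm U (\<lambda>x. u x - v x) \<le> grad_norm U u + grad_norm U v"
proof -
  have e: "(\<lambda>x. u x - v x - u x) = (\<lambda>x. 0 - v x)" by (simp add: fun_eq_iff)
  have z: "(\<lambda>x. 0) \<in> H1 U" using H1_diff[OF U u(1) u(1)] by simp
  have "grad_norm U (\<lambda>x. 0) = 0"
  proof -
    have "AE x in lebesgue_on U. weak_partial U b (\<lambda>x. 0) x = 0" if "b \<in> Basis" for b
      using weak_partial_diff[OF U z z that] by simp
    then have "Lp_norm 2 (lebesgue_on U) (weak_partial U b (\<lambda>x. 0)) = 0" if "b \<in> Basis" for b
      using L2_norm_eq_0_iff[OF weak_partial_Lp_2[OF z that]] that by blast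
    then have "(grad_norm U (\<lambda>x. 0))\<^sup>2 = 0" by (simp add: grad_norm_sq[OF z])
    then show ?thesis by simp
  qed
  then have "grad_norm U (\<lambda>x. 0 - v x) \<le> grad_norm U v"
    using grad_norm_diff_ge[OF U H1_diff[OF U z u(2)] z] grad_norm_minus_commute[OF U z u(2)]
    by (simp add: grad_norm_minus_commute[OF U z u(2)])
  then show ?thesis using grad_norm_diff_ge[OF U H1_diff[OF U u] u(1)] e by simp
qed

subsection \<open>Weak derivatives of smooth functions\<close>

lemma smooth_measurable: "smooth_on UNIV f \<Longrightarrow> f \<in> borel_measurable borel"
  using smooth_on_continuous borel_measurable_continuous_onI by blast

lemma continuous_Lp_2:
  fixes f :: "'a::euclidean_space \<Rightarrow> real"
  assumes "continuous_on UNIV f" "bounded U" "U \<in> sets lebesgue"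
  shows "f \<in> Lp 2 (lebesgue_on U)"
proof -
  have "compact (closure U)" using assms(2) by simp
  from compact_continuous_image[OF continuous_on_subset[OF assms(1)] this]
  have "bounded (f ` closure U)" using compact_imp_bounded by blast
  then obtain B where B: "\<And>x. x \<in> U \<Longrightarrow> \<bar>f x\<bar> \<le> B"
    using closure_subset by (force simp: bounded_iff)
  have [measurable]: "f \<in> borel_measurable (lebesgue_on U)"
    using borel_measurable_continuous_onI[OF assms(1)]
    by (intro measurable_restrict_space1) (simp add: measurable_completion)
  have "finite_measure (lebesgue_on U)"
    using bounded_set_imp_lmeasurable[OF assms(2,3)] by (rule finite_measure_lebesgue_on)
  then have "integrable (lebesgue_on U) (\<lambda>x. (f x)\<^sup>2)"
  proof (rule finite_measure.integrable_const_bound[where B="B\<^sup>2"])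
    show "AE x in lebesgue_on U. norm ((f x)\<^sup>2) \<le> B\<^sup>2"
    proof (rule AE_I2)
      fix x assume "x \<in> space (lebesgue_on U)"
      then have "\<bar>f x\<bar> \<le> B" using B by simp
      then show "norm ((f x)\<^sup>2) \<le> B\<^sup>2" using power_mono[of "\<bar>f x\<bar>" B 2] by simp
    qed
  qed measurable
  then show ?thesis by (simp add: Lp_2_iff)
qed

lemma lebesgue_on_test_integral:
  assumes U: "open U" and p: "g \<in> borel_measurable borel" "\<And>x. x \<notin> U \<Longrightarrow> g x = (0::real)"
  shows "(\<integral>x. g x \<partial>lebesgue_on U) = (\<integral>x. g x \<partial>lborel)"
proof -
  have "(\<integral>x. g x \<partial>lebesgue_on U) = (\<integral>x. indicator U x * g x \<partial>lebesgue)"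
    using U by (simp add: integral_restrict_space)
  also have "(\<lambda>x. indicator U x * g x) = g" using p(2) by (auto split: split_indicator)
  also have "(\<integral>x. g x \<partial>lebesgue) = (\<integral>x. g x \<partial>lborel)" using p(1) by (simp add: integral_completion)
  finally show ?thesis .
qed

lemma test_ibp:
  assumes U: "open U" and \<phi>: "\<phi> \<in> test_functions U" and f: "smooth_on UNIV f" and b: "b \<in> Basis"
  shows "(\<integral>x. f x * pd b \<phi> x \<partial>lebesgue_on U) = - (\<integral>x. pd b f x * \<phi> x \<partial>lebesgue_on U)"
proof -
  have t1: "(\<lambda>x. f x * pd b \<phi> x) \<in> test_functions U" by (rule test_mult[OF test_pd[OF \<phi> b] f])
  have t2: "(\<lambda>x. pd b f x * \<phi> x) \<in> test_functions U" by (rule test_mult[OF \<phi> smooth_on_pd[OF f b]])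
  show ?thesis
    using test_ibp_lborel[OF \<phi> f b]
    by (simp add: lebesgue_on_test_integral[OF U test_measurable[OF t1] test_zero_outside[OF t1]]
       lebesgue_on_test_integral[OF U test_measurable[OF t2] test_zero_outside[OF t2]])
qed

lemma smooth_weak_partial:
  assumes U: "open U" "bounded U" and f: "smooth_on UNIV f" and b: "b \<in> Basis"
  shows "is_weak_partial U b f (pd b f)"
  using test_ibp[OF U(1) _ f b] continuous_Lp_2[OF smooth_on_continuous[OF smooth_on_pd[OF f b]] U(2)] U(1)
  by (auto simp: is_weak_partial_def)

lemma smooth_H1:
  assumes "open U" "bounded U" "smooth_on UNIV f" shows "f \<in> H1 U"
  using smooth_weak_partial[OF assms] continuous_Lp_2[OF smooth_on_continuous[OF assms(3)] assms(2)] assms(1)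
  by (auto simp: H1_def)

lemma smooth_weak_partial_eq:
  assumes "open U" "bounded U" "smooth_on UNIV f" "b \<in> Basis"
  shows "AE x in lebesgue_on U. weak_partial U b f x = pd b f x"
  using weak_partial_unique[OF assms(1) weak_partial_spec[OF smooth_H1[OF assms(1-3)] assms(4)]
    smooth_weak_partial[OF assms]] .

lemma smooth_grad_norm_sq:
  assumes "open U" "bounded U" "smooth_on UNIV f"
  shows "(grad_norm U f)\<^sup>2 = (\<integral>x. (\<Sum>b\<in>Basis. (pd b f x)\<^sup>2) \<partial>lebesgue_on U)"
proof -
  have p: "pd b f \<in> Lp 2 (lebesgue_on U)" if "b \<in> Basis" for b
    using smooth_weak_partial[OF assms that] by (simp add: is_weak_partial_def)
  have "(grad_norm U f)\<^sup>2 = (\<Sum>b\<in>Basis. (Lp_norm 2 (lebesgue_on U) (pd b f))\<^sup>2)"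
    unfolding grad_norm_sq[OF smooth_H1[OF assms]]
  proof (rule sum.cong[OF refl])
    fix b :: 'a assume b: "b \<in> Basis"
    show "(Lp_norm 2 (lebesgue_on U) (weak_partial U b f))\<^sup>2 = (Lp_norm 2 (lebesgue_on U) (pd b f))\<^sup>2"
      using Lp_norm_AE_cong[OF Lp_measurable[OF weak_partial_Lp_2[OF smooth_H1[OF assms] b]]
        Lp_measurable[OF p[OF b]] smooth_weak_partial_eq[OF assms b]] by simp
  qed
  also have "\<dots> = (\<integral>x. (\<Sum>b\<in>Basis. (pd b f x)\<^sup>2) \<partial>lebesgue_on U)"
    using p by (simp add: L2_norm_sq Lp_2_iff Bochner_Integration.integral_sum)
  finally show ?thesis .
qed

lemma H1_norm_bounds:
  "Lp_norm 2 (lebesgue_on U) u \<le> H1_norm U u" "grad_norm U u \<le> H1_norm U u"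
  "(H1_norm U u)\<^sup>2 = (Lp_norm 2 (lebesgue_on U) u)\<^sup>2 + (grad_norm U u)\<^sup>2" "0 \<le> H1_norm U u"
  by (auto simp: H1_norm_def intro: real_le_rsqrt)

lemma H1_norm_le_sum: "H1_norm U u \<le> Lp_norm 2 (lebesgue_on U) u + grad_norm U u"
  unfolding H1_norm_def by (rule sqrt_sum_squares_le_sum) auto

section \<open>Sobolev and trace inequalities for smooth functions\<close>

subsection \<open>Integration in affine coordinates\<close>

text \<open>Both measures give boxes the same volume, which determines \<open>lborel\<close>. This
  makes iterated integration available for vectors.\<close>

lemma lborel_vec3:
  "(lborel :: (real^3) measure) = distr (lborel \<Otimes>\<^sub>M (lborel \<Otimes>\<^sub>M lborel)) borel (\<lambda>(a, b, c). vector [a, b, c])"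
proof (rule lborel_eqI)
  have m: "(\<lambda>(a, b, c). vector [a, b, c] :: real^3) \<in> borel_measurable (lborel \<Otimes>\<^sub>M (lborel \<Otimes>\<^sub>M lborel))"
  proof -
    have "(\<lambda>(a, b, c). vector [a, b, c] :: real^3) = (\<lambda>p. fst p *\<^sub>R axis 1 1 + fst (snd p) *\<^sub>R axis 2 1 + snd (snd p) *\<^sub>R axis 3 1)"
      by (auto simp: fun_eq_iff vec_eq_iff forall_3 axis_def)
    then show ?thesis by simp
  qed
  fix l u :: "real^3" assume le: "\<And>b. b \<in> Basis \<Longrightarrow> l \<bullet> b \<le> u \<bullet> b"
  have le': "l $ i \<le> u $ i" for i using le[of "axis i 1"] by (simp add: inner_axis)
  have "(\<lambda>(a, b, c). vector [a, b, c] :: real^3) -` box l u \<inter> space (lborel \<Otimes>\<^sub>M (lborel \<Otimes>\<^sub>M lborel))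
     = {l$1<..<u$1} \<times> {l$2<..<u$2} \<times> {l$3<..<u$3}"
    by (auto simp: space_pair_measure mem_box_cart forall_3)
  then have "emeasure (distr (lborel \<Otimes>\<^sub>M (lborel \<Otimes>\<^sub>M lborel)) borel (\<lambda>(a, b, c). vector [a, b, c])) (box l u)
      = emeasure (lborel \<Otimes>\<^sub>M (lborel \<Otimes>\<^sub>M lborel)) ({l$1<..<u$1} \<times> {l$2<..<u$2} \<times> {l$3<..<u$3})"
    using m by (subst emeasure_distr) auto
  also have "\<dots> = ennreal (u$1 - l$1) * (ennreal (u$2 - l$2) * ennreal (u$3 - l$3))"
  proof -
    have P: "sigma_finite_measure (lborel \<Otimes>\<^sub>M lborel :: (real \<times> real) measure)"
      by (simp add: lborel_prod sigma_finite_lborel)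
    show ?thesis using le'
      by (subst sigma_finite_measure.emeasure_pair_measure_Times[OF P], simp, simp)
         (subst lborel.emeasure_pair_measure_Times, auto)
  qed
  also have "\<dots> = ennreal (\<Prod>b\<in>Basis. (u - l) \<bullet> b)"
  proof -
    have B: "(Basis :: (real^3) set) = range (\<lambda>i. axis i 1)" by (auto simp: Basis_vec_def)
    have "inj (\<lambda>i::3. axis i (1::real))" by (auto simp: inj_on_def axis_eq_axis)
    then have "(\<Prod>b\<in>Basis. (u - l) \<bullet> b) = (\<Prod>i\<in>UNIV. u$i - l$i)"
      unfolding B by (subst prod.reindex) (auto simp: inner_axis)
    also have "\<dots> = (u$1 - l$1) * ((u$2 - l$2) * (u$3 - l$3))"
      unfolding UNIV_3 by simp
    finally show ?thesis using le' by (simp add: ennreal_mult)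
  qed
  finally show "emeasure (distr (lborel \<Otimes>\<^sub>M (lborel \<Otimes>\<^sub>M lborel)) borel (\<lambda>(a, b, c). vector [a, b, c])) (box l u)
    = ennreal (\<Prod>b\<in>Basis. (u - l) \<bullet> b)" .
qed simp

lemma lborel_vec2:
  "(lborel :: (real^2) measure) = distr (lborel \<Otimes>\<^sub>M lborel) borel (\<lambda>(a, b). vector [a, b])"
proof (rule lborel_eqI)
  have m: "(\<lambda>(a, b). vector [a, b] :: real^2) \<in> borel_measurable (lborel \<Otimes>\<^sub>M lborel)"
  proof -
    have "(\<lambda>(a, b). vector [a, b] :: real^2) = (\<lambda>p. fst p *\<^sub>R axis 1 1 + snd p *\<^sub>R axis 2 1)"
      by (auto simp: fun_eq_iff vec_eq_iff forall_2 axis_def)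
    then show ?thesis by simp
  qed
  fix l u :: "real^2" assume le: "\<And>b. b \<in> Basis \<Longrightarrow> l \<bullet> b \<le> u \<bullet> b"
  have le': "l $ i \<le> u $ i" for i using le[of "axis i 1"] by (simp add: inner_axis)
  have "(\<lambda>(a, b). vector [a, b] :: real^2) -` box l u \<inter> space (lborel \<Otimes>\<^sub>M lborel)
     = {l$1<..<u$1} \<times> {l$2<..<u$2}"
    by (auto simp: space_pair_measure mem_box_cart forall_2)
  then have "emeasure (distr (lborel \<Otimes>\<^sub>M lborel) borel (\<lambda>(a, b). vector [a, b])) (box l u)
      = emeasure (lborel \<Otimes>\<^sub>M lborel) ({l$1<..<u$1} \<times> {l$2<..<u$2})"
    using m by (subst emeasure_distr) auto
  also have "\<dots> = ennreal (u$1 - l$1) * ennreal (u$2 - l$2)"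
    using le' by (subst lborel.emeasure_pair_measure_Times) auto
  also have "\<dots> = ennreal (\<Prod>b\<in>Basis. (u - l) \<bullet> b)"
  proof -
    have B: "(Basis :: (real^2) set) = range (\<lambda>i. axis i 1)" by (auto simp: Basis_vec_def)
    have "inj (\<lambda>i::2. axis i (1::real))" by (auto simp: inj_on_def axis_eq_axis)
    then have "(\<Prod>b\<in>Basis. (u - l) \<bullet> b) = (\<Prod>i\<in>UNIV. u$i - l$i)"
      unfolding B by (subst prod.reindex) (auto simp: inner_axis)
    also have "\<dots> = (u$1 - l$1) * (u$2 - l$2)"
      unfolding UNIV_2 by simp
    finally show ?thesis using le' by (simp add: ennreal_mult)
  qed
  finally show "emeasure (distr (lborel \<Otimes>\<^sub>M lborel) borel (\<lambda>(a, b). vector [a, b])) (box l u)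
    = ennreal (\<Prod>b\<in>Basis. (u - l) \<bullet> b)" .
qed simp

lemma vec2_measurable: "(\<lambda>(a, b). vector [a, b] :: real^2) \<in> borel_measurable (borel \<Otimes>\<^sub>M borel)"
proof -
  have "(\<lambda>(a, b). vector [a, b] :: real^2) = (\<lambda>p. fst p *\<^sub>R axis 1 1 + snd p *\<^sub>R axis 2 1)"
    by (auto simp: fun_eq_iff vec_eq_iff forall_2 axis_def)
  then show ?thesis by simp
qed

lemma vec3_measurable: "(\<lambda>(a, b, c). vector [a, b, c] :: real^3) \<in> borel_measurable (borel \<Otimes>\<^sub>M (borel \<Otimes>\<^sub>M borel))"
proof -
  have "(\<lambda>(a, b, c). vector [a, b, c] :: real^3) = (\<lambda>p. fst p *\<^sub>R axis 1 1 + fst (snd p) *\<^sub>R axis 2 1 + snd (snd p) *\<^sub>R axis 3 1)"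
    by (auto simp: fun_eq_iff vec_eq_iff forall_3 axis_def)
  then show ?thesis by simp
qed

lemma nn_integral_vec2:
  assumes [measurable]: "f \<in> borel_measurable (borel :: (real^2) measure)"
  shows "(\<integral>\<^sup>+x. f x \<partial>lborel) = (\<integral>\<^sup>+a. \<integral>\<^sup>+b. f (vector [a, b]) \<partial>lborel \<partial>lborel)"
proof -
  note [measurable] = vec2_measurable
  have "(\<integral>\<^sup>+x. f x \<partial>lborel) = (\<integral>\<^sup>+p. f (case p of (a, b) \<Rightarrow> vector [a, b]) \<partial>(lborel \<Otimes>\<^sub>M lborel))"
    by (subst lborel_vec2, subst nn_integral_distr) auto
  also have "\<dots> = (\<integral>\<^sup>+a. \<integral>\<^sup>+b. f (vector [a, b]) \<partial>lborel \<partial>lborel)"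
    by (subst lborel.nn_integral_fst[symmetric]) auto
  finally show ?thesis .
qed

lemma nn_integral_vec3:
  assumes [measurable]: "f \<in> borel_measurable (borel :: (real^3) measure)"
  shows "(\<integral>\<^sup>+x. f x \<partial>lborel) = (\<integral>\<^sup>+a. \<integral>\<^sup>+b. \<integral>\<^sup>+c. f (vector [a, b, c]) \<partial>lborel \<partial>lborel \<partial>lborel)"
proof -
  note [measurable] = vec3_measurable
  have P: "sigma_finite_measure (lborel \<Otimes>\<^sub>M lborel :: (real \<times> real) measure)"
    by (simp add: lborel_prod sigma_finite_lborel)
  have "(\<integral>\<^sup>+x. f x \<partial>lborel) = (\<integral>\<^sup>+p. f (case p of (a, b, c) \<Rightarrow> vector [a, b, c]) \<partial>(lborel \<Otimes>\<^sub>M (lborel \<Otimes>\<^sub>M lborel)))"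
    by (subst lborel_vec3, subst nn_integral_distr) auto
  also have "\<dots> = (\<integral>\<^sup>+a. \<integral>\<^sup>+p. f (vector [a, fst p, snd p]) \<partial>(lborel \<Otimes>\<^sub>M lborel) \<partial>lborel)"
  proof -
    have "borel_measurable (lborel \<Otimes>\<^sub>M (lborel \<Otimes>\<^sub>M lborel)) = (borel_measurable (borel \<Otimes>\<^sub>M (borel \<Otimes>\<^sub>M borel)) :: (real \<times> real \<times> real \<Rightarrow> ennreal) set)"
      by (intro measurable_cong_sets sets_pair_measure_cong sets_lborel refl)
    then have "(\<lambda>p. f (case p of (a, b, c) \<Rightarrow> vector [a, b, c])) \<in> borel_measurable (lborel \<Otimes>\<^sub>M (lborel \<Otimes>\<^sub>M lborel))"
      using measurable_compose[OF vec3_measurable assms] by simp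
    from sigma_finite_measure.nn_integral_fst[OF P this] show ?thesis by (simp add: case_prod_beta)
  qed
  also have "\<dots> = (\<integral>\<^sup>+a. \<integral>\<^sup>+b. \<integral>\<^sup>+c. f (vector [a, b, c]) \<partial>lborel \<partial>lborel \<partial>lborel)"
  proof (intro nn_integral_cong)
    fix a :: real
    have "(\<lambda>p. vector [a, fst p, snd p] :: real^3) = (\<lambda>p. a *\<^sub>R axis 1 1 + fst p *\<^sub>R axis 2 1 + snd p *\<^sub>R axis 3 1)"
      by (auto simp: fun_eq_iff vec_eq_iff forall_3 axis_def)
    then have "(\<lambda>p. vector [a, fst p, snd p] :: real^3) \<in> borel_measurable (lborel \<Otimes>\<^sub>M lborel)" by simp
    from lborel.nn_integral_fst[OF measurable_compose[OF this assms]]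
    show "(\<integral>\<^sup>+p. f (vector [a, fst p, snd p]) \<partial>(lborel \<Otimes>\<^sub>M lborel)) = (\<integral>\<^sup>+b. \<integral>\<^sup>+c. f (vector [a, b, c]) \<partial>lborel \<partial>lborel)"
      by simp
  qed
  finally show ?thesis .
qed

lemma nn_integral_linear_vec3:
  fixes T :: "real^3 \<Rightarrow> real^3"
  assumes T: "linear T" "inj T"
  obtains k where "0 < k"
    "\<And>f. f \<in> borel_measurable borel \<Longrightarrow> (\<integral>\<^sup>+x. f x \<partial>lborel) = ennreal k * (\<integral>\<^sup>+x. f (T x) \<partial>lborel)"
proof -
  obtain S where S: "linear S" "S \<circ> T = id" "T \<circ> S = id"
    using linear_injective_isomorphism[OF T] by (auto simp: fun_eq_iff)
  have Tm [measurable]: "T \<in> borel_measurable borel"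
    using linear_continuous_on[of T UNIV] T(1) by (intro borel_measurable_continuous_onI) (simp add: linear_conv_bounded_linear)
  have dS: "det (matrix S) \<noteq> 0"
    using S by (metis det_nz_iff_inj inj_iff id_apply comp_apply injI)
  \<comment> \<open>The Jacobian of \<open>T\<close>, written through its inverse \<open>S\<close>
    because the preimage of a box under \<open>T\<close> is its image under
    \<open>S\<close>.\<close>
  define k where "k = 1 / \<bar>det (matrix S)\<bar>"
  have k: "0 < k" using dS by (simp add: k_def)
  have eq: "lborel = density (distr lborel borel T) (\<lambda>_. ennreal k)"
  proof (rule lborel_eqI)
    fix l u :: "real^3" assume le: "\<And>b. b \<in> Basis \<Longrightarrow> l \<bullet> b \<le> u \<bullet> b"
    have v: "T -` box l u = S ` box l u"
      using S by (auto simp: fun_eq_iff image_iff) metis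
    have ob: "open (T -` box l u)" using T(1) by (intro open_vimage) (auto simp: linear_continuous_on linear_conv_bounded_linear)
    have bd: "bounded (S ` box l u)"
      using S(1) by (intro bounded_linear_image) (auto simp: linear_conv_bounded_linear)
    have "emeasure lborel (T -` box l u) = emeasure lebesgue (S ` box l u)"
      using ob by (simp add: v)
    also have "\<dots> = ennreal (measure lebesgue (S ` box l u))"
      using bounded_set_imp_lmeasurable[OF bd] ob v by (intro emeasure_eq_measure2) (auto simp: fmeasurable_def)
    also have "measure lebesgue (S ` box l u) = \<bar>det (matrix S)\<bar> * measure lebesgue (box l u)"
      using S(1) by (intro measure_lebesgue_linear_transformation) auto
    also have "measure lebesgue (box l u) = (\<Prod>b\<in>Basis. (u - l) \<bullet> b)"
      using le by (simp add: measure_lborel_box)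
    finally have "emeasure lborel (T -` box l u) = ennreal (\<bar>det (matrix S)\<bar> * (\<Prod>b\<in>Basis. (u - l) \<bullet> b))" .
    then have "emeasure (density (distr lborel borel T) (\<lambda>_. ennreal k)) (box l u)
       = ennreal k * ennreal (\<bar>det (matrix S)\<bar> * (\<Prod>b\<in>Basis. (u - l) \<bullet> b))"
      by (simp add: emeasure_density nn_integral_cmult_indicator emeasure_distr)
    also have "\<dots> = ennreal (\<Prod>b\<in>Basis. (u - l) \<bullet> b)"
      using k dS le by (simp add: k_def ennreal_mult[symmetric] prod_nonneg inner_diff_left)
    finally show "emeasure (density (distr lborel borel T) (\<lambda>_. ennreal k)) (box l u) = ennreal (\<Prod>b\<in>Basis. (u - l) \<bullet> b)" .
  qed simp
  show thesis
  proof (rule that[OF k])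
    fix f :: "real^3 \<Rightarrow> ennreal" assume [measurable]: "f \<in> borel_measurable borel"
    show "(\<integral>\<^sup>+x. f x \<partial>lborel) = ennreal k * (\<integral>\<^sup>+x. f (T x) \<partial>lborel)"
      by (subst eq) (simp add: nn_integral_density nn_integral_cmult nn_integral_distr)
  qed
qed

text \<open>The Jacobian \<open>k\<close> depends on the three directions alone; the base point
  \<open>p\<close> drops out by translation invariance.\<close>

lemma affine_coordinates3:
  fixes e1 e2 e3 :: "real^3"
  assumes ind: "\<And>a b c. a *\<^sub>R e1 + b *\<^sub>R e2 + c *\<^sub>R e3 = 0 \<Longrightarrow> a = 0 \<and> b = 0 \<and> c = 0"
  obtains k where "0 < k"
    "\<And>f p. f \<in> borel_measurable borel \<Longrightarrow> (\<integral>\<^sup>+x. f x \<partial>lborel)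
       = ennreal k * (\<integral>\<^sup>+a. \<integral>\<^sup>+b. \<integral>\<^sup>+c. f (p + a *\<^sub>R e1 + b *\<^sub>R e2 + c *\<^sub>R e3) \<partial>lborel \<partial>lborel \<partial>lborel)"
proof -
  define T where "T = (\<lambda>v::real^3. v$1 *\<^sub>R e1 + v$2 *\<^sub>R e2 + v$3 *\<^sub>R e3)"
  have T: "linear T" unfolding T_def by (intro linearI) (auto simp: algebra_simps)
  have "inj T"
  proof (rule linear_injective_0[OF T, THEN iffD2], intro allI impI)
    fix v assume "T v = 0"
    from ind[OF this[unfolded T_def]] show "v = 0" by (simp add: vec_eq_iff forall_3)
  qed
  from nn_integral_linear_vec3[OF T this] obtain k where k: "0 < k"
    "\<And>f. f \<in> borel_measurable borel \<Longrightarrow> (\<integral>\<^sup>+x. f x \<partial>lborel) = ennreal k * (\<integral>\<^sup>+x. f (T x) \<partial>lborel)" by metis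
  have Tm [measurable]: "T \<in> borel_measurable borel" unfolding T_def by measurable
  show thesis
  proof (rule that[OF k(1)])
    fix f :: "real^3 \<Rightarrow> ennreal" and p assume [measurable]: "f \<in> borel_measurable borel"
    have "(\<integral>\<^sup>+x. f x \<partial>lborel) = (\<integral>\<^sup>+x. f (p + x) \<partial>lborel)"
    proof -
      have "(\<integral>\<^sup>+x. f x \<partial>lborel) = (\<integral>\<^sup>+x. f x \<partial>distr lborel borel ((+) p))" by (simp add: lborel_distr_plus)
      also have "\<dots> = (\<integral>\<^sup>+x. f (p + x) \<partial>lborel)" by (subst nn_integral_distr) auto
      finally show ?thesis .
    qed
    also have "\<dots> = ennreal k * (\<integral>\<^sup>+x. f (p + T x) \<partial>lborel)" by (rule k(2)) measurable
    also have "(\<integral>\<^sup>+x. f (p + T x) \<partial>lborel)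
       = (\<integral>\<^sup>+a. \<integral>\<^sup>+b. \<integral>\<^sup>+c. f (p + T (vector [a, b, c])) \<partial>lborel \<partial>lborel \<partial>lborel)"
      by (rule nn_integral_vec3) measurable
    also have "\<dots> = (\<integral>\<^sup>+a. \<integral>\<^sup>+b. \<integral>\<^sup>+c. f (p + a *\<^sub>R e1 + b *\<^sub>R e2 + c *\<^sub>R e3) \<partial>lborel \<partial>lborel \<partial>lborel)"
      by (simp add: T_def add.assoc)
    finally show "(\<integral>\<^sup>+x. f x \<partial>lborel)
       = ennreal k * (\<integral>\<^sup>+a. \<integral>\<^sup>+b. \<integral>\<^sup>+c. f (p + a *\<^sub>R e1 + b *\<^sub>R e2 + c *\<^sub>R e3) \<partial>lborel \<partial>lborel \<partial>lborel)" .
  qed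
qed

subsection \<open>The inequality of Loomis and Whitney\<close>

text \<open>Two applications of Cauchy-Schwarz: in the variables \<open>a, b\<close> against
  \<open>g3\<close>, then in \<open>c\<close> for fixed \<open>a, b\<close> between
  \<open>g1\<close> and \<open>g2\<close>. What remains is a product of a function of
  \<open>b\<close> and a function of \<open>a\<close>, so the integral factors.\<close>

lemma Loomis_Whitney:
  fixes g1 g2 g3 :: "real \<times> real \<Rightarrow> ennreal"
  assumes [measurable]: "g1 \<in> borel_measurable (borel \<Otimes>\<^sub>M borel)" "g2 \<in> borel_measurable (borel \<Otimes>\<^sub>M borel)"
    "g3 \<in> borel_measurable (borel \<Otimes>\<^sub>M borel)"
  shows "(\<integral>\<^sup>+a. \<integral>\<^sup>+b. \<integral>\<^sup>+c. g1 (b, c) * g2 (a, c) * g3 (a, b) \<partial>lborel \<partial>lborel \<partial>lborel)\<^sup>2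
    \<le> (\<integral>\<^sup>+b. \<integral>\<^sup>+c. (g1 (b, c))\<^sup>2 \<partial>lborel \<partial>lborel) * (\<integral>\<^sup>+a. \<integral>\<^sup>+c. (g2 (a, c))\<^sup>2 \<partial>lborel \<partial>lborel)
      * (\<integral>\<^sup>+a. \<integral>\<^sup>+b. (g3 (a, b))\<^sup>2 \<partial>lborel \<partial>lborel)"
proof -
  define w where "w = (\<lambda>(a, b). \<integral>\<^sup>+c. g1 (b, c) * g2 (a, c) \<partial>lborel)"
  define G1 where "G1 = (\<lambda>b. \<integral>\<^sup>+c. (g1 (b, c))\<^sup>2 \<partial>lborel)"
  define G2 where "G2 = (\<lambda>a. \<integral>\<^sup>+c. (g2 (a, c))\<^sup>2 \<partial>lborel)"
  have [measurable]: "w \<in> borel_measurable (borel \<Otimes>\<^sub>M borel)" unfolding w_def by measurable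
  have [measurable]: "G1 \<in> borel_measurable borel" "G2 \<in> borel_measurable borel" unfolding G1_def G2_def by measurable
  have "(\<integral>\<^sup>+a. \<integral>\<^sup>+b. \<integral>\<^sup>+c. g1 (b, c) * g2 (a, c) * g3 (a, b) \<partial>lborel \<partial>lborel \<partial>lborel)
      = (\<integral>\<^sup>+a. \<integral>\<^sup>+b. w (a, b) * g3 (a, b) \<partial>lborel \<partial>lborel)"
    by (simp add: w_def nn_integral_multc)
  also have "\<dots> = (\<integral>\<^sup>+p. w p * g3 p \<partial>(lborel \<Otimes>\<^sub>M lborel))"
    by (subst lborel.nn_integral_fst[symmetric]) auto
  finally have "(\<integral>\<^sup>+a. \<integral>\<^sup>+b. \<integral>\<^sup>+c. g1 (b, c) * g2 (a, c) * g3 (a, b) \<partial>lborel \<partial>lborel \<partial>lborel)\<^sup>2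
      \<le> (\<integral>\<^sup>+p. (w p)\<^sup>2 \<partial>(lborel \<Otimes>\<^sub>M lborel)) * (\<integral>\<^sup>+p. (g3 p)\<^sup>2 \<partial>(lborel \<Otimes>\<^sub>M lborel))"
    using Cauchy_Schwarz_nn_integral[of w "lborel \<Otimes>\<^sub>M lborel" g3] by simp
  also have "(\<integral>\<^sup>+p. (g3 p)\<^sup>2 \<partial>(lborel \<Otimes>\<^sub>M lborel)) = (\<integral>\<^sup>+a. \<integral>\<^sup>+b. (g3 (a, b))\<^sup>2 \<partial>lborel \<partial>lborel)"
    by (subst lborel.nn_integral_fst[symmetric]) auto
  also have "(\<integral>\<^sup>+p. (w p)\<^sup>2 \<partial>(lborel \<Otimes>\<^sub>M lborel)) = (\<integral>\<^sup>+a. \<integral>\<^sup>+b. (w (a, b))\<^sup>2 \<partial>lborel \<partial>lborel)"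
    by (subst lborel.nn_integral_fst[symmetric]) auto
  also have "(\<integral>\<^sup>+a. \<integral>\<^sup>+b. (w (a, b))\<^sup>2 \<partial>lborel \<partial>lborel) \<le> (\<integral>\<^sup>+a. \<integral>\<^sup>+b. G1 b * G2 a \<partial>lborel \<partial>lborel)"
    unfolding w_def G1_def G2_def prod.case
    by (intro nn_integral_mono Cauchy_Schwarz_nn_integral) measurable
  also have "\<dots> = (\<integral>\<^sup>+b. G1 b \<partial>lborel) * (\<integral>\<^sup>+a. G2 a \<partial>lborel)"
    by (simp add: nn_integral_multc nn_integral_cmult)
  finally show ?thesis unfolding G1_def G2_def
    by (simp add: mult_right_mono)
qed

text \<open>Each of the three line integrals is independent of one coordinate and dominates
  \<open>h^2\<close>, so \<open>h^3\<close> is at most a product of three square roots as in the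
  Loomis-Whitney inequality; the squares of these roots integrate back to \<open>q\<close>. In the
  application \<open>h\<close> is \<open>f^2\<close> near a point of the closure.\<close>

lemma Gagliardo3:
  fixes q :: "real \<times> real \<times> real \<Rightarrow> ennreal" and h :: "real \<Rightarrow> real \<Rightarrow> real \<Rightarrow> real"
  assumes q [measurable]: "q \<in> borel_measurable (borel \<Otimes>\<^sub>M (borel \<Otimes>\<^sub>M borel))"
    and h0: "\<And>a b c. 0 \<le> h a b c"
    and h: "\<And>a b c. ennreal ((h a b c)\<^sup>2) \<le> (\<integral>\<^sup>+s. q (s, b, c) \<partial>lborel)"
      "\<And>a b c. ennreal ((h a b c)\<^sup>2) \<le> (\<integral>\<^sup>+s. q (a, s, c) \<partial>lborel)"
      "\<And>a b c. ennreal ((h a b c)\<^sup>2) \<le> (\<integral>\<^sup>+s. q (a, b, s) \<partial>lborel)"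
    and fin: "\<And>b c. (\<integral>\<^sup>+s. q (s, b, c) \<partial>lborel) < \<infinity>" "\<And>a c. (\<integral>\<^sup>+s. q (a, s, c) \<partial>lborel) < \<infinity>"
      "\<And>a b. (\<integral>\<^sup>+s. q (a, b, s) \<partial>lborel) < \<infinity>"
  shows "(\<integral>\<^sup>+a. \<integral>\<^sup>+b. \<integral>\<^sup>+c. ennreal ((h a b c) ^ 3) \<partial>lborel \<partial>lborel \<partial>lborel)\<^sup>2
    \<le> (\<integral>\<^sup>+a. \<integral>\<^sup>+b. \<integral>\<^sup>+c. q (a, b, c) \<partial>lborel \<partial>lborel \<partial>lborel) ^ 3"
proof -
  \<comment> \<open>A square root on \<open>ennreal\<close> that passes through the reals and is
    correct for finite arguments; the assumption \<open>fin\<close> keeps the line integrals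
    there.\<close>
  define r where "r = (\<lambda>x::ennreal. ennreal (sqrt (enn2real x)))"
  have [measurable]: "r \<in> borel_measurable borel" unfolding r_def by measurable
  have r2: "(r x)\<^sup>2 = x" if "x < \<infinity>" for x
    using that by (cases x) (auto simp: r_def ennreal_power)
  have rh: "ennreal t \<le> r x" if "ennreal (t\<^sup>2) \<le> x" "x < \<infinity>" "0 \<le> t" for t x
    using that by (cases x) (auto simp: r_def real_le_rsqrt)
  define g1 where "g1 = (\<lambda>(b, c). r (\<integral>\<^sup>+s. q (s, b, c) \<partial>lborel))"
  define g2 where "g2 = (\<lambda>(a, c). r (\<integral>\<^sup>+s. q (a, s, c) \<partial>lborel))"
  define g3 where "g3 = (\<lambda>(a, b). r (\<integral>\<^sup>+s. q (a, b, s) \<partial>lborel))"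
  have [measurable]: "g1 \<in> borel_measurable (borel \<Otimes>\<^sub>M borel)" "g2 \<in> borel_measurable (borel \<Otimes>\<^sub>M borel)"
    "g3 \<in> borel_measurable (borel \<Otimes>\<^sub>M borel)" unfolding g1_def g2_def g3_def by measurable
  let ?Q = "\<integral>\<^sup>+a. \<integral>\<^sup>+b. \<integral>\<^sup>+c. q (a, b, c) \<partial>lborel \<partial>lborel \<partial>lborel"
  have sw: "(\<integral>\<^sup>+a. \<integral>\<^sup>+b. f (a, b) \<partial>lborel \<partial>lborel) = (\<integral>\<^sup>+b. \<integral>\<^sup>+a. f (a, b) \<partial>lborel \<partial>lborel)"
    if "f \<in> borel_measurable (borel \<Otimes>\<^sub>M borel)" for f :: "real \<times> real \<Rightarrow> ennreal"
    using that by (intro lborel_pair.Fubini') simp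
  have "(\<integral>\<^sup>+a. \<integral>\<^sup>+b. \<integral>\<^sup>+c. ennreal ((h a b c) ^ 3) \<partial>lborel \<partial>lborel \<partial>lborel)
     \<le> (\<integral>\<^sup>+a. \<integral>\<^sup>+b. \<integral>\<^sup>+c. g1 (b, c) * g2 (a, c) * g3 (a, b) \<partial>lborel \<partial>lborel \<partial>lborel)"
  proof (intro nn_integral_mono)
    fix a b c
    have "ennreal ((h a b c) ^ 3) = ennreal (h a b c) * ennreal (h a b c) * ennreal (h a b c)"
      using h0[of a b c] by (simp add: ennreal_mult[symmetric] power3_eq_cube)
    also have "\<dots> \<le> g1 (b, c) * g2 (a, c) * g3 (a, b)"
      unfolding g1_def g2_def g3_def prod.case using h fin h0 by (intro mult_mono rh) auto
    finally show "ennreal ((h a b c) ^ 3) \<le> g1 (b, c) * g2 (a, c) * g3 (a, b)" .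
  qed
  then have "(\<integral>\<^sup>+a. \<integral>\<^sup>+b. \<integral>\<^sup>+c. ennreal ((h a b c) ^ 3) \<partial>lborel \<partial>lborel \<partial>lborel)\<^sup>2
      \<le> (\<integral>\<^sup>+a. \<integral>\<^sup>+b. \<integral>\<^sup>+c. g1 (b, c) * g2 (a, c) * g3 (a, b) \<partial>lborel \<partial>lborel \<partial>lborel)\<^sup>2"
    by (intro power_mono) auto
  also have "\<dots> \<le> (\<integral>\<^sup>+b. \<integral>\<^sup>+c. (g1 (b, c))\<^sup>2 \<partial>lborel \<partial>lborel) * (\<integral>\<^sup>+a. \<integral>\<^sup>+c. (g2 (a, c))\<^sup>2 \<partial>lborel \<partial>lborel)
      * (\<integral>\<^sup>+a. \<integral>\<^sup>+b. (g3 (a, b))\<^sup>2 \<partial>lborel \<partial>lborel)"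
    by (rule Loomis_Whitney) measurable
  also have "(\<integral>\<^sup>+a. \<integral>\<^sup>+b. (g3 (a, b))\<^sup>2 \<partial>lborel \<partial>lborel) = ?Q"
    using fin by (simp add: g3_def r2)
  also have "(\<integral>\<^sup>+a. \<integral>\<^sup>+c. (g2 (a, c))\<^sup>2 \<partial>lborel \<partial>lborel) = (\<integral>\<^sup>+a. \<integral>\<^sup>+c. \<integral>\<^sup>+s. q (a, s, c) \<partial>lborel \<partial>lborel \<partial>lborel)"
    using fin by (simp add: g2_def r2)
  also have "\<dots> = ?Q"
    using sw[of "\<lambda>(b, c). q (a, b, c)" for a] by simp
  also have "(\<integral>\<^sup>+b. \<integral>\<^sup>+c. (g1 (b, c))\<^sup>2 \<partial>lborel \<partial>lborel) = (\<integral>\<^sup>+b. \<integral>\<^sup>+c. \<integral>\<^sup>+s. q (s, b, c) \<partial>lborel \<partial>lborel \<partial>lborel)"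
    using fin by (simp add: g1_def r2)
  also have "\<dots> = (\<integral>\<^sup>+b. \<integral>\<^sup>+s. \<integral>\<^sup>+c. q (s, b, c) \<partial>lborel \<partial>lborel \<partial>lborel)"
    using sw[of "\<lambda>(s, c). q (s, b, c)" for b] by simp
  also have "\<dots> = ?Q"
    using sw[of "\<lambda>(s, b). \<integral>\<^sup>+c. q (s, b, c) \<partial>lborel"] by simp
  finally show ?thesis by (simp add: power3_eq_cube)
qed

subsection \<open>One-sided segments\<close>

text \<open>Integrate the derivative of \<open>(s / s0 - 1) * h s\<close>, which vanishes at
  \<open>s0\<close> and equals \<open>- h 0\<close> at 0. The weight removes the far end point, so
  \<open>h\<close> need not vanish anywhere.\<close>

lemma segment_bound:
  fixes h h' :: "real \<Rightarrow> real"
  assumes s0: "0 < s0"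
    and d: "\<And>t. (h has_real_derivative h' t) (at t)"
    and c: "continuous_on UNIV h'"
  shows "ennreal \<bar>h 0\<bar> \<le> (\<integral>\<^sup>+s. ennreal (indicator {0<..s0} s * (\<bar>h s\<bar> / s0 + \<bar>h' s\<bar>)) \<partial>lborel)"
proof -
  have hc: "continuous_on A h" for A using d by (meson DERIV_isCont continuous_at_imp_continuous_on)
  have h'c: "continuous_on A h'" for A using c continuous_on_subset by blast
  have "((\<lambda>s. h s / s0 - (1 - s / s0) * h' s) has_integral ((s0 / s0 - 1) * h s0 - (0 / s0 - 1) * h 0)) {0..s0}"
  proof (rule fundamental_theorem_of_calculus)
    show "0 \<le> s0" using s0 by simp
    fix t assume "t \<in> {0..s0}"
    have "((\<lambda>s. s / s0 - 1) has_real_derivative 1 / s0) (at t)"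
      using s0 by (auto intro!: derivative_eq_intros)
    from DERIV_mult[OF this d[of t]]
    have "((\<lambda>s. (s / s0 - 1) * h s) has_real_derivative h t / s0 - (1 - t / s0) * h' t) (at t)"
      by (simp add: algebra_simps)
    then show "((\<lambda>s. (s / s0 - 1) * h s) has_vector_derivative h t / s0 - (1 - t / s0) * h' t) (at t within {0..s0})"
      using has_field_derivative_at_within has_real_derivative_iff_has_vector_derivative by blast
  qed
  then have 1: "((\<lambda>s. h s / s0 - (1 - s / s0) * h' s) has_integral h 0) {0..s0}" using s0 by simp
  have "(\<lambda>s. \<bar>h s\<bar> / s0 + \<bar>h' s\<bar>) integrable_on {0..s0}"
    by (intro integrable_continuous_interval continuous_intros hc h'c) (use s0 in auto)
  then obtain I where I: "((\<lambda>s. \<bar>h s\<bar> / s0 + \<bar>h' s\<bar>) has_integral I) {0..s0}" by blast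
  have le: "\<bar>h s / s0 - (1 - s / s0) * h' s\<bar> \<le> \<bar>h s\<bar> / s0 + \<bar>h' s\<bar>" if s: "s \<in> {0..s0}" for s
  proof -
    have "\<bar>(1 - s / s0) * h' s\<bar> \<le> 1 * \<bar>h' s\<bar>"
      unfolding abs_mult using s s0 by (intro mult_right_mono) auto
    moreover have "\<bar>h s / s0\<bar> = \<bar>h s\<bar> / s0" using s0 by simp
    ultimately show ?thesis by linarith
  qed
  have "h 0 \<le> I"
    by (rule has_integral_le[OF 1 I]) (use le in \<open>auto simp: abs_le_iff\<close>)
  moreover have "- h 0 \<le> I"
    by (rule has_integral_le[OF has_integral_neg[OF 1] I]) (use le in \<open>auto simp: abs_le_iff\<close>)
  ultimately have "\<bar>h 0\<bar> \<le> I" by simp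
  also have "ennreal I = (\<integral>\<^sup>+s. ennreal (indicator {0..s0} s * (\<bar>h s\<bar> / s0 + \<bar>h' s\<bar>)) \<partial>lborel)"
    using s0 by (intro nn_integral_has_integral_lebesgue[symmetric] I) auto
  \<comment> \<open>The starting point is dropped as a null set: it may lie on the boundary, and
    only positive parameters are known to lead into the domain.\<close>
  also have "\<dots> = (\<integral>\<^sup>+s. ennreal (indicator {0<..s0} s * (\<bar>h s\<bar> / s0 + \<bar>h' s\<bar>)) \<partial>lborel)"
    using AE_lborel_singleton[of 0]
    by (intro nn_integral_cong_AE) (auto elim!: eventually_mono split: split_indicator)
  finally show ?thesis by (simp add: ennreal_leI)
qed

lemma line_deriv:
  fixes f :: "'a::euclidean_space \<Rightarrow> real"
  assumes "f differentiable at (y + t *\<^sub>R e)"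
  shows "((\<lambda>t. f (y + t *\<^sub>R e)) has_real_derivative frechet_derivative f (at (y + t *\<^sub>R e)) e) (at t)"
proof -
  let ?D = "frechet_derivative f (at (y + t *\<^sub>R e))"
  have D: "(f has_derivative ?D) (at (y + t *\<^sub>R e))" using assms frechet_derivative_works by blast
  have "((\<lambda>t. y + t *\<^sub>R e) has_derivative (\<lambda>h. h *\<^sub>R e)) (at t)" by (auto intro!: derivative_eq_intros)
  from has_derivative_compose[OF this D]
  have "((\<lambda>t. f (y + t *\<^sub>R e)) has_derivative (\<lambda>h. ?D (h *\<^sub>R e))) (at t)" .
  moreover have "(*) (?D e) = (\<lambda>h. ?D (h *\<^sub>R e))"
    using linear_scale[OF has_derivative_linear[OF D]] by (simp add: fun_eq_iff mult.commute)
  ultimately show ?thesis by (simp add: has_field_derivative_def)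
qed

text \<open>The l1 norm of the gradient, which bounds the derivative in any direction
  \<open>e\<close> up to the factor \<open>norm e\<close>.\<close>

definition gsum :: "('a::euclidean_space \<Rightarrow> real) \<Rightarrow> 'a \<Rightarrow> real" where
  "gsum f x = (\<Sum>b\<in>Basis. \<bar>pd b f x\<bar>)"

lemma gsum_nonneg [simp]: "0 \<le> gsum f x" by (simp add: gsum_def sum_nonneg)

lemma gsum_continuous: "smooth_on UNIV f \<Longrightarrow> continuous_on UNIV (gsum f)"
  unfolding gsum_def[abs_def]
  by (intro continuous_on_sum continuous_on_rabs smooth_on_continuous smooth_on_pd)

lemma gsum_measurable: "smooth_on UNIV f \<Longrightarrow> gsum f \<in> borel_measurable borel"
  using gsum_continuous borel_measurable_continuous_onI by blast

lemma frechet_derivative_le_gsum: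
  assumes "f differentiable at x" shows "\<bar>frechet_derivative f (at x) e\<bar> \<le> norm e * gsum f x"
proof -
  have "\<bar>frechet_derivative f (at x) e\<bar> \<le> (\<Sum>b\<in>Basis. \<bar>(e \<bullet> b) * pd b f x\<bar>)"
    unfolding pd_expand[OF assms, where h=e] by (rule sum_abs)
  also have "\<dots> \<le> (\<Sum>b\<in>Basis. norm e * \<bar>pd b f x\<bar>)"
    unfolding abs_mult by (intro sum_mono mult_right_mono Basis_le_norm) auto
  finally show ?thesis by (simp add: gsum_def sum_distrib_left)
qed

lemma gsum_sq_le: "(gsum f x)\<^sup>2 \<le> real DIM('a) * (\<Sum>b\<in>Basis. (pd b f (x::'a::euclidean_space))\<^sup>2)"
  using Cauchy_Schwarz_ineq_sum[of "\<lambda>_. 1" "\<lambda>b. \<bar>pd b f x\<bar>" "Basis :: 'a set"] by (simp add: gsum_def)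

text \<open>\<open>segment_bound\<close> for the power \<open>f^(n+1)\<close> along the ray. The
  constant \<open>K\<close> absorbs both the length of the segment and the factor from
  differentiating the power. Extending the integral to all parameters with the ray in
  \<open>U\<close> turns the right side into a full line integral.\<close>

lemma ray_bound:
  fixes f :: "'a::euclidean_space \<Rightarrow> real"
  assumes f: "smooth_on UNIV f" and s0: "0 < s0" and U: "\<And>s. s \<in> {0<..s0} \<Longrightarrow> y + s *\<^sub>R e \<in> U"
    and K: "1 / s0 + real (Suc n) * norm e \<le> K"
  shows "ennreal (\<bar>f y\<bar> ^ Suc n) \<le> (\<integral>\<^sup>+s. ennreal (indicator U (y + s *\<^sub>R e) *
     (K * (\<bar>f (y + s *\<^sub>R e)\<bar> ^ n * (\<bar>f (y + s *\<^sub>R e)\<bar> + gsum f (y + s *\<^sub>R e))))) \<partial>lborel)"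
proof -
  let ?l = "\<lambda>s. y + s *\<^sub>R e"
  define h where "h = (\<lambda>s. f (?l s) ^ Suc n)"
  define h' where "h' = (\<lambda>s. real (Suc n) * (frechet_derivative f (at (?l s)) e * f (?l s) ^ n))"
  have df: "f differentiable at x" for x using smooth_on_differentiable[OF f] by simp
  have d: "(h has_real_derivative h' s) (at s)" for s
    using DERIV_power_Suc[OF line_deriv[OF df, of y e s], of n] by (simp add: h_def h'_def algebra_simps)
  have lc: "continuous_on UNIV ?l" by (intro continuous_intros)
  have "continuous_on UNIV (\<lambda>s. g (?l s))" if "continuous_on UNIV g" for g :: "'a \<Rightarrow> real"
    using continuous_on_compose2[OF that lc] by simp
  then have c: "continuous_on UNIV h'"
    unfolding h'_def pd_expand[OF df, where h=e] using smooth_on_continuous[OF f] smooth_on_continuous[OF smooth_on_pd[OF f]]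
    by (intro continuous_on_mult continuous_on_const continuous_on_power continuous_on_sum) auto
  have "ennreal (\<bar>f y\<bar> ^ Suc n) = ennreal \<bar>h 0\<bar>" by (simp add: h_def power_abs abs_mult)
  also have "\<dots> \<le> (\<integral>\<^sup>+s. ennreal (indicator {0<..s0} s * (\<bar>h s\<bar> / s0 + \<bar>h' s\<bar>)) \<partial>lborel)"
    by (rule segment_bound[OF s0 d c])
  also have "\<dots> \<le> (\<integral>\<^sup>+s. ennreal (indicator U (?l s) * (K * (\<bar>f (?l s)\<bar> ^ n * (\<bar>f (?l s)\<bar> + gsum f (?l s))))) \<partial>lborel)"
  proof (intro nn_integral_mono ennreal_leI)
    fix s
    show "indicator {0<..s0} s * (\<bar>h s\<bar> / s0 + \<bar>h' s\<bar>)
      \<le> indicator U (?l s) * (K * (\<bar>f (?l s)\<bar> ^ n * (\<bar>f (?l s)\<bar> + gsum f (?l s))))"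
    proof (cases "s \<in> {0<..s0}")
      case True
      let ?a = "\<bar>f (?l s)\<bar>" and ?g = "gsum f (?l s)"
      have "0 \<le> 1 / s0" "0 \<le> real (Suc n) * norm e" using s0 by auto
      then have K0: "1 / s0 \<le> K" "real (Suc n) * norm e \<le> K" using K by linarith+
      have "\<bar>h' s\<bar> \<le> real (Suc n) * ((norm e * ?g) * ?a ^ n)"
      proof -
        have "\<bar>h' s\<bar> = real (Suc n) * (\<bar>frechet_derivative f (at (?l s)) e\<bar> * ?a ^ n)"
          by (simp add: h'_def abs_mult power_abs)
        also have "\<dots> \<le> real (Suc n) * ((norm e * ?g) * ?a ^ n)"
          by (intro mult_left_mono mult_right_mono frechet_derivative_le_gsum df) auto
        finally show ?thesis .
      qed
      moreover have "\<bar>h s\<bar> / s0 = (1 / s0) * (?a ^ n * ?a)" by (simp add: h_def power_abs abs_mult)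
      moreover have "(1 / s0) * (?a ^ n * ?a) \<le> K * (?a ^ n * ?a)"
        by (intro mult_right_mono K0) auto
      moreover have "(real (Suc n) * norm e) * (?a ^ n * ?g) \<le> K * (?a ^ n * ?g)"
        by (intro mult_right_mono K0) auto
      ultimately have "\<bar>h s\<bar> / s0 + \<bar>h' s\<bar> \<le> K * (?a ^ n * ?a) + K * (?a ^ n * ?g)"
        by (simp only: mult_ac)
      then show ?thesis using U[OF True] True by (simp add: algebra_simps)
    next
      case False
      have "0 \<le> 1 / s0 + real (Suc n) * norm e" using s0 by simp
      with K have "0 \<le> K" by linarith
      then show ?thesis using False by (auto intro!: mult_nonneg_nonneg add_nonneg_nonneg)
    qed
  qed
  finally show ?thesis .
qed

text \<open>Up to constants, the size of the power \<open>f^(n+1)\<close> plus that of its gradient: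
  the density that the ray estimate leaves behind.\<close>

definition Qn :: "nat \<Rightarrow> ('a::euclidean_space \<Rightarrow> real) \<Rightarrow> 'a \<Rightarrow> real" where
  "Qn n f x = \<bar>f x\<bar> ^ n * (\<bar>f x\<bar> + gsum f x)"

lemma Qn_nonneg [simp]: "0 \<le> Qn n f x" by (simp add: Qn_def)

lemma Qn_continuous: "smooth_on UNIV f \<Longrightarrow> continuous_on UNIV (Qn n f)"
  unfolding Qn_def[abs_def]
  by (intro continuous_on_mult continuous_on_add continuous_on_power continuous_on_rabs
     smooth_on_continuous gsum_continuous)

lemma Qn_measurable: "smooth_on UNIV f \<Longrightarrow> Qn n f \<in> borel_measurable borel"
  using Qn_continuous borel_measurable_continuous_onI by blast

lemma lebesgue_on_nn:
  assumes "U \<in> sets borel" "g \<in> borel_measurable borel"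
  shows "(\<integral>\<^sup>+x. g x \<partial>lebesgue_on U) = (\<integral>\<^sup>+x. indicator U x * g x \<partial>lborel)"
  using assms by (simp add: nn_integral_restrict_space nn_integral_completion mult.commute)

text \<open>The factor 2 comes from squaring a sum of two terms, the dimension from comparing the l1
  norm of the gradient with the Euclidean one.\<close>

lemma smooth_H1_nn:
  fixes f :: "'a::euclidean_space \<Rightarrow> real"
  assumes "open U" "bounded U" "smooth_on UNIV f"
  shows "(\<integral>\<^sup>+x. ennreal ((\<bar>f x\<bar> + gsum f x)\<^sup>2) \<partial>lebesgue_on U) \<le> ennreal (2 * DIM('a) * (H1_norm U f)\<^sup>2)"
proof -
  let ?N = "lebesgue_on U"
  have p: "pd b f \<in> Lp 2 ?N" if "b \<in> Basis" for b
    using smooth_weak_partial[OF assms that] by (simp add: is_weak_partial_def)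
  have fL: "f \<in> Lp 2 ?N" using H1_Lp_2[OF smooth_H1[OF assms]] .
  have i: "integrable ?N (\<lambda>x. (f x)\<^sup>2)" "integrable ?N (\<lambda>x. \<Sum>b\<in>Basis. (pd b f x)\<^sup>2)"
    using p fL by (auto simp: Lp_2_iff)
  have "(\<integral>\<^sup>+x. ennreal ((\<bar>f x\<bar> + gsum f x)\<^sup>2) \<partial>?N)
      \<le> (\<integral>\<^sup>+x. ennreal (2 * DIM('a) * ((f x)\<^sup>2 + (\<Sum>b\<in>Basis. (pd b f x)\<^sup>2))) \<partial>?N)"
  proof (intro nn_integral_mono ennreal_leI)
    fix x
    have "(\<bar>f x\<bar> + gsum f x)\<^sup>2 \<le> 2 * (f x)\<^sup>2 + 2 * (gsum f x)\<^sup>2"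
      using sum_squares_bound[of "\<bar>f x\<bar>" "gsum f x"] by (simp add: power2_sum)
    also have "\<dots> \<le> 2 * (real DIM('a) * (f x)\<^sup>2) + 2 * (real DIM('a) * (\<Sum>b\<in>Basis. (pd b f x)\<^sup>2))"
    proof (intro add_mono mult_left_mono gsum_sq_le)
      have "1 * (f x)\<^sup>2 \<le> real DIM('a) * (f x)\<^sup>2"
        using DIM_positive[where 'a='a] by (intro mult_right_mono) auto
      then show "(f x)\<^sup>2 \<le> real DIM('a) * (f x)\<^sup>2" by simp
    qed auto
    finally show "(\<bar>f x\<bar> + gsum f x)\<^sup>2 \<le> 2 * DIM('a) * ((f x)\<^sup>2 + (\<Sum>b\<in>Basis. (pd b f x)\<^sup>2))"
      by (simp add: algebra_simps)
  qed
  also have "\<dots> = ennreal (\<integral>x. 2 * DIM('a) * ((f x)\<^sup>2 + (\<Sum>b\<in>Basis. (pd b f x)\<^sup>2)) \<partial>?N)"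
    using i by (intro nn_integral_eq_integral) (auto intro!: AE_I2 mult_nonneg_nonneg add_nonneg_nonneg sum_nonneg)
  also have "(\<integral>x. 2 * DIM('a) * ((f x)\<^sup>2 + (\<Sum>b\<in>Basis. (pd b f x)\<^sup>2)) \<partial>?N) = 2 * DIM('a) * (H1_norm U f)\<^sup>2"
    using i by (simp add: H1_norm_bounds(3) L2_norm_sq smooth_grad_norm_sq[OF assms])
  finally show ?thesis .
qed

text \<open>For \<open>n = 3\<close> the sixth power reappears on the right and the Sobolev estimate
  closes on itself; for \<open>n = 1\<close> the right side contains an \<open>L2\<close> norm,
  which makes the trace estimate multiplicative; in the plane it drives an induction on the
  exponent.\<close>

lemma Qn_Cauchy_Schwarz:
  fixes f :: "'a::euclidean_space \<Rightarrow> real"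
  assumes "open U" "bounded U" "smooth_on UNIV f"
  shows "(\<integral>\<^sup>+x. ennreal (Qn n f x) \<partial>lebesgue_on U)\<^sup>2
    \<le> (\<integral>\<^sup>+x. ennreal (\<bar>f x\<bar> ^ (2 * n)) \<partial>lebesgue_on U) * ennreal (2 * DIM('a) * (H1_norm U f)\<^sup>2)"
proof -
  let ?N = "lebesgue_on U"
  have m: "f \<in> borel_measurable ?N" "gsum f \<in> borel_measurable ?N"
    using smooth_measurable[OF assms(3)] gsum_measurable[OF assms(3)]
    by (auto intro!: measurable_restrict_space1 simp: measurable_completion)
  have "(\<integral>\<^sup>+x. ennreal (Qn n f x) \<partial>?N)\<^sup>2 = (\<integral>\<^sup>+x. ennreal (\<bar>f x\<bar> ^ n) * ennreal (\<bar>f x\<bar> + gsum f x) \<partial>?N)\<^sup>2"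
    by (simp add: Qn_def ennreal_mult del: ennreal_plus)
  also have "\<dots> \<le> (\<integral>\<^sup>+x. (ennreal (\<bar>f x\<bar> ^ n))\<^sup>2 \<partial>?N) * (\<integral>\<^sup>+x. (ennreal (\<bar>f x\<bar> + gsum f x))\<^sup>2 \<partial>?N)"
    using m by (intro Cauchy_Schwarz_nn_integral) auto
  also have "\<dots> = (\<integral>\<^sup>+x. ennreal (\<bar>f x\<bar> ^ (2 * n)) \<partial>?N) * (\<integral>\<^sup>+x. ennreal ((\<bar>f x\<bar> + gsum f x)\<^sup>2) \<partial>?N)"
    by (simp add: ennreal_power power_mult[symmetric] mult.commute del: ennreal_plus)
  also have "\<dots> \<le> (\<integral>\<^sup>+x. ennreal (\<bar>f x\<bar> ^ (2 * n)) \<partial>?N) * ennreal (2 * DIM('a) * (H1_norm U f)\<^sup>2)"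
    by (intro mult_left_mono smooth_H1_nn assms) auto
  finally show ?thesis .
qed

subsection \<open>Domains with smooth boundary have inward cones\<close>

text \<open>A cone condition uniform near \<open>x\<close>. A whole ball of directions is demanded,
  so that linearly independent directions, or one transversal to a plane, can be selected from
  it.\<close>

definition inward_cone :: "'a::euclidean_space set \<Rightarrow> 'a \<Rightarrow> real \<Rightarrow> real \<Rightarrow> 'a \<Rightarrow> real \<Rightarrow> bool" where
  "inward_cone U x r s0 e \<kappa> \<longleftrightarrow> 0 < r \<and> 0 < s0 \<and> 0 < \<kappa> \<and>
     (\<forall>y\<in>closure U \<inter> ball x r. \<forall>e'\<in>ball e \<kappa>. \<forall>s\<in>{0<..s0}. y + s *\<^sub>R e' \<in> U)"

text \<open>Near a boundary point the domain is where \<open>\<rho>\<close> is negative, and some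
  direction decreases \<open>\<rho>\<close> because its derivative is not 0. By continuity the
  decrease persists for nearby base points and directions, so a short segment from a point of the
  closure enters the domain.\<close>

lemma inward_cone_exists:
  fixes U :: "'a::euclidean_space set"
  assumes U: "open U" "smooth_boundary U" and x: "x \<in> closure U"
  obtains r s0 e \<kappa> where "inward_cone U x r s0 e \<kappa>"
proof (cases "x \<in> U")
  case True
  with U(1) obtain r where r: "0 < r" "ball x r \<subseteq> U" using open_contains_ball by blast
  \<comment> \<open>At an interior point short steps of any direction stay in the ball, so the
    central direction may be 0.\<close>
  have "inward_cone U x (r / 2) (r / 2) 0 1" unfolding inward_cone_def
  proof (intro conjI ballI)
    fix y e' s assume *: "y \<in> closure U \<inter> ball x (r / 2)" "e' \<in> ball (0::'a) 1" "s \<in> {0<..r / 2}"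
    have "s * norm e' \<le> r / 2 * 1" using * by (intro mult_mono) auto
    then have "norm (s *\<^sub>R e') \<le> r / 2" using * by simp
    then have "dist x (y + s *\<^sub>R e') < r"
      using * dist_triangle[of x "y + s *\<^sub>R e'" y] by (simp add: dist_norm)
    then show "y + s *\<^sub>R e' \<in> U" using r by auto
  qed (use r in auto)
  then show thesis using that by blast
next
  case False
  then have "x \<in> frontier U" using x U(1) by (simp add: frontier_def interior_open)
  with U(2) obtain V \<rho> where V: "open V" "x \<in> V" "smooth_on V \<rho>"
    "frechet_derivative \<rho> (at x) \<noteq> (\<lambda>_. 0)" "U \<inter> V = {y \<in> V. \<rho> y < 0}"
    unfolding smooth_boundary_def by blast
  have df: "\<rho> differentiable at y" if "y \<in> V" for y using smooth_on_differentiable[OF V(3) that] .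
  from V(4) obtain e0 where e0: "frechet_derivative \<rho> (at x) e0 \<noteq> 0" by auto
  define e where "e = (if frechet_derivative \<rho> (at x) e0 < 0 then e0 else - e0)"
  have lin: "linear (frechet_derivative \<rho> (at x))" using df[OF V(2)] linear_frechet_derivative by blast
  have e: "frechet_derivative \<rho> (at x) e < 0" using e0 by (auto simp: e_def linear_neg[OF lin])
  \<comment> \<open>Openness jointly in the point and the direction makes the descent uniform near
    \<open>(x, e)\<close>.\<close>
  define W where "W = {p \<in> V \<times> UNIV. (\<Sum>b\<in>Basis. (snd p \<bullet> b) * pd b \<rho> (fst p)) < 0}"
  have cW: "continuous_on (V \<times> UNIV) (\<lambda>p. (\<Sum>b\<in>Basis. (snd p \<bullet> b) * pd b \<rho> (fst p)))"
  proof (intro continuous_on_sum continuous_on_mult continuous_intros)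
    fix b :: 'a assume b: "b \<in> Basis"
    show "continuous_on (V \<times> UNIV) (\<lambda>p :: 'a \<times> 'a. pd b \<rho> (fst p))"
      by (rule continuous_on_compose2[OF smooth_on_continuous[OF smooth_on_pd[OF V(3) b]]])
         (auto intro: continuous_intros)
  qed
  have "open W"
    using continuous_open_preimage[OF cW open_Times[OF V(1) open_UNIV] open_lessThan[of 0]]
    by (simp add: W_def vimage_def Int_def)
  moreover have "(x, e) \<in> W" using e V(2) by (simp add: W_def pd_expand[OF df, where h=e])
  ultimately obtain \<epsilon> where \<epsilon>: "0 < \<epsilon>" "ball (x, e) \<epsilon> \<subseteq> W" using open_contains_ball by blast
  \<comment> \<open>A base point within \<open>r\<close> of \<open>x\<close> and a step of length at
    most \<open>r\<close> give distance less than \<open>\<epsilon> / 2\<close>; a direction within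
    \<open>\<epsilon> / 2\<close> of \<open>e\<close> then keeps the pair in the ball of radius
    \<open>\<epsilon>\<close>.\<close>
  define r where "r = \<epsilon> / 4"
  define s0 where "s0 = r / (norm e + \<epsilon>)"
  have rp: "0 < r" "0 < s0" using \<epsilon> by (auto simp: r_def s0_def add_nonneg_pos)
  have "inward_cone U x r s0 e (\<epsilon> / 2)" unfolding inward_cone_def
  proof (intro conjI ballI)
    fix y e' s assume *: "y \<in> closure U \<inter> ball x r" "e' \<in> ball e (\<epsilon> / 2)" "s \<in> {0<..s0}"
    have inW: "(y + t *\<^sub>R e', e') \<in> W" if t: "0 \<le> t" "t \<le> s" for t
    proof -
      have "norm e' \<le> norm e + \<epsilon>" using * norm_triangle_sub[of e' e] \<epsilon>(1) by (simp add: dist_norm norm_minus_commute)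
      then have "t * norm e' \<le> s0 * (norm e + \<epsilon>)" using t * rp by (intro mult_mono) auto
      also have "\<dots> = r" using \<epsilon> norm_ge_zero[of e] by (simp add: s0_def add_nonneg_pos[THEN less_imp_neq, symmetric])
      finally have "dist x (y + t *\<^sub>R e') < 2 * r"
        using * t dist_triangle[of x "y + t *\<^sub>R e'" y] by (simp add: dist_norm)
      then have "dist (x, e) (y + t *\<^sub>R e', e') < \<epsilon>"
        using * sqrt_sum_squares_le_sum[of "dist x (y + t *\<^sub>R e')" "dist e e'"]
        by (simp add: dist_Pair_Pair r_def)
      then show ?thesis using \<epsilon>(2) by auto
    qed
    have yV: "y + t *\<^sub>R e' \<in> V" and neg: "frechet_derivative \<rho> (at (y + t *\<^sub>R e')) e' < 0"
      if "0 \<le> t" "t \<le> s" for t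
      using inW[OF that] by (auto simp: W_def pd_expand[OF df, where h=e'])
    have s: "0 < s" using * by simp
    have "\<rho> (y + s *\<^sub>R e') < \<rho> (y + 0 *\<^sub>R e')"
    proof (rule DERIV_neg_imp_decreasing[OF s])
      fix t assume "0 \<le> t" "t \<le> s"
      then show "\<exists>z. ((\<lambda>t. \<rho> (y + t *\<^sub>R e')) has_real_derivative z) (at t) \<and> z < 0"
        using line_deriv[OF df[OF yV], of t] neg by blast
    qed
    \<comment> \<open>The base point lies in the closure, so it is a limit of points where
      \<open>\<rho>\<close> is negative; a positive value at it would persist nearby.\<close>
    moreover have "\<rho> y \<le> 0"
    proof (rule ccontr)
      assume "\<not> \<rho> y \<le> 0"
      have "open (V \<inter> \<rho> -` {0<..})"
        using V(1) smooth_on_continuous[OF V(3)] by (intro continuous_open_preimage) auto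
      moreover have "y \<in> V \<inter> \<rho> -` {0<..}" using yV[of 0] s \<open>\<not> \<rho> y \<le> 0\<close> by simp
      ultimately have "U \<inter> (V \<inter> \<rho> -` {0<..}) \<noteq> {}"
        using * by (metis IntD1 IntI closure_iff_nhds_not_empty order_refl Int_commute)
      then obtain z where z: "z \<in> U \<inter> V" "0 < \<rho> z" by auto
      have "z \<in> {y \<in> V. \<rho> y < 0}" using z(1) V(5) by blast
      then show False using z(2) by simp
    qed
    ultimately have "\<rho> (y + s *\<^sub>R e') < 0" by simp
    moreover have "y + s *\<^sub>R e' \<in> V" using yV[of s] s by simp
    ultimately show "y + s *\<^sub>R e' \<in> U" using V(5) by blast
  qed (use rp \<epsilon> in auto)
  then show thesis using that by blast
qed

lemma closure_cover:
  fixes U :: "'a::euclidean_space set"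
  assumes "bounded U" "\<And>x. x \<in> closure U \<Longrightarrow> 0 < r x"
  obtains X where "finite X" "X \<subseteq> closure U" "closure U \<subseteq> (\<Union>x\<in>X. ball x (r x))"
proof -
  have "compact (closure U)" using assms(1) by simp
  moreover have "closure U \<subseteq> (\<Union>x\<in>closure U. ball x (r x))" using assms(2) by force
  ultimately show thesis
    using that compactE_image[of "closure U" "closure U" "\<lambda>x. ball x (r x)"] by (metis open_ball)
qed

subsection \<open>The critical Sobolev inequality in three dimensions\<close>

text \<open>The vectors \<open>e\<close> plus \<open>t\<close> times a coordinate vector have
  determinant \<open>t^2 * (\<sigma> + t)\<close>, where \<open>\<sigma>\<close> is the sum of the
  coordinates of \<open>e\<close>. Two candidate values of \<open>t\<close> are enough to avoid the
  zero at \<open>- \<sigma>\<close>.\<close>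

lemma three_directions:
  fixes e :: "real^3"
  assumes "0 < \<kappa>"
  obtains e1 e2 e3 where "e1 \<in> ball e \<kappa>" "e2 \<in> ball e \<kappa>" "e3 \<in> ball e \<kappa>"
    "\<And>a b c. a *\<^sub>R e1 + b *\<^sub>R e2 + c *\<^sub>R e3 = 0 \<Longrightarrow> a = 0 \<and> b = 0 \<and> c = 0"
proof -
  define \<sigma> where "\<sigma> = e$1 + e$2 + e$3"
  define t where "t = (if \<sigma> = - (\<kappa> / 2) then \<kappa> / 3 else \<kappa> / 2)"
  have t: "0 < t" "t < \<kappa>" "\<sigma> + t \<noteq> 0" using assms by (auto simp: t_def)
  let ?e = "\<lambda>i. e + t *\<^sub>R axis i 1"
  show thesis
  proof (rule that[of "?e 1" "?e 2" "?e 3"])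
    show "?e 1 \<in> ball e \<kappa>" "?e 2 \<in> ball e \<kappa>" "?e 3 \<in> ball e \<kappa>" using t by (auto simp: dist_norm)
    fix a b c assume z: "a *\<^sub>R ?e 1 + b *\<^sub>R ?e 2 + c *\<^sub>R ?e 3 = 0"
    have "(a + b + c) * e$1 + t * a = 0" "(a + b + c) * e$2 + t * b = 0" "(a + b + c) * e$3 + t * c = 0"
      using arg_cong[OF z, of "\<lambda>v. v$1"] arg_cong[OF z, of "\<lambda>v. v$2"] arg_cong[OF z, of "\<lambda>v. v$3"]
      by (simp_all add: axis_def algebra_simps)
    moreover from this have "(a + b + c) * (\<sigma> + t) = 0" by (simp add: \<sigma>_def algebra_simps)
    ultimately show "a = 0 \<and> b = 0 \<and> c = 0" using t by auto
  qed
qed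

text \<open>In affine coordinates along three independent inward directions, every coordinate line
  through a point of \<open>U\<close> near \<open>x\<close> starts with a segment in
  \<open>U\<close>. The ray estimate with \<open>n = 3\<close> bounds \<open>f^4\<close> by the
  three line integrals of \<open>Qn 3 f\<close>, and \<open>Gagliardo3\<close> with
  \<open>h = f^2\<close> turns this into a bound for the integral of \<open>f^6\<close>.\<close>

lemma local_Sobolev:
  fixes U :: "(real^3) set"
  assumes U: "open U" "bounded U" and cone: "inward_cone U x r s0 e \<kappa>"
  obtains C where "0 \<le> C" "\<And>f. smooth_on UNIV f \<Longrightarrow>
    (\<integral>\<^sup>+y. ennreal (indicator (U \<inter> ball x r) y * \<bar>f y\<bar> ^ 6) \<partial>lborel)\<^sup>2
      \<le> ennreal C * (\<integral>\<^sup>+y. ennreal (indicator U y * Qn 3 f y) \<partial>lborel) ^ 3"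
proof -
  from cone have c: "0 < r" "0 < s0" "0 < \<kappa>"
    "\<And>y e' s. y \<in> closure U \<Longrightarrow> y \<in> ball x r \<Longrightarrow> e' \<in> ball e \<kappa> \<Longrightarrow> s \<in> {0<..s0} \<Longrightarrow> y + s *\<^sub>R e' \<in> U"
    unfolding inward_cone_def by blast+
  obtain e1 e2 e3 where e: "e1 \<in> ball e \<kappa>" "e2 \<in> ball e \<kappa>" "e3 \<in> ball e \<kappa>"
    and ind: "\<And>a b c. a *\<^sub>R e1 + b *\<^sub>R e2 + c *\<^sub>R e3 = 0 \<Longrightarrow> a = 0 \<and> b = 0 \<and> c = 0"
    using three_directions[OF c(3)] by blast
  obtain k where k: "0 < k" "\<And>f p. f \<in> borel_measurable borel \<Longrightarrow> (\<integral>\<^sup>+x. f x \<partial>lborel)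
       = ennreal k * (\<integral>\<^sup>+a. \<integral>\<^sup>+b. \<integral>\<^sup>+c. f (p + a *\<^sub>R e1 + b *\<^sub>R e2 + c *\<^sub>R e3) \<partial>lborel \<partial>lborel \<partial>lborel)"
    using affine_coordinates3[OF ind] by metis
  define L where "L = (\<lambda>(a, b, c). a *\<^sub>R e1 + b *\<^sub>R e2 + c *\<^sub>R e3)"
  have Lm [measurable]: "L \<in> borel_measurable (borel \<Otimes>\<^sub>M (borel \<Otimes>\<^sub>M borel))"
    unfolding L_def by measurable
  have kL: "(\<integral>\<^sup>+x. f x \<partial>lborel) = ennreal k * (\<integral>\<^sup>+a. \<integral>\<^sup>+b. \<integral>\<^sup>+c. f (L (a, b, c)) \<partial>lborel \<partial>lborel \<partial>lborel)"
    if "f \<in> borel_measurable borel" for f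
    using k(2)[OF that, of 0] by (simp add: L_def)
  define K where "K = 1 / s0 + 4 * norm e1 + 4 * norm e2 + 4 * norm e3"
  have K: "0 < K" "1 / s0 + real (Suc 3) * norm e1 \<le> K" "1 / s0 + real (Suc 3) * norm e2 \<le> K"
    "1 / s0 + real (Suc 3) * norm e3 \<le> K"
    using c(2) by (auto simp: K_def add_pos_nonneg)
  \<comment> \<open>Points of \<open>U\<close> have bounded coordinates in the new system; together
    with the bound of \<open>Qn 3 f\<close> on \<open>U\<close> this makes the line integrals
    finite, as \<open>Gagliardo3\<close> requires.\<close>
  have Lbd: "\<exists>R. \<forall>a b c. L (a, b, c) \<in> U \<longrightarrow> \<bar>a\<bar> \<le> R \<and> \<bar>b\<bar> \<le> R \<and> \<bar>c\<bar> \<le> R"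
  proof -
    define T where "T = (\<lambda>v::real^3. L (v$1, v$2, v$3))"
    have T: "linear T" unfolding T_def L_def by (intro linearI) (auto simp: algebra_simps)
    have "inj T"
    proof (rule linear_injective_0[OF T, THEN iffD2], intro allI impI)
      fix v assume "T v = 0"
      then show "v = 0" using ind[of "v$1" "v$2" "v$3"] by (simp add: T_def L_def vec_eq_iff forall_3)
    qed
    with T obtain B where B: "0 < B" "\<And>v. B * norm v \<le> norm (T v)"
      using linear_inj_bounded_below_pos[of T] by metis
    obtain M where M: "\<And>y. y \<in> U \<Longrightarrow> norm y \<le> M" using U(2) by (auto simp: bounded_iff)
    have "\<bar>a\<bar> \<le> M / B \<and> \<bar>b\<bar> \<le> M / B \<and> \<bar>c\<bar> \<le> M / B" if "L (a, b, c) \<in> U" for a b c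
    proof -
      let ?v = "vector [a, b, c] :: real^3"
      have "B * norm ?v \<le> M" using B(2)[of ?v] M[OF that] by (simp add: T_def)
      then have "norm ?v \<le> M / B" using B(1) by (simp add: field_simps)
      moreover have "\<bar>?v$1\<bar> \<le> norm ?v" "\<bar>?v$2\<bar> \<le> norm ?v" "\<bar>?v$3\<bar> \<le> norm ?v"
        by (rule component_le_norm_cart)+
      ultimately show ?thesis by simp
    qed
    then show ?thesis by blast
  qed
  then obtain R where R: "\<And>a b c. L (a, b, c) \<in> U \<Longrightarrow> \<bar>a\<bar> \<le> R \<and> \<bar>b\<bar> \<le> R \<and> \<bar>c\<bar> \<le> R" by blast
  show thesis
  \<comment> \<open>Passing to the new coordinates costs a Jacobian on both sides:
    \<open>k^2 * J^3 = (k * J)^3 / k\<close>, and \<open>k * J\<close> is \<open>K\<close> times the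
    integral of \<open>Qn 3 f\<close>.\<close>
  proof (rule that[of "K ^ 3 / k"])
    show "0 \<le> K ^ 3 / k" using K(1) k(1) by simp
    fix f :: "real^3 \<Rightarrow> real" assume f: "smooth_on UNIV f"
    have [measurable]: "f \<in> borel_measurable borel" "Qn 3 f \<in> borel_measurable borel"
      using smooth_measurable[OF f] Qn_measurable[OF f] by auto
    have Ub [measurable]: "U \<in> sets borel" using U(1) by simp
    define q where "q = (\<lambda>p. ennreal (indicator U (L p) * (K * Qn 3 f (L p))))"
    define h where "h = (\<lambda>a b c. indicator (U \<inter> ball x r) (L (a, b, c)) * (f (L (a, b, c)))\<^sup>2 :: real)"
    have q [measurable]: "q \<in> borel_measurable (borel \<Otimes>\<^sub>M (borel \<Otimes>\<^sub>M borel))"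
      unfolding q_def by measurable
    obtain B where B: "\<And>y. y \<in> U \<Longrightarrow> Qn 3 f y \<le> B"
    proof -
      have "compact (closure U)" using U(2) by simp
      from compact_continuous_image[OF continuous_on_subset[OF Qn_continuous[OF f]] this, of 3]
      have "bounded (Qn 3 f ` closure U)" using compact_imp_bounded by blast
      then show thesis using closure_subset that unfolding bounded_iff by (metis abs_le_D1 image_eqI real_norm_def subsetD)
    qed
    have qbd: "q (a, b, c) \<le> ennreal (K * B) * indicator {-R..R} a"
      "q (a, b, c) \<le> ennreal (K * B) * indicator {-R..R} b"
      "q (a, b, c) \<le> ennreal (K * B) * indicator {-R..R} c" for a b c
      using R[of a b c] B[of "L (a, b, c)"] K(1)
      by (auto simp: q_def abs_le_iff intro!: ennreal_leI split: split_indicator)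
    have fin0: "(\<integral>\<^sup>+s. ennreal (K * B) * indicator {-R..R} s \<partial>lborel) < \<infinity>"
      by (simp add: nn_integral_cmult_indicator ennreal_mult_less_top emeasure_lborel_Icc_eq)
    have ray: "ennreal ((h a b c)\<^sup>2) \<le> (\<integral>\<^sup>+s. ennreal (indicator U (L (a, b, c) + s *\<^sub>R e') *
       (K * Qn 3 f (L (a, b, c) + s *\<^sub>R e'))) \<partial>lborel)"
      if e': "e' \<in> ball e \<kappa>" "1 / s0 + real (Suc 3) * norm e' \<le> K" for a b c e'
    proof (cases "L (a, b, c) \<in> U \<inter> ball x r")
      case True
      have "ennreal ((h a b c)\<^sup>2) = ennreal (\<bar>f (L (a, b, c))\<bar> ^ Suc 3)"
        using True by (simp add: h_def power_mult[symmetric] numeral_eq_Suc)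
      also have "\<dots> \<le> (\<integral>\<^sup>+s. ennreal (indicator U (L (a, b, c) + s *\<^sub>R e') *
       (K * Qn 3 f (L (a, b, c) + s *\<^sub>R e'))) \<partial>lborel)"
        unfolding Qn_def
      proof (rule ray_bound[OF f c(2) _ e'(2)])
        fix s assume "s \<in> {0<..s0}"
        then show "L (a, b, c) + s *\<^sub>R e' \<in> U"
          using True closure_subset[of U] e'(1) by (intro c(4)) auto
      qed
      finally show ?thesis .
    qed (simp add: h_def)
    have shift: "(\<integral>\<^sup>+s. g (t + s) \<partial>lborel) = (\<integral>\<^sup>+s. g s \<partial>lborel)"
      if "g \<in> borel_measurable borel" for g :: "real \<Rightarrow> ennreal" and t
      using nn_integral_real_affine[OF that, of 1 t] by simp
    have "(\<integral>\<^sup>+a. \<integral>\<^sup>+b. \<integral>\<^sup>+c. ennreal ((h a b c) ^ 3) \<partial>lborel \<partial>lborel \<partial>lborel)\<^sup>2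
      \<le> (\<integral>\<^sup>+a. \<integral>\<^sup>+b. \<integral>\<^sup>+c. q (a, b, c) \<partial>lborel \<partial>lborel \<partial>lborel) ^ 3"
    proof (rule Gagliardo3[OF q])
      fix a b c
      show "0 \<le> h a b c" by (simp add: h_def)
      have "ennreal ((h a b c)\<^sup>2) \<le> (\<integral>\<^sup>+s. q (a + s, b, c) \<partial>lborel)"
        using ray[OF e(1) K(2), of a b c] by (simp add: q_def L_def algebra_simps)
      then show "ennreal ((h a b c)\<^sup>2) \<le> (\<integral>\<^sup>+s. q (s, b, c) \<partial>lborel)"
        using shift[of "\<lambda>s. q (s, b, c)" a] by simp
      have "ennreal ((h a b c)\<^sup>2) \<le> (\<integral>\<^sup>+s. q (a, b + s, c) \<partial>lborel)"
        using ray[OF e(2) K(3), of a b c] by (simp add: q_def L_def algebra_simps)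
      then show "ennreal ((h a b c)\<^sup>2) \<le> (\<integral>\<^sup>+s. q (a, s, c) \<partial>lborel)"
        using shift[of "\<lambda>s. q (a, s, c)" b] by simp
      have "ennreal ((h a b c)\<^sup>2) \<le> (\<integral>\<^sup>+s. q (a, b, c + s) \<partial>lborel)"
        using ray[OF e(3) K(4), of a b c] by (simp add: q_def L_def algebra_simps)
      then show "ennreal ((h a b c)\<^sup>2) \<le> (\<integral>\<^sup>+s. q (a, b, s) \<partial>lborel)"
        using shift[of "\<lambda>s. q (a, b, s)" c] by simp
      show "(\<integral>\<^sup>+s. q (s, b, c) \<partial>lborel) < \<infinity>" "(\<integral>\<^sup>+s. q (a, s, c) \<partial>lborel) < \<infinity>"
        "(\<integral>\<^sup>+s. q (a, b, s) \<partial>lborel) < \<infinity>"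
        by (rule le_less_trans[OF nn_integral_mono fin0], rule qbd)+
    qed
    moreover have "(\<integral>\<^sup>+y. ennreal (indicator (U \<inter> ball x r) y * \<bar>f y\<bar> ^ 6) \<partial>lborel)
       = ennreal k * (\<integral>\<^sup>+a. \<integral>\<^sup>+b. \<integral>\<^sup>+c. ennreal ((h a b c) ^ 3) \<partial>lborel \<partial>lborel \<partial>lborel)"
    proof -
      have "ennreal (indicator (U \<inter> ball x r) (L (a, b, c)) * \<bar>f (L (a, b, c))\<bar> ^ 6) = ennreal ((h a b c) ^ 3)" for a b c
        by (simp add: h_def power_mult[symmetric] split: split_indicator)
      moreover have "(\<lambda>y. ennreal (indicator (U \<inter> ball x r) y * \<bar>f y\<bar> ^ 6)) \<in> borel_measurable borel"
      proof -
        have "U \<inter> ball x r \<in> sets borel" using U(1) by (intro borel_open) auto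
        then show ?thesis using smooth_measurable[OF f]
          by (intro measurable_compose[OF _ measurable_ennreal] borel_measurable_times
              borel_measurable_indicator borel_measurable_power borel_measurable_abs)
      qed
      ultimately show ?thesis by (simp only: kL)
    qed
    moreover have "ennreal k * (\<integral>\<^sup>+a. \<integral>\<^sup>+b. \<integral>\<^sup>+c. q (a, b, c) \<partial>lborel \<partial>lborel \<partial>lborel)
       = ennreal K * (\<integral>\<^sup>+y. ennreal (indicator U y * Qn 3 f y) \<partial>lborel)"
    proof -
      have "ennreal k * (\<integral>\<^sup>+a. \<integral>\<^sup>+b. \<integral>\<^sup>+c. q (a, b, c) \<partial>lborel \<partial>lborel \<partial>lborel)
         = (\<integral>\<^sup>+y. ennreal (indicator U y * (K * Qn 3 f y)) \<partial>lborel)"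
        unfolding q_def by (rule kL[symmetric]) measurable
      also have "\<dots> = (\<integral>\<^sup>+y. ennreal K * ennreal (indicator U y * Qn 3 f y) \<partial>lborel)"
        using K(1) by (intro nn_integral_cong) (simp add: ennreal_mult[symmetric] algebra_simps)
      also have "\<dots> = ennreal K * (\<integral>\<^sup>+y. ennreal (indicator U y * Qn 3 f y) \<partial>lborel)"
        by (rule nn_integral_cmult) measurable
      finally show ?thesis .
    qed
    ultimately show "(\<integral>\<^sup>+y. ennreal (indicator (U \<inter> ball x r) y * \<bar>f y\<bar> ^ 6) \<partial>lborel)\<^sup>2
      \<le> ennreal (K ^ 3 / k) * (\<integral>\<^sup>+y. ennreal (indicator U y * Qn 3 f y) \<partial>lborel) ^ 3"
    proof -
      let ?I = "\<integral>\<^sup>+a. \<integral>\<^sup>+b. \<integral>\<^sup>+c. ennreal ((h a b c) ^ 3) \<partial>lborel \<partial>lborel \<partial>lborel"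
      let ?J = "\<integral>\<^sup>+a. \<integral>\<^sup>+b. \<integral>\<^sup>+c. q (a, b, c) \<partial>lborel \<partial>lborel \<partial>lborel"
      let ?Q = "\<integral>\<^sup>+y. ennreal (indicator U y * Qn 3 f y) \<partial>lborel"
      assume IJ: "?I\<^sup>2 \<le> ?J ^ 3" and I: "(\<integral>\<^sup>+y. ennreal (indicator (U \<inter> ball x r) y * \<bar>f y\<bar> ^ 6) \<partial>lborel) = ennreal k * ?I"
        and J: "ennreal k * ?J = ennreal K * ?Q"
      have "(ennreal k * ?I)\<^sup>2 \<le> (ennreal k)\<^sup>2 * ?J ^ 3"
        unfolding power_mult_distrib by (intro mult_left_mono IJ) auto
      also have "\<dots> = ennreal (1 / k) * (ennreal k * ?J) ^ 3"
      proof -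
        have "(ennreal k)\<^sup>2 = ennreal (1 / k) * ennreal k ^ 3"
          using k(1) by (simp add: ennreal_power ennreal_mult[symmetric] power2_eq_square power3_eq_cube)
        then show ?thesis by (simp add: power_mult_distrib mult.assoc)
      qed
      also have "\<dots> = ennreal (K ^ 3 / k) * ?Q ^ 3"
        unfolding J power_mult_distrib using k(1) K(1)
        by (simp add: ennreal_power mult.assoc[symmetric] ennreal_mult[symmetric])
      finally show ?thesis unfolding I .
    qed
  qed
qed

text \<open>Let \<open>I\<close> be the integral of \<open>f^6\<close>, \<open>J\<close> that of
  \<open>Qn 3 f\<close> and \<open>H\<close> the \<open>H1\<close> norm. The local estimates over a
  finite cover give \<open>I <= A * J^(3/2)\<close>, and Cauchy-Schwarz gives
  \<open>J^2 <= 6 * I * H^2\<close>. Hence \<open>I^4 <= A^4 * 6^3 * I^3 * H^6\<close>, and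
  \<open>I^3\<close> cancels, since \<open>I\<close> is finite for a function continuous on the
  closure of a bounded set.\<close>

lemma Sobolev_smooth:
  fixes U :: "(real^3) set"
  assumes U: "open U" "bounded U" "smooth_boundary U"
  obtains C where "0 \<le> C" "\<And>f. smooth_on UNIV f \<Longrightarrow>
    (\<integral>\<^sup>+y. ennreal (\<bar>f y\<bar> ^ 6) \<partial>lebesgue_on U) \<le> ennreal (C * (H1_norm U f) ^ 6)"
proof -
  define P where "P x r C \<longleftrightarrow> (\<forall>f. smooth_on UNIV f \<longrightarrow>
      (\<integral>\<^sup>+y. ennreal (indicator (U \<inter> ball x r) y * \<bar>f y\<bar> ^ 6) \<partial>lborel)\<^sup>2
      \<le> ennreal C * (\<integral>\<^sup>+y. ennreal (indicator U y * Qn 3 f y) \<partial>lborel) ^ 3)" for x r C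
  have "\<exists>r C. 0 < r \<and> 0 \<le> C \<and> P x r C" if x: "x \<in> closure U" for x
  proof -
    from inward_cone_exists[OF U(1,3) x] obtain r s0 e \<kappa> where c: "inward_cone U x r s0 e \<kappa>" by blast
    then have r: "0 < r" by (simp add: inward_cone_def)
    show ?thesis
    proof (rule local_Sobolev[OF U(1,2) c])
      fix C assume "0 \<le> C" and *: "\<And>f. smooth_on UNIV f \<Longrightarrow>
        (\<integral>\<^sup>+y. ennreal (indicator (U \<inter> ball x r) y * \<bar>f y\<bar> ^ 6) \<partial>lborel)\<^sup>2
        \<le> ennreal C * (\<integral>\<^sup>+y. ennreal (indicator U y * Qn 3 f y) \<partial>lborel) ^ 3"
      moreover have "P x r C" unfolding P_def using * by blast
      ultimately show ?thesis using r by blast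
    qed
  qed
  then obtain r C where rC: "\<And>x. x \<in> closure U \<Longrightarrow> 0 < r x" "\<And>x. x \<in> closure U \<Longrightarrow> 0 \<le> C x"
    "\<And>x. x \<in> closure U \<Longrightarrow> P x (r x) (C x)" by metis
  obtain X where X: "finite X" "X \<subseteq> closure U" "closure U \<subseteq> (\<Union>x\<in>X. ball x (r x))"
    by (rule closure_cover[where r=r, OF U(2) rC(1)])
  define A where "A = (\<Sum>x\<in>X. sqrt (C x))"
  have A: "0 \<le> A" unfolding A_def using X rC(2) by (intro sum_nonneg) auto
  show thesis
  proof (rule that[of "A ^ 4 * 6 ^ 3"])
    show "0 \<le> A ^ 4 * 6 ^ 3" using A by simp
    fix f :: "real^3 \<Rightarrow> real" assume f: "smooth_on UNIV f"
    let ?N = "lebesgue_on U"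
    have fm [measurable]: "f \<in> borel_measurable borel" "Qn 3 f \<in> borel_measurable borel"
      using smooth_measurable[OF f] Qn_measurable[OF f] by auto
    have Ub [measurable]: "U \<in> sets borel" using U(1) by simp
    have c6: "continuous_on UNIV (\<lambda>y. \<bar>f y\<bar> ^ 3)"
      by (intro continuous_on_power continuous_on_rabs smooth_on_continuous f)
    define I where "I = (\<integral>y. \<bar>f y\<bar> ^ 6 \<partial>?N)"
    have "integrable ?N (\<lambda>y. (\<bar>f y\<bar> ^ 3)\<^sup>2)"
      using continuous_Lp_2[OF c6 U(2)] U(1) by (simp add: Lp_2_iff)
    then have "integrable ?N (\<lambda>y. \<bar>f y\<bar> ^ 6)" by (simp add: power_mult[symmetric])
    then have I: "(\<integral>\<^sup>+y. ennreal (\<bar>f y\<bar> ^ 6) \<partial>?N) = ennreal I" "0 \<le> I"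
      unfolding I_def by (auto intro!: nn_integral_eq_integral)
    have Qc: "Qn 3 f \<in> Lp 2 ?N" using continuous_Lp_2[OF Qn_continuous[OF f] U(2)] U(1) by simp
    have J2: "(\<integral>\<^sup>+y. ennreal (Qn 3 f y) \<partial>?N)\<^sup>2 \<le> ennreal (I * (6 * (H1_norm U f)\<^sup>2))"
      using Qn_Cauchy_Schwarz[OF U(1,2) f, of 3] I by (simp add: ennreal_mult)
    then have "(\<integral>\<^sup>+y. ennreal (Qn 3 f y) \<partial>?N) \<noteq> \<infinity>" by (auto simp: power2_eq_square top_unique)
    then obtain J where J: "(\<integral>\<^sup>+y. ennreal (Qn 3 f y) \<partial>?N) = ennreal J" "0 \<le> J"
      by (metis ennreal_cases infinity_ennreal_def)
    have J2': "J\<^sup>2 \<le> I * (6 * (H1_norm U f)\<^sup>2)" using J2 J I by (simp add: ennreal_power)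
    have Jl: "(\<integral>\<^sup>+y. ennreal (indicator U y * Qn 3 f y) \<partial>lborel) = ennreal J"
      using lebesgue_on_nn[OF Ub, of "\<lambda>y. ennreal (Qn 3 f y)"] J(1) by (simp add: ennreal_mult' ennreal_indicator)
    have loc: "(\<integral>\<^sup>+y. ennreal (indicator (U \<inter> ball x (r x)) y * \<bar>f y\<bar> ^ 6) \<partial>lborel) \<le> ennreal (sqrt (C x) * sqrt (J ^ 3))"
      if x: "x \<in> X" for x
    proof -
      let ?i = "\<integral>\<^sup>+y. ennreal (indicator (U \<inter> ball x (r x)) y * \<bar>f y\<bar> ^ 6) \<partial>lborel"
      have xc: "x \<in> closure U" using x X by blast
      have "?i\<^sup>2 \<le> ennreal (C x) * (\<integral>\<^sup>+y. ennreal (indicator U y * Qn 3 f y) \<partial>lborel) ^ 3"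
        using rC(3)[OF xc] f unfolding P_def by blast
      also have "\<dots> = ennreal (C x * J ^ 3)"
        unfolding Jl using rC(2)[OF xc] J(2) by (simp only: ennreal_power ennreal_mult zero_le_power)
      finally have i2: "?i\<^sup>2 \<le> ennreal (C x * J ^ 3)" .
      have "?i \<noteq> top"
      proof
        assume "?i = top"
        with i2 show False by (simp add: power2_eq_square top_unique)
      qed
      then obtain i where i: "?i = ennreal i" "0 \<le> i" by (cases ?i) auto
      have nn: "0 \<le> C x * J ^ 3" using rC(2)[OF xc] J(2) by simp
      have "ennreal (i\<^sup>2) \<le> ennreal (C x * J ^ 3)" using i2 unfolding i(1) by (simp only: ennreal_power i(2))
      then have "i\<^sup>2 \<le> C x * J ^ 3" using nn by (simp only: ennreal_le_iff)
      then have "i \<le> sqrt (C x) * sqrt (J ^ 3)" unfolding real_sqrt_mult[symmetric] by (rule real_le_rsqrt)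
      then show ?thesis unfolding i(1) by (rule ennreal_leI)
    qed
    have "ennreal I = (\<integral>\<^sup>+y. ennreal (indicator U y * \<bar>f y\<bar> ^ 6) \<partial>lborel)"
      using lebesgue_on_nn[OF Ub, of "\<lambda>y. ennreal (\<bar>f y\<bar> ^ 6)"] I(1) by (simp add: ennreal_mult' ennreal_indicator)
    also have "\<dots> \<le> (\<integral>\<^sup>+y. (\<Sum>x\<in>X. ennreal (indicator (U \<inter> ball x (r x)) y * \<bar>f y\<bar> ^ 6)) \<partial>lborel)"
    proof (intro nn_integral_mono)
      fix y
      show "ennreal (indicator U y * \<bar>f y\<bar> ^ 6) \<le> (\<Sum>x\<in>X. ennreal (indicator (U \<inter> ball x (r x)) y * \<bar>f y\<bar> ^ 6))"
      proof (cases "y \<in> U")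
        case True
        then obtain x where x: "x \<in> X" "y \<in> ball x (r x)" using X(3) closure_subset by blast
        then have "ennreal (indicator U y * \<bar>f y\<bar> ^ 6) = ennreal (indicator (U \<inter> ball x (r x)) y * \<bar>f y\<bar> ^ 6)"
          using True by simp
        also have "\<dots> \<le> (\<Sum>x\<in>X. ennreal (indicator (U \<inter> ball x (r x)) y * \<bar>f y\<bar> ^ 6))"
          using x X(1) by (intro member_le_sum) auto
        finally show ?thesis .
      qed simp
    qed
    also have "\<dots> = (\<Sum>x\<in>X. \<integral>\<^sup>+y. ennreal (indicator (U \<inter> ball x (r x)) y * \<bar>f y\<bar> ^ 6) \<partial>lborel)"
    proof (rule nn_integral_sum)
      fix x
      have "U \<inter> ball x (r x) \<in> sets borel" using U(1) by (intro borel_open) auto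
      then show "(\<lambda>y. ennreal (indicator (U \<inter> ball x (r x)) y * \<bar>f y\<bar> ^ 6)) \<in> borel_measurable lborel"
        using fm(1)
        by (intro measurable_compose[OF _ measurable_ennreal] borel_measurable_times
            borel_measurable_indicator borel_measurable_power borel_measurable_abs) simp_all
    qed
    also have "\<dots> \<le> (\<Sum>x\<in>X. ennreal (sqrt (C x) * sqrt (J ^ 3)))"
      by (intro sum_mono loc)
    also have "\<dots> = ennreal (A * sqrt (J ^ 3))"
      using X rC(2) J(2) by (subst sum_ennreal) (auto simp: A_def sum_distrib_right)
    finally have IA: "I \<le> A * sqrt (J ^ 3)" using A J(2) by simp
    have I4: "I ^ 4 \<le> A ^ 4 * (J\<^sup>2) ^ 3"
    proof -
      have "I\<^sup>2 \<le> (A * sqrt (J ^ 3))\<^sup>2" using IA I(2) by (rule power_mono)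
      also have "\<dots> = A\<^sup>2 * J ^ 3" using J(2) by (simp add: power_mult_distrib)
      finally have "(I\<^sup>2)\<^sup>2 \<le> (A\<^sup>2 * J ^ 3)\<^sup>2" using I(2) by (intro power_mono) auto
      then show ?thesis by (simp add: power_mult_distrib power_mult[symmetric] mult.commute)
    qed
    also have "A ^ 4 * (J\<^sup>2) ^ 3 \<le> A ^ 4 * (I * (6 * (H1_norm U f)\<^sup>2)) ^ 3"
      using A J2' by (intro mult_left_mono power_mono) auto
    also have "\<dots> = I ^ 3 * (A ^ 4 * 6 ^ 3 * (H1_norm U f) ^ 6)"
      by (simp add: power_mult_distrib power_mult[symmetric])
    finally have "I ^ 3 * I \<le> I ^ 3 * (A ^ 4 * 6 ^ 3 * (H1_norm U f) ^ 6)" by (simp add: numeral_eq_Suc)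
    then have "I \<le> A ^ 4 * 6 ^ 3 * (H1_norm U f) ^ 6"
      using I(2) A by (cases "I = 0") (auto simp: H1_norm_bounds(4))
    then show "(\<integral>\<^sup>+y. ennreal (\<bar>f y\<bar> ^ 6) \<partial>?N) \<le> ennreal (A ^ 4 * 6 ^ 3 * (H1_norm U f) ^ 6)"
      unfolding I(1) by (rule ennreal_leI)
  qed
qed

subsection \<open>The flat part of the boundary\<close>

text \<open>An isometry preserves distances to the image of the origin and hence, by polarisation,
  inner products; the defect of linearity then has norm 0. Surjectivity is not at hand, since the
  target has larger dimension.\<close>

lemma chart_affine:
  fixes j :: "real^2 \<Rightarrow> real^3"
  assumes iso: "\<And>x y. dist (j x) (j y) = dist x y"
  obtains b1 b2 where "\<And>z. j z = j 0 + z$1 *\<^sub>R b1 + z$2 *\<^sub>R b2"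
    "\<And>a b. a *\<^sub>R b1 + b *\<^sub>R b2 = 0 \<Longrightarrow> a = 0 \<and> b = 0"
proof -
  define A where "A = (\<lambda>z. j z - j 0)"
  have d: "norm (A x - A y) = norm (x - y)" "norm (A x) = norm x" for x y
    using iso[of x y] iso[of x 0] by (simp_all add: A_def dist_norm)
  have ip: "A x \<bullet> A y = x \<bullet> y" for x y
    by (simp add: dot_norm_neg d)
  have "linear A"
  proof (rule linearI)
    fix x y and c :: real
    have "(A (x + y) - A x - A y) \<bullet> (A (x + y) - A x - A y) = 0"
      by (simp add: inner_diff_left inner_diff_right ip inner_add_left inner_add_right inner_commute)
    then have "A (x + y) - A x - A y = 0" by (simp only: inner_eq_zero_iff)
    then show "A (x + y) = A x + A y" by (simp add: algebra_simps)
    have "(A (c *\<^sub>R x) - c *\<^sub>R A x) \<bullet> (A (c *\<^sub>R x) - c *\<^sub>R A x) = 0"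
      by (simp add: inner_diff_left inner_diff_right ip inner_commute)
    then have "A (c *\<^sub>R x) - c *\<^sub>R A x = 0" by (simp only: inner_eq_zero_iff)
    then show "A (c *\<^sub>R x) = c *\<^sub>R A x" by simp
  qed
  then interpret A: linear A .
  have eq: "A z = z$1 *\<^sub>R A (axis 1 1) + z$2 *\<^sub>R A (axis 2 1)" for z
  proof -
    have "z = z$1 *\<^sub>R axis 1 1 + z$2 *\<^sub>R axis 2 1" by (simp add: vec_eq_iff forall_2 axis_def)
    then show ?thesis by (metis A.add A.scaleR)
  qed
  show thesis
  proof (rule that[of "A (axis 1 1)" "A (axis 2 1)"])
    show "j z = j 0 + z$1 *\<^sub>R A (axis 1 1) + z$2 *\<^sub>R A (axis 2 1)" for z
      using eq[of z] by (simp add: A_def algebra_simps)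
    fix a b assume "a *\<^sub>R A (axis 1 1) + b *\<^sub>R A (axis 2 1) = 0"
    then have "A (vector [a, b]) = 0" using eq[of "vector [a, b]"] by simp
    moreover have "norm (A (vector [a, b])) = norm (vector [a, b] :: real^2)"
      using iso[of "vector [a, b]" 0] by (simp add: A_def dist_norm)
    ultimately have "(vector [a, b] :: real^2) = 0" by simp
    then show "a = 0 \<and> b = 0" by (simp add: vec_eq_iff forall_2)
  qed
qed

text \<open>Two vectors span at most a plane in three dimensions; if \<open>e\<close> happens to lie
  in their span, a small multiple of a vector outside moves it off.\<close>

lemma transversal_direction:
  fixes b1 b2 e :: "real^3"
  assumes "0 < \<kappa>" and ind: "\<And>a b. a *\<^sub>R b1 + b *\<^sub>R b2 = 0 \<Longrightarrow> a = 0 \<and> b = 0"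
  obtains e' where "e' \<in> ball e \<kappa>" "\<And>a b c. a *\<^sub>R b1 + b *\<^sub>R b2 + c *\<^sub>R e' = 0 \<Longrightarrow> a = 0 \<and> b = 0 \<and> c = 0"
proof -
  have "dim (span {b1, b2}) \<le> card {b1, b2}" by (simp add: dim_le_card')
  also have "\<dots> \<le> 2" by (simp add: card_insert_if)
  finally have "dim (span {b1, b2}) < dim (UNIV :: (real^3) set)" by simp
  then obtain v where v: "v \<notin> span {b1, b2}" by (metis UNIV_eq_I less_irrefl dim_span)
  obtain e' where e': "e' \<in> ball e \<kappa>" "e' \<notin> span {b1, b2}"
  proof (cases "e \<in> span {b1, b2}")
    case True
    define t where "t = \<kappa> / (2 * (norm v + 1))"
    have "norm v + 1 > 0" by (simp add: add_nonneg_pos)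
    then have t: "0 < t" "t * norm v < \<kappa>" using assms(1) by (auto simp: t_def field_simps add_strict_increasing)
    have "e + t *\<^sub>R v \<notin> span {b1, b2}"
    proof
      assume "e + t *\<^sub>R v \<in> span {b1, b2}"
      from span_diff[OF this True] have "t *\<^sub>R v \<in> span {b1, b2}" by simp
      from span_scale[OF this, of "1 / t"] t v show False by simp
    qed
    with t show thesis by (intro that[of "e + t *\<^sub>R v"]) (auto simp: dist_norm)
  next
    case False
    then show thesis using assms(1) by (intro that[of e]) auto
  qed
  show thesis
  proof (rule that[OF e'(1)])
    fix a b c assume z: "a *\<^sub>R b1 + b *\<^sub>R b2 + c *\<^sub>R e' = 0"
    have "c = 0"
    proof (rule ccontr)
      assume c: "c \<noteq> 0"
      have ce: "c *\<^sub>R e' = - (a *\<^sub>R b1 + b *\<^sub>R b2)" using z by (simp add: eq_neg_iff_add_eq_0 algebra_simps)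
      have "e' = (1 / c) *\<^sub>R (c *\<^sub>R e')" using c by simp
      also have "\<dots> = (1 / c) *\<^sub>R (- (a *\<^sub>R b1 + b *\<^sub>R b2))" by (simp only: ce)
      also have "\<dots> \<in> span {b1, b2}"
        by (intro span_scale span_neg span_add) (auto intro: span_base)
      finally show False using e' by blast
    qed
    with z ind[of a b] show "a = 0 \<and> b = 0 \<and> c = 0" by simp
  qed
qed

text \<open>The two chart directions and a transversal inward direction form a coordinate system in
  which the ray parameter is the third coordinate. The rays start on the flat boundary, so
  integrating the ray estimate with \<open>n = 1\<close> over the plane sweeps out a part of
  \<open>U\<close>.\<close>

lemma local_trace:
  fixes U :: "(real^3) set" and G :: "(real^2) set"
  assumes U: "open U" "bounded U" and G: "open G" "\<And>z. z \<in> G \<Longrightarrow> j z \<in> closure U"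
    and iso: "\<And>x y. dist (j x) (j y) = dist x y"
    and cone: "inward_cone U x r s0 e \<kappa>"
  obtains C where "0 \<le> C" "\<And>f. smooth_on UNIV f \<Longrightarrow>
    (\<integral>\<^sup>+z. ennreal (indicator (G \<inter> j -` ball x r) z * (f (j z))\<^sup>2) \<partial>lborel)
      \<le> ennreal C * (\<integral>\<^sup>+y. ennreal (indicator U y * Qn 1 f y) \<partial>lborel)"
proof -
  from cone have c: "0 < r" "0 < s0" "0 < \<kappa>"
    "\<And>y e' s. y \<in> closure U \<Longrightarrow> y \<in> ball x r \<Longrightarrow> e' \<in> ball e \<kappa> \<Longrightarrow> s \<in> {0<..s0} \<Longrightarrow> y + s *\<^sub>R e' \<in> U"
    unfolding inward_cone_def by blast+
  obtain b1 b2 where b: "\<And>z. j z = j 0 + z$1 *\<^sub>R b1 + z$2 *\<^sub>R b2"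
    and ind2: "\<And>a b. a *\<^sub>R b1 + b *\<^sub>R b2 = 0 \<Longrightarrow> a = 0 \<and> b = 0"
    using chart_affine[OF iso] by metis
  obtain e' where e': "e' \<in> ball e \<kappa>"
    and ind: "\<And>a b c. a *\<^sub>R b1 + b *\<^sub>R b2 + c *\<^sub>R e' = 0 \<Longrightarrow> a = 0 \<and> b = 0 \<and> c = 0"
    using transversal_direction[OF c(3) ind2] by metis
  obtain k where k: "0 < k" "\<And>f p. f \<in> borel_measurable borel \<Longrightarrow> (\<integral>\<^sup>+x. f x \<partial>lborel)
       = ennreal k * (\<integral>\<^sup>+a. \<integral>\<^sup>+b. \<integral>\<^sup>+c. f (p + a *\<^sub>R b1 + b *\<^sub>R b2 + c *\<^sub>R e') \<partial>lborel \<partial>lborel \<partial>lborel)"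
    using affine_coordinates3[OF ind] by metis
  define K where "K = 1 / s0 + real (Suc 1) * norm e'"
  have K: "0 < K" using c(2) by (auto simp: K_def add_pos_nonneg)
  have jm [measurable]: "j \<in> borel_measurable borel"
    by (subst b[abs_def]) measurable
  show thesis
  proof (rule that[of "K / k"])
    show "0 \<le> K / k" using K k by simp
    fix f :: "real^3 \<Rightarrow> real" assume f: "smooth_on UNIV f"
    have fm [measurable]: "f \<in> borel_measurable borel" "Qn 1 f \<in> borel_measurable borel"
      using smooth_measurable[OF f] Qn_measurable[OF f] by auto
    have Ub [measurable]: "U \<in> sets borel" using U(1) by simp
    let ?q = "\<lambda>y. ennreal (indicator U y * (K * Qn 1 f y))"
    have qm [measurable]: "?q \<in> borel_measurable borel" by measurable
    have "(\<integral>\<^sup>+z. ennreal (indicator (G \<inter> j -` ball x r) z * (f (j z))\<^sup>2) \<partial>lborel)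
       \<le> (\<integral>\<^sup>+z. \<integral>\<^sup>+s. ?q (j z + s *\<^sub>R e') \<partial>lborel \<partial>lborel)"
    proof (rule nn_integral_mono)
      fix z :: "real^2"
      show "ennreal (indicator (G \<inter> j -` ball x r) z * (f (j z))\<^sup>2) \<le> (\<integral>\<^sup>+s. ?q (j z + s *\<^sub>R e') \<partial>lborel)"
      proof (cases "z \<in> G \<inter> j -` ball x r")
        case True
        then have "ennreal (indicator (G \<inter> j -` ball x r) z * (f (j z))\<^sup>2) = ennreal (\<bar>f (j z)\<bar> ^ Suc 1)"
          by (simp add: power2_eq_square)
        also have "\<dots> \<le> (\<integral>\<^sup>+s. ?q (j z + s *\<^sub>R e') \<partial>lborel)"
          unfolding Qn_def
        proof (rule ray_bound[OF f c(2)])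
          show "1 / s0 + real (Suc 1) * norm e' \<le> K" by (simp add: K_def)
          fix s assume "s \<in> {0<..s0}"
          then show "j z + s *\<^sub>R e' \<in> U" using True G(2)[of z] e' by (intro c(4)) auto
        qed
        finally show ?thesis .
      qed simp
    qed
    also have "\<dots> = (\<integral>\<^sup>+a. \<integral>\<^sup>+b. \<integral>\<^sup>+s. ?q (j (vector [a, b]) + s *\<^sub>R e') \<partial>lborel \<partial>lborel \<partial>lborel)"
      by (rule nn_integral_vec2) measurable
    also have "\<dots> = (\<integral>\<^sup>+a. \<integral>\<^sup>+b. \<integral>\<^sup>+s. ?q (j 0 + a *\<^sub>R b1 + b *\<^sub>R b2 + s *\<^sub>R e') \<partial>lborel \<partial>lborel \<partial>lborel)"
    proof -
      have "j (vector [a, b]) = j 0 + a *\<^sub>R b1 + b *\<^sub>R b2" for a b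
        using b[of "vector [a, b]"] by simp
      then show ?thesis by (simp only:)
    qed
    also have "\<dots> = ennreal (1 / k) * (\<integral>\<^sup>+y. ?q y \<partial>lborel)"
      using k(1) by (subst k(2)[OF qm, of "j 0"]) (simp add: mult.assoc[symmetric] ennreal_mult[symmetric])
    also have "(\<integral>\<^sup>+y. ?q y \<partial>lborel) = (\<integral>\<^sup>+y. ennreal K * ennreal (indicator U y * Qn 1 f y) \<partial>lborel)"
      using K by (intro nn_integral_cong) (simp add: ennreal_mult[symmetric] algebra_simps)
    also have "\<dots> = ennreal K * (\<integral>\<^sup>+y. ennreal (indicator U y * Qn 1 f y) \<partial>lborel)"
      by (rule nn_integral_cmult) measurable
    also have "ennreal (1 / k) * (ennreal K * (\<integral>\<^sup>+y. ennreal (indicator U y * Qn 1 f y) \<partial>lborel))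
      = ennreal (K / k) * (\<integral>\<^sup>+y. ennreal (indicator U y * Qn 1 f y) \<partial>lborel)"
      using k(1) K by (simp add: mult.assoc[symmetric] ennreal_mult[symmetric])
    finally show "(\<integral>\<^sup>+z. ennreal (indicator (G \<inter> j -` ball x r) z * (f (j z))\<^sup>2) \<partial>lborel)
      \<le> ennreal (K / k) * (\<integral>\<^sup>+y. ennreal (indicator U y * Qn 1 f y) \<partial>lborel)" .
  qed
qed

text \<open>The right side is a product of the \<open>L2\<close> and the \<open>H1\<close> norm
  rather than a squared \<open>H1\<close> norm: a function small in \<open>L2\<close> and bounded in
  \<open>H1\<close> has a small trace. This is what controls the increment of the trace in
  time.\<close>

lemma trace_smooth:
  fixes U :: "(real^3) set" and G :: "(real^2) set"
  assumes U: "open U" "bounded U" "smooth_boundary U" and G: "open G" "\<And>z. z \<in> G \<Longrightarrow> j z \<in> closure U"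
    and iso: "\<And>x y. dist (j x) (j y) = dist x y"
  obtains C where "0 \<le> C" "\<And>f. smooth_on UNIV f \<Longrightarrow>
    (\<integral>\<^sup>+z. ennreal ((f (j z))\<^sup>2) \<partial>lebesgue_on G) \<le> ennreal (C * (Lp_norm 2 (lebesgue_on U) f * H1_norm U f))"
proof -
  define P where "P x r C \<longleftrightarrow> (\<forall>f. smooth_on UNIV f \<longrightarrow>
      (\<integral>\<^sup>+z. ennreal (indicator (G \<inter> j -` ball x r) z * (f (j z))\<^sup>2) \<partial>lborel)
      \<le> ennreal C * (\<integral>\<^sup>+y. ennreal (indicator U y * Qn 1 f y) \<partial>lborel))" for x r C
  have "\<exists>r C. 0 < r \<and> 0 \<le> C \<and> P x r C" if x: "x \<in> closure U" for x
  proof -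
    from inward_cone_exists[OF U(1,3) x] obtain r s0 e \<kappa> where c: "inward_cone U x r s0 e \<kappa>" by blast
    then have r: "0 < r" by (simp add: inward_cone_def)
    show ?thesis
    proof (rule local_trace[OF U(1,2) G iso c])
      fix C assume "0 \<le> C" and *: "\<And>f. smooth_on UNIV f \<Longrightarrow>
        (\<integral>\<^sup>+z. ennreal (indicator (G \<inter> j -` ball x r) z * (f (j z))\<^sup>2) \<partial>lborel)
        \<le> ennreal C * (\<integral>\<^sup>+y. ennreal (indicator U y * Qn 1 f y) \<partial>lborel)"
      moreover have "P x r C" unfolding P_def using * by blast
      ultimately show ?thesis using r by blast
    qed
  qed
  then obtain r C where rC: "\<And>x. x \<in> closure U \<Longrightarrow> 0 < r x" "\<And>x. x \<in> closure U \<Longrightarrow> 0 \<le> C x"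
    "\<And>x. x \<in> closure U \<Longrightarrow> P x (r x) (C x)" by metis
  obtain X where X: "finite X" "X \<subseteq> closure U" "closure U \<subseteq> (\<Union>x\<in>X. ball x (r x))"
    by (rule closure_cover[where r=r, OF U(2) rC(1)])
  define A where "A = (\<Sum>x\<in>X. C x)"
  have A: "0 \<le> A" unfolding A_def using X rC(2) by (intro sum_nonneg) auto
  have jc: "continuous_on UNIV j"
    by (rule lipschitz_on_continuous_on[where L=1], rule lipschitz_onI) (auto simp: iso)
  have jm: "j \<in> borel_measurable borel" using jc by (rule borel_measurable_continuous_onI)
  show thesis
  proof (rule that[of "A * sqrt 6"])
    show "0 \<le> A * sqrt 6" using A by simp
    fix f :: "real^3 \<Rightarrow> real" assume f: "smooth_on UNIV f"
    let ?N = "lebesgue_on U" and ?H = "H1_norm U f"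
    have fm: "f \<in> borel_measurable borel" using smooth_measurable[OF f] .
    have fjm: "(\<lambda>z. (f (j z))\<^sup>2) \<in> borel_measurable borel" using measurable_compose[OF jm fm] by simp
    have fL: "f \<in> Lp 2 ?N" using H1_Lp_2[OF smooth_H1[OF U(1,2) f]] .
    have Jl: "(\<integral>\<^sup>+y. ennreal (Qn 1 f y) \<partial>?N) = (\<integral>\<^sup>+y. ennreal (indicator U y * Qn 1 f y) \<partial>lborel)"
      using lebesgue_on_nn[of U "\<lambda>y. ennreal (Qn 1 f y)"] U(1) Qn_measurable[OF f, of 1]
      by (simp add: ennreal_mult' ennreal_indicator)
    have J2: "(\<integral>\<^sup>+y. ennreal (Qn 1 f y) \<partial>?N)\<^sup>2 \<le> ennreal ((Lp_norm 2 ?N f)\<^sup>2 * (6 * ?H\<^sup>2))"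
      using Qn_Cauchy_Schwarz[OF U(1,2) f, of 1] L2_norm_nn[OF fL] by (simp add: ennreal_mult)
    have "(\<integral>\<^sup>+y. ennreal (Qn 1 f y) \<partial>?N) \<noteq> top"
    proof
      assume "(\<integral>\<^sup>+y. ennreal (Qn 1 f y) \<partial>?N) = top"
      with J2 show False by (simp add: power2_eq_square top_unique)
    qed
    then obtain J where J: "(\<integral>\<^sup>+y. ennreal (Qn 1 f y) \<partial>?N) = ennreal J" "0 \<le> J"
      by (cases "\<integral>\<^sup>+y. ennreal (Qn 1 f y) \<partial>?N") auto
    have "ennreal (J\<^sup>2) \<le> ennreal ((Lp_norm 2 ?N f)\<^sup>2 * (6 * ?H\<^sup>2))"
      using J2 unfolding J(1) by (simp only: ennreal_power J(2))
    then have "J\<^sup>2 \<le> (Lp_norm 2 ?N f)\<^sup>2 * (6 * ?H\<^sup>2)" by (subst (asm) ennreal_le_iff) auto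
    then have "J\<^sup>2 \<le> (sqrt 6 * (Lp_norm 2 ?N f * ?H))\<^sup>2" by (simp add: power_mult_distrib mult_ac)
    then have J': "J \<le> sqrt 6 * (Lp_norm 2 ?N f * ?H)"
      by (rule power2_le_imp_le) (simp add: H1_norm_bounds(4))
    have "(\<integral>\<^sup>+z. ennreal ((f (j z))\<^sup>2) \<partial>lebesgue_on G) = (\<integral>\<^sup>+z. ennreal (indicator G z * (f (j z))\<^sup>2) \<partial>lborel)"
      using lebesgue_on_nn[of G "\<lambda>z. ennreal ((f (j z))\<^sup>2)"] G(1) fjm by (simp add: ennreal_mult' ennreal_indicator)
    also have "\<dots> \<le> (\<integral>\<^sup>+z. (\<Sum>x\<in>X. ennreal (indicator (G \<inter> j -` ball x (r x)) z * (f (j z))\<^sup>2)) \<partial>lborel)"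
    proof (intro nn_integral_mono)
      fix z
      show "ennreal (indicator G z * (f (j z))\<^sup>2) \<le> (\<Sum>x\<in>X. ennreal (indicator (G \<inter> j -` ball x (r x)) z * (f (j z))\<^sup>2))"
      proof (cases "z \<in> G")
        case True
        then obtain x where x: "x \<in> X" "j z \<in> ball x (r x)" using X(3) G(2) by blast
        then have "ennreal (indicator G z * (f (j z))\<^sup>2) = ennreal (indicator (G \<inter> j -` ball x (r x)) z * (f (j z))\<^sup>2)"
          using True by simp
        also have "\<dots> \<le> (\<Sum>x\<in>X. ennreal (indicator (G \<inter> j -` ball x (r x)) z * (f (j z))\<^sup>2))"
          using x X(1) by (intro member_le_sum) auto
        finally show ?thesis .
      qed simp
    qed
    also have "\<dots> = (\<Sum>x\<in>X. \<integral>\<^sup>+z. ennreal (indicator (G \<inter> j -` ball x (r x)) z * (f (j z))\<^sup>2) \<partial>lborel)"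
    proof (rule nn_integral_sum)
      fix x
      have "G \<inter> j -` ball x (r x) \<in> sets borel"
        using G(1) jc by (intro borel_open open_Int open_vimage) auto
      then show "(\<lambda>z. ennreal (indicator (G \<inter> j -` ball x (r x)) z * (f (j z))\<^sup>2)) \<in> borel_measurable lborel"
        using fjm
        by (intro measurable_compose[OF _ measurable_ennreal] borel_measurable_times
            borel_measurable_indicator) simp_all
    qed
    also have "\<dots> \<le> (\<Sum>x\<in>X. ennreal (C x * J))"
    proof (rule sum_mono)
      fix x assume "x \<in> X"
      then have x: "x \<in> closure U" using X by blast
      have "(\<integral>\<^sup>+z. ennreal (indicator (G \<inter> j -` ball x (r x)) z * (f (j z))\<^sup>2) \<partial>lborel)
        \<le> ennreal (C x) * (\<integral>\<^sup>+y. ennreal (indicator U y * Qn 1 f y) \<partial>lborel)"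
        using rC(3)[OF x] f unfolding P_def by blast
      then show "(\<integral>\<^sup>+z. ennreal (indicator (G \<inter> j -` ball x (r x)) z * (f (j z))\<^sup>2) \<partial>lborel) \<le> ennreal (C x * J)"
        unfolding Jl[symmetric] J(1) using rC(2)[OF x] J(2) by (simp only: ennreal_mult)
    qed
    also have "\<dots> = ennreal (A * J)"
      using X rC(2) J(2) by (subst sum_ennreal) (auto simp: A_def sum_distrib_right)
    also have "\<dots> \<le> ennreal (A * sqrt 6 * (Lp_norm 2 ?N f * ?H))"
      using J' A by (intro ennreal_leI) (simp add: mult.assoc mult_left_mono)
    finally show "(\<integral>\<^sup>+z. ennreal ((f (j z))\<^sup>2) \<partial>lebesgue_on G) \<le> ennreal (A * sqrt 6 * (Lp_norm 2 ?N f * ?H))" .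
  qed
qed

text \<open>\<open>\<Gamma>\<close> is open relative to the boundary; openness in the plane has to
  be derived. For \<open>p\<close> in the plane near a point of \<open>\<Gamma>\<close>, a short
  transversal segment through \<open>p\<close> has one end inside \<open>U\<close> and the other
  outside, so it meets the boundary. There the boundary belongs to \<open>\<Gamma>\<close> and thus
  to the plane, and by transversality the meeting point is \<open>p\<close>.\<close>

lemma flat_boundary_open:
  fixes U \<Gamma> :: "(real^3) set" and j :: "real^2 \<Rightarrow> real^3"
  assumes U: "open U" "smooth_boundary U" and iso: "\<And>x y. dist (j x) (j y) = dist x y"
    and \<Gamma>: "openin (top_of_set (frontier U)) \<Gamma>" "\<Gamma> \<subseteq> range j"
  shows "open (j -` \<Gamma>)"
proof (subst open_contains_ball, intro ballI)
  fix z0 assume "z0 \<in> j -` \<Gamma>"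
  then have x0: "j z0 \<in> \<Gamma>" by simp
  from \<Gamma>(1) obtain T where T: "open T" "\<Gamma> = frontier U \<inter> T" unfolding openin_open by blast
  obtain \<epsilon> where \<epsilon>: "0 < \<epsilon>" "ball (j z0) \<epsilon> \<subseteq> T" using T x0 open_contains_ball by blast
  have x0f: "j z0 \<in> closure U" "j z0 \<notin> U" using x0 T U(1) by (auto simp: frontier_def interior_open)
  obtain r s0 e \<kappa> where cone: "inward_cone U (j z0) r s0 e \<kappa>" using inward_cone_exists[OF U x0f(1)] by blast
  then have c: "0 < r" "0 < s0" "0 < \<kappa>"
    "\<And>y e' s. y \<in> closure U \<Longrightarrow> y \<in> ball (j z0) r \<Longrightarrow> e' \<in> ball e \<kappa> \<Longrightarrow> s \<in> {0<..s0} \<Longrightarrow> y + s *\<^sub>R e' \<in> U"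
    unfolding inward_cone_def by blast+
  obtain b1 b2 where b: "\<And>z. j z = j 0 + z$1 *\<^sub>R b1 + z$2 *\<^sub>R b2"
    and ind2: "\<And>a b. a *\<^sub>R b1 + b *\<^sub>R b2 = 0 \<Longrightarrow> a = 0 \<and> b = 0"
    using chart_affine[OF iso] by metis
  obtain e' where e': "e' \<in> ball e \<kappa>"
    and ind: "\<And>a b c. a *\<^sub>R b1 + b *\<^sub>R b2 + c *\<^sub>R e' = 0 \<Longrightarrow> a = 0 \<and> b = 0 \<and> c = 0"
    using transversal_direction[OF c(3) ind2] by metis
  define \<kappa>' where "\<kappa>' = \<kappa> - dist e e'"
  have \<kappa>': "0 < \<kappa>'" "\<And>v. norm v < \<kappa>' \<Longrightarrow> e' + v \<in> ball e \<kappa>"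
  proof -
    show "0 < \<kappa>'" using e' by (simp add: \<kappa>'_def)
    fix v :: "real^3" assume "norm v < \<kappa>'"
    then show "e' + v \<in> ball e \<kappa>"
      using dist_triangle[of e "e' + v" e'] by (simp add: \<kappa>'_def dist_norm)
  qed
  \<comment> \<open>Half the length of the transversal segment: short enough for the cone and for
    both neighbourhoods of \<open>j z0\<close>.\<close>
  define m where "m = min s0 (min (r / 2) (\<epsilon> / 2) / (norm e' + 1))"
  have n1: "0 < norm e' + 1" by (simp add: add_nonneg_pos)
  have m: "0 < m" "m \<le> s0" "m * norm e' \<le> r / 2" "m * norm e' \<le> \<epsilon> / 2"
  proof -
    show "0 < m" "m \<le> s0" using c \<epsilon> n1 by (auto simp: m_def)
    have "m * norm e' \<le> m * (norm e' + 1)" using \<open>0 < m\<close> by simp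
    also have "\<dots> \<le> min (r / 2) (\<epsilon> / 2)"
    proof -
      have "m \<le> min (r / 2) (\<epsilon> / 2) / (norm e' + 1)" unfolding m_def by (rule min.cobounded2)
      then show ?thesis using n1 pos_le_divide_eq by blast
    qed
    finally show "m * norm e' \<le> r / 2" "m * norm e' \<le> \<epsilon> / 2" by auto
  qed
  \<comment> \<open>The bound \<open>m * \<kappa>'\<close> lets the displacement from
    \<open>j z0\<close> to \<open>p\<close> be written as \<open>m\<close> times a vector short
    enough to be a perturbation of the direction \<open>e'\<close>.\<close>
  define \<rho> where "\<rho> = min (m * \<kappa>') (min (r / 2) (\<epsilon> / 2))"
  have \<rho>: "0 < \<rho>" using m \<kappa>' c \<epsilon> by (simp add: \<rho>_def)
  have "z \<in> j -` \<Gamma>" if z: "z \<in> ball z0 \<rho>" for z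
  proof -
    define p where "p = j z"
    have d: "dist (j z0) p < \<rho>" using z iso by (simp add: p_def)
    have near: "p + t *\<^sub>R e' \<in> ball (j z0) r" "p + t *\<^sub>R e' \<in> ball (j z0) \<epsilon>" if "\<bar>t\<bar> \<le> m" for t
    proof -
      have "\<bar>t\<bar> * norm e' \<le> m * norm e'" using that by (intro mult_right_mono) auto
      then have "norm (t *\<^sub>R e') \<le> r / 2" "norm (t *\<^sub>R e') \<le> \<epsilon> / 2" using m by auto
      moreover have "dist (j z0) (p + t *\<^sub>R e') \<le> dist (j z0) p + norm (t *\<^sub>R e')"
        using dist_triangle[of "j z0" "p + t *\<^sub>R e'" p] by (simp add: dist_norm)
      ultimately show "p + t *\<^sub>R e' \<in> ball (j z0) r" "p + t *\<^sub>R e' \<in> ball (j z0) \<epsilon>"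
        using d by (auto simp: \<rho>_def)
    qed
    define v where "v = (1 / m) *\<^sub>R (p - j z0)"
    have v: "m *\<^sub>R v = p - j z0" "norm v < \<kappa>'"
    proof -
      show "m *\<^sub>R v = p - j z0" using m by (simp add: v_def)
      have "norm (p - j z0) < m * \<kappa>'" using d by (simp add: \<rho>_def dist_norm norm_minus_commute)
      moreover have "norm v = norm (p - j z0) / m" using m(1) unfolding v_def norm_scaleR by simp
      ultimately show "norm v < \<kappa>'" using m(1) by (simp add: pos_divide_less_eq mult.commute)
    qed
    \<comment> \<open>The upper end is reached from \<open>j z0\<close> along the perturbed
      direction \<open>e' + v\<close>, which is still inward.\<close>
    have up: "p + m *\<^sub>R e' \<in> U"
    proof -
      have "j z0 + m *\<^sub>R (e' + v) \<in> U" using x0f c(1) m \<kappa>'(2)[OF v(2)] by (intro c(4)) auto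
      then show ?thesis using v(1) by (simp add: scaleR_add_right algebra_simps)
    qed
    \<comment> \<open>From a lower end in \<open>U\<close>, the inward direction
      \<open>e' - v\<close> would lead to \<open>j z0\<close>, which is a boundary point.\<close>
    have dn: "p - m *\<^sub>R e' \<notin> U"
    proof
      assume "p - m *\<^sub>R e' \<in> U"
      moreover have "p - m *\<^sub>R e' \<in> ball (j z0) r" using near(1)[of "- m"] m by simp
      moreover have "e' + (- v) \<in> ball e \<kappa>" using v(2) by (intro \<kappa>'(2)) simp
      ultimately have "(p - m *\<^sub>R e') + m *\<^sub>R (e' + (- v)) \<in> U" using m closure_subset by (intro c(4)) auto
      then have "j z0 \<in> U" using v(1) by (simp add: scaleR_diff_right)
      then show False using x0f by blast
    qed
    let ?S = "(\<lambda>t. p + t *\<^sub>R e') ` {-m..m}"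
    have "connected ?S" by (intro connected_continuous_image continuous_intros) auto
    moreover have "p + m *\<^sub>R e' \<in> ?S" using m(1) by (intro image_eqI[of _ _ m]) auto
    moreover have "p - m *\<^sub>R e' \<in> ?S" using m(1) by (intro image_eqI[of _ _ "- m"]) auto
    ultimately have "?S \<inter> frontier U \<noteq> {}"
      using up dn by (intro connected_Int_frontier) blast+
    then obtain t where t0: "t \<in> {-m..m}" "p + t *\<^sub>R e' \<in> frontier U" by blast
    then have t: "\<bar>t\<bar> \<le> m" "p + t *\<^sub>R e' \<in> frontier U" by auto
    with near(2) \<epsilon> T have "p + t *\<^sub>R e' \<in> \<Gamma>" by blast
    then obtain z' where z': "p + t *\<^sub>R e' = j z'" using \<Gamma>(2) by blast
    have "(z$1 - z'$1) *\<^sub>R b1 + (z$2 - z'$2) *\<^sub>R b2 + t *\<^sub>R e' = 0"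
      using z' b[of z] b[of z'] by (simp add: p_def algebra_simps)
    from ind[OF this] have "t = 0" by simp
    with \<open>p + t *\<^sub>R e' \<in> \<Gamma>\<close> show ?thesis by (simp add: p_def)
  qed
  then show "\<exists>\<rho>>0. ball z0 \<rho> \<subseteq> j -` \<Gamma>" using \<rho> by blast
qed

section \<open>Embeddings and traces in the Sobolev spaces\<close>

lemma grad_norm_AE_zero:
  assumes U: "open U" and u: "u \<in> borel_measurable (lebesgue_on U)" "AE x in lebesgue_on U. u x = 0"
  shows "u \<in> H1 U" "grad_norm U u = 0" "b \<in> Basis \<Longrightarrow> AE x in lebesgue_on U. weak_partial U b u x = 0"
proof -
  have "is_weak_partial U b (\<lambda>x. 0) (\<lambda>x. 0)" for b by (simp add: is_weak_partial_def)
  then have z: "(\<lambda>x. 0) \<in> H1 U" by (auto simp: H1_def)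
  have zu: "AE x in lebesgue_on U. 0 = u x" using u(2) by eventually_elim simp
  show uH: "u \<in> H1 U" using H1_AE_cong(1)[OF U z u(1) zu] .
  have w: "AE x in lebesgue_on U. weak_partial U b u x = 0" if b: "b \<in> Basis" for b
  proof -
    have "weak_partial U b (\<lambda>x. 0) = weak_partial U b u" using H1_AE_cong(2)[OF U z u(1) zu, of b] b by blast
    moreover have "AE x in lebesgue_on U. weak_partial U b (\<lambda>x. 0) x = 0"
      using weak_partial_diff[OF U z z b] by simp
    ultimately show ?thesis by simp
  qed
  then show "b \<in> Basis \<Longrightarrow> AE x in lebesgue_on U. weak_partial U b u x = 0" .
  have "(grad_norm U u)\<^sup>2 = 0"
    unfolding grad_norm_sq[OF uH] using w L2_norm_eq_0_iff[OF weak_partial_Lp_2[OF uH]] by (intro sum.neutral) auto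
  then show "grad_norm U u = 0" by simp
qed

lemma tendsto_0_le:
  fixes a b :: "nat \<Rightarrow> real"
  assumes "b \<longlonglongrightarrow> 0" "\<And>n. 0 \<le> a n" "\<And>n. a n \<le> b n" shows "a \<longlonglongrightarrow> 0"
  by (rule tendsto_sandwich[OF _ _ tendsto_const assms(1)]) (simp_all add: assms)

lemma H1_approx:
  assumes U: "open U" and u: "u \<in> H1 U" and f: "\<And>n. f n \<in> H1 U"
    and lim: "(\<lambda>n. H1_norm U (\<lambda>x. f n x - u x)) \<longlonglongrightarrow> 0"
  shows "(\<lambda>n. Lp_norm 2 (lebesgue_on U) (\<lambda>x. f n x - u x)) \<longlonglongrightarrow> 0"
    and "(\<lambda>n. Lp_norm 2 (lebesgue_on U) (f n)) \<longlonglongrightarrow> Lp_norm 2 (lebesgue_on U) u"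
    and "(\<lambda>n. grad_norm U (f n)) \<longlonglongrightarrow> grad_norm U u"
    and "(\<lambda>n. H1_norm U (f n)) \<longlonglongrightarrow> H1_norm U u"
proof -
  show 1: "(\<lambda>n. Lp_norm 2 (lebesgue_on U) (\<lambda>x. f n x - u x)) \<longlonglongrightarrow> 0"
    by (rule Lim_null_comparison[OF _ lim]) (auto simp: H1_norm_bounds(1))
  show 2: "(\<lambda>n. Lp_norm 2 (lebesgue_on U) (f n)) \<longlonglongrightarrow> Lp_norm 2 (lebesgue_on U) u"
    by (rule L2_norm_tendsto[OF H1_Lp_2[OF f] H1_Lp_2[OF u] 1])
  have "(\<lambda>n. grad_norm U (\<lambda>x. f n x - u x)) \<longlonglongrightarrow> 0"
    by (rule Lim_null_comparison[OF _ lim]) (auto simp: H1_norm_bounds(2))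
  then have "(\<lambda>n. grad_norm U (f n) - grad_norm U u) \<longlonglongrightarrow> 0"
    by (rule Lim_null_comparison[rotated]) (auto intro!: always_eventually grad_norm_reverse[OF U f u])
  then show 3: "(\<lambda>n. grad_norm U (f n)) \<longlonglongrightarrow> grad_norm U u" using Lim_null by blast
  show "(\<lambda>n. H1_norm U (f n)) \<longlonglongrightarrow> H1_norm U u"
    unfolding H1_norm_def by (intro tendsto_intros 2 3)
qed

text \<open>The factor 2 results from estimating the \<open>H1\<close> norm by the sum of the
  \<open>L2\<close> norm and the gradient norm; in the limits where this is applied it is
  harmless.\<close>

lemma H1_norm_diff_le:
  assumes "open U" "p \<in> H1 U" "q \<in> H1 U"
  shows "H1_norm U (\<lambda>x. p x - q x) \<le> 2 * (H1_norm U p + H1_norm U q)"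
proof -
  have "H1_norm U (\<lambda>x. p x - q x) \<le> (Lp_norm 2 (lebesgue_on U) p + Lp_norm 2 (lebesgue_on U) q)
      + (grad_norm U p + grad_norm U q)"
    by (rule order_trans[OF H1_norm_le_sum add_mono[OF L2_norm_diff grad_norm_triangle_diff]])
       (use assms H1_Lp_2 in auto)
  also have "\<dots> \<le> (H1_norm U p + H1_norm U q) + (H1_norm U p + H1_norm U q)"
    by (intro add_mono H1_norm_bounds)
  finally show ?thesis by simp
qed

text \<open>Approximability by smooth functions is an assumption, not a density theorem: elements of
  \<open>H1_Gamma0\<close> carry such a sequence in the definition of their trace on
  \<open>Gamma0\<close>.\<close>

lemma Sobolev_H1:
  fixes U :: "(real^3) set"
  assumes U: "open U" "bounded U" "smooth_boundary U"
  obtains C where "0 \<le> C" "\<And>u f. u \<in> H1 U \<Longrightarrow> (\<And>n. smooth_on UNIV (f n)) \<Longrightarrow>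
    (\<lambda>n. H1_norm U (\<lambda>x. f n x - u x)) \<longlonglongrightarrow> 0 \<Longrightarrow>
    (\<integral>\<^sup>+y. ennreal (\<bar>u y\<bar> ^ 6) \<partial>lebesgue_on U) \<le> ennreal (C * (H1_norm U u) ^ 6)"
proof -
  obtain C where C: "0 \<le> C" "\<And>f. smooth_on UNIV f \<Longrightarrow>
    (\<integral>\<^sup>+y. ennreal (\<bar>f y\<bar> ^ 6) \<partial>lebesgue_on U) \<le> ennreal (C * (H1_norm U f) ^ 6)"
    by (rule Sobolev_smooth[OF U]) blast
  show thesis
  proof (rule that[OF C(1)])
    fix u :: "real^3 \<Rightarrow> real" and f :: "nat \<Rightarrow> real^3 \<Rightarrow> real"
    assume u: "u \<in> H1 U" and f: "\<And>n. smooth_on UNIV (f n)"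
      and lim: "(\<lambda>n. H1_norm U (\<lambda>x. f n x - u x)) \<longlonglongrightarrow> 0"
    have fH: "f n \<in> H1 U" for n by (rule smooth_H1[OF U(1,2) f])
    note ap = H1_approx[OF U(1) u fH lim]
    obtain r where r: "strict_mono r" "AE x in lebesgue_on U. (\<lambda>n. f (r n) x) \<longlonglongrightarrow> u x"
      by (rule L2_AE_subseq[OF H1_Lp_2[OF fH] H1_Lp_2[OF u] ap(1)])
    show "(\<integral>\<^sup>+y. ennreal (\<bar>u y\<bar> ^ 6) \<partial>lebesgue_on U) \<le> ennreal (C * (H1_norm U u) ^ 6)"
    proof (rule Fatou_bound[where u="\<lambda>n. f (r n)" and G="\<lambda>s. \<bar>s\<bar> ^ 6" and v=u and C="\<lambda>n. C * (H1_norm U (f (r n))) ^ 6"])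
      show "f (r n) \<in> borel_measurable (lebesgue_on U)" for n by (rule Lp_measurable[OF H1_Lp_2[OF fH]])
      show "(\<integral>\<^sup>+x. ennreal (\<bar>f (r n) x\<bar> ^ 6) \<partial>lebesgue_on U) \<le> ennreal (C * H1_norm U (f (r n)) ^ 6)" for n
        by (rule C(2)[OF f])
      show "(\<lambda>n. C * H1_norm U (f (r n)) ^ 6) \<longlonglongrightarrow> C * H1_norm U u ^ 6"
        using LIMSEQ_subseq_LIMSEQ[OF ap(4) r(1)] by (intro tendsto_intros) (simp add: o_def)
      show "isCont (\<lambda>s::real. \<bar>s\<bar> ^ 6) x" for x by (intro continuous_intros)
    qed (use r in auto)
  qed
qed

lemma is_trace_diff:
  assumes U: "open U" "bounded U" and u: "u \<in> H1 U" "u' \<in> H1 U"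
    and t: "is_trace U N j u g" "is_trace U N j u' g'"
  shows "is_trace U N j (\<lambda>x. u x - u' x) (\<lambda>y. g y - g' y)"
proof -
  from t(1) obtain f where f: "\<And>n. smooth_on UNIV (f n)" "\<And>n. (\<lambda>y. f n (j y)) \<in> Lp 2 N"
    "(\<lambda>n. H1_norm U (\<lambda>x. f n x - u x)) \<longlonglongrightarrow> 0" "(\<lambda>n. Lp_norm 2 N (\<lambda>y. f n (j y) - g y)) \<longlonglongrightarrow> 0"
    unfolding is_trace_def by blast
  from t(2) obtain f' where f': "\<And>n. smooth_on UNIV (f' n)" "\<And>n. (\<lambda>y. f' n (j y)) \<in> Lp 2 N"
    "(\<lambda>n. H1_norm U (\<lambda>x. f' n x - u' x)) \<longlonglongrightarrow> 0" "(\<lambda>n. Lp_norm 2 N (\<lambda>y. f' n (j y) - g' y)) \<longlonglongrightarrow> 0"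
    unfolding is_trace_def by blast
  have g: "g \<in> Lp 2 N" "g' \<in> Lp 2 N" using t by (auto simp: is_trace_def)
  have fH: "f n \<in> H1 U" "f' n \<in> H1 U" for n using smooth_H1[OF U f(1)] smooth_H1[OF U f'(1)] by auto
  show ?thesis unfolding is_trace_def
  proof (intro conjI exI[of _ "\<lambda>n x. f n x - f' n x"] allI)
    show "(\<lambda>y. g y - g' y) \<in> Lp 2 N" using g by auto
    fix n
    show "smooth_on UNIV (\<lambda>x. f n x - f' n x)" using f f' by (intro smooth_on_diff) auto
    show "(\<lambda>y. f n (j y) - f' n (j y)) \<in> Lp 2 N" using f(2) f'(2) by auto
  next
    have e: "(\<lambda>x. f n x - f' n x - (u x - u' x)) = (\<lambda>x. (f n x - u x) - (f' n x - u' x))" for n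
      by (simp add: fun_eq_iff)
    have le: "H1_norm U (\<lambda>x. f n x - f' n x - (u x - u' x))
        \<le> 2 * (H1_norm U (\<lambda>x. f n x - u x) + H1_norm U (\<lambda>x. f' n x - u' x))" for n
    proof -
      have d: "(\<lambda>x. f n x - u x) \<in> H1 U" "(\<lambda>x. f' n x - u' x) \<in> H1 U" using H1_diff[OF U(1)] fH u by auto
      show ?thesis unfolding e by (rule H1_norm_diff_le[OF U(1) d])
    qed
    have "(\<lambda>n. 2 * (H1_norm U (\<lambda>x. f n x - u x) + H1_norm U (\<lambda>x. f' n x - u' x))) \<longlonglongrightarrow> 0"
      using tendsto_mult[OF tendsto_const tendsto_add[OF f(3) f'(3)], of 2] by simp
    then show "(\<lambda>n. H1_norm U (\<lambda>x. f n x - f' n x - (u x - u' x))) \<longlonglongrightarrow> 0"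
      by (rule tendsto_0_le[OF _ H1_norm_bounds(4) le])
    have e': "(\<lambda>y. f n (j y) - f' n (j y) - (g y - g' y)) = (\<lambda>y. (f n (j y) - g y) - (f' n (j y) - g' y))" for n
      by (simp add: fun_eq_iff)
    have "(\<lambda>n. Lp_norm 2 N (\<lambda>y. f n (j y) - g y) + Lp_norm 2 N (\<lambda>y. f' n (j y) - g' y)) \<longlonglongrightarrow> 0"
      using tendsto_add[OF f(4) f'(4)] by simp
    moreover have le': "Lp_norm 2 N (\<lambda>y. f n (j y) - f' n (j y) - (g y - g' y))
       \<le> Lp_norm 2 N (\<lambda>y. f n (j y) - g y) + Lp_norm 2 N (\<lambda>y. f' n (j y) - g' y)" for n
      unfolding e' using f(2) f'(2) g by (intro L2_norm_diff) auto
    ultimately have c: "(\<lambda>n. Lp_norm 2 N (\<lambda>y. f n (j y) - g y) + Lp_norm 2 N (\<lambda>y. f' n (j y) - g' y)) \<longlonglongrightarrow> 0"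
      by simp
    show "(\<lambda>n. Lp_norm 2 N (\<lambda>y. f n (j y) - f' n (j y) - (g y - g' y))) \<longlonglongrightarrow> 0"
      by (rule tendsto_0_le[OF c Lp_norm_nonneg le'])
  qed
qed

text \<open>The first claim passes to the limit in \<open>trace_smooth\<close>. The second is needed
  because \<open>Gamma_trace\<close> is chosen by \<open>SOME\<close>: restrictions of smooth
  approximants form a Cauchy sequence in \<open>L2\<close>, whose limit is a trace.\<close>

lemma trace_H1:
  fixes U :: "(real^3) set" and G :: "(real^2) set"
  assumes U: "open U" "bounded U" "smooth_boundary U" and G: "open G" "bounded G" "\<And>z. z \<in> G \<Longrightarrow> j z \<in> closure U"
    and iso: "\<And>x y. dist (j x) (j y) = dist x y"
  obtains C where "0 \<le> C"
    "\<And>u g. u \<in> H1 U \<Longrightarrow> is_trace U (lebesgue_on G) j u g \<Longrightarrow>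
      (Lp_norm 2 (lebesgue_on G) g)\<^sup>2 \<le> C * (Lp_norm 2 (lebesgue_on U) u * H1_norm U u)"
    "\<And>u f. u \<in> H1 U \<Longrightarrow> (\<And>n. smooth_on UNIV (f n)) \<Longrightarrow> (\<lambda>n::nat. H1_norm U (\<lambda>x. f n x - u x)) \<longlonglongrightarrow> 0 \<Longrightarrow>
      \<exists>g. is_trace U (lebesgue_on G) j u g"
proof -
  let ?N = "lebesgue_on G" and ?n = "Lp_norm 2 (lebesgue_on U)"
  obtain C where C: "0 \<le> C" "\<And>f. smooth_on UNIV f \<Longrightarrow>
    (\<integral>\<^sup>+z. ennreal ((f (j z))\<^sup>2) \<partial>?N) \<le> ennreal (C * (?n f * H1_norm U f))"
    by (rule trace_smooth[OF U G(1,3) iso]) blast+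
  have jc: "continuous_on UNIV j"
    by (rule lipschitz_on_continuous_on[where L=1], rule lipschitz_onI) (auto simp: iso)
  have fL: "(\<lambda>y. f (j y)) \<in> Lp 2 ?N" if "smooth_on UNIV f" for f
  proof (rule continuous_Lp_2[OF _ G(2)])
    show "continuous_on UNIV (\<lambda>y. f (j y))"
      using continuous_on_compose2[OF smooth_on_continuous[OF that] jc] by simp
  qed (use G in auto)
  have fb: "(Lp_norm 2 ?N (\<lambda>y. f (j y)))\<^sup>2 \<le> C * (?n f * H1_norm U f)" if "smooth_on UNIV f" for f
    using C(2)[OF that] C(1) L2_norm_nn[OF fL[OF that]]
    by (simp add: H1_norm_bounds(4))
  show thesis
  proof (rule that[OF C(1)])
    fix u g assume u: "u \<in> H1 U" and "is_trace U ?N j u g"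
    then obtain f where f: "\<And>n. smooth_on UNIV (f n)" "(\<lambda>n. H1_norm U (\<lambda>x. f n x - u x)) \<longlonglongrightarrow> 0"
      "(\<lambda>n. Lp_norm 2 ?N (\<lambda>y. f n (j y) - g y)) \<longlonglongrightarrow> 0" and g: "g \<in> Lp 2 ?N"
      unfolding is_trace_def by blast
    have fH: "f n \<in> H1 U" for n by (rule smooth_H1[OF U(1,2) f(1)])
    note ap = H1_approx[OF U(1) u fH f(2)]
    have 1: "(\<lambda>n. (Lp_norm 2 ?N (\<lambda>y. f n (j y)))\<^sup>2) \<longlonglongrightarrow> (Lp_norm 2 ?N g)\<^sup>2"
      by (intro tendsto_power L2_norm_tendsto[OF fL[OF f(1)] g f(3)])
    have 2: "(\<lambda>n. C * (?n (f n) * H1_norm U (f n))) \<longlonglongrightarrow> C * (?n u * H1_norm U u)"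
      by (intro tendsto_intros ap)
    show "(Lp_norm 2 ?N g)\<^sup>2 \<le> C * (?n u * H1_norm U u)"
      by (rule LIMSEQ_le[OF 1 2]) (use fb[OF f(1)] in auto)
  next
    fix u f assume u: "u \<in> H1 U" and f: "\<And>n. smooth_on UNIV (f n)"
      and lim: "(\<lambda>n::nat. H1_norm U (\<lambda>x. f n x - u x)) \<longlonglongrightarrow> 0"
    have fH: "f n \<in> H1 U" for n by (rule smooth_H1[OF U(1,2) f])
    have H: "H1_norm U (\<lambda>x. f n x - f k x) \<le> 2 * (H1_norm U (\<lambda>x. f n x - u x) + H1_norm U (\<lambda>x. f k x - u x))" for n k
    proof -
      have e: "(\<lambda>x. f n x - f k x) = (\<lambda>x. (f n x - u x) - (f k x - u x))" by (simp add: fun_eq_iff)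
      have d: "(\<lambda>x. f n x - u x) \<in> H1 U" "(\<lambda>x. f k x - u x) \<in> H1 U" using H1_diff[OF U(1) fH u] by auto
      show ?thesis unfolding e by (rule H1_norm_diff_le[OF U(1) d])
    qed
    have d: "Lp_norm 2 ?N (\<lambda>y. f n (j y) - f k (j y)) \<le> sqrt C * H1_norm U (\<lambda>x. f n x - f k x)" for n k
    proof -
      have s: "smooth_on UNIV (\<lambda>x. f n x - f k x)" by (intro smooth_on_diff f open_UNIV)
      have "(Lp_norm 2 ?N (\<lambda>y. f n (j y) - f k (j y)))\<^sup>2 \<le> C * (?n (\<lambda>x. f n x - f k x) * H1_norm U (\<lambda>x. f n x - f k x))"
        using fb[OF s] .
      also have "\<dots> \<le> C * (H1_norm U (\<lambda>x. f n x - f k x) * H1_norm U (\<lambda>x. f n x - f k x))"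
        using C(1) by (intro mult_left_mono mult_right_mono H1_norm_bounds) auto
      also have "\<dots> = (sqrt C * H1_norm U (\<lambda>x. f n x - f k x))\<^sup>2"
        using C(1) by (simp add: power_mult_distrib power2_eq_square)
      finally show ?thesis by (rule power2_le_imp_le) (simp add: C(1) H1_norm_bounds(4))
    qed
    have fin: "finite_measure ?N"
      using G(1,2) by (intro finite_measure_lebesgue_on bounded_set_imp_lmeasurable) auto
    obtain g where g: "g \<in> Lp 2 ?N" "(\<lambda>n. Lp_norm 2 ?N (\<lambda>y. f n (j y) - g y)) \<longlonglongrightarrow> 0"
    proof (rule finite_measure.L2_complete[OF fin, of "\<lambda>n y. f n (j y)"])
      show "(\<lambda>y. f n (j y)) \<in> Lp 2 ?N" for n by (rule fL[OF f])
      fix e :: real assume e: "0 < e"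
      define \<delta> where "\<delta> = e / (4 * (sqrt C + 1))"
      have sC: "0 < sqrt C + 1" using C(1) by (simp add: add_nonneg_pos)
      then have "0 < \<delta>" using e by (simp add: \<delta>_def)
      with lim obtain K where K: "\<And>n. n \<ge> K \<Longrightarrow> H1_norm U (\<lambda>x. f n x - u x) < \<delta>"
        using LIMSEQ_D[OF lim, of \<delta>] by (auto simp: H1_norm_bounds(4) abs_of_nonneg)
      show "\<exists>K. \<forall>i\<ge>K. \<forall>k\<ge>K. Lp_norm 2 ?N (\<lambda>x. f i (j x) - f k (j x)) < e"
      proof (intro exI allI impI)
        fix i k assume ik: "K \<le> i" "K \<le> k"
        have "2 * (H1_norm U (\<lambda>x. f i x - u x) + H1_norm U (\<lambda>x. f k x - u x)) < 2 * (\<delta> + \<delta>)"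
          by (intro mult_strict_left_mono add_strict_mono K ik) simp
        then have "H1_norm U (\<lambda>x. f i x - f k x) < 2 * (\<delta> + \<delta>)" by (rule le_less_trans[OF H])
        then have "H1_norm U (\<lambda>x. f i x - f k x) < 4 * \<delta>" by (rule less_le_trans) simp
        then have "sqrt C * H1_norm U (\<lambda>x. f i x - f k x) \<le> sqrt C * (4 * \<delta>)" using C(1) by (intro mult_left_mono) auto
        also have "\<dots> < (sqrt C + 1) * (4 * \<delta>)" using \<open>0 < \<delta>\<close> by simp
        also have "\<dots> = e"
        proof -
          have "x * (4 * (e / (4 * x))) = e" if "0 < x" for x :: real using that by simp
          from this[OF sC] show ?thesis by (simp only: \<delta>_def)
        qed
        finally show "Lp_norm 2 ?N (\<lambda>x. f i (j x) - f k (j x)) < e" by (rule le_less_trans[OF d])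
      qed
    qed blast
    then show "\<exists>g. is_trace U ?N j u g"
      unfolding is_trace_def using f lim fL[OF f] by blast
  qed
qed

text \<open>For \<open>t = |u| / l\<close> one has \<open>t^k <= 1 + t^n\<close>. Scaling by
  \<open>l\<close> before integrating keeps the right side homogeneous of degree \<open>k\<close> in
  \<open>l\<close>, as the quotients defining \<open>K1\<close> and \<open>K2\<close>
  demand.\<close>

lemma power_interp:
  assumes fin: "finite_measure N" and um: "u \<in> borel_measurable N"
    and M: "(\<integral>\<^sup>+x. ennreal (\<bar>u x\<bar> ^ n) \<partial>N) \<le> ennreal (A * l ^ n)" "0 \<le> A" "0 \<le> l"
    and k: "0 < k" "k \<le> real n" and n: "0 < n"
  shows "(\<integral>\<^sup>+x. ennreal (\<bar>u x\<bar> powr k) \<partial>N) \<le> ennreal ((measure N (space N) + A) * l powr k)"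
proof (cases "l = 0")
  case True
  then have "(\<integral>\<^sup>+x. ennreal (\<bar>u x\<bar> ^ n) \<partial>N) = 0" using M(1) n by (simp add: zero_power)
  then have "AE x in N. ennreal (\<bar>u x\<bar> ^ n) = 0" using um by (subst (asm) nn_integral_0_iff_AE) auto
  moreover have "a = 0" if "ennreal (\<bar>a\<bar> ^ n) = 0" for a :: real
    using that zero_less_power[of "\<bar>a\<bar>" n] by (force simp: ennreal_eq_0_iff not_le[symmetric])
  ultimately have "AE x in N. u x = 0" by (auto elim!: eventually_mono)
  then have "(\<integral>\<^sup>+x. ennreal (\<bar>u x\<bar> powr k) \<partial>N) = (\<integral>\<^sup>+x. 0 \<partial>N)"
    using k by (intro nn_integral_cong_AE) (auto elim!: eventually_mono)
  then show ?thesis by simp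
next
  case False
  then have l: "0 < l" using M(3) by simp
  have pt: "\<bar>a\<bar> powr k \<le> l powr k * (1 + \<bar>a\<bar> ^ n / l ^ n)" for a
  proof -
    define t where "t = \<bar>a\<bar> / l"
    have t: "0 \<le> t" using l by (simp add: t_def)
    have "t powr k \<le> 1 + t ^ n"
    proof (cases "t \<le> 1")
      case True
      then have "t powr k \<le> 1" using k t powr_mono2[of k t 1] by simp
      then show ?thesis using t by (simp add: add_increasing2)
    next
      case False
      then have "t powr k \<le> t powr real n" using k by (intro powr_mono) auto
      also have "\<dots> = t ^ n" using False by (simp add: powr_realpow)
      finally show ?thesis by simp
    qed
    then have "l powr k * t powr k \<le> l powr k * (1 + t ^ n)" by (intro mult_left_mono) auto
    moreover have "l powr k * t powr k = \<bar>a\<bar> powr k"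
      using l t by (simp add: powr_mult[symmetric] t_def)
    ultimately show ?thesis by (simp add: t_def power_divide)
  qed
  have "(\<integral>\<^sup>+x. ennreal (\<bar>u x\<bar> powr k) \<partial>N)
     \<le> (\<integral>\<^sup>+x. ennreal (l powr k) * (1 + ennreal (1 / l ^ n) * ennreal (\<bar>u x\<bar> ^ n)) \<partial>N)"
  proof (intro nn_integral_mono)
    fix x
    have "ennreal (\<bar>u x\<bar> powr k) \<le> ennreal (l powr k * (1 + \<bar>u x\<bar> ^ n / l ^ n))" by (rule ennreal_leI[OF pt])
    also have "\<dots> = ennreal (l powr k) * (1 + ennreal (1 / l ^ n) * ennreal (\<bar>u x\<bar> ^ n))"
    proof -
      have "ennreal (1 + (1 / l ^ n) * \<bar>u x\<bar> ^ n) = 1 + ennreal (1 / l ^ n) * ennreal (\<bar>u x\<bar> ^ n)"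
        using l by (subst ennreal_plus) (auto simp: ennreal_mult[symmetric])
      then show ?thesis using l by (simp add: ennreal_mult' del: ennreal_plus)
    qed
    finally show "ennreal (\<bar>u x\<bar> powr k) \<le> ennreal (l powr k) * (1 + ennreal (1 / l ^ n) * ennreal (\<bar>u x\<bar> ^ n))" .
  qed
  also have "\<dots> = ennreal (l powr k) * (emeasure N (space N) + ennreal (1 / l ^ n) * (\<integral>\<^sup>+x. ennreal (\<bar>u x\<bar> ^ n) \<partial>N))"
    using um by (simp add: nn_integral_cmult nn_integral_add)
  also have "\<dots> \<le> ennreal (l powr k) * (ennreal (measure N (space N)) + ennreal (1 / l ^ n) * ennreal (A * l ^ n))"
    using M(1) finite_measure.emeasure_eq_measure[OF fin] by (intro mult_left_mono add_mono) auto
  also have "ennreal (1 / l ^ n) * ennreal (A * l ^ n) = ennreal A"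
    using l M(2) by (simp add: ennreal_mult[symmetric])
  also have "ennreal (l powr k) * (ennreal (measure N (space N)) + ennreal A) = ennreal ((measure N (space N) + A) * l powr k)"
    using M(2) by (simp add: ennreal_mult mult.commute)
  finally show ?thesis .
qed

subsection \<open>The planar embedding\<close>

text \<open>In the plane two line integrals suffice: each bounds the power \<open>f^(n+1)\<close>
  and depends on one coordinate, so the integral of their product factors. Whole lines are
  admissible, and rays of length 1 along unit vectors give the constant
  \<open>1 + (n + 1)\<close>.\<close>

lemma Gagliardo2_smooth:
  fixes f :: "real^2 \<Rightarrow> real"
  assumes f: "smooth_on UNIV f"
  shows "(\<integral>\<^sup>+y. ennreal (\<bar>f y\<bar> ^ (2 * Suc n)) \<partial>lborel)
    \<le> (ennreal (1 + real (Suc n)) * (\<integral>\<^sup>+y. ennreal (Qn n f y) \<partial>lborel))\<^sup>2"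
proof -
  define K where "K = 1 + real (Suc n)"
  have K: "0 < K" by (simp add: K_def)
  have fm [measurable]: "f \<in> borel_measurable borel" "Qn n f \<in> borel_measurable borel"
    using smooth_measurable[OF f] Qn_measurable[OF f] by auto
  define q where "q = (\<lambda>y. ennreal (K * Qn n f y))"
  have qm [measurable]: "q \<in> borel_measurable borel" unfolding q_def by measurable
  have vm [measurable]: "(\<lambda>(a, b). vector [a, b] :: real^2) \<in> borel_measurable (borel \<Otimes>\<^sub>M borel)" by (rule vec2_measurable)
  define qq where "qq = (\<lambda>(a, b). q (vector [a, b]))"
  have qqm [measurable]: "qq \<in> borel_measurable (borel \<Otimes>\<^sub>M borel)"
    using measurable_compose[OF vm qm] by (simp add: qq_def case_prod_beta)
  define G1 where "G1 = (\<lambda>b. \<integral>\<^sup>+s. qq (s, b) \<partial>lborel)"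
  define G2 where "G2 = (\<lambda>a. \<integral>\<^sup>+s. qq (a, s) \<partial>lborel)"
  have [measurable]: "G1 \<in> borel_measurable borel" "G2 \<in> borel_measurable borel" unfolding G1_def G2_def by measurable
  have shift: "(\<integral>\<^sup>+s. g (t + s) \<partial>lborel) = (\<integral>\<^sup>+s. g s \<partial>lborel)"
    if "g \<in> borel_measurable borel" for g :: "real \<Rightarrow> ennreal" and t
    using nn_integral_real_affine[OF that, of 1 t] by simp
  have ax: "vector [a, b] + s *\<^sub>R axis 1 1 = (vector [a + s, b] :: real^2)"
    "vector [a, b] + s *\<^sub>R axis 2 1 = (vector [a, b + s] :: real^2)" for a b s
    by (auto simp: vec_eq_iff forall_2 axis_def)
  have r: "ennreal (\<bar>f y\<bar> ^ Suc n) \<le> (\<integral>\<^sup>+s. q (y + s *\<^sub>R axis i 1) \<partial>lborel)" for y i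
    using ray_bound[OF f zero_less_one, of y "axis i 1" UNIV n K] by (simp add: K_def q_def Qn_def)
  have r1: "ennreal (\<bar>f (vector [a, b])\<bar> ^ Suc n) \<le> G1 b" for a b
    using r[of "vector [a, b]" 1] shift[of "\<lambda>s. qq (s, b)" a] by (simp add: ax G1_def qq_def)
  have r2: "ennreal (\<bar>f (vector [a, b])\<bar> ^ Suc n) \<le> G2 a" for a b
    using r[of "vector [a, b]" 2] shift[of "\<lambda>s. qq (a, s)" b] by (simp add: ax G2_def qq_def)
  have "(\<integral>\<^sup>+y. ennreal (\<bar>f y\<bar> ^ (2 * Suc n)) \<partial>lborel)
      = (\<integral>\<^sup>+a. \<integral>\<^sup>+b. ennreal (\<bar>f (vector [a, b])\<bar> ^ (2 * Suc n)) \<partial>lborel \<partial>lborel)"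
    by (rule nn_integral_vec2) measurable
  also have "\<dots> \<le> (\<integral>\<^sup>+a. \<integral>\<^sup>+b. G1 b * G2 a \<partial>lborel \<partial>lborel)"
  proof (intro nn_integral_mono)
    fix a b
    have "ennreal (\<bar>f (vector [a, b])\<bar> ^ (2 * Suc n)) = ennreal (\<bar>f (vector [a, b])\<bar> ^ Suc n) * ennreal (\<bar>f (vector [a, b])\<bar> ^ Suc n)"
      by (subst ennreal_mult[symmetric]) (auto simp: power_add[symmetric] mult_2)
    also have "\<dots> \<le> G1 b * G2 a" by (intro mult_mono r1 r2) auto
    finally show "ennreal (\<bar>f (vector [a, b])\<bar> ^ (2 * Suc n)) \<le> G1 b * G2 a" .
  qed
  also have "\<dots> = (\<integral>\<^sup>+b. G1 b \<partial>lborel) * (\<integral>\<^sup>+a. G2 a \<partial>lborel)"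
    by (simp add: nn_integral_multc nn_integral_cmult)
  also have "(\<integral>\<^sup>+a. G2 a \<partial>lborel) = (\<integral>\<^sup>+y. q y \<partial>lborel)"
    unfolding G2_def qq_def by (simp add: nn_integral_vec2)
  also have "(\<integral>\<^sup>+b. G1 b \<partial>lborel) = (\<integral>\<^sup>+a. G2 a \<partial>lborel)"
    unfolding G1_def G2_def by (rule lborel_pair.Fubini'[symmetric]) simp
  also have "(\<integral>\<^sup>+a. G2 a \<partial>lborel) = (\<integral>\<^sup>+y. q y \<partial>lborel)"
    unfolding G2_def qq_def by (simp add: nn_integral_vec2)
  also have "(\<integral>\<^sup>+y. q y \<partial>lborel) = ennreal K * (\<integral>\<^sup>+y. ennreal (Qn n f y) \<partial>lborel)"
    unfolding q_def using K by (simp add: ennreal_mult nn_integral_cmult)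
  finally show ?thesis by (simp add: K_def power2_eq_square)
qed

text \<open>Each step raises the exponent by 2: the planar inequality bounds the integral by the
  square of the integral of \<open>Qn (Suc n) f\<close>, and Cauchy-Schwarz brings in the previous
  exponent times a squared \<open>H1\<close> norm. Compact support in \<open>G\<close> allows
  integration over the whole plane.\<close>

lemma test_power_embedding:
  fixes G :: "(real^2) set"
  assumes G: "open G" "bounded G"
  shows "\<exists>C\<ge>0. \<forall>f\<in>test_functions G. (\<integral>\<^sup>+y. ennreal (\<bar>f y\<bar> ^ (2 * Suc n)) \<partial>lebesgue_on G)
    \<le> ennreal (C * (H1_norm G f) ^ (2 * Suc n))"
proof (induction n)
  case 0
  have "(\<integral>\<^sup>+y. ennreal (\<bar>f y\<bar> ^ (2 * Suc 0)) \<partial>lebesgue_on G) \<le> ennreal (1 * (H1_norm G f) ^ (2 * Suc 0))"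
    if "f \<in> test_functions G" for f
  proof -
    have "f \<in> Lp 2 (lebesgue_on G)" using test_Lp_2[OF that] G(1) by simp
    then show ?thesis using L2_norm_nn[of f "lebesgue_on G"] H1_norm_bounds(1)[of G f]
      by (simp add: power_mono)
  qed
  then show ?case by (intro exI[of _ 1]) auto
next
  case (Suc n)
  then obtain C where C: "0 \<le> C" "\<And>f. f \<in> test_functions G \<Longrightarrow> (\<integral>\<^sup>+y. ennreal (\<bar>f y\<bar> ^ (2 * Suc n)) \<partial>lebesgue_on G)
    \<le> ennreal (C * (H1_norm G f) ^ (2 * Suc n))" by blast
  let ?K = "1 + real (Suc (Suc n))"
  have "(\<integral>\<^sup>+y. ennreal (\<bar>f y\<bar> ^ (2 * Suc (Suc n))) \<partial>lebesgue_on G)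
    \<le> ennreal ((?K\<^sup>2 * C * 4) * (H1_norm G f) ^ (2 * Suc (Suc n)))" if f: "f \<in> test_functions G" for f
  proof -
    have fs: "smooth_on UNIV f" using test_smooth[OF f] .
    from f obtain K where K: "compact K" "K \<subseteq> G" "\<forall>x. x \<notin> K \<longrightarrow> f x = 0" by (auto simp: test_functions_def)
    have z: "f x = 0" "Qn (Suc n) f x = 0" if "x \<notin> G" for x
      using K that by (auto simp: Qn_def)
    have on: "(\<integral>\<^sup>+y. ennreal (g y) \<partial>lebesgue_on G) = (\<integral>\<^sup>+y. ennreal (g y) \<partial>lborel)"
      if "g \<in> borel_measurable borel" "\<And>x. x \<notin> G \<Longrightarrow> g x = 0" for g :: "real^2 \<Rightarrow> real"
    proof -
      have "(\<integral>\<^sup>+y. ennreal (g y) \<partial>lebesgue_on G) = (\<integral>\<^sup>+y. indicator G y * ennreal (g y) \<partial>lborel)"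
        using that(1) G(1) by (intro lebesgue_on_nn) auto
      also have "\<dots> = (\<integral>\<^sup>+y. ennreal (g y) \<partial>lborel)"
        using that(2) by (intro nn_integral_cong) (auto split: split_indicator)
      finally show ?thesis .
    qed
    have m: "(\<lambda>y. \<bar>f y\<bar> ^ (2 * Suc (Suc n))) \<in> borel_measurable borel" "Qn (Suc n) f \<in> borel_measurable borel"
      using smooth_measurable[OF fs] Qn_measurable[OF fs] by auto
    have "(\<integral>\<^sup>+y. ennreal (\<bar>f y\<bar> ^ (2 * Suc (Suc n))) \<partial>lebesgue_on G)
       = (\<integral>\<^sup>+y. ennreal (\<bar>f y\<bar> ^ (2 * Suc (Suc n))) \<partial>lborel)"
      by (rule on[OF m(1)]) (simp add: z)
    also have "\<dots> \<le> (ennreal ?K * (\<integral>\<^sup>+y. ennreal (Qn (Suc n) f y) \<partial>lborel))\<^sup>2"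
      by (rule Gagliardo2_smooth[OF fs])
    also have "(\<integral>\<^sup>+y. ennreal (Qn (Suc n) f y) \<partial>lborel) = (\<integral>\<^sup>+y. ennreal (Qn (Suc n) f y) \<partial>lebesgue_on G)"
      by (rule on[OF m(2) z(2), symmetric])
    also have "(ennreal ?K * (\<integral>\<^sup>+y. ennreal (Qn (Suc n) f y) \<partial>lebesgue_on G))\<^sup>2
      = ennreal (?K\<^sup>2) * (\<integral>\<^sup>+y. ennreal (Qn (Suc n) f y) \<partial>lebesgue_on G)\<^sup>2"
      unfolding power_mult_distrib by (subst ennreal_power) auto
    also have "\<dots> \<le> ennreal (?K\<^sup>2) * ((\<integral>\<^sup>+y. ennreal (\<bar>f y\<bar> ^ (2 * Suc n)) \<partial>lebesgue_on G) * ennreal (4 * (H1_norm G f)\<^sup>2))"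
      using Qn_Cauchy_Schwarz[OF G fs, of "Suc n"] by (intro mult_left_mono) auto
    also have "\<dots> \<le> ennreal (?K\<^sup>2) * (ennreal (C * (H1_norm G f) ^ (2 * Suc n)) * ennreal (4 * (H1_norm G f)\<^sup>2))"
      by (intro mult_left_mono mult_right_mono C(2) f) auto
    also have "\<dots> = ennreal (?K\<^sup>2 * ((C * (H1_norm G f) ^ (2 * Suc n)) * (4 * (H1_norm G f)\<^sup>2)))"
      using C(1) H1_norm_bounds(4)[of G f] by (simp only: ennreal_mult zero_le_power mult_nonneg_nonneg zero_le_numeral)
    also have "?K\<^sup>2 * ((C * (H1_norm G f) ^ (2 * Suc n)) * (4 * (H1_norm G f)\<^sup>2)) = (?K\<^sup>2 * C * 4) * (H1_norm G f) ^ (2 * Suc (Suc n))"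
      by (simp add: power2_eq_square)
    finally show ?thesis .
  qed
  then show ?case using C(1) by (intro exI[of _ "?K\<^sup>2 * C * 4"]) auto
qed

subsection \<open>The spaces of the model\<close>

lemma H2_H1: "w \<in> H2 U \<Longrightarrow> w \<in> H1 U" "w \<in> H2 U \<Longrightarrow> b \<in> Basis \<Longrightarrow> weak_partial U b w \<in> H1 U"
  by (auto simp: H2_def)

text \<open>The first derivative of the difference agrees with the difference of derivatives almost
  everywhere; by \<open>H1_AE_cong\<close> their own weak derivatives are then literally the same
  functions.\<close>

lemma weak_partial2_diff:
  assumes U: "open U" and w: "w \<in> H2 U" "v \<in> H2 U" and b: "b \<in> Basis" "c \<in> Basis"
  shows "weak_partial U b (\<lambda>x. w x - v x) \<in> H1 U"
    and "AE x in lebesgue_on U. weak_partial U c (weak_partial U b (\<lambda>x. w x - v x)) x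
      = weak_partial U c (weak_partial U b w) x - weak_partial U c (weak_partial U b v) x"
proof -
  let ?d = "\<lambda>x. weak_partial U b w x - weak_partial U b v x"
  have dH: "?d \<in> H1 U" using H1_diff[OF U] H2_H1(2)[OF w(1) b(1)] H2_H1(2)[OF w(2) b(1)] by blast
  have ae: "AE x in lebesgue_on U. ?d x = weak_partial U b (\<lambda>x. w x - v x) x"
    using weak_partial_diff[OF U H2_H1(1)[OF w(1)] H2_H1(1)[OF w(2)] b(1)] by eventually_elim simp
  have m: "weak_partial U b (\<lambda>x. w x - v x) \<in> borel_measurable (lebesgue_on U)"
    using Lp_measurable[OF weak_partial_Lp_2[OF H1_diff[OF U H2_H1(1)[OF w(1)] H2_H1(1)[OF w(2)]] b(1)]] .
  show "weak_partial U b (\<lambda>x. w x - v x) \<in> H1 U" by (rule H1_AE_cong(1)[OF U dH m ae])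
  have "weak_partial U c ?d = weak_partial U c (weak_partial U b (\<lambda>x. w x - v x))"
    using H1_AE_cong(2)[OF U dH m ae, of c] b(2) by blast
  then show "AE x in lebesgue_on U. weak_partial U c (weak_partial U b (\<lambda>x. w x - v x)) x
      = weak_partial U c (weak_partial U b w) x - weak_partial U c (weak_partial U b v) x"
    using weak_partial_diff[OF U H2_H1(2)[OF w(1) b(1)] H2_H1(2)[OF w(2) b(1)] b(2)] by simp
qed

lemma H2_diff:
  assumes "open U" "w \<in> H2 U" "v \<in> H2 U" shows "(\<lambda>x. w x - v x) \<in> H2 U"
  unfolding H2_def
  using weak_partial2_diff(1)[OF assms] H1_diff[OF assms(1) H2_H1(1)[OF assms(2)] H2_H1(1)[OF assms(3)]]
  by blast

lemma weak_laplacian_Lp_2: "w \<in> H2 U \<Longrightarrow> weak_laplacian U w \<in> Lp 2 (lebesgue_on U)"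
  unfolding weak_laplacian_def[abs_def] using weak_partial_Lp_2[OF H2_H1(2)] by (intro Lp_2_sum) auto

lemma weak_laplacian_diff:
  assumes "open U" "w \<in> H2 U" "v \<in> H2 U"
  shows "AE x in lebesgue_on U. weak_laplacian U (\<lambda>x. w x - v x) x = weak_laplacian U w x - weak_laplacian U v x"
proof -
  have "AE x in lebesgue_on U. \<forall>b\<in>Basis. weak_partial U b (weak_partial U b (\<lambda>x. w x - v x)) x
      = weak_partial U b (weak_partial U b w) x - weak_partial U b (weak_partial U b v) x"
    using weak_partial2_diff(2)[OF assms] by (subst AE_ball_countable) (auto intro: countable_finite)
  then show ?thesis by eventually_elim (simp add: weak_laplacian_def sum_subtractf)
qed

lemma lap_norm_nonneg [simp]: "0 \<le> lap_norm U w" by (simp add: lap_norm_def)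

lemma lap_norm_reverse:
  assumes "open U" "w \<in> H2 U" "v \<in> H2 U"
  shows "\<bar>lap_norm U w - lap_norm U v\<bar> \<le> lap_norm U (\<lambda>x. w x - v x)"
proof -
  have "lap_norm U (\<lambda>x. w x - v x) = Lp_norm 2 (lebesgue_on U) (\<lambda>x. weak_laplacian U w x - weak_laplacian U v x)"
    unfolding lap_norm_def
    using weak_laplacian_Lp_2[OF H2_diff[OF assms]] weak_laplacian_Lp_2[OF assms(2)] weak_laplacian_Lp_2[OF assms(3)]
      weak_laplacian_diff[OF assms] by (intro Lp_norm_AE_cong) (auto simp: Lp_2_iff)
  then show ?thesis unfolding lap_norm_def
    using L2_norm_reverse[OF weak_laplacian_Lp_2[OF assms(2)] weak_laplacian_Lp_2[OF assms(3)]] by simp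
qed

lemma lap_norm_AE_cong:
  assumes U: "open U" and w: "w \<in> H2 U" "v \<in> borel_measurable (lebesgue_on U)" "AE x in lebesgue_on U. w x = v x"
  shows "lap_norm U w = lap_norm U v"
proof -
  have "weak_partial U b w = weak_partial U b v" if "b \<in> Basis" for b
    using H1_AE_cong(2)[OF U H2_H1(1)[OF w(1)] w(2,3), of b] that by blast
  then show ?thesis by (simp add: lap_norm_def weak_laplacian_def[abs_def])
qed

lemma L2_partial_le_grad:
  assumes "u \<in> H1 U" "b \<in> Basis" shows "Lp_norm 2 (lebesgue_on U) (weak_partial U b u) \<le> grad_norm U u"
proof (rule power2_le_imp_le)
  show "(Lp_norm 2 (lebesgue_on U) (weak_partial U b u))\<^sup>2 \<le> (grad_norm U u)\<^sup>2"
    unfolding grad_norm_sq[OF assms(1)]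
    by (rule member_le_sum[of b Basis "\<lambda>b. (Lp_norm 2 (lebesgue_on U) (weak_partial U b u))\<^sup>2"]) (use assms in auto)
qed simp

lemma H2_norm_bounds:
  "H1_norm U w \<le> H2_norm U w" "b \<in> Basis \<Longrightarrow> grad_norm U (weak_partial U b w) \<le> H2_norm U w" "0 \<le> H2_norm U w"
proof -
  have s: "0 \<le> (\<Sum>b\<in>Basis. (grad_norm U (weak_partial U b w))\<^sup>2)" by (intro sum_nonneg) auto
  show "H1_norm U w \<le> H2_norm U w" unfolding H2_norm_def using s by (intro real_le_rsqrt) simp
  show "0 \<le> H2_norm U w" unfolding H2_norm_def using s by simp
  assume b: "b \<in> Basis"
  have "(grad_norm U (weak_partial U b w))\<^sup>2 \<le> (\<Sum>b\<in>Basis. (grad_norm U (weak_partial U b w))\<^sup>2)"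
    by (rule member_le_sum[of b Basis "\<lambda>b. (grad_norm U (weak_partial U b w))\<^sup>2"]) (use b in auto)
  then show "grad_norm U (weak_partial U b w) \<le> H2_norm U w" unfolding H2_norm_def
    by (intro real_le_rsqrt) (simp add: add_increasing)
qed

lemma lap_norm_le_H2_norm:
  assumes "w \<in> H2 (U :: 'a::euclidean_space set)" shows "lap_norm U w \<le> real DIM('a) * H2_norm U w"
proof -
  have "lap_norm U w \<le> (\<Sum>b\<in>Basis. Lp_norm 2 (lebesgue_on U) (weak_partial U b (weak_partial U b w)))"
    unfolding lap_norm_def weak_laplacian_def[abs_def]
    using weak_partial_Lp_2[OF H2_H1(2)[OF assms]] by (intro L2_norm_sum) auto
  also have "\<dots> \<le> (\<Sum>b\<in>(Basis :: 'a set). H2_norm U w)"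
    by (intro sum_mono order_trans[OF L2_partial_le_grad H2_norm_bounds(2)] H2_H1(2)[OF assms])
  finally show ?thesis by simp
qed

lemma test_H2:
  assumes U: "open U" "bounded U" and f: "f \<in> test_functions U"
  shows "f \<in> H2 U" "AE x in lebesgue_on U. weak_laplacian U f x = (\<Sum>b\<in>Basis. pd b (pd b f) x)" "f \<in> H20 U"
proof -
  have fs: "smooth_on UNIV f" using test_smooth[OF f] .
  have fH: "f \<in> H1 U" by (rule smooth_H1[OF U fs])
  have 1: "weak_partial U b f \<in> H1 U \<and> (AE x in lebesgue_on U. weak_partial U b (weak_partial U b f) x = pd b (pd b f) x)"
    if b: "b \<in> Basis" for b
  proof -
    have ps: "smooth_on UNIV (pd b f)" by (rule smooth_on_pd[OF fs b])
    have ae: "AE x in lebesgue_on U. pd b f x = weak_partial U b f x"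
      using smooth_weak_partial_eq[OF U fs b] by eventually_elim simp
    note c = H1_AE_cong[OF U(1) smooth_H1[OF U ps] Lp_measurable[OF weak_partial_Lp_2[OF fH b]] ae]
    have "weak_partial U b (pd b f) = weak_partial U b (weak_partial U b f)" using c(2)[of b] b by blast
    then show ?thesis using c(1) smooth_weak_partial_eq[OF U ps b] by simp
  qed
  then show fH2: "f \<in> H2 U" using fH by (auto simp: H2_def)
  have "AE x in lebesgue_on U. \<forall>b\<in>Basis. weak_partial U b (weak_partial U b f) x = pd b (pd b f) x"
    using 1 by (subst AE_ball_countable) (auto intro: countable_finite)
  then show "AE x in lebesgue_on U. weak_laplacian U f x = (\<Sum>b\<in>Basis. pd b (pd b f) x)"
    by eventually_elim (simp add: weak_laplacian_def)
  have "H2_norm U (\<lambda>x. f x - f x) = 0"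
  proof -
    have z: "(\<lambda>x. 0) \<in> borel_measurable (lebesgue_on U)" "AE x in lebesgue_on U. (\<lambda>x. 0::real) x = 0" by auto
    note gz = grad_norm_AE_zero[OF U(1) z]
    have "grad_norm U (weak_partial U b (\<lambda>x. 0)) = 0" if "b \<in> Basis" for b
      using grad_norm_AE_zero(2)[OF U(1) Lp_measurable[OF weak_partial_Lp_2[OF gz(1) that]] gz(3)[OF that]] .
    then show ?thesis using gz(2) by (simp add: H2_norm_def H1_norm_def L2_norm_eq)
  qed
  then show "f \<in> H20 U" unfolding H20_def using fH2 f
    by (intro CollectI conjI exI[of _ "\<lambda>_. f"]) auto
qed

text \<open>Integration by parts turns the squared gradient norm into minus the pairing of the
  function with its Laplacian; Cauchy-Schwarz finishes.\<close>

lemma test_grad_le_lap: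
  assumes U: "open U" "bounded U" and f: "f \<in> test_functions U"
  shows "(grad_norm U f)\<^sup>2 \<le> Lp_norm 2 (lebesgue_on U) f * lap_norm U f"
proof -
  let ?N = "lebesgue_on U"
  have fs: "smooth_on UNIV f" using test_smooth[OF f] .
  have pL: "pd b f \<in> Lp 2 ?N" "pd b (pd b f) \<in> Lp 2 ?N" if "b \<in> Basis" for b
    using test_Lp_2[OF test_pd[OF f that], of U] test_Lp_2[OF test_pd[OF test_pd[OF f that] that], of U] U(1) by auto
  have fL: "f \<in> Lp 2 ?N" using test_Lp_2[OF f, of U] U(1) by simp
  have "(grad_norm U f)\<^sup>2 = (\<Sum>b\<in>Basis. \<integral>x. pd b f x * pd b f x \<partial>?N)"
    unfolding smooth_grad_norm_sq[OF U fs] power2_eq_square[symmetric]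
    using pL(1) by (subst Bochner_Integration.integral_sum) (auto simp: Lp_2_iff)
  also have "\<dots> = (\<Sum>b\<in>Basis. - (\<integral>x. pd b (pd b f) x * f x \<partial>?N))"
    by (intro sum.cong refl test_ibp[OF U(1) f smooth_on_pd[OF fs]])
  also have "\<dots> = - (\<integral>x. (\<Sum>b\<in>Basis. pd b (pd b f) x) * f x \<partial>?N)"
    using L2_mult_integrable[OF pL(2) fL]
    by (simp add: sum_negf sum_distrib_right Bochner_Integration.integral_sum)
  also have "(\<integral>x. (\<Sum>b\<in>Basis. pd b (pd b f) x) * f x \<partial>?N) = L2_inner ?N (weak_laplacian U f) f"
    unfolding L2_inner_def
  proof (rule integral_cong_AE)
    show "(\<lambda>x. weak_laplacian U f x * f x) \<in> borel_measurable ?N"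
      using weak_laplacian_Lp_2[OF test_H2(1)[OF U f]] fL by (auto simp: Lp_2_iff)
    show "(\<lambda>x. (\<Sum>b\<in>Basis. pd b (pd b f) x) * f x) \<in> borel_measurable ?N"
      by (intro borel_measurable_times borel_measurable_sum Lp_measurable[OF pL(2)] Lp_measurable[OF fL])
    show "AE x in ?N. (\<Sum>b\<in>Basis. pd b (pd b f) x) * f x = weak_laplacian U f x * f x"
      using test_H2(2)[OF U f] by eventually_elim simp
  qed
  also have "- L2_inner ?N (weak_laplacian U f) f \<le> lap_norm U f * Lp_norm 2 ?N f"
    using L2_Cauchy_Schwarz[OF weak_laplacian_Lp_2[OF test_H2(1)[OF U f]] fL] by (simp add: lap_norm_def)
  finally show ?thesis by (simp add: mult.commute)
qed

text \<open>For test functions the assumed \<open>L2\<close> bound and the interpolation of the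
  gradient between function and Laplacian give an \<open>H1\<close> bound by \<open>D\<close> times
  the Laplacian norm, with \<open>D^2 = c2 + sqrt c2\<close>. Test functions approximate
  \<open>H20\<close> by definition, and Fatou passes to the limit.\<close>

lemma H20_power_embedding:
  fixes G :: "(real^2) set"
  assumes G: "open G" "bounded G" and c2: "0 < c2" "\<And>w. w \<in> H20 G \<Longrightarrow> (Lp_norm 2 (lebesgue_on G) w)\<^sup>2 \<le> c2 * (lap_norm G w)\<^sup>2"
  obtains C where "0 \<le> C" "\<And>w. w \<in> H20 G \<Longrightarrow>
    (\<integral>\<^sup>+y. ennreal (\<bar>w y\<bar> ^ (2 * Suc n)) \<partial>lebesgue_on G) \<le> ennreal (C * (lap_norm G w) ^ (2 * Suc n))"
proof -
  obtain C where C: "0 \<le> C" "\<And>f. f \<in> test_functions G \<Longrightarrow> (\<integral>\<^sup>+y. ennreal (\<bar>f y\<bar> ^ (2 * Suc n)) \<partial>lebesgue_on G)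
    \<le> ennreal (C * (H1_norm G f) ^ (2 * Suc n))" using test_power_embedding[OF G, of n] by blast
  define D where "D = sqrt (c2 + sqrt c2)"
  have D: "0 \<le> D" using c2 by (simp add: D_def)
  have HD: "H1_norm G f \<le> D * lap_norm G f" if f: "f \<in> test_functions G" for f
  proof (rule power2_le_imp_le)
    have l: "(Lp_norm 2 (lebesgue_on G) f)\<^sup>2 \<le> c2 * (lap_norm G f)\<^sup>2" by (rule c2(2)[OF test_H2(3)[OF G f]])
    then have "(Lp_norm 2 (lebesgue_on G) f)\<^sup>2 \<le> (sqrt c2 * lap_norm G f)\<^sup>2" using c2(1) by (simp add: power_mult_distrib)
    then have l': "Lp_norm 2 (lebesgue_on G) f \<le> sqrt c2 * lap_norm G f" by (rule power2_le_imp_le) (use c2 in simp)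
    have "(grad_norm G f)\<^sup>2 \<le> Lp_norm 2 (lebesgue_on G) f * lap_norm G f" by (rule test_grad_le_lap[OF G f])
    also have "\<dots> \<le> (sqrt c2 * lap_norm G f) * lap_norm G f" by (intro mult_right_mono l') simp
    finally have "(grad_norm G f)\<^sup>2 \<le> sqrt c2 * (lap_norm G f)\<^sup>2" by (simp add: power2_eq_square mult.assoc)
    then have "(H1_norm G f)\<^sup>2 \<le> c2 * (lap_norm G f)\<^sup>2 + sqrt c2 * (lap_norm G f)\<^sup>2"
      unfolding H1_norm_bounds(3) using l by linarith
    also have "\<dots> = (D * lap_norm G f)\<^sup>2" using c2 by (simp add: D_def power_mult_distrib algebra_simps)
    finally show "(H1_norm G f)\<^sup>2 \<le> (D * lap_norm G f)\<^sup>2" .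
  qed (use D in simp)
  show thesis
  proof (rule that[of "C * D ^ (2 * Suc n)"])
    show "0 \<le> C * D ^ (2 * Suc n)" using C(1) D by simp
    fix w assume w: "w \<in> H20 G"
    then obtain f where f: "\<And>n. f n \<in> test_functions G" "(\<lambda>n. H2_norm G (\<lambda>x. f n x - w x)) \<longlonglongrightarrow> 0" and w2: "w \<in> H2 G"
      by (auto simp: H20_def)
    have f2: "f n \<in> H2 G" for n by (rule test_H2(1)[OF G f(1)])
    have l1: "(\<lambda>n. H1_norm G (\<lambda>x. f n x - w x)) \<longlonglongrightarrow> 0"
      by (rule tendsto_0_le[OF f(2) H1_norm_bounds(4) H2_norm_bounds(1)])
    have "(\<lambda>n. real DIM(real^2) * H2_norm G (\<lambda>x. f n x - w x)) \<longlonglongrightarrow> 0"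
      using tendsto_mult[OF tendsto_const f(2)] by simp
    then have "(\<lambda>n. \<bar>lap_norm G (f n) - lap_norm G w\<bar>) \<longlonglongrightarrow> 0"
      by (rule tendsto_0_le)
         (simp, rule order_trans[OF lap_norm_reverse[OF G(1) f2 w2] lap_norm_le_H2_norm[OF H2_diff[OF G(1) f2 w2]]])
    then have l2: "(\<lambda>n. lap_norm G (f n)) \<longlonglongrightarrow> lap_norm G w" using tendsto_rabs_zero_cancel Lim_null by blast
    note ap = H1_approx[OF G(1) H2_H1(1)[OF w2] H2_H1(1)[OF f2] l1]
    obtain r where r: "strict_mono r" "AE x in lebesgue_on G. (\<lambda>n. f (r n) x) \<longlonglongrightarrow> w x"
      by (rule L2_AE_subseq[OF H1_Lp_2[OF H2_H1(1)[OF f2]] H1_Lp_2[OF H2_H1(1)[OF w2]] ap(1)])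
    show "(\<integral>\<^sup>+y. ennreal (\<bar>w y\<bar> ^ (2 * Suc n)) \<partial>lebesgue_on G) \<le> ennreal (C * D ^ (2 * Suc n) * (lap_norm G w) ^ (2 * Suc n))"
    proof (rule Fatou_bound[where u="\<lambda>i. f (r i)" and G="\<lambda>s. \<bar>s\<bar> ^ (2 * Suc n)" and v=w
          and C="\<lambda>i. C * D ^ (2 * Suc n) * (lap_norm G (f (r i))) ^ (2 * Suc n)"])
      show "f (r i) \<in> borel_measurable (lebesgue_on G)" for i by (rule Lp_measurable[OF H1_Lp_2[OF H2_H1(1)[OF f2]]])
      show "(\<integral>\<^sup>+x. ennreal (\<bar>f (r i) x\<bar> ^ (2 * Suc n)) \<partial>lebesgue_on G) \<le> ennreal (C * D ^ (2 * Suc n) * lap_norm G (f (r i)) ^ (2 * Suc n))" for i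
      proof (rule order_trans[OF C(2)[OF f(1)] ennreal_leI])
        have "H1_norm G (f (r i)) ^ (2 * Suc n) \<le> (D * lap_norm G (f (r i))) ^ (2 * Suc n)"
          by (intro power_mono HD f H1_norm_bounds)
        then show "C * H1_norm G (f (r i)) ^ (2 * Suc n) \<le> C * D ^ (2 * Suc n) * lap_norm G (f (r i)) ^ (2 * Suc n)"
          using C(1) unfolding power_mult_distrib mult.assoc by (intro mult_left_mono) auto
      qed
      show "(\<lambda>i. C * D ^ (2 * Suc n) * lap_norm G (f (r i)) ^ (2 * Suc n)) \<longlonglongrightarrow> C * D ^ (2 * Suc n) * lap_norm G w ^ (2 * Suc n)"
        using LIMSEQ_subseq_LIMSEQ[OF l2 r(1)] by (intro tendsto_intros) (simp add: o_def)
      show "isCont (\<lambda>s::real. \<bar>s\<bar> ^ (2 * Suc n)) x" for x by (intro continuous_intros)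
      show "(\<lambda>s::real. \<bar>s\<bar> ^ (2 * Suc n)) \<in> borel_measurable borel" by measurable
    qed (rule r(2))
  qed
qed

section \<open>Embeddings, traces and best constants on the domain of the model\<close>

lemma admissible_facts:
  assumes A: "admissible_domain S"
  shows "open (Omega S)" "bounded (Omega S)" "smooth_boundary (Omega S)" "Omega S \<noteq> {}"
    "open (Gamma_plane S)" "bounded (Gamma_plane S)" "Gamma_plane S \<noteq> {}"
    "\<And>z. z \<in> Gamma_plane S \<Longrightarrow> chart S z \<in> closure (Omega S)"
    "\<And>x y. dist (chart S x) (chart S y) = dist x y"
    "Gamma0 S \<inter> Omega S = {}"
proof -
  show O: "open (Omega S)" "bounded (Omega S)" "smooth_boundary (Omega S)"
    and iso: "\<And>x y. dist (chart S x) (chart S y) = dist x y" using A by (auto simp: admissible_domain_def)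
  have G: "openin (top_of_set (frontier (Omega S))) (Gamma S)" "Gamma S \<subseteq> range (chart S)"
    "openin (top_of_set (frontier (Omega S))) (Gamma0 S)" "emeasure hausdorff2 (Gamma S) > 0"
    using A by (auto simp: admissible_domain_def)
  have Gf: "Gamma S \<subseteq> frontier (Omega S)" "Gamma0 S \<subseteq> frontier (Omega S)"
    using openin_imp_subset[OF G(1)] openin_imp_subset[OF G(3)] by auto
  have Gne: "Gamma S \<noteq> {}" using G(4) by (metis emeasure_empty less_irrefl)
  show "Omega S \<noteq> {}" using Gne Gf by (auto simp: frontier_def)
  show "open (Gamma_plane S)" unfolding Gamma_plane_def by (rule flat_boundary_open[OF O(1,3) iso G(1,2)])
  show cl: "chart S z \<in> closure (Omega S)" if "z \<in> Gamma_plane S" for z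
    using that Gf by (auto simp: Gamma_plane_def frontier_def)
  show "Gamma_plane S \<noteq> {}" using Gne G(2) by (auto simp: Gamma_plane_def)
  show "bounded (Gamma_plane S)"
  proof -
    have "bounded (closure (Omega S))" using O(2) by (rule bounded_closure)
    then obtain R where "\<And>y. y \<in> closure (Omega S) \<Longrightarrow> dist (chart S 0) y \<le> R" unfolding bounded_any_center[where a="chart S 0"] by blast
    then have "dist 0 z \<le> R" if "z \<in> Gamma_plane S" for z using cl[OF that] iso[of 0 z] by metis
    then show ?thesis unfolding bounded_def by blast
  qed
  show "Gamma0 S \<inter> Omega S = {}" using Gf O(1) by (auto simp: frontier_def interior_open)
qed

lemma bounded_open_measure:
  fixes U :: "'a::euclidean_space set"
  assumes "open U" "bounded U" "U \<noteq> {}"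
  shows "finite_measure (lebesgue_on U)" "0 < measure lebesgue U" "measure (lebesgue_on U) (space (lebesgue_on U)) = measure lebesgue U"
proof -
  have m: "U \<in> lmeasurable" using assms by (intro bounded_set_imp_lmeasurable) auto
  then show "finite_measure (lebesgue_on U)" by (rule finite_measure_lebesgue_on)
  show "measure (lebesgue_on U) (space (lebesgue_on U)) = measure lebesgue U"
    using m by (simp add: measure_restrict_space fmeasurable_def)
  show "0 < measure lebesgue U" using open_not_negligible[OF assms(1,3)] m negligible_iff_measure0 zero_less_measure_iff by blast
qed

text \<open>Supplies a nonzero element of the Sobolev spaces, so that the suprema \<open>K1\<close>
  and \<open>K2\<close> are taken over nonempty sets and are positive.\<close>

lemma exists_bump:
  fixes U :: "'a::euclidean_space set"
  assumes U: "open U" "U \<noteq> {}"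
  obtains f where "f \<in> test_functions U" "\<not> (AE x in lebesgue_on U. f x = 0)"
proof -
  obtain x where x: "x \<in> U" using U by blast
  obtain a b where ab: "x \<in> box a b" "cbox a b \<subseteq> U" using open_contains_cbox[OF U(1) x] by metis
  show thesis
  proof (rule that[of "box_bump 1 a b"])
    show "box_bump 1 a b \<in> test_functions U" using ab by (intro box_bump_test) auto
    show "\<not> (AE x in lebesgue_on U. box_bump 1 a b x = 0)"
    proof
      assume "AE x in lebesgue_on U. box_bump 1 a b x = 0"
      then have "AE x in lebesgue. x \<in> U \<longrightarrow> box_bump 1 a b x = 0" using U(1) by (simp add: AE_restrict_space_iff)
      then have "AE x in lebesgue. x \<notin> box a b"
        by eventually_elim (metis ab(2) box_bump_pos box_subset_cbox less_irrefl subsetD)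
      then have "box a b \<in> null_sets lebesgue" by (subst AE_iff_null_sets) auto
      then show False using ab(1) open_not_negligible[of "box a b"] by (auto simp: negligible_iff_null_sets)
    qed
  qed
qed

lemma H1_Gamma0_H1: "u \<in> H1_Gamma0 S \<Longrightarrow> u \<in> H1 (Omega S)"
  by (simp add: H1_Gamma0_def)

lemma H1_Gamma0_approx:
  assumes "u \<in> H1_Gamma0 S"
  obtains f where "\<And>n. smooth_on UNIV (f n)" "(\<lambda>n::nat. H1_norm (Omega S) (\<lambda>x. f n x - u x)) \<longlonglongrightarrow> 0"
  using assms unfolding H1_Gamma0_def is_trace_def by blast

lemma H1_Gamma0_diff:
  assumes A: "admissible_domain S" and u: "u \<in> H1_Gamma0 S" "v \<in> H1_Gamma0 S"
  shows "(\<lambda>x. u x - v x) \<in> H1_Gamma0 S"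
proof -
  note af = admissible_facts[OF A]
  have t: "is_trace (Omega S) (restrict_space hausdorff2 (Gamma0 S)) (\<lambda>x. x) u (\<lambda>_. 0)"
    "is_trace (Omega S) (restrict_space hausdorff2 (Gamma0 S)) (\<lambda>x. x) v (\<lambda>_. 0)"
    using u by (auto simp: H1_Gamma0_def)
  show ?thesis
    using is_trace_diff[OF af(1,2) H1_Gamma0_H1[OF u(1)] H1_Gamma0_H1[OF u(2)] t]
      H1_diff[OF af(1) H1_Gamma0_H1[OF u(1)] H1_Gamma0_H1[OF u(2)]]
    by (simp add: H1_Gamma0_def)
qed

text \<open>\<open>Gamma0\<close> lies in the boundary of an open set, where a test function
  vanishes; the constant sequence therefore witnesses the zero trace.\<close>

lemma test_H1_Gamma0:
  assumes A: "admissible_domain S" and f: "f \<in> test_functions (Omega S)"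
  shows "f \<in> H1_Gamma0 S"
proof -
  note af = admissible_facts[OF A]
  have fs: "smooth_on UNIV f" by (rule test_smooth[OF f])
  let ?N = "restrict_space hausdorff2 (Gamma0 S) :: (real^3) measure"
  have z: "f y = 0" if "y \<in> space ?N" for y
    using that af(10) test_zero_outside[OF f] by (auto simp: space_restrict_space)
  have m: "f \<in> borel_measurable ?N" using z by (subst measurable_cong[of ?N f "\<lambda>_. 0"]) auto
  have "integrable ?N (\<lambda>x. (f x)\<^sup>2) \<longleftrightarrow> integrable ?N (\<lambda>x. 0 :: real)"
    using z by (intro Bochner_Integration.integrable_cong) auto
  then have L: "f \<in> Lp 2 ?N" using m by (simp add: Lp_2_iff)
  have n0: "Lp_norm 2 ?N (\<lambda>y. f y - 0) = 0"
  proof -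
    have "(\<integral>y. (f y)\<^sup>2 \<partial>?N) = (\<integral>y. 0 \<partial>?N)" using z by (intro Bochner_Integration.integral_cong) auto
    then show ?thesis by (simp add: L2_norm_eq)
  qed
  have h0: "H1_norm (Omega S) (\<lambda>x. f x - f x) = 0"
    using grad_norm_AE_zero(2)[OF af(1), of "\<lambda>x. 0"] by (simp add: H1_norm_def L2_norm_eq)
  have "is_trace (Omega S) ?N (\<lambda>x. x) f (\<lambda>_. 0)" unfolding is_trace_def
  proof (intro conjI exI[of _ "\<lambda>_. f"] allI)
    show "smooth_on UNIV f" by (rule fs)
    show "(\<lambda>y. f y) \<in> Lp 2 ?N" using L by simp
    show "(\<lambda>n. H1_norm (Omega S) (\<lambda>x. f x - f x)) \<longlonglongrightarrow> 0" unfolding h0 by (rule tendsto_const)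
    show "(\<lambda>n. Lp_norm 2 ?N (\<lambda>y. f y - 0)) \<longlonglongrightarrow> 0" unfolding n0 by (rule tendsto_const)
  qed simp
  then show ?thesis using smooth_H1[OF af(1,2) fs] by (simp add: H1_Gamma0_def)
qed

lemma Gamma_trace_spec:
  assumes A: "admissible_domain S" and u: "u \<in> H1_Gamma0 S"
  shows "is_trace (Omega S) (mG S) (chart S) u (Gamma_trace S u)"
proof -
  note af = admissible_facts[OF A]
  obtain C where C: "\<And>u f. u \<in> H1 (Omega S) \<Longrightarrow> (\<And>n. smooth_on UNIV (f n)) \<Longrightarrow>
      (\<lambda>n::nat. H1_norm (Omega S) (\<lambda>x. f n x - u x)) \<longlonglongrightarrow> 0 \<Longrightarrow> \<exists>g. is_trace (Omega S) (mG S) (chart S) u g"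
  proof (rule trace_H1[OF af(1-3,5,6,8,9)], goal_cases)
    case (2 C) show thesis by (rule 2(1)[OF 2(4)])
  qed
  obtain f where f: "\<And>n. smooth_on UNIV (f n)" "(\<lambda>n::nat. H1_norm (Omega S) (\<lambda>x. f n x - u x)) \<longlonglongrightarrow> 0"
    using H1_Gamma0_approx[OF u] by blast
  obtain g where "is_trace (Omega S) (mG S) (chart S) u g" using C[OF H1_Gamma0_H1[OF u] f] by blast
  then show ?thesis unfolding Gamma_trace_def by (rule someI[where P="is_trace (Omega S) (mG S) (chart S) u"])
qed

lemma Gamma_trace_Lp_2:
  "admissible_domain S \<Longrightarrow> u \<in> H1_Gamma0 S \<Longrightarrow> Gamma_trace S u \<in> Lp 2 (mG S)"
  using Gamma_trace_spec is_trace_def by blast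

text \<open>Stated for the difference of two chosen traces, since \<open>SOME\<close> gives no
  linearity; that difference is a trace of the difference.\<close>

lemma Gamma_trace_diff_bound:
  assumes A: "admissible_domain S"
  obtains C where "0 \<le> C" "\<And>u v. u \<in> H1_Gamma0 S \<Longrightarrow> v \<in> H1_Gamma0 S \<Longrightarrow>
    (Lp_norm 2 (mG S) (\<lambda>y. Gamma_trace S u y - Gamma_trace S v y))\<^sup>2
      \<le> C * (Lp_norm 2 (mO S) (\<lambda>x. u x - v x) * H1_norm (Omega S) (\<lambda>x. u x - v x))"
proof -
  note af = admissible_facts[OF A]
  obtain C where C: "0 \<le> C" "\<And>u g. u \<in> H1 (Omega S) \<Longrightarrow> is_trace (Omega S) (mG S) (chart S) u g \<Longrightarrow>
      (Lp_norm 2 (mG S) g)\<^sup>2 \<le> C * (Lp_norm 2 (mO S) u * H1_norm (Omega S) u)"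
  proof (rule trace_H1[OF af(1-3,5,6,8,9)], goal_cases)
    case (2 C) show thesis by (rule 2(1)[OF 2(2,3)])
  qed
  show thesis
  proof (rule that[OF C(1)])
    fix u v assume u: "u \<in> H1_Gamma0 S" "v \<in> H1_Gamma0 S"
    note H = H1_Gamma0_H1[OF u(1)] H1_Gamma0_H1[OF u(2)]
    show "(Lp_norm 2 (mG S) (\<lambda>y. Gamma_trace S u y - Gamma_trace S v y))\<^sup>2
      \<le> C * (Lp_norm 2 (mO S) (\<lambda>x. u x - v x) * H1_norm (Omega S) (\<lambda>x. u x - v x))"
      by (rule C(2)[OF H1_diff[OF af(1) H] is_trace_diff[OF af(1,2) H Gamma_trace_spec[OF A u(1)] Gamma_trace_spec[OF A u(2)]]])
  qed
qed

lemma Omega_power_embedding: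
  assumes A: "admissible_domain S" and E: "embedding_constants S"
  obtains C where "0 \<le> C" "\<And>u. u \<in> H1_Gamma0 S \<Longrightarrow>
    (\<integral>\<^sup>+y. ennreal (\<bar>u y\<bar> ^ 6) \<partial>mO S) \<le> ennreal (C * grad_norm (Omega S) u ^ 6)"
proof -
  note af = admissible_facts[OF A]
  obtain C where C: "0 \<le> C" "\<And>u f. u \<in> H1 (Omega S) \<Longrightarrow> (\<And>n. smooth_on UNIV (f n)) \<Longrightarrow>
    (\<lambda>n::nat. H1_norm (Omega S) (\<lambda>x. f n x - u x)) \<longlonglongrightarrow> 0 \<Longrightarrow>
    (\<integral>\<^sup>+y. ennreal (\<bar>u y\<bar> ^ 6) \<partial>mO S) \<le> ennreal (C * (H1_norm (Omega S) u) ^ 6)"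
  proof (rule Sobolev_H1[OF af(1-3)], goal_cases)
    case (1 C) show thesis by (rule 1(1)[OF 1(2,3)])
  qed
  have c1: "0 < emb_c1 S" using E by (simp add: embedding_constants_def)
  show thesis
  proof (rule that[of "C * (emb_c1 S + 1) ^ 3"])
    show "0 \<le> C * (emb_c1 S + 1) ^ 3" using C(1) c1 by simp
    fix u assume u: "u \<in> H1_Gamma0 S"
    obtain f where f: "\<And>n. smooth_on UNIV (f n)" "(\<lambda>n::nat. H1_norm (Omega S) (\<lambda>x. f n x - u x)) \<longlonglongrightarrow> 0"
      using H1_Gamma0_approx[OF u] by blast
    have "(H1_norm (Omega S) u)\<^sup>2 \<le> (emb_c1 S + 1) * (grad_norm (Omega S) u)\<^sup>2"
      using E u by (simp add: H1_norm_bounds(3) embedding_constants_def algebra_simps)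
    then have "((H1_norm (Omega S) u)\<^sup>2) ^ 3 \<le> ((emb_c1 S + 1) * (grad_norm (Omega S) u)\<^sup>2) ^ 3"
      by (intro power_mono) auto
    then have "C * (H1_norm (Omega S) u) ^ 6 \<le> C * (emb_c1 S + 1) ^ 3 * grad_norm (Omega S) u ^ 6"
      using C(1) by (simp add: power_mult_distrib power_mult[symmetric] mult.assoc mult_left_mono)
    then show "(\<integral>\<^sup>+y. ennreal (\<bar>u y\<bar> ^ 6) \<partial>mO S) \<le> ennreal (C * (emb_c1 S + 1) ^ 3 * grad_norm (Omega S) u ^ 6)"
      using C(2)[OF H1_Gamma0_H1[OF u] f] by (meson ennreal_leI order_trans)
  qed
qed

lemma Omega_powr_embedding:
  assumes A: "admissible_domain S" and E: "embedding_constants S" and k: "0 < k" "k \<le> 6"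
  obtains C where "0 \<le> C" "\<And>u. u \<in> H1_Gamma0 S \<Longrightarrow>
    (\<integral>\<^sup>+y. ennreal (\<bar>u y\<bar> powr k) \<partial>mO S) \<le> ennreal (C * grad_norm (Omega S) u powr k)"
proof -
  note af = admissible_facts[OF A]
  obtain C where C: "0 \<le> C" "\<And>u. u \<in> H1_Gamma0 S \<Longrightarrow>
    (\<integral>\<^sup>+y. ennreal (\<bar>u y\<bar> ^ 6) \<partial>mO S) \<le> ennreal (C * grad_norm (Omega S) u ^ 6)"
    by (rule Omega_power_embedding[OF A E]) blast
  show thesis
  proof (rule that[of "measure (mO S) (space (mO S)) + C"])
    show "0 \<le> measure (mO S) (space (mO S)) + C" using C(1) by simp
    fix u assume u: "u \<in> H1_Gamma0 S"
    show "(\<integral>\<^sup>+y. ennreal (\<bar>u y\<bar> powr k) \<partial>mO S) \<le> ennreal ((measure (mO S) (space (mO S)) + C) * grad_norm (Omega S) u powr k)"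
      by (rule power_interp[OF bounded_open_measure(1)[OF af(1,2,4)] Lp_measurable[OF H1_Lp_2[OF H1_Gamma0_H1[OF u]]]
            C(2)[OF u] C(1)]) (use k in auto)
  qed
qed

lemma Gamma_powr_embedding:
  assumes A: "admissible_domain S" and E: "embedding_constants S" and k: "0 < k"
  obtains C where "0 \<le> C" "\<And>w. w \<in> H20_Gamma S \<Longrightarrow>
    (\<integral>\<^sup>+y. ennreal (\<bar>w y\<bar> powr k) \<partial>mG S) \<le> ennreal (C * lap_norm (Gamma_plane S) w powr k)"
proof -
  note af = admissible_facts[OF A]
  obtain n :: nat where n: "k \<le> real n" using real_arch_simple by blast
  obtain C where C: "0 \<le> C" "\<And>w. w \<in> H20 (Gamma_plane S) \<Longrightarrow>
    (\<integral>\<^sup>+y. ennreal (\<bar>w y\<bar> ^ (2 * Suc n)) \<partial>mG S) \<le> ennreal (C * (lap_norm (Gamma_plane S) w) ^ (2 * Suc n))"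
  proof (rule H20_power_embedding[OF af(5,6), of "emb_c2 S" n])
    show "0 < emb_c2 S" using E by (simp add: embedding_constants_def)
    show "(Lp_norm 2 (mG S) w)\<^sup>2 \<le> emb_c2 S * (lap_norm (Gamma_plane S) w)\<^sup>2" if "w \<in> H20_Gamma S" for w
      using E that by (simp add: embedding_constants_def)
  qed blast
  show thesis
  proof (rule that[of "measure (mG S) (space (mG S)) + C"])
    show "0 \<le> measure (mG S) (space (mG S)) + C" using C(1) by simp
    fix w assume w: "w \<in> H20_Gamma S"
    then have wm: "w \<in> borel_measurable (mG S)" by (auto simp: H20_def dest!: H2_H1(1) H1_Lp_2 Lp_measurable)
    show "(\<integral>\<^sup>+y. ennreal (\<bar>w y\<bar> powr k) \<partial>mG S) \<le> ennreal ((measure (mG S) (space (mG S)) + C) * lap_norm (Gamma_plane S) w powr k)"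
      by (rule power_interp[OF bounded_open_measure(1)[OF af(5,6,7)] wm C(2)[OF w] C(1)]) (use k n in auto)
  qed
qed

text \<open>A real supremum is informative for a nonempty set that is bounded above:
  \<open>u0\<close> provides the first and \<open>C\<close> the second. Then \<open>K\<close> is the
  best constant. The bound itself excludes a nonzero function with \<open>nrm\<close> equal to
  0.\<close>

lemma Sup_ratio:
  fixes V :: "('a \<Rightarrow> real) set"
  assumes m: "\<And>u. u \<in> V \<Longrightarrow> u \<in> borel_measurable N" and k: "0 < k" and C: "0 \<le> C"
    and bd: "\<And>u. u \<in> V \<Longrightarrow> (\<integral>\<^sup>+y. ennreal (\<bar>u y\<bar> powr k) \<partial>N) \<le> ennreal (C * nrm u powr k)"
    and u0: "u0 \<in> V" "\<not> (AE x in N. u0 x = 0)"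
    and K: "K = Sup {Lp_norm k N u powr k / nrm u powr k | u. u \<in> V \<and> \<not> (AE x in N. u x = 0)}"
  shows "0 < K" "u \<in> V \<Longrightarrow> integrable N (\<lambda>y. \<bar>u y\<bar> powr k)" "u \<in> V \<Longrightarrow> (\<integral>y. \<bar>u y\<bar> powr k \<partial>N) \<le> K * nrm u powr k"
proof -
  have i: "integrable N (\<lambda>y. \<bar>u y\<bar> powr k)" if u: "u \<in> V" for u
    using m[OF u] bd[OF u] by (intro integrableI_bounded) (auto simp: le_less_trans[OF bd[OF u]])
  then show "u \<in> V \<Longrightarrow> integrable N (\<lambda>y. \<bar>u y\<bar> powr k)" .
  have le: "(\<integral>y. \<bar>u y\<bar> powr k \<partial>N) \<le> C * nrm u powr k" if u: "u \<in> V" for u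
    using bd[OF u] nn_integral_eq_integral[OF i[OF u]] C by simp
  have Lk: "Lp_norm k N u powr k = (\<integral>y. \<bar>u y\<bar> powr k \<partial>N)" if u: "u \<in> V" for u
    using k by (simp add: Lp_norm_def powr_powr)
  have pos: "0 < (\<integral>y. \<bar>u y\<bar> powr k \<partial>N)" if u: "u \<in> V" "\<not> (AE x in N. u x = 0)" for u
  proof -
    have "(\<integral>y. \<bar>u y\<bar> powr k \<partial>N) \<noteq> 0"
    proof
      assume "(\<integral>y. \<bar>u y\<bar> powr k \<partial>N) = 0"
      then have "AE x in N. \<bar>u x\<bar> powr k = 0" using i[OF u(1)] by (subst (asm) integral_nonneg_eq_0_iff_AE) auto
      then show False using u(2) by simp
    qed
    moreover have "0 \<le> (\<integral>y. \<bar>u y\<bar> powr k \<partial>N)" by simp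
    ultimately show ?thesis by linarith
  qed
  have npos: "0 < nrm u powr k" if u: "u \<in> V" "\<not> (AE x in N. u x = 0)" for u
    using le[OF u(1)] pos[OF u] C by (cases "nrm u powr k = 0") (auto simp: less_le)
  let ?X = "{Lp_norm k N u powr k / nrm u powr k | u. u \<in> V \<and> \<not> (AE x in N. u x = 0)}"
  have bdd: "bdd_above ?X"
  proof (rule bdd_aboveI[of _ C])
    fix x assume "x \<in> ?X"
    then obtain u where u: "u \<in> V" "\<not> (AE x in N. u x = 0)" "x = Lp_norm k N u powr k / nrm u powr k" by blast
    then show "x \<le> C" using le[OF u(1)] npos[OF u(1,2)] by (simp add: Lk pos_divide_le_eq)
  qed
  have upper: "Lp_norm k N u powr k / nrm u powr k \<le> K" if u: "u \<in> V" "\<not> (AE x in N. u x = 0)" for u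
    unfolding K using u by (intro cSup_upper[OF _ bdd]) blast
  have "0 < Lp_norm k N u0 powr k / nrm u0 powr k" using pos[OF u0] npos[OF u0] by (simp add: Lk[OF u0(1)])
  then show K0: "0 < K" using upper[OF u0] by linarith
  assume u: "u \<in> V"
  show "(\<integral>y. \<bar>u y\<bar> powr k \<partial>N) \<le> K * nrm u powr k"
  proof (cases "AE x in N. u x = 0")
    case True
    then have "(\<integral>y. \<bar>u y\<bar> powr k \<partial>N) = (\<integral>y. 0 \<partial>N)"
      using m[OF u] by (intro integral_cong_AE) (auto elim!: eventually_mono)
    then show ?thesis using K0 by simp
  next
    case False
    then show ?thesis using upper[OF u False] npos[OF u False] by (simp add: Lk[OF u] pos_divide_le_eq)
  qed
qed

lemma K1_props:
  assumes A: "admissible_domain S" and E: "embedding_constants S" and p: "1 < exp_p S" "exp_p S < 5"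
  shows "0 < K1 S" "u \<in> H1_Gamma0 S \<Longrightarrow> integrable (mO S) (\<lambda>y. \<bar>u y\<bar> powr (exp_p S + 1))"
    "u \<in> H1_Gamma0 S \<Longrightarrow> (\<integral>y. \<bar>u y\<bar> powr (exp_p S + 1) \<partial>mO S) \<le> K1 S * grad_norm (Omega S) u powr (exp_p S + 1)"
proof -
  note af = admissible_facts[OF A]
  have k: "0 < exp_p S + 1" "exp_p S + 1 \<le> 6" using p by auto
  obtain C where C: "0 \<le> C" "\<And>u. u \<in> H1_Gamma0 S \<Longrightarrow>
    (\<integral>\<^sup>+y. ennreal (\<bar>u y\<bar> powr (exp_p S + 1)) \<partial>mO S) \<le> ennreal (C * grad_norm (Omega S) u powr (exp_p S + 1))"
    by (rule Omega_powr_embedding[OF A E k]) blast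
  obtain f where f: "f \<in> test_functions (Omega S)" "\<not> (AE x in mO S. f x = 0)"
    by (rule exists_bump[OF af(1,4)])
  have m: "u \<in> borel_measurable (mO S)" if "u \<in> H1_Gamma0 S" for u
    using that by (auto dest!: H1_Gamma0_H1 H1_Lp_2 Lp_measurable)
  note R = Sup_ratio[of "H1_Gamma0 S" "mO S", OF m k(1) C(1) C(2) test_H1_Gamma0[OF A f(1)] f(2) K1_def]
  show "0 < K1 S" "u \<in> H1_Gamma0 S \<Longrightarrow> integrable (mO S) (\<lambda>y. \<bar>u y\<bar> powr (exp_p S + 1))"
    "u \<in> H1_Gamma0 S \<Longrightarrow> (\<integral>y. \<bar>u y\<bar> powr (exp_p S + 1) \<partial>mO S) \<le> K1 S * grad_norm (Omega S) u powr (exp_p S + 1)"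
    using R by blast+
qed

lemma H20_measurable: "w \<in> H20 U \<Longrightarrow> w \<in> borel_measurable (lebesgue_on U)"
  by (auto simp: H20_def dest!: H2_H1(1) H1_Lp_2 Lp_measurable)

lemma K2_props:
  assumes A: "admissible_domain S" and E: "embedding_constants S" and q: "1 < exp_q S"
  shows "0 < K2 S" "w \<in> H20_Gamma S \<Longrightarrow> integrable (mG S) (\<lambda>y. \<bar>w y\<bar> powr (exp_q S + 1))"
    "w \<in> H20_Gamma S \<Longrightarrow> (\<integral>y. \<bar>w y\<bar> powr (exp_q S + 1) \<partial>mG S) \<le> K2 S * lap_norm (Gamma_plane S) w powr (exp_q S + 1)"
proof -
  note af = admissible_facts[OF A]
  have k: "0 < exp_q S + 1" using q by auto
  obtain C where C: "0 \<le> C" "\<And>w. w \<in> H20_Gamma S \<Longrightarrow>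
    (\<integral>\<^sup>+y. ennreal (\<bar>w y\<bar> powr (exp_q S + 1)) \<partial>mG S) \<le> ennreal (C * lap_norm (Gamma_plane S) w powr (exp_q S + 1))"
    by (rule Gamma_powr_embedding[OF A E k]) blast
  obtain f where f: "f \<in> test_functions (Gamma_plane S)" "\<not> (AE x in mG S. f x = 0)"
    by (rule exists_bump[OF af(5,7)])
  note R = Sup_ratio[of "H20_Gamma S" "mG S", OF H20_measurable k(1) C(1) C(2) test_H2(3)[OF af(5,6) f(1)] f(2) K2_def]
  show "0 < K2 S" "w \<in> H20_Gamma S \<Longrightarrow> integrable (mG S) (\<lambda>y. \<bar>w y\<bar> powr (exp_q S + 1))"
    "w \<in> H20_Gamma S \<Longrightarrow> (\<integral>y. \<bar>w y\<bar> powr (exp_q S + 1) \<partial>mG S) \<le> K2 S * lap_norm (Gamma_plane S) w powr (exp_q S + 1)"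
    using R by blast+
qed

section \<open>The critical radius of the potential well\<close>

lemma powr_sum_strict_mono:
  fixes a b :: real
  assumes "0 < a" "0 < b" "1 < p" "1 < q" "0 \<le> s" "s < t"
  shows "a * s powr (p - 1) + b * s powr (q - 1) < a * t powr (p - 1) + b * t powr (q - 1)"
  using assms by (intro add_strict_mono mult_strict_left_mono powr_less_mono2) auto

lemma powr_sum_root:
  fixes a b :: real
  assumes ab: "0 < a" "0 < b" "1 < p" "1 < q"
  shows "\<exists>!s. 0 < s \<and> a * s powr (p - 1) + b * s powr (q - 1) = 1"
proof -
  define v where "v = (\<lambda>s. a * s powr (p - 1) + b * s powr (q - 1))"
  \<comment> \<open>At this \<open>t\<close> the first summand alone equals 1, so the root lies
    between 0 and \<open>t\<close>.\<close>
  define t where "t = (1 / a) powr (1 / (p - 1))"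
  have t: "0 < t" using ab by (simp add: t_def)
  have "t powr (p - 1) = 1 / a" using ab by (simp add: t_def powr_powr)
  then have vt: "1 \<le> v t" using ab by (simp add: v_def)
  have "continuous_on {0..t} v" unfolding v_def
    using ab by (intro continuous_intros continuous_on_powr') auto
  moreover have "v 0 \<le> 1" using ab by (simp add: v_def)
  ultimately obtain s where s: "0 \<le> s" "s \<le> t" "v s = 1" using IVT'[of v 0 1 t] vt t by auto
  have "s \<noteq> 0" using s(3) ab by (auto simp: v_def)
  then have "0 < s" using s by simp
  moreover have "s' = s" if "0 < s'" "v s' = 1" for s'
    using powr_sum_strict_mono[OF ab, of s s'] powr_sum_strict_mono[OF ab, of s' s] that s \<open>0 < s\<close>
    by (cases s s' rule: linorder_cases) (auto simp: v_def)
  ultimately show ?thesis using s(3) unfolding v_def by blast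
qed

text \<open>The derivative at \<open>x\<close> is \<open>x\<close> times 1 minus the expression
  bounded in the last assumption, and that expression is strictly increasing, hence below 1 before
  \<open>t\<close>.\<close>

lemma well_strict_mono:
  fixes A B :: real
  assumes ab: "0 < A" "0 < B" "1 < p" "1 < q" and st: "0 < s" "s < t"
    and t: "A * (p + 1) * t powr (p - 1) + B * (q + 1) * t powr (q - 1) \<le> 1"
  shows "1/2 * s\<^sup>2 - A * s powr (p + 1) - B * s powr (q + 1) < 1/2 * t\<^sup>2 - A * t powr (p + 1) - B * t powr (q + 1)"
proof (rule DERIV_pos_imp_increasing_open[OF st(2)])
  fix x assume x: "s < x" "x < t"
  have x0: "0 < x" using x st by simp
  have d: "((\<lambda>x. 1/2 * x\<^sup>2 - A * x powr (p + 1) - B * x powr (q + 1)) has_real_derivative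
     x - A * ((p + 1) * x powr p) - B * ((q + 1) * x powr q)) (at x)"
    using x0 by (auto intro!: derivative_eq_intros)
  have "A * (p + 1) * x powr (p - 1) + B * (q + 1) * x powr (q - 1) < 1"
    using powr_sum_strict_mono[of "A * (p + 1)" "B * (q + 1)" p q x t] ab t x x0 by simp
  then have "x * (A * (p + 1) * x powr (p - 1) + B * (q + 1) * x powr (q - 1)) < x * 1"
    using x0 by (intro mult_strict_left_mono) auto
  moreover have "x * x powr (p - 1) = x powr p" "x * x powr (q - 1) = x powr q"
    using x0 by (simp_all add: powr_mult_base)
  ultimately have "0 < x - A * ((p + 1) * x powr p) - B * ((q + 1) * x powr q)"
    by (simp add: algebra_simps)
  with d show "\<exists>y. ((\<lambda>x. 1/2 * x\<^sup>2 - A * x powr (p + 1) - B * x powr (q + 1)) has_real_derivative y) (at x) \<and> 0 < y"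
    by blast
next
  show "continuous_on {s..t} (\<lambda>x. 1/2 * x\<^sup>2 - A * x powr (p + 1) - B * x powr (q + 1))"
    using ab st by (intro continuous_intros continuous_on_powr') auto
qed

text \<open>\<open>const_xi S \<delta>\<close> is the left side of the equation defining
  \<open>s_star S\<close>, taken at the smaller argument \<open>s_star S - \<delta>\<close>; strict
  monotonicity puts it below 1.\<close>

lemma s_star_props:
  assumes K: "0 < K1 S" "0 < K2 S" and M: "0 < bound_M S" and pq: "1 < exp_p S" "1 < exp_q S"
  shows "0 < s_star S"
    and "0 < \<delta> \<Longrightarrow> \<delta> < s_star S \<Longrightarrow> const_xi S \<delta> < 1"
    and "0 < s \<Longrightarrow> s < t \<Longrightarrow> t \<le> s_star S \<Longrightarrow> Lambda S s < Lambda S t"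
proof -
  let ?v = "\<lambda>s. bound_M S * K1 S * (exp_p S + 1) * s powr (exp_p S - 1) + bound_M S * K2 S * (exp_q S + 1) * s powr (exp_q S - 1)"
  have ab: "0 < bound_M S * K1 S * (exp_p S + 1)" "0 < bound_M S * K2 S * (exp_q S + 1)" using K M pq by auto
  from theI'[OF powr_sum_root[OF ab pq]]
  have s: "0 < s_star S" "?v (s_star S) = 1" unfolding s_star_def by auto
  show "0 < s_star S" by (rule s(1))
  show "const_xi S \<delta> < 1" if "0 < \<delta>" "\<delta> < s_star S"
    using powr_sum_strict_mono[OF ab pq, of "s_star S - \<delta>" "s_star S"] that s
    by (simp add: const_xi_def mult_ac)
  show "Lambda S s < Lambda S t" if st: "0 < s" "s < t" "t \<le> s_star S"
  proof -
    have "?v t \<le> 1"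
      using powr_sum_strict_mono[OF ab pq, of t "s_star S"] st s by (cases "t = s_star S") auto
    then show ?thesis
      using well_strict_mono[of "bound_M S * K1 S" "bound_M S * K2 S" "exp_p S" "exp_q S" s t] K M pq st
      by (simp add: Lambda_def)
  qed
qed

section \<open>Functions of time and the damping terms\<close>

lemma lebesgue_interval_finite: "finite_measure (lebesgue_on {0..T::real})"
  by (intro finite_measure_lebesgue_on) simp

lemma integral_subinterval:
  fixes f :: "real \<Rightarrow> real"
  assumes "t \<le> T"
  shows "(\<integral>s. f s \<partial>lebesgue_on {0..t}) = (\<integral>s. indicator {0..t} s * f s \<partial>lebesgue_on {0..T})"
proof -
  have "(\<lambda>s. indicator {0..T} s * (indicator {0..t} s * f s)) = (\<lambda>s. indicator {0..t} s * f s)"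
    using assms by (auto split: split_indicator)
  then show ?thesis by (simp add: integral_restrict_space)
qed

lemma integral_interval_mono:
  fixes f :: "real \<Rightarrow> real"
  assumes "t \<le> T" "integrable (lebesgue_on {0..T}) f" "AE s in lebesgue_on {0..T}. 0 \<le> f s"
  shows "(\<integral>s. f s \<partial>lebesgue_on {0..t}) \<le> (\<integral>s. f s \<partial>lebesgue_on {0..T})"
proof -
  have "{0..t} \<in> sets (lebesgue_on {0..T})" using assms(1) by (auto simp: sets_restrict_space_iff)
  then have "integrable (lebesgue_on {0..T}) (\<lambda>s. indicator {0..t} s * f s)"
    using integrable_mult_indicator[OF _ assms(2)] by simp
  then show ?thesis
    unfolding integral_subinterval[OF assms(1), of f] using assms(2,3)
    by (intro integral_mono_AE) (auto split: split_indicator elim!: eventually_mono)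
qed

text \<open>Jensen's inequality for powers on a probability space, obtained from Young's inequality
  applied to \<open>|f|\<close> and a power of the mean of \<open>|f|\<close>.\<close>

lemma power_mean_nn:
  fixes f :: "'a \<Rightarrow> real"
  assumes N: "emeasure N (space N) = 1" and f: "f \<in> borel_measurable N" and k: "1 < k"
  shows "ennreal (\<bar>\<integral>x. f x \<partial>N\<bar> powr k) \<le> (\<integral>\<^sup>+x. ennreal (\<bar>f x\<bar> powr k) \<partial>N)"
proof (cases "(\<integral>\<^sup>+x. ennreal (\<bar>f x\<bar> powr k) \<partial>N) = \<infinity>")
  case False
  have fin: "finite_measure N" using N by (intro finite_measureI) simp
  have c1: "integrable N (\<lambda>x. c)" for c :: real by (rule finite_measure.integrable_const[OF fin])
  have m1: "measure N (space N) = 1" using N by (simp add: measure_def)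
  have i: "integrable N (\<lambda>x. \<bar>f x\<bar> powr k)"
    using f False by (intro integrableI_bounded) (auto simp: less_top)
  define q where "q = k / (k - 1)"
  have q: "1 < q" "1 / k + 1 / q = 1" "(k - 1) * q = k" using k by (auto simp: q_def field_simps)
  have if': "integrable N (\<lambda>x. \<bar>f x\<bar>)"
  proof (rule Bochner_Integration.integrable_bound)
    show "integrable N (\<lambda>x. \<bar>f x\<bar> powr k + 1)" using i c1[of 1] by (rule Bochner_Integration.integrable_add)
    have "a \<le> a powr k + 1" if "0 \<le> a" for a :: real
    proof (cases "a \<le> 1")
      case False
      then have "a powr 1 \<le> a powr k" using k by (intro powr_mono) auto
      then show ?thesis using False by simp
    next
      case True
      moreover have "0 \<le> a powr k" by simp
      ultimately show ?thesis by linarith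
    qed
    then show "AE x in N. norm \<bar>f x\<bar> \<le> norm (\<bar>f x\<bar> powr k + 1)" by (auto intro!: AE_I2)
  qed (use f in auto)
  define a where "a = (\<integral>x. \<bar>f x\<bar> \<partial>N)"
  have a: "0 \<le> a" by (simp add: a_def)
  have "a * a powr (k - 1) = (\<integral>x. \<bar>f x\<bar> * a powr (k - 1) \<partial>N)" using if' by (simp add: a_def)
  also have "\<dots> \<le> (\<integral>x. \<bar>f x\<bar> powr k / k + a powr k / q \<partial>N)"
  proof (rule integral_mono)
    show "integrable N (\<lambda>x. \<bar>f x\<bar> powr k / k + a powr k / q)"
      using i by (intro Bochner_Integration.integrable_add c1) auto
    fix x
    have "(a powr (k - 1)) powr q = a powr k" using q by (simp add: powr_powr)
    then show "\<bar>f x\<bar> * a powr (k - 1) \<le> \<bar>f x\<bar> powr k / k + a powr k / q"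
      using Youngs_inequality[OF k q(1,2), of "\<bar>f x\<bar>" "a powr (k - 1)"] by simp
  qed (use if' in auto)
  also have "\<dots> = (\<integral>x. \<bar>f x\<bar> powr k \<partial>N) / k + a powr k / q"
    using i c1[of "a powr k / q"] m1 by simp
  finally have "a powr k \<le> (\<integral>x. \<bar>f x\<bar> powr k \<partial>N) / k + a powr k / q"
    using a by (simp add: powr_mult_base)
  moreover have "a powr k / q = a powr k - a powr k / k"
  proof -
    have q1: "1 / q = 1 - 1 / k" using q(2) by simp
    have "a powr k / q = a powr k * (1 / q)" by simp
    also have "\<dots> = a powr k - a powr k / k" unfolding q1 by (simp add: right_diff_distrib)
    finally show ?thesis .
  qed
  ultimately have "a powr k / k \<le> (\<integral>x. \<bar>f x\<bar> powr k \<partial>N) / k" by simp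
  then have "a powr k \<le> (\<integral>x. \<bar>f x\<bar> powr k \<partial>N)" using k by (simp add: divide_le_cancel)
  moreover have "\<bar>\<integral>x. f x \<partial>N\<bar> powr k \<le> a powr k"
    unfolding a_def using k by (intro powr_mono2 integral_abs_bound) auto
  ultimately have "ennreal (\<bar>\<integral>x. f x \<partial>N\<bar> powr k) \<le> ennreal (\<integral>x. \<bar>f x\<bar> powr k \<partial>N)" by (intro ennreal_leI) simp
  also have "\<dots> = (\<integral>\<^sup>+x. ennreal (\<bar>f x\<bar> powr k) \<partial>N)" using i by (intro nn_integral_eq_integral[symmetric]) auto
  finally show ?thesis .
qed simp

text \<open>A jointly measurable version of the time derivative, integrated in time, yields a jointly
  measurable version of the function that is valid at every time, not only at almost every time.\<close>

lemma time_representative: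
  fixes N :: "'a measure" and V0 :: "real \<times> 'a \<Rightarrow> real"
  assumes fin: "finite_measure N" and v: "\<And>t. t \<in> {0..1} \<Longrightarrow> v t \<in> Lp 2 N"
    and d: "time_deriv 1 N v vt"
    and V0: "V0 \<in> borel_measurable (lebesgue_on {0..1} \<Otimes>\<^sub>M N)"
      "AE t in lebesgue_on {0..1}. AE x in N. vt t x = V0 (t, x)"
  obtains V where "V \<in> borel_measurable (lebesgue_on {0..1} \<Otimes>\<^sub>M N)"
    "\<And>t. t \<in> {0..1} \<Longrightarrow> AE x in N. v t x = V (t, x)"
    "\<And>t x. V (t, x) = v 0 x + (\<integral>s. (if s \<le> t then V0 (s, x) else 0) \<partial>lebesgue_on {0..1})"
proof -
  let ?T = "lebesgue_on {0..1::real}"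
  interpret T: finite_measure ?T by (rule lebesgue_interval_finite)
  interpret N: finite_measure N by (rule fin)
  interpret TN: pair_sigma_finite ?T N ..
  note V0(1) [measurable]
  have [measurable]: "v 0 \<in> borel_measurable N" using v[of 0] by (simp add: Lp_2_iff)
  have Tb [measurable]: "(\<lambda>s. s) \<in> borel_measurable ?T" by (intro measurable_restrict_space1 measurable_completion) simp
  define V where "V = (\<lambda>(t, x). v 0 x + (\<integral>s. (if s \<le> t then V0 (s, x) else 0) \<partial>?T))"
  have Vm: "V \<in> borel_measurable (?T \<Otimes>\<^sub>M N)" unfolding V_def by measurable
  have vt: "AE t in ?T. vt t \<in> Lp 2 N" "integrable ?T (\<lambda>t. Lp_norm 2 N (vt t))"
    and der: "\<And>z t. z \<in> Lp 2 N \<Longrightarrow> t \<in> {0..1} \<Longrightarrow> L2_inner N (v t) z - L2_inner N (v 0) z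
        = (\<integral>\<tau>. L2_inner N (vt \<tau>) z \<partial>lebesgue_on {0..t})"
    using d unfolding time_deriv_def L1_L2_def by auto
  have ind: "(\<lambda>x. indicator A x) \<in> Lp 2 N" if "A \<in> sets N" for A
  proof -
    have "(\<lambda>x. (indicator A x :: real)\<^sup>2) = indicator A" by (auto split: split_indicator)
    then show ?thesis using that N.emeasure_finite[of A]
      by (simp add: Lp_2_iff integrable_real_indicator less_top[symmetric] del: N.emeasure_finite)
  qed
  define c where "c = Lp_norm 2 N (\<lambda>x. indicator (space N) x)"
  \<comment> \<open>Constants are square integrable on a finite measure space, so the spatial
    \<open>L1\<close> norm at almost every time is at most a multiple of the \<open>L2\<close> norm,
    which is integrable in time.\<close>
  have V0i: "integrable (?T \<Otimes>\<^sub>M N) V0"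
  proof (rule integrableI_bounded)
    have "(\<integral>\<^sup>+p. ennreal (norm (V0 p)) \<partial>(?T \<Otimes>\<^sub>M N)) = (\<integral>\<^sup>+t. \<integral>\<^sup>+x. ennreal (norm (V0 (t, x))) \<partial>N \<partial>?T)"
      by (rule N.nn_integral_fst[symmetric]) measurable
    also have "\<dots> \<le> (\<integral>\<^sup>+t. ennreal (Lp_norm 2 N (vt t) * c) \<partial>?T)"
    proof (rule nn_integral_mono_AE, use V0(2) vt(1) in eventually_elim)
      case (elim t)
      have a: "(\<lambda>x. \<bar>vt t x\<bar>) \<in> Lp 2 N" using elim(2) by (auto simp: Lp_2_iff)
      have "(\<integral>\<^sup>+x. ennreal (norm (V0 (t, x))) \<partial>N) = (\<integral>\<^sup>+x. ennreal (\<bar>vt t x\<bar> * indicator (space N) x) \<partial>N)"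
        using elim(1) by (intro nn_integral_cong_AE) (auto elim!: eventually_mono)
      also have "\<dots> = ennreal (\<integral>x. \<bar>vt t x\<bar> * indicator (space N) x \<partial>N)"
        using L2_mult_integrable[OF a ind[of "space N"]] by (intro nn_integral_eq_integral) auto
      also have "\<dots> \<le> ennreal (Lp_norm 2 N (vt t) * c)"
        using L2_Cauchy_Schwarz[OF a ind[of "space N"]]
        by (intro ennreal_leI) (simp add: L2_inner_def c_def L2_norm_eq)
      finally show ?case .
    qed
    also have "\<dots> = ennreal (\<integral>t. Lp_norm 2 N (vt t) * c \<partial>?T)"
      using vt(2) by (intro nn_integral_eq_integral) (auto simp: c_def)
    also have "\<dots> < \<infinity>" by simp
    finally show "(\<integral>\<^sup>+p. ennreal (norm (V0 p)) \<partial>(?T \<Otimes>\<^sub>M N)) < \<infinity>" .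
  qed (rule V0(1))
  have rep: "AE x in N. v t x = V (t, x)" if t: "t \<in> {0..1}" for t
  proof -
    define W where "W = (\<lambda>x. \<integral>s. (if s \<le> t then V0 (s, x) else 0) \<partial>?T)"
    have Vt: "V (t, x) = v 0 x + W x" for x by (simp add: V_def W_def)
    have i1: "integrable (?T \<Otimes>\<^sub>M N) (\<lambda>(s, x). if s \<le> t then V0 (s, x) else 0)"
      by (rule Bochner_Integration.integrable_bound[OF V0i]) (measurable, auto intro!: AE_I2)
    have Wi: "integrable N W" unfolding W_def using TN.integrable_snd[OF i1] by simp
    have vL: "v t \<in> Lp 2 N" "v 0 \<in> Lp 2 N" using v t by auto
    have vi: "integrable N (v t)" "integrable N (v 0)"
    proof -
      have "(\<lambda>x. f x * indicator (space N) x) \<in> borel_measurable N \<and> integrable N (\<lambda>x. f x * indicator (space N) x)"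
        if "f \<in> Lp 2 N" for f using L2_mult_integrable[OF that ind[of "space N"]] by auto
      moreover have "integrable N (\<lambda>x. f x * indicator (space N) x) \<longleftrightarrow> integrable N f" for f :: "'a \<Rightarrow> real"
        by (intro Bochner_Integration.integrable_cong) auto
      ultimately show "integrable N (v t)" "integrable N (v 0)" using vL by blast+
    qed
    have "AE x in N. v t x = V (t, x)"
    \<comment> \<open>Both functions are compared through their integrals over measurable sets
      \<open>A\<close>: the derivative identity is tested with the indicator of \<open>A\<close>,
      and Fubini exchanges time and space.\<close>
    proof (rule density_unique_real)
      show "integrable N (v t)" by (rule vi)
      show "integrable N (\<lambda>x. V (t, x))" unfolding Vt using vi Wi by auto
      fix A assume A: "A \<in> sets N"
      have i2: "integrable (?T \<Otimes>\<^sub>M N) (\<lambda>(s, x). (if s \<le> t then V0 (s, x) else 0) * indicator A x)"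
      proof (rule Bochner_Integration.integrable_bound[OF V0i])
        show "(\<lambda>(s, x). (if s \<le> t then V0 (s, x) else 0) * indicator A x) \<in> borel_measurable (?T \<Otimes>\<^sub>M N)"
          using A by measurable
      qed (auto intro!: AE_I2 split: split_indicator)
      have "(\<integral>x. v t x * indicator A x \<partial>N) - (\<integral>x. v 0 x * indicator A x \<partial>N)
         = (\<integral>\<tau>. L2_inner N (vt \<tau>) (\<lambda>x. indicator A x) \<partial>lebesgue_on {0..t})"
        using der[OF ind[OF A] t] by (simp add: L2_inner_def)
      also have "\<dots> = (\<integral>\<tau>. indicator {0..t} \<tau> * L2_inner N (vt \<tau>) (\<lambda>x. indicator A x) \<partial>?T)"
        using t by (intro integral_subinterval) auto
      also have "\<dots> = (\<integral>\<tau>. \<integral>x. (if \<tau> \<le> t then V0 (\<tau>, x) else 0) * indicator A x \<partial>N \<partial>?T)"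
      proof (rule integral_cong_AE)
        show m2: "(\<lambda>\<tau>. \<integral>x. (if \<tau> \<le> t then V0 (\<tau>, x) else 0) * indicator A x \<partial>N) \<in> borel_measurable ?T"
          using A by measurable
        have sp: "AE \<tau> in ?T. \<tau> \<in> {0..1}" by (rule AE_I2) simp
        show ae: "AE \<tau> in ?T. indicator {0..t} \<tau> * L2_inner N (vt \<tau>) (\<lambda>x. indicator A x)
           = (\<integral>x. (if \<tau> \<le> t then V0 (\<tau>, x) else 0) * indicator A x \<partial>N)"
          using V0(2) vt(1) sp AE_space[of ?T]
        proof eventually_elim
          case (elim \<tau>)
          have m: "(\<lambda>x. V0 (\<tau>, x)) \<in> borel_measurable N" using measurable_Pair2[OF V0(1) elim(4)] .
          have "L2_inner N (vt \<tau>) (\<lambda>x. indicator A x) = (\<integral>x. V0 (\<tau>, x) * indicator A x \<partial>N)"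
            unfolding L2_inner_def using elim(1,2) A m by (intro integral_cong_AE) (auto simp: Lp_2_iff elim!: eventually_mono)
          then show ?case using elim(3) by (auto split: split_indicator)
        qed
        have ae2: "AE \<tau> in ?T. (\<integral>x. (if \<tau> \<le> t then V0 (\<tau>, x) else 0) * indicator A x \<partial>N)
           = indicator {0..t} \<tau> * L2_inner N (vt \<tau>) (\<lambda>x. indicator A x)"
          using ae by eventually_elim simp
        show "(\<lambda>\<tau>. indicator {0..t} \<tau> * L2_inner N (vt \<tau>) (\<lambda>x. indicator A x)) \<in> borel_measurable ?T"
          \<comment> \<open>Measurability in time of the pairing with \<open>vt\<close> is inferred
            from the jointly measurable side by completeness.\<close>
          by (rule lebesgue_on_complete[OF _ m2 ae2]) simp
      qed
      also have "\<dots> = (\<integral>x. \<integral>\<tau>. (if \<tau> \<le> t then V0 (\<tau>, x) else 0) * indicator A x \<partial>?T \<partial>N)"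
        using TN.Fubini_integral[OF i2] by simp
      also have "\<dots> = (\<integral>x. W x * indicator A x \<partial>N)" by (simp add: W_def)
      finally have "(\<integral>x. v t x * indicator A x \<partial>N) = (\<integral>x. v 0 x * indicator A x \<partial>N) + (\<integral>x. W x * indicator A x \<partial>N)"
        by simp
      also have "\<dots> = (\<integral>x. v 0 x * indicator A x + W x * indicator A x \<partial>N)"
        using integrable_real_mult_indicator[OF A vi(2)] integrable_real_mult_indicator[OF A Wi] by simp
      finally show "(\<integral>x\<in>A. v t x \<partial>N) = (\<integral>x\<in>A. V (t, x) \<partial>N)"
        by (simp add: set_lebesgue_integral_def Vt algebra_simps)
    qed
    then show ?thesis .
  qed
  show thesis by (rule that[OF Vm rep]) (simp_all add: V_def)
qed

text \<open>The power mean inequality bounds the time integral by the \<open>L^k\<close> norm in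
  time, without a further factor because the interval has length 1. It places \<open>u\<close> in
  the class of admissible test functions, given \<open>u0\<close> and \<open>ut\<close> in
  \<open>L^(m+1)\<close>.\<close>

lemma time_representative_Lp:
  fixes N :: "'a measure" and V0 V :: "real \<times> 'a \<Rightarrow> real"
  assumes fin: "finite_measure N" and k: "1 < k" and v0: "v0 \<in> Lp k N"
    and V0: "V0 \<in> Lp k (lebesgue_on {0..1} \<Otimes>\<^sub>M N)"
    and V: "V \<in> borel_measurable (lebesgue_on {0..1} \<Otimes>\<^sub>M N)"
      "\<And>t x. V (t, x) = v0 x + (\<integral>s. (if s \<le> t then V0 (s, x) else 0) \<partial>lebesgue_on {0..1})"
  shows "V \<in> Lp k (lebesgue_on {0..1} \<Otimes>\<^sub>M N)"
proof -
  let ?T = "lebesgue_on {0..1::real}"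
  interpret T: finite_measure ?T by (rule lebesgue_interval_finite)
  interpret N: finite_measure N by (rule fin)
  interpret TN: pair_sigma_finite ?T N ..
  have T1: "emeasure ?T (space ?T) = 1" by (simp add: emeasure_restrict_space)
  have V0m [measurable]: "V0 \<in> borel_measurable (?T \<Otimes>\<^sub>M N)" using V0 by (simp add: Lp_def)
  have v0m [measurable]: "v0 \<in> borel_measurable N" using v0 by (simp add: Lp_def)
  note V(1) [measurable]
  have Tb [measurable]: "(\<lambda>s. s) \<in> borel_measurable ?T" by (intro measurable_restrict_space1 measurable_completion) simp
  have two: "\<bar>a + b\<bar> powr k \<le> 2 powr k * (\<bar>a\<bar> powr k + \<bar>b\<bar> powr k)" for a b :: real
  proof -
    have "\<bar>a + b\<bar> \<le> 2 * max \<bar>a\<bar> \<bar>b\<bar>" by linarith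
    then have "\<bar>a + b\<bar> powr k \<le> (2 * max \<bar>a\<bar> \<bar>b\<bar>) powr k" using k by (intro powr_mono2) auto
    also have "\<dots> = 2 powr k * (max \<bar>a\<bar> \<bar>b\<bar>) powr k" by (simp add: powr_mult)
    also have "(max \<bar>a\<bar> \<bar>b\<bar>) powr k \<le> \<bar>a\<bar> powr k + \<bar>b\<bar> powr k" by (simp add: max_def)
    finally show ?thesis by simp
  qed
  have pt: "ennreal (\<bar>V (t, x)\<bar> powr k) \<le> ennreal (2 powr k) * (ennreal (\<bar>v0 x\<bar> powr k) + (\<integral>\<^sup>+s. ennreal (\<bar>V0 (s, x)\<bar> powr k) \<partial>?T))"
    if x: "x \<in> space N" for t x
  proof -
    let ?f = "\<lambda>s. if s \<le> t then V0 (s, x) else 0"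
    have m: "(\<lambda>s. V0 (s, x)) \<in> borel_measurable ?T" using measurable_Pair1[OF V0m x] .
    have fm: "?f \<in> borel_measurable ?T" using m by measurable
    have "ennreal (\<bar>V (t, x)\<bar> powr k) \<le> ennreal (2 powr k * (\<bar>v0 x\<bar> powr k + \<bar>\<integral>s. ?f s \<partial>?T\<bar> powr k))"
      unfolding V(2) by (intro ennreal_leI two)
    also have "\<dots> = ennreal (2 powr k) * (ennreal (\<bar>v0 x\<bar> powr k) + ennreal (\<bar>\<integral>s. ?f s \<partial>?T\<bar> powr k))"
      by (simp add: ennreal_mult)
    also have "\<dots> \<le> ennreal (2 powr k) * (ennreal (\<bar>v0 x\<bar> powr k) + (\<integral>\<^sup>+s. ennreal (\<bar>?f s\<bar> powr k) \<partial>?T))"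
      by (intro mult_left_mono add_left_mono power_mean_nn[OF T1 fm k]) auto
    also have "\<dots> \<le> ennreal (2 powr k) * (ennreal (\<bar>v0 x\<bar> powr k) + (\<integral>\<^sup>+s. ennreal (\<bar>V0 (s, x)\<bar> powr k) \<partial>?T))"
      by (intro mult_left_mono add_left_mono nn_integral_mono ennreal_leI) auto
    finally show ?thesis .
  qed
  have "(\<integral>\<^sup>+p. ennreal (\<bar>V p\<bar> powr k) \<partial>(?T \<Otimes>\<^sub>M N)) = (\<integral>\<^sup>+t. \<integral>\<^sup>+x. ennreal (\<bar>V (t, x)\<bar> powr k) \<partial>N \<partial>?T)"
    by (rule N.nn_integral_fst[symmetric]) measurable
  also have "\<dots> \<le> (\<integral>\<^sup>+t. (\<integral>\<^sup>+x. ennreal (2 powr k) * (ennreal (\<bar>v0 x\<bar> powr k) + (\<integral>\<^sup>+s. ennreal (\<bar>V0 (s, x)\<bar> powr k) \<partial>?T)) \<partial>N) \<partial>?T)"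
    by (intro nn_integral_mono pt)
  also have "\<dots> = (\<integral>\<^sup>+x. ennreal (2 powr k) * (ennreal (\<bar>v0 x\<bar> powr k) + (\<integral>\<^sup>+s. ennreal (\<bar>V0 (s, x)\<bar> powr k) \<partial>?T)) \<partial>N)"
    unfolding nn_integral_const T1 by simp
  also have "\<dots> = ennreal (2 powr k) * ((\<integral>\<^sup>+x. ennreal (\<bar>v0 x\<bar> powr k) \<partial>N) + (\<integral>\<^sup>+x. \<integral>\<^sup>+s. ennreal (\<bar>V0 (s, x)\<bar> powr k) \<partial>?T \<partial>N))"
    by (simp add: nn_integral_cmult nn_integral_add)
  also have "(\<integral>\<^sup>+x. \<integral>\<^sup>+s. ennreal (\<bar>V0 (s, x)\<bar> powr k) \<partial>?T \<partial>N) = (\<integral>\<^sup>+p. ennreal (\<bar>V0 p\<bar> powr k) \<partial>(?T \<Otimes>\<^sub>M N))"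
    by (rule TN.nn_integral_snd) measurable
  also have "ennreal (2 powr k) * ((\<integral>\<^sup>+x. ennreal (\<bar>v0 x\<bar> powr k) \<partial>N) + \<dots>) < \<infinity>"
  proof -
    have "(\<integral>\<^sup>+x. ennreal (\<bar>v0 x\<bar> powr k) \<partial>N) < \<infinity>"
      using v0 by (simp add: Lp_def nn_integral_eq_integral)
    moreover have "(\<integral>\<^sup>+p. ennreal (\<bar>V0 p\<bar> powr k) \<partial>(?T \<Otimes>\<^sub>M N)) < \<infinity>"
      using V0 by (simp add: Lp_def nn_integral_eq_integral)
    ultimately show ?thesis by (simp add: ennreal_mult_less_top)
  qed
  finally have "integrable (?T \<Otimes>\<^sub>M N) (\<lambda>p. \<bar>V p\<bar> powr k)"
    by (intro integrableI_bounded) auto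
  then show ?thesis using V(1) by (simp add: Lp_def)
qed

section \<open>Damping inequalities, pointwise and integrated\<close>

text \<open>Monotonicity with \<open>g 0 = 0\<close> gives the sign. For small \<open>s\<close> the
  values of \<open>g\<close> lie between those at -1 and 1, which explains the extra
  \<open>\<beta>\<close>. The last claim combines \<open>|g s| <= \<beta> * |s|^k\<close> with one
  remaining factor \<open>|g s|\<close>.\<close>

lemma damping_basic:
  assumes g: "damping_condition g \<alpha> \<beta> k" and ab: "0 < \<alpha>" "0 < \<beta>"
  shows "g \<in> borel_measurable borel" "1 \<le> k" "0 \<le> g s * s" "g s * s \<le> \<beta> + \<beta> * \<bar>s\<bar> powr (k + 1)"
    "1 \<le> \<bar>s\<bar> \<Longrightarrow> s\<^sup>2 \<le> g s * s / \<alpha>"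
    "1 \<le> \<bar>s\<bar> \<Longrightarrow> \<bar>g s\<bar> powr ((k + 1) / k) \<le> \<beta> powr (1 / k) * (g s * s)"
proof -
  show "g \<in> borel_measurable borel" using g borel_measurable_continuous_onI by (auto simp: damping_condition_def)
  show k: "1 \<le> k" using g by (simp add: damping_condition_def)
  have mono: "g x \<le> g y" if "x \<le> y" for x y using g that by (auto simp: damping_condition_def mono_def)
  have g0: "g 0 = 0" using g by (simp add: damping_condition_def)
  have G: "\<alpha> * \<bar>s\<bar> powr (k + 1) \<le> g s * s" "g s * s \<le> \<beta> * \<bar>s\<bar> powr (k + 1)" if "1 \<le> \<bar>s\<bar>" for s
    using g that by (auto simp: damping_condition_def)
  show nn: "0 \<le> g s * s" for s
  proof (cases "0 \<le> s")
    case True then show ?thesis using mono[of 0 s] g0 by simp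
  next
    case False then show ?thesis using mono[of s 0] g0 by (simp add: mult_nonpos_nonpos)
  qed
  show "g s * s \<le> \<beta> + \<beta> * \<bar>s\<bar> powr (k + 1)"
  proof (cases "1 \<le> \<bar>s\<bar>")
    case True then show ?thesis using G(2)[OF True] ab by simp
  next
    case False
    have "s \<le> 1" "- 1 \<le> s" using False by linarith+
    then have "\<bar>g s\<bar> \<le> \<beta>" using mono[of s 1] mono[of "-1" s] G(2)[of 1] G(2)[of "-1"] by auto
    then have "\<bar>g s\<bar> * \<bar>s\<bar> \<le> \<beta> * 1" using False ab by (intro mult_mono) auto
    then have "g s * s \<le> \<beta>" using abs_ge_self[of "g s * s"] by (simp add: abs_mult)
    moreover have "0 \<le> \<beta> * \<bar>s\<bar> powr (k + 1)" using ab by simp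
    ultimately show ?thesis by linarith
  qed
  assume s: "1 \<le> \<bar>s\<bar>"
  have "\<bar>s\<bar> powr 2 \<le> \<bar>s\<bar> powr (k + 1)" using s k by (intro powr_mono) auto
  then have "\<alpha> * s\<^sup>2 \<le> \<alpha> * \<bar>s\<bar> powr (k + 1)" using ab by (simp add: abs_powr_2 mult_left_mono)
  also have "\<dots> \<le> g s * s" by (rule G(1)[OF s])
  finally have "\<alpha> * s\<^sup>2 \<le> g s * s" .
  then show "s\<^sup>2 \<le> g s * s / \<alpha>" using ab by (simp add: pos_le_divide_eq mult.commute)
  have s0: "0 < \<bar>s\<bar>" using s by simp
  have gs: "g s * s = \<bar>g s\<bar> * \<bar>s\<bar>" using nn[of s] by (metis abs_mult abs_of_nonneg)
  have "\<bar>g s\<bar> * \<bar>s\<bar> \<le> (\<beta> * \<bar>s\<bar> powr k) * \<bar>s\<bar>"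
    using G(2)[OF s] s0 by (simp add: gs powr_add mult.assoc)
  then have gk: "\<bar>g s\<bar> \<le> \<beta> * \<bar>s\<bar> powr k" using s0 by simp
  have "\<bar>g s\<bar> powr ((k + 1) / k) = \<bar>g s\<bar> * \<bar>g s\<bar> powr (1 / k)"
    using k by (cases "g s = 0") (simp_all add: add_divide_distrib powr_add)
  also have "\<dots> \<le> \<bar>g s\<bar> * (\<beta> * \<bar>s\<bar> powr k) powr (1 / k)"
    using gk k by (intro mult_left_mono powr_mono2) auto
  also have "(\<beta> * \<bar>s\<bar> powr k) powr (1 / k) = \<beta> powr (1 / k) * \<bar>s\<bar>"
    using ab s0 k by (simp add: powr_mult powr_powr)
  finally show "\<bar>g s\<bar> powr ((k + 1) / k) \<le> \<beta> powr (1 / k) * (g s * s)"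
    unfolding gs by (simp only: mult_ac)
qed

text \<open>Young's inequality with the conjugate exponents \<open>(k + 1) / k\<close> and
  \<open>k + 1\<close>; the first power of \<open>g\<close> is controlled by the dissipation
  density.\<close>

lemma damping_Young:
  assumes g: "damping_condition g \<alpha> \<beta> k" and ab: "0 < \<alpha>" "0 < \<beta>" and e: "0 < \<epsilon>" and s: "1 \<le> \<bar>s\<bar>"
  shows "\<bar>g s\<bar> * \<bar>y\<bar> \<le> \<epsilon> powr (- 1 / k) * \<beta> powr (1 / k) * (g s * s) + \<epsilon> * \<bar>y\<bar> powr (k + 1)"
proof -
  note B = damping_basic[OF g ab]
  have k: "1 \<le> k" by (rule B(2))
  \<comment> \<open>The weight is chosen so that its power \<open>k + 1\<close> is exactly
    \<open>\<epsilon>\<close>.\<close>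
  define l where "l = \<epsilon> powr (1 / (k + 1))"
  have l: "0 < l" using e by (simp add: l_def)
  have pq: "1 < (k + 1) / k" "1 < k + 1" "1 / ((k + 1) / k) + 1 / (k + 1) = 1" using k by (auto simp: field_simps)
  have lp: "l powr (k + 1) = \<epsilon>" "l powr ((k + 1) / k) = \<epsilon> powr (1 / k)" using k e by (auto simp: l_def powr_powr)
  have "\<bar>g s\<bar> * \<bar>y\<bar> = (\<bar>g s\<bar> / l) * (l * \<bar>y\<bar>)" using l by simp
  also have "\<dots> \<le> (\<bar>g s\<bar> / l) powr ((k + 1) / k) / ((k + 1) / k) + (l * \<bar>y\<bar>) powr (k + 1) / (k + 1)"
    using l by (intro Youngs_inequality[OF pq]) auto
  also have "\<dots> \<le> (\<bar>g s\<bar> / l) powr ((k + 1) / k) + (l * \<bar>y\<bar>) powr (k + 1)"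
  proof -
    have dv: "x / p \<le> x" if "0 \<le> x" "1 < p" for x p :: real
      using divide_left_mono[of 1 p x] that by simp
    show ?thesis by (intro add_mono dv powr_ge_zero pq)
  qed
  also have "(\<bar>g s\<bar> / l) powr ((k + 1) / k) = \<epsilon> powr (- 1 / k) * \<bar>g s\<bar> powr ((k + 1) / k)"
  proof -
    have "(\<bar>g s\<bar> / l) powr ((k + 1) / k) = \<bar>g s\<bar> powr ((k + 1) / k) / l powr ((k + 1) / k)"
      by (rule powr_divide)
    moreover have "\<epsilon> powr (- 1 / k) = 1 / \<epsilon> powr (1 / k)" using powr_minus_divide[of \<epsilon> "1 / k"] by simp
    ultimately show ?thesis unfolding lp by simp
  qed
  also have "(l * \<bar>y\<bar>) powr (k + 1) = \<epsilon> * \<bar>y\<bar> powr (k + 1)" using l by (simp add: powr_mult lp)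
  also have "\<epsilon> powr (- 1 / k) * \<bar>g s\<bar> powr ((k + 1) / k) \<le> \<epsilon> powr (- 1 / k) * (\<beta> powr (1 / k) * (g s * s))"
    by (intro mult_left_mono B(6) s) auto
  finally show ?thesis by (simp add: mult.assoc)
qed

text \<open>For a concave function vanishing at 0 the quotient \<open>\<phi> s / s\<close>
  decreases, which handles \<open>s\<close> beyond \<open>D\<close>; below \<open>D\<close>
  monotonicity does. The result is affine in \<open>s\<close> and can be integrated.\<close>

lemma concave_majorant_scale:
  assumes c: "concave_majorant \<phi> g" and s: "0 \<le> s" and D: "0 < D"
  shows "\<phi> s \<le> \<phi> D * (1 + s / D)"
proof -
  have m: "mono_on {0..} \<phi>" and cc: "concave_on {0..} \<phi>" and p0: "\<phi> 0 = 0" and nn: "\<And>s. 0 \<le> s \<Longrightarrow> 0 \<le> \<phi> s"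
    using c by (auto simp: concave_majorant_def)
  have D0: "0 \<le> \<phi> D * (s / D)" using nn[of D] s D by simp
  show ?thesis
  proof (cases "s \<le> D")
    case True
    then have "\<phi> s \<le> \<phi> D" using m s by (auto intro: mono_onD)
    then show ?thesis using D0 by (simp add: distrib_left)
  next
    case False
    then have sp: "0 < s" using D by simp
    have "(1 - D / s) * \<phi> 0 + (D / s) * \<phi> s \<le> \<phi> ((1 - D / s) *\<^sub>R 0 + (D / s) *\<^sub>R s)"
      using False D sp by (intro concave_onD[OF cc]) auto
    then have "(D / s) * \<phi> s \<le> \<phi> D" using p0 sp by simp
    then have "\<phi> s \<le> \<phi> D * (s / D)" using sp D by (simp add: field_simps)
    moreover have "0 \<le> \<phi> D" using nn D by simp
    ultimately show ?thesis by (simp add: distrib_left)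
  qed
qed

text \<open>Continuity of \<open>\<phi>\<close> is known on the half-line alone; composing with
  \<open>max 0\<close> extends it continuously.\<close>

lemma concave_majorant_measurable:
  assumes c: "concave_majorant \<phi> g" and f: "f \<in> borel_measurable Q" "\<And>x. 0 \<le> f x"
  shows "(\<lambda>x. \<phi> (f x)) \<in> borel_measurable Q"
proof -
  have pc: "continuous_on {0..} \<phi>" using c by (simp add: concave_majorant_def)
  have "continuous_on UNIV (\<lambda>x. \<phi> (max 0 x))"
  proof (rule continuous_on_compose2[OF pc])
    show "continuous_on UNIV (\<lambda>x::real. max 0 x)" by (intro continuous_intros)
  qed auto
  then have "(\<lambda>x. \<phi> (max 0 x)) \<in> borel_measurable borel" by (rule borel_measurable_continuous_onI)
  from measurable_compose[OF f(1) this] show ?thesis using f(2) by (simp add: max_absorb2)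
qed

text \<open>Jensen's inequality in a form without normalisation: integrate the affine bound at
  \<open>D\<close>, the integral of \<open>f\<close> itself, so that its linear part contributes
  exactly \<open>\<phi> D\<close>.\<close>

lemma concave_majorant_integral:
  assumes fin: "finite_measure Q" and c: "concave_majorant \<phi> g"
    and f: "integrable Q f" "\<And>x. 0 \<le> f x"
  shows "(\<integral>\<^sup>+x. ennreal (\<phi> (f x)) \<partial>Q) \<le> ennreal (\<phi> (\<integral>x. f x \<partial>Q) * (measure Q (space Q) + 1))"
proof -
  define D where "D = (\<integral>x. f x \<partial>Q)"
  have D: "0 \<le> D" using f by (simp add: D_def)
  have p0: "\<phi> 0 = 0" and nn: "\<And>s. 0 \<le> s \<Longrightarrow> 0 \<le> \<phi> s" using c by (auto simp: concave_majorant_def)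
  have c1: "integrable Q (\<lambda>x. c)" for c :: real by (rule finite_measure.integrable_const[OF fin])
  show ?thesis
  proof (cases "D = 0")
    case True
    then have "AE x in Q. f x = 0" unfolding D_def using f by (subst (asm) integral_nonneg_eq_0_iff_AE) auto
    then have "(\<integral>\<^sup>+x. ennreal (\<phi> (f x)) \<partial>Q) = (\<integral>\<^sup>+x. 0 \<partial>Q)"
      by (intro nn_integral_cong_AE) (auto elim!: eventually_mono simp: p0)
    then show ?thesis by simp
  next
    case False
    with D have Dp: "0 < D" by simp
    have "(\<integral>\<^sup>+x. ennreal (\<phi> (f x)) \<partial>Q) \<le> (\<integral>\<^sup>+x. ennreal (\<phi> D + \<phi> D / D * f x) \<partial>Q)"
      using concave_majorant_scale[OF c f(2) Dp] by (intro nn_integral_mono ennreal_leI) (simp add: distrib_left)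
    also have "\<dots> = ennreal (\<integral>x. \<phi> D + \<phi> D / D * f x \<partial>Q)"
      using f nn[of D] Dp
      by (intro nn_integral_eq_integral Bochner_Integration.integrable_add c1) auto
    also have "(\<integral>x. \<phi> D + \<phi> D / D * f x \<partial>Q) = \<phi> D * measure Q (space Q) + \<phi> D / D * D"
      using f c1[of "\<phi> D"] by (simp add: D_def[symmetric])
    also have "\<dots> = \<phi> D * (measure Q (space Q) + 1)" using Dp by (simp add: distrib_left)
    finally show ?thesis unfolding D_def .
  qed
qed

lemma damping_integrable:
  assumes fin: "finite_measure Q" and g: "damping_condition g \<alpha> \<beta> k" and ab: "0 < \<alpha>" "0 < \<beta>"
    and V0: "V0 \<in> Lp (k + 1) Q"
  shows "integrable Q (\<lambda>x. g (V0 x) * V0 x)"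
proof (rule Bochner_Integration.integrable_bound)
  note B = damping_basic[OF g ab]
  have m: "V0 \<in> borel_measurable Q" using V0 by (simp add: Lp_def)
  show "integrable Q (\<lambda>x. \<beta> + \<beta> * \<bar>V0 x\<bar> powr (k + 1))"
    using V0 by (intro Bochner_Integration.integrable_add finite_measure.integrable_const[OF fin]) (auto simp: Lp_def)
  show "(\<lambda>x. g (V0 x) * V0 x) \<in> borel_measurable Q"
    using m measurable_compose[OF m B(1)] by (intro borel_measurable_times) auto
  show "AE x in Q. norm (g (V0 x) * V0 x) \<le> norm (\<beta> + \<beta> * \<bar>V0 x\<bar> powr (k + 1))"
  proof (rule AE_I2)
    fix x
    have "norm (g (V0 x) * V0 x) = g (V0 x) * V0 x" unfolding real_norm_def by (rule abs_of_nonneg[OF B(3)])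
    also have "\<dots> \<le> \<beta> + \<beta> * \<bar>V0 x\<bar> powr (k + 1)" by (rule B(4))
    also have "\<dots> \<le> norm (\<beta> + \<beta> * \<bar>V0 x\<bar> powr (k + 1))" by simp
    finally show "norm (g (V0 x) * V0 x) \<le> norm (\<beta> + \<beta> * \<bar>V0 x\<bar> powr (k + 1))" .
  qed
qed

text \<open>Where the velocity is below 1 in size its square is dominated by \<open>\<phi>\<close>
  of the dissipation density, elsewhere by that density divided by \<open>\<alpha>\<close>.\<close>

lemma damping_kinetic:
  assumes fin: "finite_measure Q" and g: "damping_condition g \<alpha> \<beta> k" and ab: "0 < \<alpha>" "0 < \<beta>"
    and c: "concave_majorant \<phi> g" and V0: "V0 \<in> Lp (k + 1) Q"
  defines "D \<equiv> \<integral>x. g (V0 x) * V0 x \<partial>Q"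
  shows "(\<integral>\<^sup>+x. ennreal ((V0 x)\<^sup>2) \<partial>Q) \<le> ennreal ((measure Q (space Q) + 1) * \<phi> D + D / \<alpha>)"
proof -
  note B = damping_basic[OF g ab] and I = damping_integrable[OF fin g ab V0]
  have m: "(\<lambda>x. g (V0 x) * V0 x) \<in> borel_measurable Q" using I by simp
  have D: "0 \<le> D" unfolding D_def using B(3) by simp
  have pD: "0 \<le> \<phi> D" using c D by (simp add: concave_majorant_def)
  have nn: "0 \<le> \<phi> (g s * s)" for s using c B(3)[of s] by (simp add: concave_majorant_def)
  have pt: "(V0 x)\<^sup>2 \<le> \<phi> (g (V0 x) * V0 x) + g (V0 x) * V0 x / \<alpha>" for x
  proof (cases "1 \<le> \<bar>V0 x\<bar>")
    case True then show ?thesis using B(5)[OF True] nn[of "V0 x"] by linarith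
  next
    case False
    then have "\<bar>g (V0 x)\<bar>\<^sup>2 + (V0 x)\<^sup>2 \<le> \<phi> (g (V0 x) * V0 x)" using c by (simp add: concave_majorant_def)
    moreover have "0 \<le> g (V0 x) * V0 x / \<alpha>" using B(3) ab by simp
    moreover have "0 \<le> \<bar>g (V0 x)\<bar>\<^sup>2" by simp
    ultimately show ?thesis by linarith
  qed
  have "(\<integral>\<^sup>+x. ennreal ((V0 x)\<^sup>2) \<partial>Q) \<le> (\<integral>\<^sup>+x. ennreal (\<phi> (g (V0 x) * V0 x)) + ennreal (g (V0 x) * V0 x / \<alpha>) \<partial>Q)"
  proof (rule nn_integral_mono)
    fix x
    have "0 \<le> g (V0 x) * V0 x / \<alpha>" using B(3) ab by simp
    then show "ennreal ((V0 x)\<^sup>2) \<le> ennreal (\<phi> (g (V0 x) * V0 x)) + ennreal (g (V0 x) * V0 x / \<alpha>)"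
      using ennreal_leI[OF pt[of x]] ennreal_plus[OF nn[of "V0 x"]] by metis
  qed
  also have "\<dots> = (\<integral>\<^sup>+x. ennreal (\<phi> (g (V0 x) * V0 x)) \<partial>Q) + (\<integral>\<^sup>+x. ennreal (g (V0 x) * V0 x / \<alpha>) \<partial>Q)"
    using concave_majorant_measurable[OF c m B(3)] m by (intro nn_integral_add) auto
  also have "(\<integral>\<^sup>+x. ennreal (g (V0 x) * V0 x / \<alpha>) \<partial>Q) = ennreal (D / \<alpha>)"
    using I B(3) ab unfolding D_def by (subst nn_integral_eq_integral) auto
  also have "(\<integral>\<^sup>+x. ennreal (\<phi> (g (V0 x) * V0 x)) \<partial>Q) + ennreal (D / \<alpha>)
      \<le> ennreal (\<phi> D * (measure Q (space Q) + 1)) + ennreal (D / \<alpha>)"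
    unfolding D_def by (intro add_right_mono concave_majorant_integral[OF fin c I B(3)])
  also have "\<dots> = ennreal ((measure Q (space Q) + 1) * \<phi> D + D / \<alpha>)"
    using pD D ab by (subst ennreal_plus[symmetric]) (simp_all add: mult.commute del: ennreal_plus)
  finally show ?thesis .
qed

text \<open>Same splitting as for the kinetic term. The part of the small velocities pairs with
  \<open>V\<close> in \<open>L2\<close>, the part of the large ones with \<open>V\<close> in
  \<open>L^(k+1)\<close>; in both the factor \<open>\<epsilon>\<close> is put on \<open>V\<close>,
  and negative powers of \<open>\<epsilon>\<close> go to the dissipation.\<close>

lemma damping_pairing:
  assumes fin: "finite_measure Q" and g: "damping_condition g \<alpha> \<beta> k" and ab: "0 < \<alpha>" "0 < \<beta>"
    and c: "concave_majorant \<phi> g" and V0: "V0 \<in> Lp (k + 1) Q" and V: "V \<in> borel_measurable Q" and e: "0 < \<epsilon>"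
    and b: "(\<integral>\<^sup>+x. ennreal ((V x)\<^sup>2) \<partial>Q) \<le> ennreal B1" "(\<integral>\<^sup>+x. ennreal (\<bar>V x\<bar> powr (k + 1)) \<partial>Q) \<le> ennreal B2" "0 \<le> B1" "0 \<le> B2"
  defines "D \<equiv> \<integral>x. g (V0 x) * V0 x \<partial>Q"
  shows "(\<integral>\<^sup>+x. ennreal \<bar>g (V0 x) * V x\<bar> \<partial>Q)
    \<le> ennreal ((measure Q (space Q) + 1) / \<epsilon> * \<phi> D + \<epsilon> powr (- 1 / k) * \<beta> powr (1 / k) * D + \<epsilon> * (B1 + B2))"
proof -
  note B = damping_basic[OF g ab] and I = damping_integrable[OF fin g ab V0]
  have m: "(\<lambda>x. g (V0 x) * V0 x) \<in> borel_measurable Q" using I by simp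
  have D: "0 \<le> D" unfolding D_def using B(3) by simp
  have pD: "0 \<le> \<phi> D" using c D by (simp add: concave_majorant_def)
  have nn: "0 \<le> \<phi> (g s * s)" for s using c B(3)[of s] by (simp add: concave_majorant_def)
  define Ce where "Ce = \<epsilon> powr (- 1 / k) * \<beta> powr (1 / k)"
  have Ce: "0 \<le> Ce" by (simp add: Ce_def)
  have pt: "\<bar>g (V0 x) * V x\<bar> \<le> 1 / \<epsilon> * \<phi> (g (V0 x) * V0 x) + (Ce * (g (V0 x) * V0 x) + (\<epsilon> * (V x)\<^sup>2 + \<epsilon> * \<bar>V x\<bar> powr (k + 1)))" for x
  proof (cases "1 \<le> \<bar>V0 x\<bar>")
    case True
    have "0 \<le> 1 / \<epsilon> * \<phi> (g (V0 x) * V0 x)" "0 \<le> \<epsilon> * (V x)\<^sup>2" using nn e by auto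
    then show ?thesis using damping_Young[OF g ab e True, of "V x"] unfolding Ce_def abs_mult by linarith
  next
    case False
    let ?a = "\<bar>g (V0 x)\<bar>" and ?y = "\<bar>V x\<bar>"
    have le: "?a\<^sup>2 + (V0 x)\<^sup>2 \<le> \<phi> (g (V0 x) * V0 x)" using c False by (simp add: concave_majorant_def)
    have "2 * (?a * (\<epsilon> * ?y)) \<le> ?a\<^sup>2 + (\<epsilon> * ?y)\<^sup>2" using sum_squares_bound[of ?a "\<epsilon> * ?y"] by simp
    moreover have "0 \<le> ?a * (\<epsilon> * ?y)" using e by simp
    ultimately have "?a * (\<epsilon> * ?y) \<le> ?a\<^sup>2 + (\<epsilon> * ?y)\<^sup>2" by linarith
    also have "\<dots> \<le> \<phi> (g (V0 x) * V0 x) + (\<epsilon> * ?y)\<^sup>2" using le zero_le_power2[of "V0 x"] by linarith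
    finally have d: "?a * (\<epsilon> * ?y) \<le> \<phi> (g (V0 x) * V0 x) + (\<epsilon> * ?y)\<^sup>2" .
    have "?a * ?y = ?a * (\<epsilon> * ?y) / \<epsilon>" using e by simp
    also have "\<dots> \<le> (\<phi> (g (V0 x) * V0 x) + (\<epsilon> * ?y)\<^sup>2) / \<epsilon>" using d e by (intro divide_right_mono) auto
    also have "\<dots> = 1 / \<epsilon> * \<phi> (g (V0 x) * V0 x) + \<epsilon> * (V x)\<^sup>2"
      using e by (simp add: add_divide_distrib power2_eq_square)
    finally have "?a * ?y \<le> 1 / \<epsilon> * \<phi> (g (V0 x) * V0 x) + \<epsilon> * (V x)\<^sup>2" .
    moreover have "0 \<le> Ce * (g (V0 x) * V0 x)" "0 \<le> \<epsilon> * \<bar>V x\<bar> powr (k + 1)" using Ce B(3) e by auto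
    ultimately show ?thesis unfolding abs_mult by linarith
  qed
  have "(\<integral>\<^sup>+x. ennreal \<bar>g (V0 x) * V x\<bar> \<partial>Q) \<le> (\<integral>\<^sup>+x. ennreal (1 / \<epsilon>) * ennreal (\<phi> (g (V0 x) * V0 x)) +
      (ennreal Ce * ennreal (g (V0 x) * V0 x) + (ennreal \<epsilon> * ennreal ((V x)\<^sup>2) + ennreal \<epsilon> * ennreal (\<bar>V x\<bar> powr (k + 1)))) \<partial>Q)"
  proof (rule nn_integral_mono)
    fix x
    have "ennreal \<bar>g (V0 x) * V x\<bar> \<le> ennreal (1 / \<epsilon> * \<phi> (g (V0 x) * V0 x) + (Ce * (g (V0 x) * V0 x) + (\<epsilon> * (V x)\<^sup>2 + \<epsilon> * \<bar>V x\<bar> powr (k + 1))))"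
      by (rule ennreal_leI[OF pt])
    also have "\<dots> = ennreal (1 / \<epsilon>) * ennreal (\<phi> (g (V0 x) * V0 x)) +
      (ennreal Ce * ennreal (g (V0 x) * V0 x) + (ennreal \<epsilon> * ennreal ((V x)\<^sup>2) + ennreal \<epsilon> * ennreal (\<bar>V x\<bar> powr (k + 1))))"
    proof -
      have nn4: "0 \<le> 1 / \<epsilon> * \<phi> (g (V0 x) * V0 x)" "0 \<le> Ce * (g (V0 x) * V0 x)" "0 \<le> \<epsilon> * (V x)\<^sup>2" "0 \<le> \<epsilon> * \<bar>V x\<bar> powr (k + 1)"
        using nn Ce B(3) e by auto
      show ?thesis using nn4 e Ce nn[of "V0 x"] B(3)[of "V0 x"]
        by (simp only: ennreal_plus add_nonneg_nonneg ennreal_mult zero_le_power2 powr_ge_zero order.strict_implies_order zero_le_divide_1_iff)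
    qed
    finally show "ennreal \<bar>g (V0 x) * V x\<bar> \<le> ennreal (1 / \<epsilon>) * ennreal (\<phi> (g (V0 x) * V0 x)) +
      (ennreal Ce * ennreal (g (V0 x) * V0 x) + (ennreal \<epsilon> * ennreal ((V x)\<^sup>2) + ennreal \<epsilon> * ennreal (\<bar>V x\<bar> powr (k + 1))))" .
  qed
  also have "\<dots> = ennreal (1 / \<epsilon>) * (\<integral>\<^sup>+x. ennreal (\<phi> (g (V0 x) * V0 x)) \<partial>Q) + (ennreal Ce * (\<integral>\<^sup>+x. ennreal (g (V0 x) * V0 x) \<partial>Q)
      + (ennreal \<epsilon> * (\<integral>\<^sup>+x. ennreal ((V x)\<^sup>2) \<partial>Q) + ennreal \<epsilon> * (\<integral>\<^sup>+x. ennreal (\<bar>V x\<bar> powr (k + 1)) \<partial>Q)))"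
    using concave_majorant_measurable[OF c m B(3)] m V by (simp add: nn_integral_add nn_integral_cmult)
  also have "\<dots> \<le> ennreal (1 / \<epsilon>) * ennreal (\<phi> D * (measure Q (space Q) + 1)) + (ennreal Ce * ennreal D
      + (ennreal \<epsilon> * ennreal B1 + ennreal \<epsilon> * ennreal B2))"
  proof -
    have "(\<integral>\<^sup>+x. ennreal (g (V0 x) * V0 x) \<partial>Q) = ennreal D"
      unfolding D_def using I B(3) by (intro nn_integral_eq_integral) auto
    then show ?thesis using concave_majorant_integral[OF fin c I B(3)] b
      unfolding D_def by (intro add_mono mult_left_mono) auto
  qed
  also have "\<dots> = ennreal (1 / \<epsilon> * (\<phi> D * (measure Q (space Q) + 1)) + (Ce * D + (\<epsilon> * B1 + \<epsilon> * B2)))"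
  proof -
    have n: "0 \<le> 1 / \<epsilon>" "0 \<le> \<epsilon>" "0 \<le> \<phi> D * (measure Q (space Q) + 1)" using e pD by auto
    have n2: "0 \<le> 1 / \<epsilon> * (\<phi> D * (measure Q (space Q) + 1))" "0 \<le> Ce * D" "0 \<le> \<epsilon> * B1" "0 \<le> \<epsilon> * B2"
      using n Ce D b by (auto intro!: mult_nonneg_nonneg)
    show ?thesis using n n2 Ce D b(3,4) by (simp only: ennreal_plus add_nonneg_nonneg ennreal_mult)
  qed
  also have "1 / \<epsilon> * (\<phi> D * (measure Q (space Q) + 1)) + (Ce * D + (\<epsilon> * B1 + \<epsilon> * B2))
     = (measure Q (space Q) + 1) / \<epsilon> * \<phi> D + \<epsilon> powr (- 1 / k) * \<beta> powr (1 / k) * D + \<epsilon> * (B1 + B2)"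
    by (simp add: Ce_def algebra_simps add_divide_distrib)
  finally show ?thesis .
qed

section \<open>Solutions in the potential well\<close>

lemma cont_into_norm:
  assumes c: "cont_into I V nrm v"
    and r: "\<And>s t. s \<in> I \<Longrightarrow> t \<in> I \<Longrightarrow> \<bar>nrm (v t) - nrm (v s)\<bar> \<le> nrm (\<lambda>x. v t x - v s x)"
  shows "continuous_on I (\<lambda>t. nrm (v t))"
  unfolding continuous_on_def
proof
  fix s assume s: "s \<in> I"
  have l: "((\<lambda>t. nrm (\<lambda>x. v t x - v s x)) \<longlongrightarrow> 0) (at s within I)" using c s by (simp add: cont_into_def)
  have "((\<lambda>t. nrm (v t) - nrm (v s)) \<longlongrightarrow> 0) (at s within I)"
  proof (rule Lim_null_comparison[OF _ l])
    show "\<forall>\<^sub>F t in at s within I. norm (nrm (v t) - nrm (v s)) \<le> nrm (\<lambda>x. v t x - v s x)"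
      unfolding eventually_at_filter using r[OF s] by (auto intro!: always_eventually)
  qed
  then show "((\<lambda>t. nrm (v t)) \<longlongrightarrow> nrm (v s)) (at s within I)" using Lim_null by blast
qed

lemma cont_into_L2_norm:
  assumes "cont_into I (Lp 2 N) (Lp_norm 2 N) v" shows "continuous_on I (\<lambda>t. Lp_norm 2 N (v t))"
  using assms by (intro cont_into_norm[OF assms] L2_norm_reverse) (auto simp: cont_into_def)

lemma cont_into_L2_inner:
  assumes u: "cont_into I (Lp 2 N) (Lp_norm 2 N) u" and v: "cont_into I (Lp 2 N) (Lp_norm 2 N) v"
  shows "continuous_on I (\<lambda>t. L2_inner N (u t) (v t))"
  unfolding continuous_on_def
proof
  fix s assume s: "s \<in> I"
  have L: "u t \<in> Lp 2 N" "v t \<in> Lp 2 N" if "t \<in> I" for t using that u v by (auto simp: cont_into_def)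
  have lu: "((\<lambda>t. Lp_norm 2 N (\<lambda>x. u t x - u s x)) \<longlongrightarrow> 0) (at s within I)"
    and lv: "((\<lambda>t. Lp_norm 2 N (\<lambda>x. v t x - v s x)) \<longlongrightarrow> 0) (at s within I)" using u v s by (simp_all add: cont_into_def)
  have nv: "((\<lambda>t. Lp_norm 2 N (v t)) \<longlongrightarrow> Lp_norm 2 N (v s)) (at s within I)"
    using cont_into_L2_norm[OF v] s by (simp add: continuous_on_def)
  let ?b = "\<lambda>t. Lp_norm 2 N (\<lambda>x. u t x - u s x) * Lp_norm 2 N (v t) + Lp_norm 2 N (u s) * Lp_norm 2 N (\<lambda>x. v t x - v s x)"
  have "(?b \<longlongrightarrow> 0 * Lp_norm 2 N (v s) + Lp_norm 2 N (u s) * 0) (at s within I)"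
    by (intro tendsto_intros lu lv nv)
  then have b: "(?b \<longlongrightarrow> 0) (at s within I)" by simp
  have "((\<lambda>t. L2_inner N (u t) (v t) - L2_inner N (u s) (v s)) \<longlongrightarrow> 0) (at s within I)"
  proof (rule Lim_null_comparison[OF _ b])
    have le: "norm (L2_inner N (u t) (v t) - L2_inner N (u s) (v s)) \<le> ?b t" if t: "t \<in> I" for t
    proof -
      have "L2_inner N (u t) (v t) - L2_inner N (u s) (v s)
        = L2_inner N (\<lambda>x. u t x - u s x) (v t) + L2_inner N (\<lambda>x. v t x - v s x) (u s)"
        using L2_inner_diff_left[OF L(1)[OF t] L(1)[OF s] L(2)[OF t]] L2_inner_diff_left[OF L(2)[OF t] L(2)[OF s] L(1)[OF s]]
        by (simp add: L2_inner_commute)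
      moreover have "\<bar>L2_inner N (\<lambda>x. u t x - u s x) (v t)\<bar> \<le> Lp_norm 2 N (\<lambda>x. u t x - u s x) * Lp_norm 2 N (v t)"
        by (intro L2_Cauchy_Schwarz Lp_2_diff L s t)
      moreover have "\<bar>L2_inner N (\<lambda>x. v t x - v s x) (u s)\<bar> \<le> Lp_norm 2 N (\<lambda>x. v t x - v s x) * Lp_norm 2 N (u s)"
        by (intro L2_Cauchy_Schwarz Lp_2_diff L s t)
      ultimately show ?thesis unfolding real_norm_def
        using abs_triangle_ineq[of "L2_inner N (\<lambda>x. u t x - u s x) (v t)" "L2_inner N (\<lambda>x. v t x - v s x) (u s)"]
        by (simp add: mult.commute)
    qed
    show "\<forall>\<^sub>F t in at s within I. norm (L2_inner N (u t) (v t) - L2_inner N (u s) (v s)) \<le> ?b t"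
      unfolding eventually_at_filter using le by (auto intro!: always_eventually)
  qed
  then show "((\<lambda>t. L2_inner N (u t) (v t)) \<longlongrightarrow> L2_inner N (u s) (v s)) (at s within I)" using Lim_null by blast
qed

lemma continuous_integrable_unit: "continuous_on {0..1::real} f \<Longrightarrow> integrable (lebesgue_on {0..1}) (f :: real \<Rightarrow> real)"
  using continuous_imp_integrable_real by blast

text \<open>The derivative identity is tested with the increment \<open>z\<close> itself; Young's
  inequality leaves half of the squared norm of \<open>z\<close>, which is absorbed on the
  left.\<close>

lemma time_deriv_Lipschitz:
  assumes v: "\<And>t. t \<in> {0..1} \<Longrightarrow> v t \<in> Lp 2 N" and d: "time_deriv 1 N v vt"
    and c: "cont_into {0..1} (Lp 2 N) (Lp_norm 2 N) vt" and st: "s \<in> {0..1}" "t \<in> {0..1}"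
  shows "(Lp_norm 2 N (\<lambda>x. v t x - v s x))\<^sup>2 \<le> (\<integral>\<tau>. (Lp_norm 2 N (vt \<tau>))\<^sup>2 \<partial>lebesgue_on {0..1})"
proof -
  let ?T = "lebesgue_on {0..1::real}"
  define z where "z = (\<lambda>x. v t x - v s x)"
  have zL: "z \<in> Lp 2 N" unfolding z_def using v st by auto
  have vtL: "vt \<tau> \<in> Lp 2 N" if "\<tau> \<in> {0..1}" for \<tau> using c that by (simp add: cont_into_def)
  have der: "L2_inner N (v r) z - L2_inner N (v 0) z = (\<integral>\<tau>. indicator {0..r} \<tau> * L2_inner N (vt \<tau>) z \<partial>?T)" if "r \<in> {0..1}" for r
    using d zL that integral_subinterval[of r 1 "\<lambda>\<tau>. L2_inner N (vt \<tau>) z"] by (simp add: time_deriv_def)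
  have cz: "cont_into {0..1} (Lp 2 N) (Lp_norm 2 N) (\<lambda>_. z)" using zL by (simp add: cont_into_def L2_norm_eq)
  have ii: "integrable ?T (\<lambda>\<tau>. L2_inner N (vt \<tau>) z)"
    by (rule continuous_integrable_unit[OF cont_into_L2_inner[OF c cz]])
  have i: "integrable ?T (\<lambda>\<tau>. indicator {0..r} \<tau> * L2_inner N (vt \<tau>) z)" if "r \<in> {0..1}" for r
    using integrable_mult_indicator[OF _ ii, of "{0..r}"] that by (auto simp: sets_restrict_space_iff)
  have ni: "integrable ?T (\<lambda>\<tau>. (Lp_norm 2 N (vt \<tau>))\<^sup>2)"
    by (intro continuous_integrable_unit continuous_intros cont_into_L2_norm[OF c])
  have T1: "measure ?T (space ?T) = 1" by (simp add: measure_restrict_space)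
  have "(Lp_norm 2 N z)\<^sup>2 = L2_inner N (v t) z - L2_inner N (v s) z"
    using L2_inner_diff_left[OF v[OF st(2)] v[OF st(1)] zL] by (simp add: z_def L2_inner_self[symmetric])
  also have "\<dots> = (\<integral>\<tau>. indicator {0..t} \<tau> * L2_inner N (vt \<tau>) z - indicator {0..s} \<tau> * L2_inner N (vt \<tau>) z \<partial>?T)"
    using der[OF st(1)] der[OF st(2)] i[OF st(1)] i[OF st(2)] by simp
  also have "\<dots> \<le> (\<integral>\<tau>. (Lp_norm 2 N (vt \<tau>))\<^sup>2 / 2 + (Lp_norm 2 N z)\<^sup>2 / 2 \<partial>?T)"
  proof (rule integral_mono)
    show "integrable ?T (\<lambda>\<tau>. indicator {0..t} \<tau> * L2_inner N (vt \<tau>) z - indicator {0..s} \<tau> * L2_inner N (vt \<tau>) z)"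
      by (intro Bochner_Integration.integrable_diff i st)
    show "integrable ?T (\<lambda>\<tau>. (Lp_norm 2 N (vt \<tau>))\<^sup>2 / 2 + (Lp_norm 2 N z)\<^sup>2 / 2)"
      by (intro continuous_integrable_unit continuous_intros cont_into_L2_norm[OF c]) auto
    fix \<tau> assume "\<tau> \<in> space ?T"
    then have "\<bar>L2_inner N (vt \<tau>) z\<bar> \<le> Lp_norm 2 N (vt \<tau>) * Lp_norm 2 N z" by (intro L2_Cauchy_Schwarz vtL zL) simp
    moreover have "2 * (Lp_norm 2 N (vt \<tau>) * Lp_norm 2 N z) \<le> (Lp_norm 2 N (vt \<tau>))\<^sup>2 + (Lp_norm 2 N z)\<^sup>2"
      using sum_squares_bound[of "Lp_norm 2 N (vt \<tau>)" "Lp_norm 2 N z"] by simp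
    ultimately have "\<bar>L2_inner N (vt \<tau>) z\<bar> \<le> (Lp_norm 2 N (vt \<tau>))\<^sup>2 / 2 + (Lp_norm 2 N z)\<^sup>2 / 2" by simp
    moreover have "0 \<le> (Lp_norm 2 N (vt \<tau>))\<^sup>2 / 2 + (Lp_norm 2 N z)\<^sup>2 / 2" by simp
    ultimately show "indicator {0..t} \<tau> * L2_inner N (vt \<tau>) z - indicator {0..s} \<tau> * L2_inner N (vt \<tau>) z
      \<le> (Lp_norm 2 N (vt \<tau>))\<^sup>2 / 2 + (Lp_norm 2 N z)\<^sup>2 / 2"
      by (auto split: split_indicator simp: abs_le_iff)
  qed
  also have "\<dots> = (\<integral>\<tau>. (Lp_norm 2 N (vt \<tau>))\<^sup>2 \<partial>?T) / 2 + (Lp_norm 2 N z)\<^sup>2 / 2"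
    using ni T1 finite_measure.integrable_const[OF lebesgue_interval_finite[of 1], of "(Lp_norm 2 N z)\<^sup>2 / 2"] by simp
  finally show ?thesis unfolding z_def by simp
qed

text \<open>The minimum over an interval of length 1/3 is at most the mean there, hence at most 3
  times the integral over the unit interval.\<close>

lemma good_time:
  fixes a :: "real \<Rightarrow> real"
  assumes a: "continuous_on {0..1} a" "\<And>t. t \<in> {0..1} \<Longrightarrow> 0 \<le> a t" and l: "0 \<le> l" "l + 1/3 \<le> 1"
  obtains t where "t \<in> {l..l + 1/3}" "a t \<le> 3 * (\<integral>\<tau>. a \<tau> \<partial>lebesgue_on {0..1})"
proof -
  let ?T = "lebesgue_on {0..1::real}"
  define J where "J = {l..l + 1/3}"
  have J: "J \<subseteq> {0..1}" "compact J" "J \<noteq> {}" using l by (auto simp: J_def)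
  obtain t where t: "t \<in> J" "\<And>s. s \<in> J \<Longrightarrow> a t \<le> a s"
    using continuous_attains_inf[OF J(2,3) continuous_on_subset[OF a(1) J(1)]] by auto
  have Js: "J \<in> sets ?T" using J(1,2) by (simp add: sets_restrict_space_iff J_def)
  have "(\<integral>\<tau>. a t * indicator J \<tau> \<partial>?T) \<le> (\<integral>\<tau>. a \<tau> \<partial>?T)"
  proof (rule integral_mono)
    show "integrable ?T (\<lambda>\<tau>. a t * indicator J \<tau>)"
      using finite_measure.emeasure_finite[OF lebesgue_interval_finite[of 1]] Js
      by (intro integrable_mult_right integrable_real_indicator) (auto simp: less_top[symmetric])
    show "integrable ?T a" by (rule continuous_integrable_unit[OF a(1)])
    show "a t * indicator J \<tau> \<le> a \<tau>" if "\<tau> \<in> space ?T" for \<tau> using t a(2)[of \<tau>] that by (auto split: split_indicator)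
  qed
  moreover have "measure ?T J = 1/3" using J(1) by (subst measure_restrict_space) (auto simp: J_def)
  then have "(\<integral>\<tau>. a t * indicator J \<tau> \<partial>?T) = a t * (1/3)"
    using J(1) by (simp only: integral_mult_right_zero integral_indicator) (simp add: inf.absorb1)
  ultimately have "a t \<le> 3 * (\<integral>\<tau>. a \<tau> \<partial>?T)" by linarith
  then show thesis using that t(1) unfolding J_def by blast
qed

text \<open>Euler's identity: differentiate the homogeneity relation in the scaling factor at
  1.\<close>

lemma homogeneous_Euler:
  assumes h: "homogeneous_potential F f k" shows "f s * s = (k + 1) * F s"
proof -
  have "((\<lambda>c. F (c * s)) has_real_derivative f (1 * s) * s) (at 1)"
    using DERIV_chain2[of F "f (1 * s)" "\<lambda>c. c * s" 1 s UNIV] h DERIV_cmult_right[OF DERIV_ident, of s 1 UNIV]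
    by (simp add: homogeneous_potential_def)
  moreover have "((\<lambda>c. c powr (k + 1) * F s) has_real_derivative (k + 1) * F s) (at 1)"
    by (auto intro!: derivative_eq_intros)
  moreover have "\<forall>\<^sub>F c in nhds 1. F (c * s) = c powr (k + 1) * F s"
    using h eventually_nhds_in_open[of "{0<..}" "1::real"]
    by (auto simp: homogeneous_potential_def elim!: eventually_mono)
  ultimately show ?thesis using DERIV_cong_ev[OF refl _ refl] DERIV_unique by (metis mult_1)
qed

lemma homogeneous_measurable: "homogeneous_potential F f k \<Longrightarrow> F \<in> borel_measurable borel"
  by (intro borel_measurable_continuous_onI)
     (auto simp: homogeneous_potential_def continuous_on_eq_continuous_at intro: DERIV_isCont)

lemma potential_integral_le:
  assumes h: "homogeneous_potential F f k" and M: "\<And>s. F s \<le> M * \<bar>s\<bar> powr (k + 1)" "0 < M"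
    and i: "integrable N (\<lambda>y. \<bar>v y\<bar> powr (k + 1))" and b: "(\<integral>y. \<bar>v y\<bar> powr (k + 1) \<partial>N) \<le> B"
  shows "0 \<le> (\<integral>y. F (v y) \<partial>N)" "(\<integral>y. F (v y) \<partial>N) \<le> M * B"
proof -
  have nn: "\<And>s. 0 \<le> F s" using h by (simp add: homogeneous_potential_def)
  then show "0 \<le> (\<integral>y. F (v y) \<partial>N)" by simp
  have "(\<integral>y. F (v y) \<partial>N) \<le> (\<integral>y. M * \<bar>v y\<bar> powr (k + 1) \<partial>N)"
    using i M by (intro integral_mono_AE') auto
  also have "\<dots> \<le> M * B" using b M(2) by simp
  finally show "(\<integral>y. F (v y) \<partial>N) \<le> M * B" .
qed

text \<open>On a bounded range a power above 2 is at most a constant times the square; superlinear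
  terms thereby become comparable with the quadratic energy.\<close>

lemma powr_le_square:
  fixes a s k :: real
  assumes "0 \<le> a" "a \<le> s" "1 \<le> k" shows "a powr (k + 1) \<le> s powr (k - 1) * a\<^sup>2"
proof (cases "a = 0")
  case False
  then have "a powr (k + 1) = a powr (k - 1) * a powr 2" using powr_add[of a "k - 1" 2] assms by (simp add: add.commute)
  also have "\<dots> \<le> s powr (k - 1) * a powr 2" using assms by (intro mult_right_mono powr_mono2) auto
  finally show ?thesis using assms False by (simp add: powr_numeral)
qed simp

text \<open>Everything about one solution except the additional bound for \<open>m > 5\<close>,
  which enters later through the constant \<open>bm\<close>.\<close>

locale well_solution =
  fixes S :: acoustic and \<delta> :: real and u0 u1 w0 w1 u ut w wt
  assumes adm: "admissible_domain S" and cA: "conditions_A S" and cB: "conditions_B S"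
    and pq: "1 < exp_p S" "exp_p S < 5" "1 < exp_q S" and emb: "embedding_constants S"
    and maj: "concave_majorant (conc_phi1 S) (damp_g1 S)" "concave_majorant (conc_phi2 S) (damp_g2 S)"
    and delta: "0 < \<delta>" "\<delta> < s_star S"
    and init: "u0 \<in> Lp (exp_m S + 1) (mO S)" "(u0, w0) \<in> W1_tilde S \<delta>"
    and sol: "potential_well_solution S u0 u1 w0 w1 u ut w wt"
    and E0: "total_energy S u ut w wt 0 \<le> Lambda S (s_star S - \<delta>)"
begin

abbreviation "EE \<equiv> total_energy S u ut w wt"
abbreviation "gr t \<equiv> grad_norm (Omega S) (u t)"
abbreviation "la t \<equiv> lap_norm (Gamma_plane S) (w t)"
abbreviation "kO t \<equiv> (Lp_norm 2 (mO S) (ut t))\<^sup>2"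
abbreviation "kG t \<equiv> (Lp_norm 2 (mG S) (wt t))\<^sup>2"
abbreviation "UT \<equiv> lebesgue_on {0..1::real}"

lemmas af = admissible_facts[OF adm]
lemmas finO = bounded_open_measure(1)[OF af(1,2,4)]
lemmas finG = bounded_open_measure(1)[OF af(5,6,7)]

lemma ws: "0 < T \<Longrightarrow> weak_solution S T u0 u1 w0 w1 u ut w wt"
  using sol by (simp add: potential_well_solution_def)

lemma ws1:
  "cont_into {0..1} (H1_Gamma0 S) (grad_norm (Omega S)) u" "cont_into {0..1} (Lp 2 (mO S)) (Lp_norm 2 (mO S)) ut"
  "time_deriv 1 (mO S) u ut" "cont_into {0..1} (H20_Gamma S) (lap_norm (Gamma_plane S)) w"
  "cont_into {0..1} (Lp 2 (mG S)) (Lp_norm 2 (mG S)) wt" "time_deriv 1 (mG S) w wt"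
  "AE x in mO S. u 0 x = u0 x" "AE y in mG S. w 0 y = w0 y"
  using ws[of 1] unfolding weak_solution_def by auto

lemma spaces:
  assumes "t \<in> {0..1}"
  shows "u t \<in> H1_Gamma0 S" "ut t \<in> Lp 2 (mO S)" "w t \<in> H20_Gamma S" "wt t \<in> Lp 2 (mG S)"
    "u t \<in> H1 (Omega S)" "w t \<in> H2 (Gamma_plane S)" "u t \<in> Lp 2 (mO S)" "w t \<in> Lp 2 (mG S)"
proof -
  show 1: "u t \<in> H1_Gamma0 S" "ut t \<in> Lp 2 (mO S)" "w t \<in> H20_Gamma S" "wt t \<in> Lp 2 (mG S)"
    using ws1(1,2,4,5) assms by (auto simp: cont_into_def)
  show 2: "u t \<in> H1 (Omega S)" "w t \<in> H2 (Gamma_plane S)" using 1 H1_Gamma0_H1 by (auto simp: H20_def)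
  show "u t \<in> Lp 2 (mO S)" "w t \<in> Lp 2 (mG S)" using H1_Lp_2 2 H2_H1(1) by blast+
qed

lemma cont_gr: "continuous_on {0..1} gr"
  by (rule cont_into_norm[OF ws1(1)]) (rule grad_norm_reverse[OF af(1) spaces(5) spaces(5)])

lemma cont_la: "continuous_on {0..1} la"
  by (rule cont_into_norm[OF ws1(4)]) (rule lap_norm_reverse[OF af(5) spaces(6) spaces(6)])

lemma cont_kin: "continuous_on {0..1} kO" "continuous_on {0..1} kG"
  by (rule continuous_on_power[OF cont_into_L2_norm[OF ws1(2)]], rule continuous_on_power[OF cont_into_L2_norm[OF ws1(5)]])

lemma constants: "0 < K1 S" "0 < K2 S" "0 < bound_M S" "0 < s_star S" "const_xi S \<delta> < 1"
  "0 < s \<Longrightarrow> s < t \<Longrightarrow> t \<le> s_star S \<Longrightarrow> Lambda S s < Lambda S t"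
proof -
  show K: "0 < K1 S" "0 < K2 S" using K1_props(1)[OF adm emb pq(1,2)] K2_props(1)[OF adm emb pq(3)] by auto
  show M: "0 < bound_M S" using cB by (simp add: conditions_B_def)
  show "0 < s_star S" "const_xi S \<delta> < 1" "0 < s \<Longrightarrow> s < t \<Longrightarrow> t \<le> s_star S \<Longrightarrow> Lambda S s < Lambda S t"
    using s_star_props[OF K M pq(1,3)] delta by auto
qed

lemma potF: "homogeneous_potential (pot_F S) (src_f S) (exp_p S)" "homogeneous_potential (pot_H S) (src_h S) (exp_q S)"
  "pot_F S s \<le> bound_M S * \<bar>s\<bar> powr (exp_p S + 1)" "pot_H S s \<le> bound_M S * \<bar>s\<bar> powr (exp_q S + 1)"
  using cB by (auto simp: conditions_B_def)

lemma intF: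
  assumes "t \<in> {0..1}"
  shows "0 \<le> (\<integral>x. pot_F S (u t x) \<partial>mO S)" "(\<integral>x. pot_F S (u t x) \<partial>mO S) \<le> bound_M S * (K1 S * gr t powr (exp_p S + 1))"
    "0 \<le> (\<integral>y. pot_H S (w t y) \<partial>mG S)" "(\<integral>y. pot_H S (w t y) \<partial>mG S) \<le> bound_M S * (K2 S * la t powr (exp_q S + 1))"
  using potential_integral_le[OF potF(1) potF(3) constants(3) K1_props(2,3)[OF adm emb pq(1,2) spaces(1)[OF assms]]]
    potential_integral_le[OF potF(2) potF(4) constants(3) K2_props(2,3)[OF adm emb pq(3) spaces(3)[OF assms]]]
  by auto

lemma energy:
  assumes "0 \<le> t"
  shows "EE t + dissipation S ut wt t = EE 0" "potential_J S (u t) (w t) \<le> EE t" "EE t \<le> EE 0"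
    "(const_c S - 2) / const_c S * quadratic_energy S u ut w wt t \<le> EE t" "EE t \<le> quadratic_energy S u ut w wt t"
  using sol assms unfolding potential_well_solution_def by auto

lemma c_gt: "2 < const_c S" using pq by (simp add: const_c_def)

lemma EE_nonneg: "0 \<le> t \<Longrightarrow> 0 \<le> EE t"
proof -
  assume "0 \<le> t"
  have "0 \<le> (const_c S - 2) / const_c S * quadratic_energy S u ut w wt t"
    using c_gt by (intro mult_nonneg_nonneg) (auto simp: quadratic_energy_def)
  then show "0 \<le> EE t" using energy(4)[OF \<open>0 \<le> t\<close>] by linarith
qed

text \<open>The well function is strictly increasing up to the critical radius, so the norm of the
  solution, being continuous in time, cannot cross the initial radius.\<close>

lemma X_bound:
  assumes t: "t \<in> {0..1}" shows "sqrt ((gr t)\<^sup>2 + (la t)\<^sup>2) \<le> s_star S - \<delta>"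
proof (rule ccontr)
  define X where "X = (\<lambda>t. sqrt ((gr t)\<^sup>2 + (la t)\<^sup>2))"
  let ?s = "s_star S - \<delta>"
  assume "\<not> sqrt ((gr t)\<^sup>2 + (la t)\<^sup>2) \<le> ?s"
  then have Xt: "?s < X t" by (simp add: X_def)
  have Xc: "continuous_on {0..1} X" unfolding X_def by (intro continuous_intros cont_gr cont_la)
  \<comment> \<open>\<open>W1_tilde\<close> speaks about \<open>u0\<close> and \<open>w0\<close>,
    with which the solution at time 0 agrees almost everywhere; the norms are the same.\<close>
  have X0: "X 0 \<le> ?s"
  proof -
    have h: "u0 \<in> H1_Gamma0 S" "w0 \<in> H20_Gamma S" "X_norm S u0 w0 \<le> ?s"
      using init(2) by (auto simp: W1_tilde_def X_space_def)
    have "grad_norm (Omega S) (u 0) = grad_norm (Omega S) u0"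
      using H1_AE_cong(3)[OF af(1) spaces(5) Lp_measurable[OF H1_Lp_2[OF H1_Gamma0_H1[OF h(1)]]] ws1(7)] by simp
    moreover have "lap_norm (Gamma_plane S) (w 0) = lap_norm (Gamma_plane S) w0"
      using lap_norm_AE_cong[OF af(5) spaces(6) H20_measurable[OF h(2)] ws1(8)] by simp
    ultimately show ?thesis using h(3) by (simp add: X_def X_norm_def)
  qed
  \<comment> \<open>Capped at \<open>s_star S\<close>, since \<open>Lambda\<close> is increasing up
    to there; the norm of the solution takes the value \<open>y\<close> at some time.\<close>
  define y where "y = min (X t) (s_star S)"
  have y: "?s < y" "y \<le> s_star S" "y \<le> X t" using Xt delta by (auto simp: y_def)
  have "continuous_on {0..t} X" using continuous_on_subset[OF Xc] t by auto
  then obtain r where r: "0 \<le> r" "r \<le> t" "X r = y" using IVT'[of X 0 y t] X0 y t by auto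
  have r1: "r \<in> {0..1}" using r t by auto
  have Xr: "0 \<le> X r" "gr r \<le> X r" "la r \<le> X r" "(X r)\<^sup>2 = (gr r)\<^sup>2 + (la r)\<^sup>2"
    unfolding X_def by (auto intro: real_le_rsqrt)
  have "Lambda S (X r) \<le> potential_J S (u r) (w r)"
  proof -
    have "gr r powr (exp_p S + 1) \<le> X r powr (exp_p S + 1)" "la r powr (exp_q S + 1) \<le> X r powr (exp_q S + 1)"
      using pq Xr(2,3) L2_norm_nn by (intro powr_mono2; simp add: grad_norm_def lap_norm_def)+
    then have k: "bound_M S * (K1 S * gr r powr (exp_p S + 1)) \<le> bound_M S * (K1 S * X r powr (exp_p S + 1))"
      "bound_M S * (K2 S * la r powr (exp_q S + 1)) \<le> bound_M S * (K2 S * X r powr (exp_q S + 1))"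
      using constants(1-3) by (meson less_imp_le mult_left_mono)+
    have "(\<integral>x. pot_F S (u r x) \<partial>mO S) \<le> bound_M S * (K1 S * X r powr (exp_p S + 1))"
      "(\<integral>y. pot_H S (w r y) \<partial>mG S) \<le> bound_M S * (K2 S * X r powr (exp_q S + 1))"
      by (rule order_trans[OF intF(2)[OF r1] k(1)], rule order_trans[OF intF(4)[OF r1] k(2)])
    moreover have "1/2 * (X r)\<^sup>2 \<le> 1/2 * ((gr r)\<^sup>2 + (la r)\<^sup>2)" using Xr(4) by simp
    ultimately show ?thesis unfolding Lambda_def potential_J_def mult.assoc by (intro diff_mono)
  qed
  also have "\<dots> \<le> EE r" by (rule energy(2)[OF r(1)])
  also have "\<dots> \<le> EE 0" by (rule energy(3)[OF r(1)])
  also note E0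
  also have "Lambda S ?s < Lambda S y" using delta by (intro constants(6) y) auto
  finally show False using r(3) by blast
qed

lemma gr_la_bound:
  assumes "t \<in> {0..1}" shows "gr t \<le> s_star S - \<delta>" "la t \<le> s_star S - \<delta>"
proof -
  have "gr t \<le> sqrt ((gr t)\<^sup>2 + (la t)\<^sup>2)" "la t \<le> sqrt ((gr t)\<^sup>2 + (la t)\<^sup>2)" by (auto intro: real_le_rsqrt)
  from this[THEN order_trans, OF X_bound[OF assms]] show "gr t \<le> s_star S - \<delta>" "la t \<le> s_star S - \<delta>" .
qed

text \<open>The integrals of \<open>pot_F\<close> and \<open>pot_H\<close> are bounded by powers
  \<open>p + 1\<close> and \<open>q + 1\<close> of norms that stay below
  \<open>s_star S - \<delta>\<close>; trading all but two factors for that radius produces exactly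
  the coefficients of \<open>const_xi\<close>.\<close>

lemma source_bound:
  assumes t: "t \<in> {0..1}"
  shows "0 \<le> source_work S (u t) (w t)" "source_work S (u t) (w t) \<le> const_xi S \<delta> * ((gr t)\<^sup>2 + (la t)\<^sup>2)"
proof -
  let ?s = "s_star S - \<delta>"
  show "0 \<le> source_work S (u t) (w t)" unfolding source_work_def
    using intF[OF t] pq by (intro add_nonneg_nonneg mult_nonneg_nonneg) auto
  have nn: "0 \<le> gr t" "0 \<le> la t" by (simp_all add: grad_norm_def lap_norm_def Lp_norm_def)
  have "(exp_p S + 1) * (\<integral>x. pot_F S (u t x) \<partial>mO S) \<le> (exp_p S + 1) * (bound_M S * (K1 S * (?s powr (exp_p S - 1) * (gr t)\<^sup>2)))"
    using pq(1) constants(1-3)[THEN less_imp_le]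
    by (intro mult_left_mono order_trans[OF intF(2)[OF t]] powr_le_square nn gr_la_bound t) simp_all
  moreover have "(exp_q S + 1) * (\<integral>y. pot_H S (w t y) \<partial>mG S) \<le> (exp_q S + 1) * (bound_M S * (K2 S * (?s powr (exp_q S - 1) * (la t)\<^sup>2)))"
    using pq(3) constants(1-3)[THEN less_imp_le]
    by (intro mult_left_mono order_trans[OF intF(4)[OF t]] powr_le_square nn gr_la_bound t) simp_all
  moreover have "0 \<le> bound_M S * (exp_p S + 1) * K1 S * ?s powr (exp_p S - 1) * (la t)\<^sup>2"
    "0 \<le> bound_M S * (exp_q S + 1) * K2 S * ?s powr (exp_q S - 1) * (gr t)\<^sup>2"
    using pq constants(1-3) by auto
  moreover have "P * f + Q * h \<le> (M * P * K * s + M * Q * L * r) * (x + y)"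
    if "P * f \<le> P * (M * (K * (s * x)))" "Q * h \<le> Q * (M * (L * (r * y)))" "0 \<le> M * P * K * s * y" "0 \<le> M * Q * L * r * x"
    for P f Q h M K s L r x y :: real
    using that by (simp add: algebra_simps)
  ultimately show "source_work S (u t) (w t) \<le> const_xi S \<delta> * ((gr t)\<^sup>2 + (la t)\<^sup>2)"
    unfolding source_work_def const_xi_def by blast
qed

end

section \<open>Integrals over the time cylinder and over time windows\<close>

lemma unit_interval_space [simp]:
  "space (lebesgue_on {0..1::real}) = {0..1}" "emeasure (lebesgue_on {0..1::real}) {0..1} = 1"
  by (simp_all add: emeasure_restrict_space)

lemma cylinder_finite:
  assumes "finite_measure N" shows "finite_measure (lebesgue_on {0..T::real} \<Otimes>\<^sub>M N)"
  by (rule finite_measure_pair_measure[OF assms lebesgue_interval_finite])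

lemma unit_cylinder_measure:
  assumes "finite_measure N"
  shows "measure (lebesgue_on {0..1::real} \<Otimes>\<^sub>M N) (space (lebesgue_on {0..1} \<Otimes>\<^sub>M N)) = measure N (space N)"
proof -
  interpret N: finite_measure N by (rule assms)
  have "emeasure (lebesgue_on {0..1::real} \<Otimes>\<^sub>M N) ({0..1} \<times> space N) = emeasure N (space N)"
    using N.emeasure_pair_measure_Times[of "{0..1::real}" "lebesgue_on {0..1}" "space N"] by (simp add: sets_restrict_space_iff)
  then show ?thesis by (simp add: space_pair_measure measure_def)
qed

text \<open>\<open>f\<close> equals the slice integral almost everywhere, because representatives in
  time are arbitrary on null sets; its measurability comes from completeness of Lebesgue
  measure.\<close>

lemma cylinder_integral:
  fixes H :: "real \<times> 'a \<Rightarrow> real"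
  assumes fin: "finite_measure N" and H: "integrable (lebesgue_on {0..T} \<Otimes>\<^sub>M N) H"
    and e: "AE t in lebesgue_on {0..T}. f t = (\<integral>x. H (t, x) \<partial>N)"
  shows "integrable (lebesgue_on {0..T}) f"
    "(\<integral>t. f t \<partial>lebesgue_on {0..T}) = (\<integral>z. H z \<partial>(lebesgue_on {0..T} \<Otimes>\<^sub>M N))"
    "(\<integral>t. \<bar>f t\<bar> \<partial>lebesgue_on {0..T}) \<le> (\<integral>z. \<bar>H z\<bar> \<partial>(lebesgue_on {0..T} \<Otimes>\<^sub>M N))"
proof -
  let ?T = "lebesgue_on {0..T}"
  interpret T: finite_measure ?T by (rule lebesgue_interval_finite)
  interpret N: finite_measure N by (rule fin)
  interpret TN: pair_sigma_finite ?T N ..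
  have i: "integrable ?T (\<lambda>t. \<integral>x. H (t, x) \<partial>N)" by (rule TN.integrable_fst'[OF H])
  have m: "f \<in> borel_measurable ?T"
    by (rule lebesgue_on_complete[OF _ borel_measurable_integrable[OF i]]) (use e in \<open>auto elim!: eventually_mono\<close>)
  have e': "AE t in ?T. (\<integral>x. H (t, x) \<partial>N) = f t" using e by (auto elim!: eventually_mono)
  show fi: "integrable ?T f" by (rule integrable_cong_AE_imp[OF i m e'])
  have "(\<integral>t. f t \<partial>?T) = (\<integral>t. \<integral>x. H (t, x) \<partial>N \<partial>?T)" by (rule integral_cong_AE[OF m borel_measurable_integrable[OF i] e])
  also have "\<dots> = (\<integral>z. H z \<partial>(?T \<Otimes>\<^sub>M N))" by (rule TN.integral_fst'[OF H])
  finally show "(\<integral>t. f t \<partial>?T) = (\<integral>z. H z \<partial>(?T \<Otimes>\<^sub>M N))" .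
  have Ha: "integrable (?T \<Otimes>\<^sub>M N) (\<lambda>z. \<bar>H z\<bar>)" using H by simp
  have "(\<integral>t. \<bar>f t\<bar> \<partial>?T) \<le> (\<integral>t. \<integral>x. \<bar>H (t, x)\<bar> \<partial>N \<partial>?T)"
  proof (rule integral_mono_AE)
    show "integrable ?T (\<lambda>t. \<bar>f t\<bar>)" using fi by simp
    show "integrable ?T (\<lambda>t. \<integral>x. \<bar>H (t, x)\<bar> \<partial>N)" using TN.integrable_fst'[OF Ha] by simp
    show "AE t in ?T. \<bar>f t\<bar> \<le> (\<integral>x. \<bar>H (t, x)\<bar> \<partial>N)" using e by (auto elim!: eventually_mono intro: integral_abs_bound)
  qed
  also have "\<dots> = (\<integral>z. \<bar>H z\<bar> \<partial>(?T \<Otimes>\<^sub>M N))" using TN.integral_fst'[OF Ha] by simp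
  finally show "(\<integral>t. \<bar>f t\<bar> \<partial>?T) \<le> (\<integral>z. \<bar>H z\<bar> \<partial>(?T \<Otimes>\<^sub>M N))" .
qed

text \<open>The weak formulation integrates from 0; differences of such integrals are rewritten with
  an indicator, so that everything lives on one fixed measure space.\<close>

lemma integral_window:
  fixes f :: "real \<Rightarrow> real"
  assumes f: "integrable (lebesgue_on {0..1}) f" and st: "0 \<le> s" "s \<le> t" "t \<le> 1"
  shows "(\<integral>r. f r \<partial>lebesgue_on {0..t}) - (\<integral>r. f r \<partial>lebesgue_on {0..s}) = (\<integral>r. indicator {s<..t} r * f r \<partial>lebesgue_on {0..1})"
    "integrable (lebesgue_on {0..1}) (\<lambda>r. indicator {s<..t} r * f r)"
proof -
  have i: "integrable (lebesgue_on {0..1}) (\<lambda>r. indicator A r * f r)" if "A \<in> sets borel" "A \<subseteq> {0..1}" for A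
    using integrable_mult_indicator[OF _ f, of A] that by (simp add: sets_restrict_space_iff)
  show "integrable (lebesgue_on {0..1}) (\<lambda>r. indicator {s<..t} r * f r)" using st by (intro i) auto
  have "(\<integral>r. f r \<partial>lebesgue_on {0..t}) - (\<integral>r. f r \<partial>lebesgue_on {0..s})
      = (\<integral>r. indicator {0..t} r * f r - indicator {0..s} r * f r \<partial>lebesgue_on {0..1})"
    unfolding integral_subinterval[OF st(3), of f] integral_subinterval[OF order_trans[OF st(2,3)], of f]
    using st by (intro Bochner_Integration.integral_diff[symmetric] i) auto
  also have "\<dots> = (\<integral>r. indicator {s<..t} r * f r \<partial>lebesgue_on {0..1})"
    using st by (intro Bochner_Integration.integral_cong) (auto split: split_indicator)
  finally show "(\<integral>r. f r \<partial>lebesgue_on {0..t}) - (\<integral>r. f r \<partial>lebesgue_on {0..s})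
    = (\<integral>r. indicator {s<..t} r * f r \<partial>lebesgue_on {0..1})" .
qed

lemma window_integral_abs:
  fixes f g :: "real \<Rightarrow> real"
  assumes f: "integrable (lebesgue_on {0..1}) f" and g: "integrable (lebesgue_on {0..1}) g"
    and st: "0 \<le> s" "s \<le> t" "t \<le> 1" and le: "\<And>r. r \<in> {0..1} \<Longrightarrow> \<bar>f r\<bar> \<le> g r"
  shows "\<bar>\<integral>r. indicator {s<..t} r * f r \<partial>lebesgue_on {0..1}\<bar> \<le> (\<integral>r. g r \<partial>lebesgue_on {0..1})"
proof -
  have "\<bar>\<integral>r. indicator {s<..t} r * f r \<partial>lebesgue_on {0..1}\<bar> \<le> (\<integral>r. \<bar>indicator {s<..t} r * f r\<bar> \<partial>lebesgue_on {0..1})"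
    by (rule integral_abs_bound)
  also have "\<dots> \<le> (\<integral>r. g r \<partial>lebesgue_on {0..1})"
  proof (rule integral_mono[OF integrable_abs[OF integral_window(2)[OF f st]] g])
    fix r assume "r \<in> space (lebesgue_on {0..1::real})"
    then have "\<bar>f r\<bar> \<le> g r" using le by simp
    moreover have "0 \<le> \<bar>f r\<bar>" by simp
    ultimately have "0 \<le> g r" "\<bar>f r\<bar> \<le> g r" by linarith+
    then show "\<bar>indicator {s<..t} r * f r\<bar> \<le> g r" by (simp add: indicator_def)
  qed
  finally show ?thesis .
qed

text \<open>A bound valid at almost every time is also a bound for the cylinder, as the time
  interval has length 1.\<close>

lemma cylinder_nn_bound:
  fixes F :: "real \<Rightarrow> ennreal" and V :: "real \<times> 'a \<Rightarrow> real"
  assumes fin: "finite_measure N" and V: "V \<in> borel_measurable (lebesgue_on {0..1} \<Otimes>\<^sub>M N)"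
    and F: "F \<in> borel_measurable borel" and v: "AE t in lebesgue_on {0..1}. AE x in N. v t x = V (t, x)"
    and b: "AE t in lebesgue_on {0..1}. (\<integral>\<^sup>+x. F (v t x) \<partial>N) \<le> B"
  shows "(\<integral>\<^sup>+z. F (V z) \<partial>(lebesgue_on {0..1} \<Otimes>\<^sub>M N)) \<le> B"
proof -
  interpret N: finite_measure N by (rule fin)
  have m: "(\<lambda>z. F (V z)) \<in> borel_measurable (lebesgue_on {0..1} \<Otimes>\<^sub>M N)" by (rule measurable_compose[OF V F])
  have "(\<integral>\<^sup>+z. F (V z) \<partial>(lebesgue_on {0..1} \<Otimes>\<^sub>M N)) = (\<integral>\<^sup>+t. \<integral>\<^sup>+x. F (V (t, x)) \<partial>N \<partial>lebesgue_on {0..1})"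
    using N.nn_integral_fst[OF m] by simp
  also have "\<dots> \<le> (\<integral>\<^sup>+t. B \<partial>lebesgue_on {0..1::real})"
  proof (rule nn_integral_mono_AE)
    show "AE t in lebesgue_on {0..1}. (\<integral>\<^sup>+x. F (V (t, x)) \<partial>N) \<le> B"
      using v b
    proof eventually_elim
      case (elim t)
      have "(\<integral>\<^sup>+x. F (V (t, x)) \<partial>N) = (\<integral>\<^sup>+x. F (v t x) \<partial>N)"
        using elim(1) by (intro nn_integral_cong_AE) (auto elim!: eventually_mono)
      then show ?case using elim(2) by simp
    qed
  qed
  also have "\<dots> = B" by simp
  finally show ?thesis .
qed

lemma damping_work_integrable:
  fixes vt :: "real \<Rightarrow> 'a \<Rightarrow> real" and V0 :: "real \<times> 'a \<Rightarrow> real"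
  assumes fin: "finite_measure N" and g: "damping_condition g \<alpha> \<beta> k" and ab: "0 < \<alpha>" "0 < \<beta>"
    and V0: "V0 \<in> Lp (k + 1) (lebesgue_on {0..T} \<Otimes>\<^sub>M N)" and v: "AE t in lebesgue_on {0..T}. AE x in N. vt t x = V0 (t, x)"
    and vm: "\<And>t. t \<in> {0..T} \<Longrightarrow> vt t \<in> borel_measurable N"
  shows "integrable (lebesgue_on {0..T}) (\<lambda>t. \<integral>x. g (vt t x) * vt t x \<partial>N)"
    "(\<integral>t. \<integral>x. g (vt t x) * vt t x \<partial>N \<partial>lebesgue_on {0..T}) = (\<integral>z. g (V0 z) * V0 z \<partial>(lebesgue_on {0..T} \<Otimes>\<^sub>M N))"
proof -
  note gm = damping_basic(1)[OF g ab]
  have V0m: "V0 \<in> borel_measurable (lebesgue_on {0..T} \<Otimes>\<^sub>M N)" using V0 by (rule Lp_measurable)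
  have "AE t in lebesgue_on {0..T}. t \<in> {0..T}" by (rule AE_I2) simp
  with v have e: "AE t in lebesgue_on {0..T}. (\<integral>x. g (vt t x) * vt t x \<partial>N) = (\<integral>x. g (V0 (t, x)) * V0 (t, x) \<partial>N)"
  proof eventually_elim
    case (elim t)
    note m = vm[OF elim(2)] measurable_Pair2[OF V0m, of t]
    show ?case using elim m measurable_compose[OF m(1) gm] measurable_compose[OF m(2) gm]
      by (intro integral_cong_AE borel_measurable_times) (auto elim!: eventually_mono)
  qed
  note I = damping_integrable[OF cylinder_finite[OF fin] g ab V0]
  show "integrable (lebesgue_on {0..T}) (\<lambda>t. \<integral>x. g (vt t x) * vt t x \<partial>N)"
    "(\<integral>t. \<integral>x. g (vt t x) * vt t x \<partial>N \<partial>lebesgue_on {0..T}) = (\<integral>z. g (V0 z) * V0 z \<partial>(lebesgue_on {0..T} \<Otimes>\<^sub>M N))"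
    using cylinder_integral(1,2)[OF fin I e] by simp_all
qed

lemma damping_kinetic_time:
  fixes vt :: "real \<Rightarrow> 'a \<Rightarrow> real" and V0 :: "real \<times> 'a \<Rightarrow> real"
  assumes fin: "finite_measure N" and g: "damping_condition g \<alpha> \<beta> k" and ab: "0 < \<alpha>" "0 < \<beta>"
    and c: "concave_majorant \<phi> g"
    and V0: "V0 \<in> Lp (k + 1) (lebesgue_on {0..1} \<Otimes>\<^sub>M N)" and v: "AE t in lebesgue_on {0..1}. AE x in N. vt t x = V0 (t, x)"
    and vm: "\<And>t. t \<in> {0..1} \<Longrightarrow> vt t \<in> borel_measurable N"
  defines "D \<equiv> \<integral>t. \<integral>x. g (vt t x) * vt t x \<partial>N \<partial>lebesgue_on {0..1}"
  shows "(\<integral>t. (Lp_norm 2 N (vt t))\<^sup>2 \<partial>lebesgue_on {0..1}) \<le> (measure N (space N) + 1) * \<phi> D + D / \<alpha>" "0 \<le> D"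
proof -
  have V0m: "V0 \<in> borel_measurable (lebesgue_on {0..1} \<Otimes>\<^sub>M N)" using V0 by (rule Lp_measurable)
  have DQ: "D = (\<integral>z. g (V0 z) * V0 z \<partial>(lebesgue_on {0..1} \<Otimes>\<^sub>M N))"
    unfolding D_def by (rule damping_work_integrable(2)[OF fin g ab V0 v vm])
  show D: "0 \<le> D" unfolding DQ using damping_basic(3)[OF g ab] by simp
  have pD: "0 \<le> \<phi> D" using c D by (simp add: concave_majorant_def)
  have B: "0 \<le> (measure N (space N) + 1) * \<phi> D + D / \<alpha>" using pD D ab by simp
  have k: "(\<integral>\<^sup>+z. ennreal ((V0 z)\<^sup>2) \<partial>(lebesgue_on {0..1} \<Otimes>\<^sub>M N)) \<le> ennreal ((measure N (space N) + 1) * \<phi> D + D / \<alpha>)"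
    using damping_kinetic[OF cylinder_finite[OF fin] g ab c V0] unfolding unit_cylinder_measure[OF fin] DQ .
  have I: "integrable (lebesgue_on {0..1} \<Otimes>\<^sub>M N) (\<lambda>z. (V0 z)\<^sup>2)"
  proof (rule integrableI_bounded)
    show "(\<lambda>z. (V0 z)\<^sup>2) \<in> borel_measurable (lebesgue_on {0..1} \<Otimes>\<^sub>M N)" using V0m by simp
    show "(\<integral>\<^sup>+z. ennreal (norm ((V0 z)\<^sup>2)) \<partial>(lebesgue_on {0..1} \<Otimes>\<^sub>M N)) < \<infinity>"
      using order_le_less_trans[OF k ennreal_less_top] by simp
  qed
  have "AE t in lebesgue_on {0..1::real}. t \<in> {0..1}" by (rule AE_I2) simp
  with v have e: "AE t in lebesgue_on {0..1}. (Lp_norm 2 N (vt t))\<^sup>2 = (\<integral>x. (V0 (t, x))\<^sup>2 \<partial>N)"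
  proof eventually_elim
    case (elim t)
    show ?case unfolding L2_norm_sq using elim vm[OF elim(2)] measurable_Pair2[OF V0m, of t]
      by (intro integral_cong_AE borel_measurable_power) (auto elim!: eventually_mono)
  qed
  have "(\<integral>t. (Lp_norm 2 N (vt t))\<^sup>2 \<partial>lebesgue_on {0..1}) = (\<integral>z. (V0 z)\<^sup>2 \<partial>(lebesgue_on {0..1} \<Otimes>\<^sub>M N))"
    by (rule cylinder_integral(2)[OF fin I e])
  also have "\<dots> \<le> (measure N (space N) + 1) * \<phi> D + D / \<alpha>"
    using k B nn_integral_eq_integral[OF I] by simp
  finally show "(\<integral>t. (Lp_norm 2 N (vt t))\<^sup>2 \<partial>lebesgue_on {0..1}) \<le> (measure N (space N) + 1) * \<phi> D + D / \<alpha>" .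
qed

lemma damping_pairing_time:
  fixes vt v :: "real \<Rightarrow> 'a \<Rightarrow> real" and V0 V :: "real \<times> 'a \<Rightarrow> real"
  assumes fin: "finite_measure N" and g: "damping_condition g \<alpha> \<beta> k" and ab: "0 < \<alpha>" "0 < \<beta>"
    and c: "concave_majorant \<phi> g"
    and V0: "V0 \<in> Lp (k + 1) (lebesgue_on {0..1} \<Otimes>\<^sub>M N)" and vt: "AE t in lebesgue_on {0..1}. AE x in N. vt t x = V0 (t, x)"
    and V: "V \<in> borel_measurable (lebesgue_on {0..1} \<Otimes>\<^sub>M N)" and v: "AE t in lebesgue_on {0..1}. AE x in N. v t x = V (t, x)"
    and vm: "\<And>t. t \<in> {0..1} \<Longrightarrow> vt t \<in> borel_measurable N" "\<And>t. t \<in> {0..1} \<Longrightarrow> v t \<in> borel_measurable N"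
    and b: "AE t in lebesgue_on {0..1}. (\<integral>\<^sup>+x. ennreal ((v t x)\<^sup>2) \<partial>N) \<le> ennreal B1"
      "AE t in lebesgue_on {0..1}. (\<integral>\<^sup>+x. ennreal (\<bar>v t x\<bar> powr (k + 1)) \<partial>N) \<le> ennreal B2" "0 \<le> B1" "0 \<le> B2"
    and e: "0 < \<epsilon>"
  defines "D \<equiv> \<integral>t. \<integral>x. g (vt t x) * vt t x \<partial>N \<partial>lebesgue_on {0..1}"
  shows "integrable (lebesgue_on {0..1}) (\<lambda>t. \<integral>x. g (vt t x) * v t x \<partial>N)"
    "(\<integral>t. \<bar>\<integral>x. g (vt t x) * v t x \<partial>N\<bar> \<partial>lebesgue_on {0..1})
      \<le> (measure N (space N) + 1) / \<epsilon> * \<phi> D + \<epsilon> powr (- 1 / k) * \<beta> powr (1 / k) * D + \<epsilon> * (B1 + B2)" (is "_ \<le> ?B")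
proof -
  let ?Q = "lebesgue_on {0..1::real} \<Otimes>\<^sub>M N"
  note gm = damping_basic(1)[OF g ab]
  have V0m: "V0 \<in> borel_measurable ?Q" using V0 by (rule Lp_measurable)
  have DQ: "D = (\<integral>z. g (V0 z) * V0 z \<partial>?Q)"
    unfolding D_def by (rule damping_work_integrable(2)[OF fin g ab V0 vt vm(1)])
  have D: "0 \<le> D" unfolding DQ using damping_basic(3)[OF g ab] by simp
  have pD: "0 \<le> \<phi> D" using c D by (simp add: concave_majorant_def)
  have B: "0 \<le> ?B" using pD D e b(3,4) by simp
  have b1: "(\<integral>\<^sup>+z. ennreal ((V z)\<^sup>2) \<partial>?Q) \<le> ennreal B1"
    by (rule cylinder_nn_bound[OF fin V _ v b(1)]) simp
  have b2: "(\<integral>\<^sup>+z. ennreal (\<bar>V z\<bar> powr (k + 1)) \<partial>?Q) \<le> ennreal B2"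
    by (rule cylinder_nn_bound[OF fin V _ v b(2)]) simp
  have k: "(\<integral>\<^sup>+z. ennreal \<bar>g (V0 z) * V z\<bar> \<partial>?Q) \<le> ennreal ?B"
    using damping_pairing[OF cylinder_finite[OF fin] g ab c V0 V e b1 b2 b(3,4)] unfolding unit_cylinder_measure[OF fin] DQ .
  have I: "integrable ?Q (\<lambda>z. g (V0 z) * V z)"
  proof (rule integrableI_bounded)
    show "(\<lambda>z. g (V0 z) * V z) \<in> borel_measurable ?Q" by (intro borel_measurable_times V measurable_compose[OF V0m gm])
    show "(\<integral>\<^sup>+z. ennreal (norm (g (V0 z) * V z)) \<partial>?Q) < \<infinity>"
      unfolding real_norm_def using order_le_less_trans[OF k ennreal_less_top] by simp
  qed
  have "AE t in lebesgue_on {0..1::real}. t \<in> {0..1}" by (rule AE_I2) simp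
  with vt v have e: "AE t in lebesgue_on {0..1}. (\<integral>x. g (vt t x) * v t x \<partial>N) = (\<integral>x. g (V0 (t, x)) * V (t, x) \<partial>N)"
  proof eventually_elim
    case (elim t)
    note m = vm(1)[OF elim(3)] measurable_Pair2[OF V0m, of t]
    have a: "AE x in N. g (vt t x) * v t x = g (V0 (t, x)) * V (t, x)" using elim(1,2) by eventually_elim simp
    show ?case using a vm(2)[OF elim(3)] measurable_Pair2[OF V, of t] elim(3) measurable_compose[OF m(1) gm] measurable_compose[OF m(2) gm]
      by (intro integral_cong_AE borel_measurable_times) auto
  qed
  show "integrable (lebesgue_on {0..1}) (\<lambda>t. \<integral>x. g (vt t x) * v t x \<partial>N)" by (rule cylinder_integral(1)[OF fin I e])
  have "(\<integral>t. \<bar>\<integral>x. g (vt t x) * v t x \<partial>N\<bar> \<partial>lebesgue_on {0..1}) \<le> (\<integral>z. \<bar>g (V0 z) * V z\<bar> \<partial>?Q)"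
    by (rule cylinder_integral(3)[OF fin I e])
  also have "\<dots> \<le> ?B" using k B nn_integral_eq_integral[OF integrable_abs[OF I]] by simp
  finally show "(\<integral>t. \<bar>\<integral>x. g (vt t x) * v t x \<partial>N\<bar> \<partial>lebesgue_on {0..1}) \<le> ?B" .
qed

text \<open>Proved for the jointly measurable version and transferred to the given representatives
  by completeness.\<close>

lemma composition_time_measurable:
  fixes F :: "real \<Rightarrow> real" and v :: "real \<Rightarrow> 'a \<Rightarrow> real"
  assumes fin: "finite_measure N" and F: "F \<in> borel_measurable borel"
    and V: "V \<in> borel_measurable (lebesgue_on {0..1} \<Otimes>\<^sub>M N)" and v: "AE t in lebesgue_on {0..1}. AE x in N. v t x = V (t, x)"
    and vm: "\<And>t. t \<in> {0..1} \<Longrightarrow> v t \<in> borel_measurable N"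
  shows "(\<lambda>t. \<integral>x. F (v t x) \<partial>N) \<in> borel_measurable (lebesgue_on {0..1})"
proof (rule lebesgue_on_complete)
  interpret N: finite_measure N by (rule fin)
  have "(\<lambda>(t, x). F (V (t, x))) \<in> borel_measurable (lebesgue_on {0..1} \<Otimes>\<^sub>M N)" using measurable_compose[OF V F] by (simp add: case_prod_beta)
  then show "(\<lambda>t. \<integral>x. F (V (t, x)) \<partial>N) \<in> borel_measurable (lebesgue_on {0..1})" by (rule N.borel_measurable_lebesgue_integral)
  have "AE t in lebesgue_on {0..1::real}. t \<in> {0..1}" by (rule AE_I2) simp
  with v show "AE t in lebesgue_on {0..1}. (\<integral>x. F (V (t, x)) \<partial>N) = (\<integral>x. F (v t x) \<partial>N)"
  proof eventually_elim
    case (elim t)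
    note m = vm[OF elim(2)] measurable_Pair2[OF V, of t]
    show ?case using elim m measurable_compose[OF m(1) F] measurable_compose[OF m(2) F]
      by (intro integral_cong_AE) (auto elim!: eventually_mono)
  qed
qed simp

lemma Young_quadratic: "0 < \<eta> \<Longrightarrow> a * b \<le> a\<^sup>2 / (2 * \<eta>) + \<eta> / 2 * b\<^sup>2" for a b :: real
proof -
  assume e: "0 < \<eta>"
  have "0 \<le> (a - \<eta> * b)\<^sup>2 / (2 * \<eta>)" using e by simp
  also have "\<dots> = a\<^sup>2 / (2 * \<eta>) + \<eta> / 2 * b\<^sup>2 - a * b" using e by (simp add: power2_eq_square field_simps)
  finally show ?thesis by simp
qed

section \<open>Testing the equations with the solution\<close>

context well_solution
begin

abbreviation "Iv t f \<equiv> integral\<^sup>L (lebesgue_on {0..t::real}) (f :: real \<Rightarrow> real)"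
abbreviation "ga t \<equiv> Gamma_trace S (u t)"

text \<open>The quantities of the tested identity: \<open>pr\<close> is the boundary coupling,
  \<open>RO\<close> and \<open>RG\<close> the damping work on the displacement, \<open>srO\<close>
  and \<open>srG\<close> the source work after Euler's identity, and \<open>bb\<close> collects the
  terms outside the time integrals.\<close>

definition "pr = (\<lambda>t. L2_inner (mG S) (wt t) (ga t))"
definition "RO = (\<lambda>t. \<integral>x. damp_g1 S (ut t x) * u t x \<partial>mO S)"
definition "RG = (\<lambda>t. \<integral>y. damp_g2 S (wt t y) * w t y \<partial>mG S)"
definition "srO = (\<lambda>t. (exp_p S + 1) * (\<integral>x. pot_F S (u t x) \<partial>mO S))"
definition "srG = (\<lambda>t. (exp_q S + 1) * (\<integral>y. pot_H S (w t y) \<partial>mG S))"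
definition "bb = (\<lambda>t. L2_inner (mO S) (ut t) (u t) + L2_inner (mG S) (wt t) (w t) + L2_inner (mG S) (ga t) (w t))"

lemma damp: "damping_condition (damp_g1 S) (coef_alpha S) (coef_beta S) (exp_m S)"
  "damping_condition (damp_g2 S) (coef_alpha S) (coef_beta S) (exp_r S)" "0 < coef_alpha S" "0 < coef_beta S"
  "1 \<le> exp_m S" "1 \<le> exp_r S"
  using cA by (auto simp: conditions_A_def damping_condition_def)

lemma emb_pos: "0 < emb_c1 S" "0 < emb_c2 S" "0 < emb_tr S"
  using emb by (auto simp: embedding_constants_def)

lemma emb_norms:
  assumes "t \<in> {0..1}"
  shows "(Lp_norm 2 (mO S) (u t))\<^sup>2 \<le> emb_c1 S * (gr t)\<^sup>2" "(Lp_norm 2 (mG S) (ga t))\<^sup>2 \<le> emb_tr S * (gr t)\<^sup>2"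
    "(Lp_norm 2 (mG S) (w t))\<^sup>2 \<le> emb_c2 S * (la t)\<^sup>2" "ga t \<in> Lp 2 (mG S)"
  using emb spaces(1,3)[OF assms] Gamma_trace_Lp_2[OF adm spaces(1)[OF assms]] by (simp_all add: embedding_constants_def)

text \<open>\<open>V\<close> lies in \<open>L^(m+1)\<close> of the cylinder because
  \<open>u0\<close> and \<open>ut\<close> do; thus \<open>u\<close> qualifies as a test function in
  its own equation.\<close>

lemma reps_Omega:
  obtains V0 V where "V0 \<in> Lp (exp_m S + 1) (UT \<Otimes>\<^sub>M mO S)" "AE t in UT. AE x in mO S. ut t x = V0 (t, x)"
    "V \<in> Lp (exp_m S + 1) (UT \<Otimes>\<^sub>M mO S)" "AE t in UT. AE x in mO S. u t x = V (t, x)"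
proof -
  have "ut \<in> Lp_cyl (exp_m S + 1) {0..1} (mO S)" using ws[of 1] by (simp add: weak_solution_def)
  then obtain V0 where V0: "V0 \<in> Lp (exp_m S + 1) (UT \<Otimes>\<^sub>M mO S)" "AE t in UT. AE x in mO S. ut t x = V0 (t, x)"
    unfolding Lp_cyl_def by blast
  obtain V where V: "V \<in> borel_measurable (UT \<Otimes>\<^sub>M mO S)" "\<And>t. t \<in> {0..1} \<Longrightarrow> AE x in mO S. u t x = V (t, x)"
    "\<And>t x. V (t, x) = u 0 x + (\<integral>s. (if s \<le> t then V0 (s, x) else 0) \<partial>UT)"
    by (rule time_representative[OF finO spaces(7) ws1(3) Lp_measurable[OF V0(1)] V0(2)]) blast+
  have m0: "u 0 \<in> borel_measurable (mO S)" by (rule Lp_measurable[OF spaces(7)]) simp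
  have "u 0 \<in> Lp (exp_m S + 1) (mO S)"
  proof -
    have i: "u0 \<in> borel_measurable (mO S)" "integrable (mO S) (\<lambda>x. \<bar>u0 x\<bar> powr (exp_m S + 1))" using init(1) by (auto simp: Lp_def)
    have "integrable (mO S) (\<lambda>x. \<bar>u 0 x\<bar> powr (exp_m S + 1))"
      by (rule integrable_cong_AE_imp[OF i(2)]) (use m0 ws1(7) in \<open>auto elim!: eventually_mono\<close>)
    then show ?thesis using m0 by (simp add: Lp_def)
  qed
  from time_representative_Lp[OF finO _ this V0(1) V(1,3)] damp(5)
  have VL: "V \<in> Lp (exp_m S + 1) (UT \<Otimes>\<^sub>M mO S)" by simp
  have VA: "AE t in UT. AE x in mO S. u t x = V (t, x)" by (rule AE_I2) (rule V(2), simp)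
  show thesis by (rule that[OF V0 VL VA])
qed

lemma reps_Gamma:
  obtains W0 W where "W0 \<in> Lp (exp_r S + 1) (UT \<Otimes>\<^sub>M mG S)" "AE t in UT. AE y in mG S. wt t y = W0 (t, y)"
    "W \<in> borel_measurable (UT \<Otimes>\<^sub>M mG S)" "AE t in UT. AE y in mG S. w t y = W (t, y)"
proof -
  have "wt \<in> Lp_cyl (exp_r S + 1) {0..1} (mG S)" using ws[of 1] by (simp add: weak_solution_def)
  then obtain W0 where W0: "W0 \<in> Lp (exp_r S + 1) (UT \<Otimes>\<^sub>M mG S)" "AE t in UT. AE y in mG S. wt t y = W0 (t, y)"
    unfolding Lp_cyl_def by blast
  obtain W where W: "W \<in> borel_measurable (UT \<Otimes>\<^sub>M mG S)" "\<And>t. t \<in> {0..1} \<Longrightarrow> AE y in mG S. w t y = W (t, y)"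
    by (rule time_representative[OF finG spaces(8) ws1(6) Lp_measurable[OF W0(1)] W0(2)]) blast+
  have WA: "AE t in UT. AE y in mG S. w t y = W (t, y)" by (rule AE_I2) (rule W(2), simp)
  show thesis by (rule that[OF W0 W(1) WA])
qed

lemma quad_bound:
  assumes "0 \<le> t"
  shows "kO t + kG t + (gr t)\<^sup>2 + (la t)\<^sup>2 \<le> 2 * (const_c S / (const_c S - 2)) * EE 0"
proof -
  define q where "q = quadratic_energy S u ut w wt t"
  have "(const_c S - 2) / const_c S * q \<le> EE 0" unfolding q_def using energy(3,4)[OF assms] by (rule order_trans[rotated])
  then have "q \<le> const_c S / (const_c S - 2) * EE 0" using c_gt by (simp add: field_simps)
  moreover have "kO t + kG t + (gr t)\<^sup>2 + (la t)\<^sup>2 = 2 * q" by (simp add: q_def quadratic_energy_def)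
  ultimately show ?thesis by simp
qed

text \<open>The integrands are nonnegative, but integrability on the longer interval has to be shown
  as well: a nonintegrable function has integral 0 by default, and monotonicity would fail.\<close>

lemma dissipation_mono:
  assumes "0 \<le> t" "t \<le> T" "0 < T"
  shows "0 \<le> dissipation S ut wt t" "dissipation S ut wt t \<le> dissipation S ut wt T"
proof -
  note gnn = damping_basic(3)[OF damp(1,3,4)] damping_basic(3)[OF damp(2,3,4)]
  show "0 \<le> dissipation S ut wt t" unfolding dissipation_def using gnn by simp
  have W: "weak_solution S T u0 u1 w0 w1 u ut w wt" by (rule ws[OF assms(3)])
  then obtain V0 where V0: "V0 \<in> Lp (exp_m S + 1) (lebesgue_on {0..T} \<Otimes>\<^sub>M mO S)"
    "AE t in lebesgue_on {0..T}. AE x in mO S. ut t x = V0 (t, x)" unfolding weak_solution_def Lp_cyl_def by blast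
  from W obtain W0 where W0: "W0 \<in> Lp (exp_r S + 1) (lebesgue_on {0..T} \<Otimes>\<^sub>M mG S)"
    "AE t in lebesgue_on {0..T}. AE y in mG S. wt t y = W0 (t, y)" unfolding weak_solution_def Lp_cyl_def by blast
  have m: "ut t \<in> borel_measurable (mO S)" "wt t \<in> borel_measurable (mG S)" if "t \<in> {0..T}" for t
    using W that by (auto simp: weak_solution_def cont_into_def intro: Lp_measurable)
  have i: "integrable (lebesgue_on {0..T}) (\<lambda>t. \<integral>x. damp_g1 S (ut t x) * ut t x \<partial>mO S)"
    "integrable (lebesgue_on {0..T}) (\<lambda>t. \<integral>y. damp_g2 S (wt t y) * wt t y \<partial>mG S)"
    by (rule damping_work_integrable(1)[OF finO damp(1,3,4) V0 m(1)], assumption)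
       (rule damping_work_integrable(1)[OF finG damp(2,3,4) W0 m(2)], assumption)
  have nn: "0 \<le> (\<integral>x. damp_g1 S (ut r x) * ut r x \<partial>mO S)" "0 \<le> (\<integral>y. damp_g2 S (wt r y) * wt r y \<partial>mG S)" for r
    using gnn by simp_all
  show "dissipation S ut wt t \<le> dissipation S ut wt T" unfolding dissipation_def
    by (intro add_mono integral_interval_mono[OF assms(2)] i AE_I2 nn)
qed

text \<open>The solution itself is tested against the equations (equipartition of energy).\<close>

lemma test_equations:
  obtains c where "\<And>t. t \<in> {0..1} \<Longrightarrow> bb t - Iv t kO - Iv t kG + Iv t (\<lambda>r. (gr r)\<^sup>2) + Iv t (\<lambda>r. (la r)\<^sup>2)
    - 2 * Iv t pr + Iv t RO + Iv t RG - Iv t srO - Iv t srG = c"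
proof -
  obtain V0 V where V: "V0 \<in> Lp (exp_m S + 1) (UT \<Otimes>\<^sub>M mO S)" "AE t in UT. AE x in mO S. ut t x = V0 (t, x)"
    "V \<in> Lp (exp_m S + 1) (UT \<Otimes>\<^sub>M mO S)" "AE t in UT. AE x in mO S. u t x = V (t, x)"
    by (rule reps_Omega)
  have "u \<in> Lp_cyl (exp_m S + 1) {0..1} (mO S)" unfolding Lp_cyl_def using V(3,4) by blast
  then have tu: "test_phi S 1 u ut" using ws1(1,3) by (simp add: test_phi_def)
  have tw: "test_psi S 1 w wt" using ws1(4,6) by (simp add: test_psi_def)
  \<comment> \<open>Removes the twelve regularity and initial conditions; the two weak equations
    remain.\<close>
  note W = ws[OF zero_less_one, unfolded weak_solution_def, THEN conjunct2, THEN conjunct2, THEN conjunct2, THEN conjunct2,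
    THEN conjunct2, THEN conjunct2, THEN conjunct2, THEN conjunct2, THEN conjunct2, THEN conjunct2, THEN conjunct2, THEN conjunct2]
  define cO where "cO = L2_inner (mO S) u1 (u 0)"
  define cG where "cG = L2_inner (mG S) (\<lambda>y. w1 y + Gamma_trace S (u 0) y) (w 0)"
  have cm: "L2_inner (mG S) (Gamma_trace S (u r)) (wt r) = L2_inner (mG S) (wt r) (Gamma_trace S (u r))" for r
    by (rule L2_inner_commute)
  \<comment> \<open>The source term \<open>f(u) * u\<close> becomes \<open>(p + 1) * F(u)\<close> by
    Euler's identity. The coupling appears here and in the plate equation with the same sign, hence
    twice in the sum.\<close>
  have eO: "L2_inner (mO S) (ut t) (u t) - cO - Iv t kO + Iv t (\<lambda>r. (gr r)\<^sup>2) - Iv t pr + Iv t RO = Iv t srO" if "t \<in> {0..1}" for t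
    using W[THEN conjunct1, rule_format, OF tu that]
    by (simp only: cO_def L2_inner_self weak_grad_inner_self pr_def RO_def srO_def homogeneous_Euler[OF potF(1)] integral_mult_right_zero)
  have eG: "L2_inner (mG S) (\<lambda>y. wt t y + ga t y) (w t) - cG - Iv t kG - Iv t pr + Iv t (\<lambda>r. (la r)\<^sup>2) + Iv t RG = Iv t srG" if "t \<in> {0..1}" for t
    using W[THEN conjunct2, rule_format, OF tw that]
    by (simp only: cG_def L2_inner_self lap_norm_def cm pr_def RG_def srG_def homogeneous_Euler[OF potF(2)] integral_mult_right_zero)
  have lin: "b1 + b2 + b3 - k1 - k2 + g1 + g2 - 2 * p + r1 + r2 - s1 - s2 = c1 + c2"
    if "b1 - c1 - k1 + g1 - p + r1 = s1" "b - c2 - k2 - p + g2 + r2 = s2" "b = b2 + b3"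
    for b b1 b2 b3 k1 k2 g1 g2 p r1 r2 s1 s2 c1 c2 :: real using that by simp
  show thesis
  proof (rule that)
    fix t :: real assume t: "t \<in> {0..1}"
    have sp: "L2_inner (mG S) (\<lambda>y. wt t y + ga t y) (w t) = L2_inner (mG S) (wt t) (w t) + L2_inner (mG S) (ga t) (w t)"
      by (rule L2_inner_add_left[OF spaces(4)[OF t] emb_norms(4)[OF t] spaces(8)[OF t]])
    from lin[OF eO[OF t] eG[OF t] sp]
    show "bb t - Iv t kO - Iv t kG + Iv t (\<lambda>r. (gr r)\<^sup>2) + Iv t (\<lambda>r. (la r)\<^sup>2)
      - 2 * Iv t pr + Iv t RO + Iv t RG - Iv t srO - Iv t srG = cO + cG" unfolding bb_def .
  qed
qed

text \<open>Both terms are nonnegative and their sum is at most \<open>const_xi S \<delta>\<close>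
  times a function continuous in time.\<close>

lemma source_integrable: "integrable UT srO" "integrable UT srG"
proof -
  obtain V0 V where V: "V0 \<in> Lp (exp_m S + 1) (UT \<Otimes>\<^sub>M mO S)" "AE t in UT. AE x in mO S. ut t x = V0 (t, x)"
    "V \<in> Lp (exp_m S + 1) (UT \<Otimes>\<^sub>M mO S)" "AE t in UT. AE x in mO S. u t x = V (t, x)"
    by (rule reps_Omega)
  obtain W0 W where W: "W0 \<in> Lp (exp_r S + 1) (UT \<Otimes>\<^sub>M mG S)" "AE t in UT. AE y in mG S. wt t y = W0 (t, y)"
    "W \<in> borel_measurable (UT \<Otimes>\<^sub>M mG S)" "AE t in UT. AE y in mG S. w t y = W (t, y)"
    by (rule reps_Gamma)
  have gm: "(\<lambda>t. (gr t)\<^sup>2 + (la t)\<^sup>2) \<in> borel_measurable UT" "integrable UT (\<lambda>t. const_xi S \<delta> * ((gr t)\<^sup>2 + (la t)\<^sup>2))"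
    using continuous_integrable_unit[of "\<lambda>t. (gr t)\<^sup>2 + (la t)\<^sup>2"] continuous_on_add[OF continuous_on_power[OF cont_gr] continuous_on_power[OF cont_la]] by auto
  have m: "srO \<in> borel_measurable UT" "srG \<in> borel_measurable UT" unfolding srO_def srG_def
    using composition_time_measurable[OF finO homogeneous_measurable[OF potF(1)] Lp_measurable[OF V(3)] V(4) Lp_measurable[OF spaces(7)]]
      composition_time_measurable[OF finG homogeneous_measurable[OF potF(2)] W(3,4) Lp_measurable[OF spaces(8)]]
    by (auto intro!: borel_measurable_times)
  have b: "norm (srO t) \<le> norm (const_xi S \<delta> * ((gr t)\<^sup>2 + (la t)\<^sup>2))" "norm (srG t) \<le> norm (const_xi S \<delta> * ((gr t)\<^sup>2 + (la t)\<^sup>2))"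
    if t: "t \<in> {0..1}" for t
  proof -
    have nn: "0 \<le> srO t" "0 \<le> srG t" unfolding srO_def srG_def using intF(1,3)[OF t] pq by simp_all
    have "srO t + srG t \<le> const_xi S \<delta> * ((gr t)\<^sup>2 + (la t)\<^sup>2)" using source_bound(2)[OF t] by (simp only: srO_def srG_def source_work_def)
    then show "norm (srO t) \<le> norm (const_xi S \<delta> * ((gr t)\<^sup>2 + (la t)\<^sup>2))" "norm (srG t) \<le> norm (const_xi S \<delta> * ((gr t)\<^sup>2 + (la t)\<^sup>2))"
      unfolding real_norm_def using nn by linarith+
  qed
  show "integrable UT srO" "integrable UT srG"
    by (rule Bochner_Integration.integrable_bound[OF gm(2) m(1)], rule AE_I2, rule b(1), simp)
       (rule Bochner_Integration.integrable_bound[OF gm(2) m(2)], rule AE_I2, rule b(2), simp)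
qed

end

section \<open>Estimates with constants uniform over the solutions\<close>

text \<open>The constants \<open>tr\<close>, \<open>bm\<close>, \<open>br\<close> are parameters of
  the locale, so the final constant is an expression in them and in the model, visibly the same for
  all solutions. The power bounds are quadratic in the norms in order to be absorbed by the
  energy.\<close>

locale well_estimate = well_solution +
  fixes tr bm br :: real
  assumes tr: "0 \<le> tr" "\<And>v v'. v \<in> H1_Gamma0 S \<Longrightarrow> v' \<in> H1_Gamma0 S \<Longrightarrow>
      (Lp_norm 2 (mG S) (\<lambda>y. Gamma_trace S v y - Gamma_trace S v' y))\<^sup>2
        \<le> tr * (Lp_norm 2 (mO S) (\<lambda>x. v x - v' x) * H1_norm (Omega S) (\<lambda>x. v x - v' x))"
    and bm: "0 \<le> bm" "AE t in UT. (\<integral>\<^sup>+x. ennreal (\<bar>u t x\<bar> powr (exp_m S + 1)) \<partial>mO S) \<le> ennreal (bm * (gr t)\<^sup>2)"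
    and br: "0 \<le> br" "AE t in UT. (\<integral>\<^sup>+y. ennreal (\<bar>w t y\<bar> powr (exp_r S + 1)) \<partial>mG S) \<le> ennreal (br * (la t)\<^sup>2)"
begin

lemma diff_H1_bound:
  assumes "v \<in> H1_Gamma0 S" "v' \<in> H1_Gamma0 S"
  shows "(H1_norm (Omega S) (\<lambda>x. v x - v' x))\<^sup>2 \<le> (emb_c1 S + 1) * (grad_norm (Omega S) (\<lambda>x. v x - v' x))\<^sup>2"
proof -
  have "(\<lambda>x. v x - v' x) \<in> H1_Gamma0 S" by (rule H1_Gamma0_diff[OF adm assms])
  then have "(Lp_norm 2 (mO S) (\<lambda>x. v x - v' x))\<^sup>2 \<le> emb_c1 S * (grad_norm (Omega S) (\<lambda>x. v x - v' x))\<^sup>2"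
    using emb by (simp add: embedding_constants_def)
  then show ?thesis by (simp add: H1_norm_bounds(3) distrib_right)
qed

text \<open>The traces \<open>ga t\<close> are chosen separately for each \<open>t\<close>; the
  trace inequality for differences still makes them continuous in \<open>L2\<close>.\<close>

lemma cont_trace: "cont_into {0..1} (Lp 2 (mG S)) (Lp_norm 2 (mG S)) ga"
  unfolding cont_into_def
proof (intro conjI ballI)
  show "ga t \<in> Lp 2 (mG S)" if "t \<in> {0..1}" for t by (rule emb_norms(4)[OF that])
  fix s :: real assume s: "s \<in> {0..1}"
  let ?C = "sqrt (tr * (emb_c1 S + 1))"
  have l: "((\<lambda>t. grad_norm (Omega S) (\<lambda>x. u t x - u s x)) \<longlongrightarrow> 0) (at s within {0..1})"
    using ws1(1) s by (simp add: cont_into_def)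
  from tendsto_mult_right_zero[OF l, of ?C]
  have l': "((\<lambda>t. ?C * grad_norm (Omega S) (\<lambda>x. u t x - u s x)) \<longlongrightarrow> 0) (at s within {0..1})" .
  have b: "norm (Lp_norm 2 (mG S) (\<lambda>y. ga t y - ga s y)) \<le> ?C * grad_norm (Omega S) (\<lambda>x. u t x - u s x)" if t: "t \<in> {0..1}" for t
  proof -
    let ?z = "\<lambda>x. u t x - u s x"
    note sp = spaces(1)[OF t] spaces(1)[OF s]
    have H: "Lp_norm 2 (mO S) ?z \<le> H1_norm (Omega S) ?z" "0 \<le> H1_norm (Omega S) ?z" by (rule H1_norm_bounds)+
    have gz: "0 \<le> grad_norm (Omega S) ?z" by (simp add: grad_norm_def Lp_norm_def)
    have "(Lp_norm 2 (mG S) (\<lambda>y. ga t y - ga s y))\<^sup>2 \<le> tr * (Lp_norm 2 (mO S) ?z * H1_norm (Omega S) ?z)" by (rule tr(2)[OF sp])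
    also have "\<dots> \<le> tr * (H1_norm (Omega S) ?z)\<^sup>2"
      unfolding power2_eq_square using tr(1) H by (intro mult_left_mono mult_right_mono)
    also have "\<dots> \<le> tr * ((emb_c1 S + 1) * (grad_norm (Omega S) ?z)\<^sup>2)" by (intro mult_left_mono diff_H1_bound sp tr(1))
    also have "\<dots> = (?C * grad_norm (Omega S) ?z)\<^sup>2" using tr(1) emb_pos(1) by (simp add: power_mult_distrib)
    finally have "Lp_norm 2 (mG S) (\<lambda>y. ga t y - ga s y) \<le> ?C * grad_norm (Omega S) ?z"
      by (rule power2_le_imp_le) (use gz tr(1) emb_pos(1) in simp)
    then show ?thesis by (simp add: Lp_norm_def)
  qed
  show "((\<lambda>t. Lp_norm 2 (mG S) (\<lambda>y. ga t y - ga s y)) \<longlongrightarrow> 0) (at s within {0..1})"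
  proof (rule Lim_null_comparison[OF _ l'])
    show "\<forall>\<^sub>F t in at s within {0..1}. norm (Lp_norm 2 (mG S) (\<lambda>y. ga t y - ga s y)) \<le> ?C * grad_norm (Omega S) (\<lambda>x. u t x - u s x)"
      unfolding eventually_at_filter using b by (auto intro!: always_eventually)
  qed
qed

lemma pr_integrable: "integrable UT pr"
  unfolding pr_def by (rule continuous_integrable_unit[OF cont_into_L2_inner[OF ws1(5) cont_trace]])

end

lemma L2_inner_Young:
  assumes "f \<in> Lp 2 N" "g \<in> Lp 2 N" "0 < \<eta>" "(Lp_norm 2 N g)\<^sup>2 \<le> B"
  shows "\<bar>L2_inner N f g\<bar> \<le> (Lp_norm 2 N f)\<^sup>2 / (2 * \<eta>) + \<eta> / 2 * B"
proof -
  have "\<bar>L2_inner N f g\<bar> \<le> Lp_norm 2 N f * Lp_norm 2 N g" by (rule L2_Cauchy_Schwarz[OF assms(1,2)])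
  also have "\<dots> \<le> (Lp_norm 2 N f)\<^sup>2 / (2 * \<eta>) + \<eta> / 2 * (Lp_norm 2 N g)\<^sup>2" by (rule Young_quadratic[OF assms(3)])
  also have "\<dots> \<le> (Lp_norm 2 N f)\<^sup>2 / (2 * \<eta>) + \<eta> / 2 * B" using assms(3,4) by (intro add_left_mono mult_left_mono) auto
  finally show ?thesis .
qed

text \<open>Collects all terms that carry the small factor \<open>\<eta>\<close>. The factor in
  front is 3/2 from the window estimate times the ratio of \<open>Y\<close> to the initial
  energy.\<close>

definition decay_A :: "acoustic \<Rightarrow> real \<Rightarrow> real \<Rightarrow> real \<Rightarrow> real" where
  "decay_A S tr bm br = 3 * (const_c S / (const_c S - 2)) *
     (2 * emb_c1 S + 5/2 * emb_c2 S + 3/2 * emb_tr S + tr * (emb_c1 S + 1) + bm + br)"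

text \<open>A single factor dominating both measures plus 1 and the coefficient
  \<open>1 / coef_alpha S\<close> of the dissipation.\<close>

definition decay_mass :: "acoustic \<Rightarrow> real" where
  "decay_mass S = measure lebesgue (Omega S) + measure lebesgue (Gamma_plane S) + 1 + 1 / coef_alpha S"

text \<open>The number 9/2 is the sum of 3 from the velocities at the two end points, 1/2 from the
  increment of \<open>w\<close>, and 1 from the boundary coupling, which counts twice; the cubic
  term comes from the increment of the trace.\<close>

definition decay_C :: "acoustic \<Rightarrow> real \<Rightarrow> real \<Rightarrow> real" where
  "decay_C S tr \<eta> = 3/2 * ((2 + 9 / (2 * \<eta>) + tr / (4 * \<eta> ^ 3)) * decay_mass S + decay_mass S / \<eta>
     + \<eta> powr (- 1 / exp_m S) * coef_beta S powr (1 / exp_m S) + \<eta> powr (- 1 / exp_r S) * coef_beta S powr (1 / exp_r S))"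

context well_estimate
begin

abbreviation "mu1 \<equiv> measure lebesgue (Omega S)"
abbreviation "mu2 \<equiv> measure lebesgue (Gamma_plane S)"
abbreviation "X s t f \<equiv> integral\<^sup>L UT (\<lambda>r. indicator {s<..t} r * f r :: real)"

text \<open>A common bound for the squared gradient and Laplacian norms at all times, proportional
  to the initial energy; every term multiplied by it has to carry a factor
  \<open>\<eta>\<close>.\<close>

definition "Y = 2 * (const_c S / (const_c S - 2)) * EE 0"
definition "DO = (\<integral>t. \<integral>x. damp_g1 S (ut t x) * ut t x \<partial>mO S \<partial>UT)"
definition "DG = (\<integral>t. \<integral>y. damp_g2 S (wt t y) * wt t y \<partial>mG S \<partial>UT)"
definition "KO = (\<integral>t. kO t \<partial>UT)"
definition "KG = (\<integral>t. kG t \<partial>UT)"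
definition "Z = Phi S (dissipation S ut wt 1)"

lemma Y_bounds:
  assumes "0 \<le> t" shows "(gr t)\<^sup>2 \<le> Y" "(la t)\<^sup>2 \<le> Y" "0 \<le> Y"
  using quad_bound[OF assms] zero_le_power2[of "gr t"] zero_le_power2[of "la t"]
    zero_le_power2[of "Lp_norm 2 (mO S) (ut t)"] zero_le_power2[of "Lp_norm 2 (mG S) (wt t)"]
  unfolding Y_def by linarith+

lemma emb_Y:
  assumes "t \<in> {0..1}"
  shows "(Lp_norm 2 (mO S) (u t))\<^sup>2 \<le> emb_c1 S * Y" "(Lp_norm 2 (mG S) (ga t))\<^sup>2 \<le> emb_tr S * Y"
    "(Lp_norm 2 (mG S) (w t))\<^sup>2 \<le> emb_c2 S * Y"
proof -
  have "0 \<le> t" using assms by simp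
  note b = Y_bounds[OF this]
  show "(Lp_norm 2 (mO S) (u t))\<^sup>2 \<le> emb_c1 S * Y" "(Lp_norm 2 (mG S) (ga t))\<^sup>2 \<le> emb_tr S * Y"
    "(Lp_norm 2 (mG S) (w t))\<^sup>2 \<le> emb_c2 S * Y"
    by (rule order_trans[OF emb_norms(1)[OF assms] mult_left_mono[OF b(1) less_imp_le[OF emb_pos(1)]]],
        rule order_trans[OF emb_norms(2)[OF assms] mult_left_mono[OF b(1) less_imp_le[OF emb_pos(3)]]],
        rule order_trans[OF emb_norms(3)[OF assms] mult_left_mono[OF b(2) less_imp_le[OF emb_pos(2)]]])
qed

lemma time_measurable:
  assumes "t \<in> {0..1}"
  shows "ut t \<in> borel_measurable (mO S)" "wt t \<in> borel_measurable (mG S)" "u t \<in> borel_measurable (mO S)" "w t \<in> borel_measurable (mG S)"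
  using spaces[OF assms] Lp_measurable by blast+

lemma kinetic:
  "KO \<le> (mu1 + 1) * conc_phi1 S DO + DO / coef_alpha S" "KG \<le> (mu2 + 1) * conc_phi2 S DG + DG / coef_alpha S" "0 \<le> DO" "0 \<le> DG"
proof -
  obtain V0 V where V: "V0 \<in> Lp (exp_m S + 1) (UT \<Otimes>\<^sub>M mO S)" "AE t in UT. AE x in mO S. ut t x = V0 (t, x)"
    "V \<in> Lp (exp_m S + 1) (UT \<Otimes>\<^sub>M mO S)" "AE t in UT. AE x in mO S. u t x = V (t, x)"
    by (rule reps_Omega)
  obtain W0 W where W: "W0 \<in> Lp (exp_r S + 1) (UT \<Otimes>\<^sub>M mG S)" "AE t in UT. AE y in mG S. wt t y = W0 (t, y)"
    "W \<in> borel_measurable (UT \<Otimes>\<^sub>M mG S)" "AE t in UT. AE y in mG S. w t y = W (t, y)"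
    by (rule reps_Gamma)
  note kO' = damping_kinetic_time[OF finO damp(1,3,4) maj(1) V(1,2) time_measurable(1), unfolded bounded_open_measure(3)[OF af(1,2,4)]]
  note kG' = damping_kinetic_time[OF finG damp(2,3,4) maj(2) W(1,2) time_measurable(2), unfolded bounded_open_measure(3)[OF af(5,6,7)]]
  show "KO \<le> (mu1 + 1) * conc_phi1 S DO + DO / coef_alpha S" "0 \<le> DO" unfolding KO_def DO_def using kO' by blast+
  show "KG \<le> (mu2 + 1) * conc_phi2 S DG + DG / coef_alpha S" "0 \<le> DG" unfolding KG_def DG_def using kG' by blast+
qed

lemma nn_L2_bound:
  assumes "v \<in> Lp 2 N" "(Lp_norm 2 N v)\<^sup>2 \<le> B"
  shows "(\<integral>\<^sup>+x. ennreal ((v x)\<^sup>2) \<partial>N) \<le> ennreal B"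
  unfolding L2_norm_nn[OF assms(1)] by (rule ennreal_leI[OF assms(2)])

text \<open>For every \<open>\<eta>\<close>: the part carried by the displacement is at most
  \<open>\<eta>\<close> times a multiple of \<open>Y\<close>, the rest is controlled by the
  dissipation with negative powers of \<open>\<eta>\<close>.\<close>

lemma pairing:
  assumes e: "0 < \<eta>"
  shows "integrable UT RO" "(\<integral>t. \<bar>RO t\<bar> \<partial>UT) \<le> (mu1 + 1) / \<eta> * conc_phi1 S DO
      + \<eta> powr (- 1 / exp_m S) * coef_beta S powr (1 / exp_m S) * DO + \<eta> * (emb_c1 S * Y + bm * Y)"
    "integrable UT RG" "(\<integral>t. \<bar>RG t\<bar> \<partial>UT) \<le> (mu2 + 1) / \<eta> * conc_phi2 S DG
      + \<eta> powr (- 1 / exp_r S) * coef_beta S powr (1 / exp_r S) * DG + \<eta> * (emb_c2 S * Y + br * Y)"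
proof -
  obtain V0 V where V: "V0 \<in> Lp (exp_m S + 1) (UT \<Otimes>\<^sub>M mO S)" "AE t in UT. AE x in mO S. ut t x = V0 (t, x)"
    "V \<in> Lp (exp_m S + 1) (UT \<Otimes>\<^sub>M mO S)" "AE t in UT. AE x in mO S. u t x = V (t, x)"
    by (rule reps_Omega)
  obtain W0 W where W: "W0 \<in> Lp (exp_r S + 1) (UT \<Otimes>\<^sub>M mG S)" "AE t in UT. AE y in mG S. wt t y = W0 (t, y)"
    "W \<in> borel_measurable (UT \<Otimes>\<^sub>M mG S)" "AE t in UT. AE y in mG S. w t y = W (t, y)"
    by (rule reps_Gamma)
  have Ymem: "AE t in UT. (gr t)\<^sup>2 \<le> Y" "AE t in UT. (la t)\<^sup>2 \<le> Y"
    by (rule AE_I2, rule Y_bounds(1), simp) (rule AE_I2, rule Y_bounds(2), simp)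
  have b1: "AE t in UT. (\<integral>\<^sup>+x. ennreal ((u t x)\<^sup>2) \<partial>mO S) \<le> ennreal (emb_c1 S * Y)"
    by (rule AE_I2, rule nn_L2_bound[OF spaces(7) emb_Y(1)]) simp_all
  have b2: "AE t in UT. (\<integral>\<^sup>+x. ennreal (\<bar>u t x\<bar> powr (exp_m S + 1)) \<partial>mO S) \<le> ennreal (bm * Y)"
    using bm(2) Ymem(1) by eventually_elim (rule order_trans, assumption, intro ennreal_leI mult_left_mono bm(1), assumption)
  have b3: "AE t in UT. (\<integral>\<^sup>+x. ennreal ((w t x)\<^sup>2) \<partial>mG S) \<le> ennreal (emb_c2 S * Y)"
    by (rule AE_I2, rule nn_L2_bound[OF spaces(8) emb_Y(3)]) simp_all
  have b4: "AE t in UT. (\<integral>\<^sup>+x. ennreal (\<bar>w t x\<bar> powr (exp_r S + 1)) \<partial>mG S) \<le> ennreal (br * Y)"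
    using br(2) Ymem(2) by eventually_elim (rule order_trans, assumption, intro ennreal_leI mult_left_mono br(1), assumption)
  have Y0: "0 \<le> Y" by (rule Y_bounds(3)[of 0]) simp
  have nn: "0 \<le> emb_c1 S * Y" "0 \<le> bm * Y" "0 \<le> emb_c2 S * Y" "0 \<le> br * Y"
    using Y0 emb_pos bm(1) br(1) by auto
  note pO = damping_pairing_time[OF finO damp(1,3,4) maj(1) V(1,2) Lp_measurable[OF V(3)] V(4) time_measurable(1,3) b1 b2 nn(1,2) e,
    unfolded bounded_open_measure(3)[OF af(1,2,4)]]
  note pG = damping_pairing_time[OF finG damp(2,3,4) maj(2) W time_measurable(2,4) b3 b4 nn(3,4) e,
    unfolded bounded_open_measure(3)[OF af(5,6,7)]]
  show "integrable UT RO" unfolding RO_def using pO(1) by blast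
  show "integrable UT RG" unfolding RG_def using pG(1) by blast
  show "(\<integral>t. \<bar>RO t\<bar> \<partial>UT) \<le> (mu1 + 1) / \<eta> * conc_phi1 S DO
      + \<eta> powr (- 1 / exp_m S) * coef_beta S powr (1 / exp_m S) * DO + \<eta> * (emb_c1 S * Y + bm * Y)"
    unfolding RO_def DO_def using pO(2) by blast
  show "(\<integral>t. \<bar>RG t\<bar> \<partial>UT) \<le> (mu2 + 1) / \<eta> * conc_phi2 S DG
      + \<eta> powr (- 1 / exp_r S) * coef_beta S powr (1 / exp_r S) * DG + \<eta> * (emb_c2 S * Y + br * Y)"
    unfolding RG_def DG_def using pG(2) by blast
qed

lemma basic_integrable:
  "integrable UT kO" "integrable UT kG" "integrable UT (\<lambda>r. (gr r)\<^sup>2)" "integrable UT (\<lambda>r. (la r)\<^sup>2)"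
  by (rule continuous_integrable_unit[OF cont_kin(1)], rule continuous_integrable_unit[OF cont_kin(2)],
      rule continuous_integrable_unit[OF continuous_on_power[OF cont_gr]],
      rule continuous_integrable_unit[OF continuous_on_power[OF cont_la]])

text \<open>The tested identity at \<open>t\<close> minus the one at \<open>s\<close>; the constant
  made of the initial data cancels.\<close>

lemma virial:
  assumes st: "0 \<le> s" "s \<le> t" "t \<le> 1"
  shows "bb t - bb s - X s t kO - X s t kG + X s t (\<lambda>r. (gr r)\<^sup>2) + X s t (\<lambda>r. (la r)\<^sup>2)
    - 2 * X s t pr + X s t RO + X s t RG - X s t srO - X s t srG = 0"
proof -
  obtain c where c: "\<And>t. t \<in> {0..1} \<Longrightarrow> bb t - Iv t kO - Iv t kG + Iv t (\<lambda>r. (gr r)\<^sup>2) + Iv t (\<lambda>r. (la r)\<^sup>2)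
    - 2 * Iv t pr + Iv t RO + Iv t RG - Iv t srO - Iv t srG = c" by (rule test_equations) blast
  note w = integral_window(1)[OF _ st, symmetric]
  have "(a1 - a2) - (b1 - b2) - (c1 - c2) + (d1 - d2) + (e1 - e2) - 2 * (f1 - f2) + (g1 - g2) + (h1 - h2) - (i1 - i2) - (j1 - j2) = 0"
    if "a1 - b1 - c1 + d1 + e1 - 2 * f1 + g1 + h1 - i1 - j1 = c" "a2 - b2 - c2 + d2 + e2 - 2 * f2 + g2 + h2 - i2 - j2 = c"
    for a1 a2 b1 b2 c1 c2 d1 d2 e1 e2 f1 f2 g1 g2 h1 h2 i1 i2 j1 j2 :: real using that by simp
  from this[OF c c] st show ?thesis
    unfolding w[OF basic_integrable(1)] w[OF basic_integrable(2)] w[OF basic_integrable(3)] w[OF basic_integrable(4)]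
      w[OF pr_integrable] w[OF pairing(1)[OF zero_less_one]] w[OF pairing(3)[OF zero_less_one]] w[OF source_integrable(1)] w[OF source_integrable(2)]
    by simp
qed

text \<open>The \<open>\<eta>\<close>-terms are absorbed by the energy in the end, so the end points of the time window
  only have to be good enough to control \<open>bb\<close> by the total kinetic energy.  The product of the
  trace with \<open>w\<close> carries no velocity; it is its increment over the window that is small.\<close>

lemma boundary_terms:
  assumes st: "s \<in> {0..1}" "t \<in> {0..1}" and e: "0 < \<eta>"
    and k: "kO s + kG s \<le> 3 * (KO + KG)" "kO t + kG t \<le> 3 * (KO + KG)"
  shows "\<bar>bb t - bb s\<bar> \<le> 3 * (KO + KG) / \<eta> + (KO + KG) * tr / (4 * \<eta> ^ 3) + (KO + KG) / (2 * \<eta>)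
    + \<eta> * Y * (emb_c1 S + 3/2 * emb_c2 S + tr * (emb_c1 S + 1) + 1/2 * emb_tr S)"
proof -
  have p: "\<bar>L2_inner (mO S) (ut r) (u r)\<bar> \<le> kO r / (2 * \<eta>) + \<eta> / 2 * (emb_c1 S * Y)"
    "\<bar>L2_inner (mG S) (wt r) (w r)\<bar> \<le> kG r / (2 * \<eta>) + \<eta> / 2 * (emb_c2 S * Y)" if r: "r \<in> {0..1}" for r
    by (rule L2_inner_Young[OF spaces(2)[OF r] spaces(7)[OF r] e emb_Y(1)[OF r]],
        rule L2_inner_Young[OF spaces(4)[OF r] spaces(8)[OF r] e emb_Y(3)[OF r]])
  have dO: "(Lp_norm 2 (mO S) (\<lambda>x. u t x - u s x))\<^sup>2 \<le> KO" unfolding KO_def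
    by (rule time_deriv_Lipschitz[OF spaces(7) ws1(3,2) st])
  have dG: "(Lp_norm 2 (mG S) (\<lambda>x. w t x - w s x))\<^sup>2 \<le> KG" unfolding KG_def
    by (rule time_deriv_Lipschitz[OF spaces(8) ws1(6,5) st])
  have KK: "0 \<le> KO" "0 \<le> KG" by (simp_all add: KO_def KG_def)
  let ?z = "\<lambda>x. u t x - u s x"
  have gz: "(grad_norm (Omega S) ?z)\<^sup>2 \<le> 4 * Y"
  proof -
    have "grad_norm (Omega S) ?z \<le> gr t + gr s" by (rule grad_norm_triangle_diff[OF af(1) spaces(5)[OF st(2)] spaces(5)[OF st(1)]])
    then have "(grad_norm (Omega S) ?z)\<^sup>2 \<le> (gr t + gr s)\<^sup>2" by (intro power_mono) (simp_all add: grad_norm_def Lp_norm_def)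
    also have "\<dots> \<le> 2 * (gr t)\<^sup>2 + 2 * (gr s)\<^sup>2" using sum_squares_bound[of "gr t" "gr s"] by (simp add: power2_sum)
    finally show ?thesis using Y_bounds(1)[of s] Y_bounds(1)[of t] st by auto
  qed
  \<comment> \<open>The Young parameter is the square of \<open>\<eta>\<close>: after the later
    division by \<open>2 * \<eta>\<close> the part bounded by \<open>Y\<close> still carries one
    factor \<open>\<eta>\<close>.\<close>
  have tz: "(Lp_norm 2 (mG S) (\<lambda>y. ga t y - ga s y))\<^sup>2 \<le> tr * (KO / (2 * \<eta>\<^sup>2) + \<eta>\<^sup>2 / 2 * ((emb_c1 S + 1) * (4 * Y)))"
  proof (rule order_trans[OF tr(2)[OF spaces(1)[OF st(2)] spaces(1)[OF st(1)]]], rule mult_left_mono[OF _ tr(1)])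
    have "Lp_norm 2 (mO S) ?z * H1_norm (Omega S) ?z \<le> (Lp_norm 2 (mO S) ?z)\<^sup>2 / (2 * \<eta>\<^sup>2) + \<eta>\<^sup>2 / 2 * (H1_norm (Omega S) ?z)\<^sup>2"
      using e by (intro Young_quadratic) simp
    also have "\<dots> \<le> KO / (2 * \<eta>\<^sup>2) + \<eta>\<^sup>2 / 2 * ((emb_c1 S + 1) * (4 * Y))"
      using dO order_trans[OF diff_H1_bound[OF spaces(1)[OF st(2)] spaces(1)[OF st(1)]] mult_left_mono[OF gz]] emb_pos(1)
      by (intro add_mono divide_right_mono mult_left_mono) auto
    finally show "Lp_norm 2 (mO S) ?z * H1_norm (Omega S) ?z \<le> KO / (2 * \<eta>\<^sup>2) + \<eta>\<^sup>2 / 2 * ((emb_c1 S + 1) * (4 * Y))" .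
  qed
  have q1: "\<bar>L2_inner (mG S) (\<lambda>y. ga t y - ga s y) (w t)\<bar> \<le> KO * tr / (4 * \<eta> ^ 3) + \<eta> * tr * (emb_c1 S + 1) * Y + \<eta> / 2 * (emb_c2 S * Y)"
  proof -
    have "\<bar>L2_inner (mG S) (\<lambda>y. ga t y - ga s y) (w t)\<bar> \<le> (Lp_norm 2 (mG S) (\<lambda>y. ga t y - ga s y))\<^sup>2 / (2 * \<eta>) + \<eta> / 2 * (emb_c2 S * Y)"
      by (rule L2_inner_Young[OF Lp_2_diff[OF emb_norms(4)[OF st(2)] emb_norms(4)[OF st(1)]] spaces(8)[OF st(2)] e emb_Y(3)[OF st(2)]])
    moreover have "(Lp_norm 2 (mG S) (\<lambda>y. ga t y - ga s y))\<^sup>2 / (2 * \<eta>)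
      \<le> tr * (KO / (2 * \<eta>\<^sup>2) + \<eta>\<^sup>2 / 2 * ((emb_c1 S + 1) * (4 * Y))) / (2 * \<eta>)"
      using tz e by (intro divide_right_mono) auto
    moreover have "tr * (KO / (2 * \<eta>\<^sup>2) + \<eta>\<^sup>2 / 2 * ((emb_c1 S + 1) * (4 * Y))) / (2 * \<eta>)
      = KO * tr / (4 * \<eta> ^ 3) + \<eta> * tr * (emb_c1 S + 1) * Y"
      using e by (simp add: field_simps power2_eq_square power3_eq_cube)
    ultimately show ?thesis by linarith
  qed
  have q2: "\<bar>L2_inner (mG S) (\<lambda>y. w t y - w s y) (ga s)\<bar> \<le> KG / (2 * \<eta>) + \<eta> / 2 * (emb_tr S * Y)"
  proof -
    have "\<bar>L2_inner (mG S) (\<lambda>y. w t y - w s y) (ga s)\<bar> \<le> (Lp_norm 2 (mG S) (\<lambda>y. w t y - w s y))\<^sup>2 / (2 * \<eta>) + \<eta> / 2 * (emb_tr S * Y)"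
      by (rule L2_inner_Young[OF Lp_2_diff[OF spaces(8)[OF st(2)] spaces(8)[OF st(1)]] emb_norms(4)[OF st(1)] e emb_Y(2)[OF st(1)]])
    moreover have "(Lp_norm 2 (mG S) (\<lambda>y. w t y - w s y))\<^sup>2 / (2 * \<eta>) \<le> KG / (2 * \<eta>)" using dG e by (intro divide_right_mono) auto
    ultimately show ?thesis by linarith
  qed
  \<comment> \<open>The increment of the product is split into the increment of the trace against
    \<open>w\<close> and the increment of \<open>w\<close> against the trace.\<close>
  have sp: "L2_inner (mG S) (ga t) (w t) - L2_inner (mG S) (ga s) (w s)
    = L2_inner (mG S) (\<lambda>y. ga t y - ga s y) (w t) + L2_inner (mG S) (\<lambda>y. w t y - w s y) (ga s)"
    using L2_inner_diff_left[OF emb_norms(4)[OF st(2)] emb_norms(4)[OF st(1)] spaces(8)[OF st(2)]]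
      L2_inner_diff_left[OF spaces(8)[OF st(2)] spaces(8)[OF st(1)] emb_norms(4)[OF st(1)]]
    by (simp add: L2_inner_commute)
  have kk: "(kO s + kG s) / (2 * \<eta>) + (kO t + kG t) / (2 * \<eta>) \<le> 3 * (KO + KG) / \<eta>"
  proof -
    have "(kO s + kG s) / (2 * \<eta>) + (kO t + kG t) / (2 * \<eta>) \<le> 3 * (KO + KG) / (2 * \<eta>) + 3 * (KO + KG) / (2 * \<eta>)"
      using k e by (intro add_mono divide_right_mono) auto
    also have "3 * (KO + KG) / (2 * \<eta>) + 3 * (KO + KG) / (2 * \<eta>) = 3 * (KO + KG) / \<eta>" by (simp add: field_simps)
    finally show ?thesis .
  qed
  have kt: "KO * tr / (4 * \<eta> ^ 3) \<le> (KO + KG) * tr / (4 * \<eta> ^ 3)" "KG / (2 * \<eta>) \<le> (KO + KG) / (2 * \<eta>)"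
    using KK e tr(1) by (auto intro!: divide_right_mono mult_right_mono)
  \<comment> \<open>The assembly is stated for plain numbers, so that linear arithmetic meets no
    integrals.\<close>
  have lin: "\<bar>(a1 + b1 + c1) - (a2 + b2 + c2)\<bar> \<le> k3 + kT + kH + \<eta> * Y * (e1 + 3/2 * e2 + T * (e1 + 1) + 1/2 * e3)"
    if "\<bar>a1\<bar> \<le> k1 / (2 * \<eta>) + \<eta> / 2 * (e1 * Y)" "\<bar>b1\<bar> \<le> l1 / (2 * \<eta>) + \<eta> / 2 * (e2 * Y)"
      "\<bar>a2\<bar> \<le> k2 / (2 * \<eta>) + \<eta> / 2 * (e1 * Y)" "\<bar>b2\<bar> \<le> l2 / (2 * \<eta>) + \<eta> / 2 * (e2 * Y)"
      "c1 - c2 = x + y" "\<bar>x\<bar> \<le> kt + \<eta> * T * (e1 + 1) * Y + \<eta> / 2 * (e2 * Y)" "\<bar>y\<bar> \<le> kh + \<eta> / 2 * (e3 * Y)"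
      "(k2 + l2) / (2 * \<eta>) + (k1 + l1) / (2 * \<eta>) \<le> k3" "kt \<le> kT" "kh \<le> kH"
    for a1 b1 c1 a2 b2 c2 k1 l1 k2 l2 k3 e1 e2 e3 x y kt kT kh kH T
  proof -
    have "(k2 + l2) / (2 * \<eta>) + (k1 + l1) / (2 * \<eta>) = k1 / (2 * \<eta>) + l1 / (2 * \<eta>) + k2 / (2 * \<eta>) + l2 / (2 * \<eta>)"
      by (simp add: add_divide_distrib)
    moreover have "\<eta> * Y * (e1 + 3/2 * e2 + T * (e1 + 1) + 1/2 * e3) = 2 * (\<eta> / 2 * (e1 * Y)) + 3 * (\<eta> / 2 * (e2 * Y))
      + \<eta> * T * (e1 + 1) * Y + \<eta> / 2 * (e3 * Y)" by (simp add: algebra_simps)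
    ultimately show ?thesis using that unfolding abs_le_iff by linarith
  qed
  show ?thesis unfolding bb_def
    by (rule lin[OF p(1)[OF st(2)] p(2)[OF st(2)] p(1)[OF st(1)] p(2)[OF st(1)] sp q1 q2 kk kt])
qed

end

context well_estimate
begin

lemma dissipation_split: "dissipation S ut wt 1 = DO + DG"
  by (simp add: dissipation_def DO_def DG_def)

text \<open>The kinetic estimates involve each majorant at its own dissipation \<open>DO\<close> or
  \<open>DG\<close>; monotonicity moves both to the total, where they form
  \<open>Phi\<close>.\<close>

lemma Phi_bounds:
  "(mu1 + 1) * conc_phi1 S DO + (mu2 + 1) * conc_phi2 S DG + (DO + DG) / coef_alpha S \<le> decay_mass S * Z"
  "KO + KG \<le> decay_mass S * Z" "(mu1 + 1) * conc_phi1 S DO + (mu2 + 1) * conc_phi2 S DG \<le> decay_mass S * Z"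
  "DO \<le> Z" "DG \<le> Z" "DO + DG \<le> Z"
proof -
  note D = kinetic(3,4)
  define p1 where "p1 = conc_phi1 S (DO + DG)"
  define p2 where "p2 = conc_phi2 S (DO + DG)"
  have le: "conc_phi1 S DO \<le> p1" "conc_phi2 S DG \<le> p2" unfolding p1_def p2_def
    using maj D by (auto simp: concave_majorant_def intro: mono_onD)
  have nn: "0 \<le> p1" "0 \<le> p2" unfolding p1_def p2_def using maj D by (simp_all add: concave_majorant_def)
  have Z: "Z = p1 + p2 + (DO + DG)" by (simp add: Z_def Phi_def dissipation_split p1_def p2_def)
  show "DO \<le> Z" "DG \<le> Z" "DO + DG \<le> Z" using D nn by (auto simp: Z)
  have mu: "0 \<le> mu1" "0 \<le> mu2" by simp_all
  have a: "0 < 1 / coef_alpha S" using damp(3) by simp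
  have 1: "(mu1 + 1) * conc_phi1 S DO \<le> (mu1 + 1) * p1" "(mu2 + 1) * conc_phi2 S DG \<le> (mu2 + 1) * p2"
    using le mu by (auto intro!: mult_left_mono)
  have 2: "(mu1 + 1) * p1 \<le> decay_mass S * p1" "(mu2 + 1) * p2 \<le> decay_mass S * p2"
    using nn mu a unfolding decay_mass_def by (auto intro!: mult_right_mono)
  have "1 / coef_alpha S \<le> decay_mass S" using mu unfolding decay_mass_def by linarith
  then have 6: "1 / coef_alpha S * (DO + DG) \<le> decay_mass S * (DO + DG)" by (rule mult_right_mono) (use D in simp)
  have 3: "decay_mass S * Z = decay_mass S * p1 + decay_mass S * p2 + decay_mass S * (DO + DG)" by (simp add: Z algebra_simps)
  have 4: "(DO + DG) / coef_alpha S = 1 / coef_alpha S * (DO + DG)" by simp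
  show 5: "(mu1 + 1) * conc_phi1 S DO + (mu2 + 1) * conc_phi2 S DG + (DO + DG) / coef_alpha S \<le> decay_mass S * Z"
    unfolding 3 4 using 1 2 6 by linarith
  have "0 \<le> (DO + DG) / coef_alpha S" using D damp(3) by simp
  then show "(mu1 + 1) * conc_phi1 S DO + (mu2 + 1) * conc_phi2 S DG \<le> decay_mass S * Z" using 5 by linarith
  show "KO + KG \<le> decay_mass S * Z" using kinetic(1,2) 5 by (simp add: add_divide_distrib)
qed

text \<open>The source takes away the fraction \<open>\<xi>\<close> of the potential part
  \<open>g + l\<close>, so the identity bounds \<open>(1 - \<xi>) * (g + l)\<close>. The kinetic
  terms count twice: once in the identity, once as part of the quadratic energy.\<close>

lemma decay_numbers:
  fixes E1 \<xi> k1 k2 g l p r1 r2 s1 s2 b :: real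
  assumes v: "b - k1 - k2 + g + l - 2 * p + r1 + r2 - s1 - s2 = 0" and s: "s1 + s2 \<le> \<xi> * (g + l)"
    and E: "E1 \<le> 3/2 * (k1 + k2 + g + l)" and x: "0 \<le> \<xi>" "\<xi> < 1"
    and k: "\<bar>k1\<bar> \<le> K1'" "\<bar>k2\<bar> \<le> K2'" and p: "\<bar>p\<bar> \<le> P" and r: "\<bar>r1\<bar> \<le> R1" "\<bar>r2\<bar> \<le> R2" and b: "\<bar>b\<bar> \<le> B"
  shows "(1 - \<xi>) * E1 \<le> 3/2 * (2 * (K1' + K2') + B + 2 * P + R1 + R2)"
proof -
  have "(1 - \<xi>) * (k1 + k2) \<le> (1 - \<xi>) * (K1' + K2')" using k x by (intro mult_left_mono) (auto simp: abs_le_iff)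
  also have "\<dots> \<le> 1 * (K1' + K2')" using k x by (intro mult_right_mono) auto
  finally have a: "(1 - \<xi>) * (k1 + k2) \<le> K1' + K2'" by simp
  have "(1 - \<xi>) * (g + l) \<le> (g + l) - (s1 + s2)" using s by (simp add: algebra_simps)
  also have "\<dots> \<le> K1' + K2' + B + 2 * P + R1 + R2" using v k p r b by (simp add: abs_le_iff)
  finally have c: "(1 - \<xi>) * (g + l) \<le> K1' + K2' + B + 2 * P + R1 + R2" .
  have alg: "x * (3/2 * (k1 + k2 + g + l)) = 3/2 * (x * (k1 + k2) + x * (g + l))" for x :: real by (simp add: algebra_simps)
  have "(1 - \<xi>) * E1 \<le> (1 - \<xi>) * (3/2 * (k1 + k2 + g + l))" using E x by (intro mult_left_mono) auto
  also have "\<dots> = 3/2 * ((1 - \<xi>) * (k1 + k2) + (1 - \<xi>) * (g + l))" by (rule alg)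
  also have "\<dots> \<le> 3/2 * (2 * (K1' + K2') + B + 2 * P + R1 + R2)" using a c by simp
  finally show ?thesis .
qed

lemma xi_nonneg: "0 \<le> const_xi S \<delta>"
  unfolding const_xi_def using constants(1-3) pq by (intro add_nonneg_nonneg mult_nonneg_nonneg) auto

text \<open>The energy at time 1 is at most the energy at any time of the window, which is at most
  the quadratic energy. The factor 3/2 is 1/2 from the quadratic energy times 3 from a window of
  length at least 1/3.\<close>

lemma window_energy:
  assumes st: "0 \<le> s" "s \<le> t" "t \<le> 1" "1/3 \<le> t - s"
  shows "EE 1 \<le> 3/2 * (X s t kO + X s t kG + X s t (\<lambda>r. (gr r)\<^sup>2) + X s t (\<lambda>r. (la r)\<^sup>2))"
    "X s t srO + X s t srG \<le> const_xi S \<delta> * (X s t (\<lambda>r. (gr r)\<^sup>2) + X s t (\<lambda>r. (la r)\<^sup>2))"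
proof -
  let ?h = "\<lambda>r. indicator {s<..t} r :: real"
  note i = integral_window(2)[OF _ st(1-3)]
  note bi = i[OF basic_integrable(1)] i[OF basic_integrable(2)] i[OF basic_integrable(3)] i[OF basic_integrable(4)]
  note si = i[OF source_integrable(1)] i[OF source_integrable(2)]
  have m: "measure UT {s<..t} = t - s"
  proof -
    have "{s<..t} \<subseteq> {0..1}" using st by auto
    then show ?thesis using st(2) by (subst measure_restrict_space) auto
  qed
  have "(\<integral>r. indicator A r \<partial>UT) = measure UT A" if "A \<subseteq> {0..1}" for A :: "real set"
    using that by (simp add: inf.absorb1)
  moreover have "{s<..t} \<subseteq> {0..1}" using st by auto
  ultimately have ih: "(\<integral>r. ?h r \<partial>UT) = t - s" unfolding m[symmetric] by blast
  have ic: "integrable UT (\<lambda>r. ?h r * EE 1)" by (rule i[OF finite_measure.integrable_const[OF lebesgue_interval_finite]])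
  have E1: "(\<integral>r. ?h r * EE 1 \<partial>UT) = (t - s) * EE 1"
    by (simp only: integral_mult_left_zero ih)
  have "1/3 * EE 1 \<le> (t - s) * EE 1" using st(4) EE_nonneg[of 1] by (intro mult_right_mono) auto
  also have "\<dots> \<le> (\<integral>r. 1/2 * (?h r * kO r + ?h r * kG r + ?h r * (gr r)\<^sup>2 + ?h r * (la r)\<^sup>2) \<partial>UT)"
    unfolding E1[symmetric]
  proof (rule integral_mono[OF ic])
    show "integrable UT (\<lambda>r. 1/2 * (?h r * kO r + ?h r * kG r + ?h r * (gr r)\<^sup>2 + ?h r * (la r)\<^sup>2))"
      by (intro integrable_mult_right Bochner_Integration.integrable_add bi)
    fix r :: real assume "r \<in> space UT"
    then have r: "0 \<le> r" "r \<le> 1" by auto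
    have "EE 1 \<le> EE r" using energy(1)[OF r(1)] energy(1)[of 1] dissipation_mono(2)[OF r zero_less_one] by simp
    also have "\<dots> \<le> 1/2 * (kO r + kG r + (gr r)\<^sup>2 + (la r)\<^sup>2)" using energy(5)[OF r(1)] by (simp add: quadratic_energy_def)
    finally show "?h r * EE 1 \<le> 1/2 * (?h r * kO r + ?h r * kG r + ?h r * (gr r)\<^sup>2 + ?h r * (la r)\<^sup>2)"
      by (simp add: indicator_def)
  qed
  also have "\<dots> = 1/2 * (X s t kO + X s t kG + X s t (\<lambda>r. (gr r)\<^sup>2) + X s t (\<lambda>r. (la r)\<^sup>2))"
    using bi by (simp only: integral_mult_right_zero Bochner_Integration.integral_add Bochner_Integration.integrable_add)
  finally show "EE 1 \<le> 3/2 * (X s t kO + X s t kG + X s t (\<lambda>r. (gr r)\<^sup>2) + X s t (\<lambda>r. (la r)\<^sup>2))" by simp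
  have "X s t srO + X s t srG = (\<integral>r. ?h r * srO r + ?h r * srG r \<partial>UT)" using si by simp
  also have "\<dots> \<le> (\<integral>r. const_xi S \<delta> * (?h r * (gr r)\<^sup>2 + ?h r * (la r)\<^sup>2) \<partial>UT)"
  proof (rule integral_mono)
    show "integrable UT (\<lambda>r. ?h r * srO r + ?h r * srG r)" using si by simp
    show "integrable UT (\<lambda>r. const_xi S \<delta> * (?h r * (gr r)\<^sup>2 + ?h r * (la r)\<^sup>2))"
      by (intro integrable_mult_right Bochner_Integration.integrable_add bi)
    fix r :: real assume "r \<in> space UT"
    then have "srO r + srG r \<le> const_xi S \<delta> * ((gr r)\<^sup>2 + (la r)\<^sup>2)"
      using source_bound(2)[of r] by (simp add: srO_def srG_def source_work_def)
    then show "?h r * srO r + ?h r * srG r \<le> const_xi S \<delta> * (?h r * (gr r)\<^sup>2 + ?h r * (la r)\<^sup>2)"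
      by (simp add: indicator_def)
  qed
  also have "\<dots> = const_xi S \<delta> * (X s t (\<lambda>r. (gr r)\<^sup>2) + X s t (\<lambda>r. (la r)\<^sup>2))"
    using bi(3,4) by (simp only: integral_mult_right_zero Bochner_Integration.integral_add)
  finally show "X s t srO + X s t srG \<le> const_xi S \<delta> * (X s t (\<lambda>r. (gr r)\<^sup>2) + X s t (\<lambda>r. (la r)\<^sup>2))" .
qed

lemma window_pr:
  assumes st: "0 \<le> s" "s \<le> t" "t \<le> 1" and e: "0 < \<eta>"
  shows "\<bar>X s t pr\<bar> \<le> (KO + KG) / (2 * \<eta>) + \<eta> / 2 * (emb_tr S * Y)"
proof -
  have i: "integrable UT (\<lambda>r. kG r / (2 * \<eta>) + \<eta> / 2 * (emb_tr S * Y))"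
    using basic_integrable(2) finite_measure.integrable_const[OF lebesgue_interval_finite]
    by (intro Bochner_Integration.integrable_add integrable_divide) auto
  have "\<bar>X s t pr\<bar> \<le> (\<integral>r. kG r / (2 * \<eta>) + \<eta> / 2 * (emb_tr S * Y) \<partial>UT)"
    by (rule window_integral_abs[OF pr_integrable i st], unfold pr_def,
        rule L2_inner_Young[OF spaces(4) emb_norms(4) e emb_Y(2)])
  also have "\<dots> = KG / (2 * \<eta>) + \<eta> / 2 * (emb_tr S * Y)"
  proof -
    have "measure UT {0..1} = 1" by (simp add: measure_def)
    then show ?thesis
      using basic_integrable(2) finite_measure.integrable_const[OF lebesgue_interval_finite[of 1], of "\<eta> / 2 * (emb_tr S * Y)"]
      by (subst Bochner_Integration.integral_add) (simp_all add: KG_def)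
  qed
  also have "\<dots> \<le> (KO + KG) / (2 * \<eta>) + \<eta> / 2 * (emb_tr S * Y)"
    using e by (intro add_right_mono divide_right_mono) (simp_all add: KO_def)
  finally show ?thesis .
qed

text \<open>Valid for every positive \<open>\<eta>\<close>, which is fixed later: a smaller
  \<open>\<eta>\<close> lowers the share of the initial energy and enlarges the coefficient of the
  dissipation.\<close>

lemma decay_estimate:
  assumes e: "0 < \<eta>"
  shows "(1 - const_xi S \<delta>) * EE 1 \<le> decay_C S tr \<eta> * Z + \<eta> * decay_A S tr bm br * EE 0"
proof -
  have kc: "continuous_on {0..1} (\<lambda>t. kO t + kG t)" by (intro continuous_on_add cont_kin)
  have kI: "(\<integral>r. kO r + kG r \<partial>UT) = KO + KG" using basic_integrable(1,2) by (simp add: KO_def KG_def)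
  \<comment> \<open>The averaging uses the first and the last third of the unit interval, so the
    chosen times are at least 1/3 apart.\<close>
  obtain s where s: "s \<in> {0..0 + 1/3}" "kO s + kG s \<le> 3 * (KO + KG)"
    by (rule good_time[OF kc, of 0]) (auto simp: kI)
  obtain t where t: "t \<in> {2/3..2/3 + 1/3}" "kO t + kG t \<le> 3 * (KO + KG)"
    by (rule good_time[OF kc, of "2/3"]) (auto simp: kI)
  have st: "0 \<le> s" "s \<le> t" "t \<le> 1" "1/3 \<le> t - s" "s \<in> {0..1}" "t \<in> {0..1}" using s(1) t(1) by auto
  have aK: "\<bar>X s t kO\<bar> \<le> KO" "\<bar>X s t kG\<bar> \<le> KG" unfolding KO_def KG_def
    by (rule window_integral_abs[OF basic_integrable(1,1) st(1-3)], simp)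
       (rule window_integral_abs[OF basic_integrable(2,2) st(1-3)], simp)
  note pO = pairing(1,2)[OF e] and pG = pairing(3,4)[OF e]
  have aR: "\<bar>X s t RO\<bar> \<le> (\<integral>r. \<bar>RO r\<bar> \<partial>UT)" "\<bar>X s t RG\<bar> \<le> (\<integral>r. \<bar>RG r\<bar> \<partial>UT)"
    by (rule window_integral_abs[OF pO(1) integrable_abs[OF pO(1)] st(1-3)], simp)
       (rule window_integral_abs[OF pG(1) integrable_abs[OF pG(1)] st(1-3)], simp)
  let ?e1 = "\<eta> powr (- 1 / exp_m S) * coef_beta S powr (1 / exp_m S)"
  let ?e2 = "\<eta> powr (- 1 / exp_r S) * coef_beta S powr (1 / exp_r S)"
  note main = decay_numbers[OF virial[OF st(1-3)] window_energy(2,1)[OF st(1-4)] xi_nonneg constants(5) aK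
    window_pr[OF st(1-3) e] order_trans[OF aR(1) pO(2)] order_trans[OF aR(2) pG(2)] boundary_terms[OF st(5,6) e s(2) t(2)]]
  \<comment> \<open>Collects the coefficients of the kinetic energy, the dissipation and the initial
    energy as an inequality between real numbers.\<close>
  have num: "3/2 * (2 * K + (3 * K / \<eta> + K * tr / (4 * \<eta> ^ 3) + K / (2 * \<eta>)
        + \<eta> * Y * (c1 + 3/2 * c2 + tr * (c1 + 1) + 1/2 * c3)) + 2 * (K / (2 * \<eta>) + \<eta> / 2 * (c3 * Y))
        + (m1 / \<eta> * f1 + e1 * d1 + \<eta> * (c1 * Y + bm * Y)) + (m2 / \<eta> * f2 + e2 * d2 + \<eta> * (c2 * Y + br * Y)))
      \<le> 3/2 * ((2 + 9 / (2 * \<eta>) + tr / (4 * \<eta> ^ 3)) * M + M / \<eta> + e1 + e2) * Z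
        + \<eta> * (3 * \<theta> * (2 * c1 + 5/2 * c2 + 3/2 * c3 + tr * (c1 + 1) + bm + br)) * E"
    if K: "K \<le> M * Z" and f: "m1 * f1 + m2 * f2 \<le> M * Z" and d: "e1 * d1 \<le> e1 * Z" "e2 * d2 \<le> e2 * Z" and Y: "Y = 2 * \<theta> * E"
    for K c1 c2 c3 m1 f1 e1 d1 m2 f2 e2 d2 M Z \<theta> E Y :: real
  proof -
    have "0 \<le> 2 + 9 / (2 * \<eta>) + tr / (4 * \<eta> ^ 3)" using e tr(1) by simp
    from mult_left_mono[OF K this]
    have k: "(2 + 9 / (2 * \<eta>) + tr / (4 * \<eta> ^ 3)) * K \<le> (2 + 9 / (2 * \<eta>) + tr / (4 * \<eta> ^ 3)) * M * Z" by (simp only: mult.assoc)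
    have f': "m1 / \<eta> * f1 + m2 / \<eta> * f2 \<le> M / \<eta> * Z" using divide_right_mono[OF f less_imp_le[OF e]] by (simp add: add_divide_distrib)
    have kk: "(2 + 9 / (2 * \<eta>) + tr / (4 * \<eta> ^ 3)) * K = 2 * K + 3 * K / \<eta> + K * tr / (4 * \<eta> ^ 3) + K / (2 * \<eta>) + K / \<eta>"
      using e by (simp add: field_simps)
    have "3/2 * (2 * K + (3 * K / \<eta> + K * tr / (4 * \<eta> ^ 3) + K / (2 * \<eta>)
        + \<eta> * Y * (c1 + 3/2 * c2 + tr * (c1 + 1) + 1/2 * c3)) + 2 * (K / (2 * \<eta>) + \<eta> / 2 * (c3 * Y))
        + (m1 / \<eta> * f1 + e1 * d1 + \<eta> * (c1 * Y + bm * Y)) + (m2 / \<eta> * f2 + e2 * d2 + \<eta> * (c2 * Y + br * Y)))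
      = 3/2 * ((2 + 9 / (2 * \<eta>) + tr / (4 * \<eta> ^ 3)) * K + (m1 / \<eta> * f1 + m2 / \<eta> * f2) + e1 * d1 + e2 * d2)
        + \<eta> * (3 * \<theta> * (2 * c1 + 5/2 * c2 + 3/2 * c3 + tr * (c1 + 1) + bm + br)) * E"
      unfolding kk Y by (simp add: algebra_simps)
    also have "\<dots> \<le> 3/2 * ((2 + 9 / (2 * \<eta>) + tr / (4 * \<eta> ^ 3)) * M * Z + M / \<eta> * Z + e1 * Z + e2 * Z)
        + \<eta> * (3 * \<theta> * (2 * c1 + 5/2 * c2 + 3/2 * c3 + tr * (c1 + 1) + bm + br)) * E"
      by (rule add_right_mono[OF mult_left_mono[OF add_mono[OF add_mono[OF add_mono[OF k f'] d(1)] d(2)]]]) simp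
    finally show ?thesis by (simp only: distrib_right mult.assoc)
  qed
  have d: "?e1 * DO \<le> ?e1 * Z" "?e2 * DG \<le> ?e2 * Z" using Phi_bounds(4,5) by (intro mult_left_mono; simp)+
  show ?thesis unfolding decay_C_def decay_A_def
    by (rule order_trans[OF main num[OF Phi_bounds(2,3) d Y_def]])
qed

end

section \<open>Power bounds for the displacement in the damping terms\<close>

text \<open>Young's inequality with exponents \<open>3\<close> and \<open>3/2\<close> trades the power \<open>m + 1\<close> against the Sobolev
  exponent \<open>6\<close>; the remaining factor has exponent \<open>3/2 * (m - 1)\<close>.\<close>

lemma power_trading:
  fixes v :: "'a \<Rightarrow> real"
  assumes m: "5 < m" and v: "v \<in> Lp (3/2 * (m - 1)) N" "Lp_norm (3/2 * (m - 1)) N v \<le> R"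
    and six: "(\<integral>\<^sup>+x. ennreal (\<bar>v x\<bar> ^ 6) \<partial>N) \<le> ennreal (C * g ^ 6)" and nn: "0 \<le> C" "0 \<le> g"
  shows "(\<integral>\<^sup>+x. ennreal (\<bar>v x\<bar> powr (m + 1)) \<partial>N) \<le> ennreal ((C + R powr (3/2 * (m - 1))) * g\<^sup>2)"
proof (cases "g = 0")
  case True
  have vm: "v \<in> borel_measurable N" by (rule Lp_measurable[OF v(1)])
  have "(\<integral>\<^sup>+x. ennreal (\<bar>v x\<bar> ^ 6) \<partial>N) = 0" using six True by simp
  then have "AE x in N. v x = 0" using vm by (subst (asm) nn_integral_0_iff_AE) (auto elim!: eventually_mono)
  then have "(\<integral>\<^sup>+x. ennreal (\<bar>v x\<bar> powr (m + 1)) \<partial>N) = (\<integral>\<^sup>+x. 0 \<partial>N)"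
    by (intro nn_integral_cong_AE) (auto elim!: eventually_mono)
  then show ?thesis by simp
next
  case False
  then have g: "0 < g" using nn by simp
  let ?\<sigma> = "3/2 * (m - 1)"
  have vm: "v \<in> borel_measurable N" by (rule Lp_measurable[OF v(1)])
  have i: "integrable N (\<lambda>x. \<bar>v x\<bar> powr ?\<sigma>)" using v(1) by (simp add: Lp_def)
  have s: "(\<integral>\<^sup>+x. ennreal (\<bar>v x\<bar> powr ?\<sigma>) \<partial>N) \<le> ennreal (R powr ?\<sigma>)"
  proof -
    define I where "I = (\<integral>x. \<bar>v x\<bar> powr ?\<sigma> \<partial>N)"
    have I: "0 \<le> I" by (simp add: I_def)
    have "I = Lp_norm ?\<sigma> N v powr ?\<sigma>" unfolding Lp_norm_def I_def[symmetric] using m I by (simp add: powr_powr)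
    also have "\<dots> \<le> R powr ?\<sigma>" using m v(2) by (intro powr_mono2) (auto simp: Lp_norm_def)
    finally show ?thesis using nn_integral_eq_integral[OF i] by (simp add: I_def ennreal_leI)
  qed
  \<comment> \<open>Two of the \<open>m + 1\<close> factors are divided by \<open>g\<close> before
    Young's inequality. The sixth power over \<open>g^6\<close> then integrates to at most
    \<open>C\<close>, and \<open>g^2\<close> survives as a common factor.\<close>
  have pt: "\<bar>y\<bar> powr (m + 1) \<le> g\<^sup>2 * (\<bar>y\<bar> ^ 6 / g ^ 6 + \<bar>y\<bar> powr ?\<sigma>)" for y :: real
  proof (cases "y = 0")
    case False
    have "\<bar>y\<bar> powr (m + 1) = \<bar>y\<bar>\<^sup>2 * \<bar>y\<bar> powr (m - 1)" using powr_add[of "\<bar>y\<bar>" 2 "m - 1"] False by (simp add: powr_numeral add.commute)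
    also have "\<dots> = g\<^sup>2 * ((\<bar>y\<bar> / g)\<^sup>2 * \<bar>y\<bar> powr (m - 1))" using g by (simp add: power_divide)
    also have "(\<bar>y\<bar> / g)\<^sup>2 * \<bar>y\<bar> powr (m - 1) \<le> ((\<bar>y\<bar> / g)\<^sup>2) powr 3 / 3 + (\<bar>y\<bar> powr (m - 1)) powr (3/2) / (3/2)"
      by (rule Youngs_inequality) auto
    also have "((\<bar>y\<bar> / g)\<^sup>2) powr 3 = \<bar>y\<bar> ^ 6 / g ^ 6"
      using g False by (simp add: powr_numeral power_divide flip: power_mult)
    also have "(\<bar>y\<bar> powr (m - 1)) powr (3/2) = \<bar>y\<bar> powr ?\<sigma>" by (simp add: powr_powr mult.commute)
    also have "\<bar>y\<bar> ^ 6 / g ^ 6 / 3 + \<bar>y\<bar> powr ?\<sigma> / (3/2) \<le> \<bar>y\<bar> ^ 6 / g ^ 6 + \<bar>y\<bar> powr ?\<sigma>"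
    proof -
      have "a / 3 + b / (3/2) \<le> a + b" if "0 \<le> a" "0 \<le> b" for a b :: real using that by simp
      then show ?thesis using g by (metis abs_ge_zero divide_nonneg_nonneg less_imp_le powr_ge_zero zero_le_power)
    qed
    finally show ?thesis using g by simp
  qed simp
  have "(\<integral>\<^sup>+x. ennreal (\<bar>v x\<bar> powr (m + 1)) \<partial>N)
      \<le> (\<integral>\<^sup>+x. ennreal (g\<^sup>2 / g ^ 6) * ennreal (\<bar>v x\<bar> ^ 6) + ennreal (g\<^sup>2) * ennreal (\<bar>v x\<bar> powr ?\<sigma>) \<partial>N)"
  proof (intro nn_integral_mono)
    fix x
    have "ennreal (\<bar>v x\<bar> powr (m + 1)) \<le> ennreal (g\<^sup>2 / g ^ 6 * \<bar>v x\<bar> ^ 6 + g\<^sup>2 * \<bar>v x\<bar> powr ?\<sigma>)"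
      using pt[of "v x"] by (intro ennreal_leI) (simp add: distrib_left)
    also have "\<dots> = ennreal (g\<^sup>2 / g ^ 6 * \<bar>v x\<bar> ^ 6) + ennreal (g\<^sup>2 * \<bar>v x\<bar> powr ?\<sigma>)"
      using g by (intro ennreal_plus) auto
    also have "\<dots> = ennreal (g\<^sup>2 / g ^ 6) * ennreal (\<bar>v x\<bar> ^ 6) + ennreal (g\<^sup>2) * ennreal (\<bar>v x\<bar> powr ?\<sigma>)"
      using g by (intro arg_cong2[where f = "(+)"] ennreal_mult) auto
    finally show "ennreal (\<bar>v x\<bar> powr (m + 1)) \<le> ennreal (g\<^sup>2 / g ^ 6) * ennreal (\<bar>v x\<bar> ^ 6) + ennreal (g\<^sup>2) * ennreal (\<bar>v x\<bar> powr ?\<sigma>)" .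
  qed
  also have "\<dots> = ennreal (g\<^sup>2 / g ^ 6) * (\<integral>\<^sup>+x. ennreal (\<bar>v x\<bar> ^ 6) \<partial>N) + ennreal (g\<^sup>2) * (\<integral>\<^sup>+x. ennreal (\<bar>v x\<bar> powr ?\<sigma>) \<partial>N)"
    using vm by (simp add: nn_integral_add nn_integral_cmult)
  also have "\<dots> \<le> ennreal (g\<^sup>2 / g ^ 6) * ennreal (C * g ^ 6) + ennreal (g\<^sup>2) * ennreal (R powr ?\<sigma>)"
    by (intro add_mono mult_left_mono six s) auto
  also have "\<dots> = ennreal (g\<^sup>2 / g ^ 6 * (C * g ^ 6)) + ennreal (g\<^sup>2 * R powr ?\<sigma>)"
    using g nn by (intro arg_cong2[where f = "(+)"] ennreal_mult[symmetric]) auto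
  also have "\<dots> = ennreal (g\<^sup>2 / g ^ 6 * (C * g ^ 6) + g\<^sup>2 * R powr ?\<sigma>)"
    using g nn by (intro ennreal_plus[symmetric]) auto
  also have "g\<^sup>2 / g ^ 6 * (C * g ^ 6) + g\<^sup>2 * R powr ?\<sigma> = (C + R powr ?\<sigma>) * g\<^sup>2"
    using g by (simp add: field_simps)
  finally show ?thesis .
qed

text \<open>For \<open>m <= 5\<close> the exponent \<open>m + 1\<close> is within the Sobolev range
  and the surplus powers of the gradient norm are bounded by \<open>s\<close>; for larger
  \<open>m\<close> the bound \<open>R\<close> takes over. Either way the result is quadratic in the
  gradient norm.\<close>

lemma Omega_damping_power:
  assumes A: "admissible_domain S" and E: "embedding_constants S" and m: "1 \<le> m"
  obtains b where "0 \<le> b" "\<And>v. v \<in> H1_Gamma0 S \<Longrightarrow> grad_norm (Omega S) v \<le> s \<Longrightarrow>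
    (5 < m \<longrightarrow> v \<in> Lp (3/2 * (m - 1)) (mO S) \<and> Lp_norm (3/2 * (m - 1)) (mO S) v \<le> R) \<Longrightarrow>
    (\<integral>\<^sup>+x. ennreal (\<bar>v x\<bar> powr (m + 1)) \<partial>mO S) \<le> ennreal (b * (grad_norm (Omega S) v)\<^sup>2)"
proof (cases "5 < m")
  case True
  obtain C where C: "0 \<le> C" "\<And>u. u \<in> H1_Gamma0 S \<Longrightarrow>
    (\<integral>\<^sup>+y. ennreal (\<bar>u y\<bar> ^ 6) \<partial>mO S) \<le> ennreal (C * grad_norm (Omega S) u ^ 6)"
    by (rule Omega_power_embedding[OF A E]) blast
  have g: "0 \<le> grad_norm (Omega S) v" for v by (simp add: grad_norm_def Lp_norm_def)
  show thesis
  proof (rule that)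
    show "0 \<le> C + R powr (3/2 * (m - 1))" using C(1) by simp
    fix v assume v: "v \<in> H1_Gamma0 S" "5 < m \<longrightarrow> v \<in> Lp (3/2 * (m - 1)) (mO S) \<and> Lp_norm (3/2 * (m - 1)) (mO S) v \<le> R"
    then show "(\<integral>\<^sup>+x. ennreal (\<bar>v x\<bar> powr (m + 1)) \<partial>mO S) \<le> ennreal ((C + R powr (3/2 * (m - 1))) * (grad_norm (Omega S) v)\<^sup>2)"
      using True by (intro power_trading C g) auto
  qed
next
  case False
  obtain C where C: "0 \<le> C" "\<And>u. u \<in> H1_Gamma0 S \<Longrightarrow>
    (\<integral>\<^sup>+y. ennreal (\<bar>u y\<bar> powr (m + 1)) \<partial>mO S) \<le> ennreal (C * grad_norm (Omega S) u powr (m + 1))"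
    by (rule Omega_powr_embedding[OF A E, of "m + 1"]) (use m False in auto)
  show thesis
  proof (rule that)
    show "0 \<le> C * s powr (m - 1)" using C(1) by simp
    fix v assume v: "v \<in> H1_Gamma0 S" "grad_norm (Omega S) v \<le> s"
    have "C * grad_norm (Omega S) v powr (m + 1) \<le> C * (s powr (m - 1) * (grad_norm (Omega S) v)\<^sup>2)"
      by (intro mult_left_mono powr_le_square C(1) v m) (simp add: grad_norm_def Lp_norm_def)
    then show "(\<integral>\<^sup>+x. ennreal (\<bar>v x\<bar> powr (m + 1)) \<partial>mO S) \<le> ennreal (C * s powr (m - 1) * (grad_norm (Omega S) v)\<^sup>2)"
      by (intro order_trans[OF C(2)[OF v(1)]] ennreal_leI) (simp add: mult.assoc)
  qed
qed

lemma Gamma_damping_power: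
  assumes A: "admissible_domain S" and E: "embedding_constants S" and r: "1 \<le> r"
  obtains b where "0 \<le> b" "\<And>v. v \<in> H20_Gamma S \<Longrightarrow> lap_norm (Gamma_plane S) v \<le> s \<Longrightarrow>
    (\<integral>\<^sup>+x. ennreal (\<bar>v x\<bar> powr (r + 1)) \<partial>mG S) \<le> ennreal (b * (lap_norm (Gamma_plane S) v)\<^sup>2)"
proof -
  obtain C where C: "0 \<le> C" "\<And>w. w \<in> H20_Gamma S \<Longrightarrow>
    (\<integral>\<^sup>+y. ennreal (\<bar>w y\<bar> powr (r + 1)) \<partial>mG S) \<le> ennreal (C * lap_norm (Gamma_plane S) w powr (r + 1))"
    by (rule Gamma_powr_embedding[OF A E, of "r + 1"]) (use r in auto)
  show thesis
  proof (rule that)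
    show "0 \<le> C * s powr (r - 1)" using C(1) by simp
    fix v assume v: "v \<in> H20_Gamma S" "lap_norm (Gamma_plane S) v \<le> s"
    have "C * lap_norm (Gamma_plane S) v powr (r + 1) \<le> C * (s powr (r - 1) * (lap_norm (Gamma_plane S) v)\<^sup>2)"
      by (intro mult_left_mono powr_le_square C(1) v r) (simp add: lap_norm_def Lp_norm_def)
    then show "(\<integral>\<^sup>+x. ennreal (\<bar>v x\<bar> powr (r + 1)) \<partial>mG S) \<le> ennreal (C * s powr (r - 1) * (lap_norm (Gamma_plane S) v)\<^sup>2)"
      by (intro order_trans[OF C(2)[OF v(1)]] ennreal_leI) (simp add: mult.assoc)
  qed
qed

text \<open>The inner argument is the chosen \<open>\<eta>\<close>. With it the share of the initial
  energy is at most half of \<open>1 - const_xi S \<delta>\<close>, whence the factor 2 after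
  absorption; the summand 1 comes from replacing the initial energy by the energy at time 1 plus the
  dissipation.\<close>

definition decay_K :: "acoustic \<Rightarrow> real \<Rightarrow> real \<Rightarrow> real \<Rightarrow> real \<Rightarrow> real" where
  "decay_K S \<delta> tr bm br =
     2 * decay_C S tr ((1 - const_xi S \<delta>) / (2 * (decay_A S tr bm br + 1))) / (1 - const_xi S \<delta>) + 1"

context well_estimate
begin

lemma Phi_mono:
  assumes "0 \<le> a" "a \<le> b" shows "0 \<le> Phi S a" "Phi S a \<le> Phi S b"
proof -
  have "conc_phi1 S a \<le> conc_phi1 S b" "conc_phi2 S a \<le> conc_phi2 S b" "0 \<le> conc_phi1 S a" "0 \<le> conc_phi2 S a"
    using maj assms by (auto simp: concave_majorant_def intro: mono_onD)
  then show "0 \<le> Phi S a" "Phi S a \<le> Phi S b" using assms by (simp_all add: Phi_def)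
qed

text \<open>The estimate on the unit interval is carried to \<open>T\<close> in two monotone steps:
  the energy decreases from 1 to \<open>T\<close>, while the dissipation, and \<open>Phi\<close> of
  it, increases.\<close>

lemma energy_decay:
  assumes T: "1 \<le> T"
  shows "EE T \<le> decay_K S \<delta> tr bm br * Phi S (dissipation S ut wt T)"
proof -
  define x where "x = 1 - const_xi S \<delta>"
  define A where "A = decay_A S tr bm br"
  define \<eta> where "\<eta> = x / (2 * (A + 1))"
  define C where "C = decay_C S tr \<eta>"
  have x: "0 < x" using constants(5) by (simp add: x_def)
  have A: "0 \<le> A" using c_gt emb_pos tr(1) bm(1) br(1) unfolding A_def decay_A_def
    by (intro mult_nonneg_nonneg add_nonneg_nonneg divide_nonneg_nonneg) auto
  have \<eta>: "0 < \<eta>" using x A by (simp add: \<eta>_def)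
  have "x * (A / (A + 1)) \<le> x * 1" using x A by (intro mult_left_mono) auto
  then have \<eta>A: "\<eta> * A \<le> x / 2" using A by (simp add: \<eta>_def field_simps)
  have mass: "0 \<le> decay_mass S" using damp(3) by (simp add: decay_mass_def)
  have C: "0 \<le> C" using \<eta> tr(1) mass unfolding C_def decay_C_def
    by (intro mult_nonneg_nonneg add_nonneg_nonneg divide_nonneg_nonneg) auto
  have "x * EE 1 \<le> C * Z + \<eta> * A * EE 0" unfolding x_def A_def C_def by (rule decay_estimate[OF \<eta>])
  also have "\<dots> \<le> C * Z + x / 2 * EE 0" using EE_nonneg[of 0] by (intro add_left_mono mult_right_mono \<eta>A) simp
  \<comment> \<open>The initial energy differs from the energy at time 1 by the dissipation, which
    is at most \<open>Z\<close>; half of the left side is absorbed.\<close>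
  also have "EE 0 = EE 1 + (DO + DG)" using energy(1)[of 1] by (simp add: dissipation_split)
  also have "C * Z + x / 2 * (EE 1 + (DO + DG)) \<le> C * Z + x / 2 * (EE 1 + Z)" using x Phi_bounds(6) by simp
  finally have "x / 2 * EE 1 \<le> (C + x / 2) * Z" by (simp add: field_simps)
  then have E1: "EE 1 \<le> (2 * C / x + 1) * Z" using x by (simp add: field_simps)
  have d: "0 \<le> dissipation S ut wt 1" "dissipation S ut wt 1 \<le> dissipation S ut wt T"
    using dissipation_mono[of 1 T] T by auto
  have "EE T \<le> EE 1" using energy(1)[of T] energy(1)[of 1] d(2) T by simp
  also note E1
  also have "(2 * C / x + 1) * Z \<le> (2 * C / x + 1) * Phi S (dissipation S ut wt T)"
    unfolding Z_def using C x by (intro mult_left_mono Phi_mono d) simp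
  also have "2 * C / x + 1 = decay_K S \<delta> tr bm br" by (simp add: decay_K_def C_def x_def \<eta>_def A_def)
  finally show ?thesis .
qed

end

section \<open>Choice of the Young constant and the final estimate\<close>

text \<open>\<open>C_tilde\<close> is affine in \<open>Cy\<close> with slope proportional to the
  total measure, which is positive; the rest is positive too, so \<open>Cy\<close> can be solved for
  any target \<open>K\<close>.\<close>

lemma C_tilde_large:
  assumes A: "admissible_domain S" and x: "const_xi S \<delta> < 1" and c: "2 < const_c S"
  obtains Cy where "0 < Cy" "0 < C_tilde S \<delta> Cy" "K \<le> C_tilde S \<delta> Cy"
proof -
  note af = admissible_facts[OF A]
  define \<mu> where "\<mu> = measure lebesgue (Omega S) + measure lebesgue (Gamma_plane S)"
  have \<mu>: "0 < \<mu>" using bounded_open_measure(2)[OF af(1,2,4)] bounded_open_measure(2)[OF af(5,6,7)] by (simp add: \<mu>_def)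
  define x where "x = 4 / (1 - const_xi S \<delta>)"
  have x: "0 < x" using assms(2) by (simp add: x_def)
  define h where "h = const_c S * const_c0 S / (const_c S - 2)"
  have "1 \<le> const_c0 S" by (simp add: const_c0_def)
  then have h: "0 < h" using c by (simp add: h_def)
  have C: "C_tilde S \<delta> Cy = x * (h + Cy * \<mu>)" for Cy by (simp add: C_tilde_def x_def h_def \<mu>_def)
  define Cy where "Cy = (\<bar>K\<bar> + 1) / (x * \<mu>)"
  have "C_tilde S \<delta> Cy = x * h + (\<bar>K\<bar> + 1)" unfolding C Cy_def using x \<mu> by (simp add: field_simps)
  moreover have "0 < x * h" using x h by simp
  ultimately show thesis using that[of Cy] x \<mu> by (simp add: Cy_def)
qed

text \<open>The order of the quantifiers expresses the uniformity: \<open>Cy\<close> is chosen after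
  \<open>\<delta>\<close> and the radius \<open>R\<close> of the additional bound, and before the
  data, the solution and \<open>T\<close>.\<close>

theorem lemma4p1:
  fixes S :: acoustic
  assumes "admissible_domain S"
    and "conditions_A S"
    and "conditions_B S"
    and "1 < exp_p S" and "exp_p S < 5" and "1 < exp_q S"
    and "embedding_constants S"
    and "concave_majorant (conc_phi1 S) (damp_g1 S)"
    and "concave_majorant (conc_phi2 S) (damp_g2 S)"
  shows "\<exists>\<delta>0>0. \<forall>\<delta>. 0 < \<delta> \<and> \<delta> < \<delta>0 \<longrightarrow>
    (\<forall>R. \<exists>Cy>0. 0 < C_tilde S \<delta> Cy \<and>
      (\<forall>u0 u1 w0 w1 u ut w wt.
         u0 \<in> H1_Gamma0 S \<and> u0 \<in> Lp (exp_m S + 1) (mO S) \<and> u1 \<in> Lp 2 (mO S) \<and>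
         w0 \<in> H20_Gamma S \<and> w1 \<in> Lp 2 (mG S) \<and>
         (u0, w0) \<in> W1_tilde S \<delta> \<and>
         potential_well_solution S u0 u1 w0 w1 u ut w wt \<and>
         total_energy S u ut w wt 0 \<le> Lambda S (s_star S - \<delta>) \<and>
         (exp_m S > 5 \<longrightarrow> u \<in> Linf_Lp_ball (3/2 * (exp_m S - 1)) (mO S) R)
       \<longrightarrow> (\<forall>T\<ge>time_T0 S.
              total_energy S u ut w wt T \<le> C_tilde S \<delta> Cy * Phi S (dissipation S ut wt T))))"
proof -
  note A = assms(1) and E = assms(7)
  have K: "0 < K1 S" "0 < K2 S" using K1_props(1)[OF A E assms(4,5)] K2_props(1)[OF A E assms(6)] .
  have M: "0 < bound_M S" using assms(3) by (simp add: conditions_B_def)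
  note ss = s_star_props[OF K M assms(4,6)]
  have mr: "1 \<le> exp_m S" "1 \<le> exp_r S" using assms(2) by (auto simp: conditions_A_def damping_condition_def)
  obtain tr where tr: "0 \<le> tr" "\<And>v v'. v \<in> H1_Gamma0 S \<Longrightarrow> v' \<in> H1_Gamma0 S \<Longrightarrow>
      (Lp_norm 2 (mG S) (\<lambda>y. Gamma_trace S v y - Gamma_trace S v' y))\<^sup>2
        \<le> tr * (Lp_norm 2 (mO S) (\<lambda>x. v x - v' x) * H1_norm (Omega S) (\<lambda>x. v x - v' x))"
    by (rule Gamma_trace_diff_bound[OF A]) blast
  obtain br where br: "0 \<le> br" "\<And>v. v \<in> H20_Gamma S \<Longrightarrow> lap_norm (Gamma_plane S) v \<le> s_star S \<Longrightarrow>
    (\<integral>\<^sup>+x. ennreal (\<bar>v x\<bar> powr (exp_r S + 1)) \<partial>mG S) \<le> ennreal (br * (lap_norm (Gamma_plane S) v)\<^sup>2)"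
    by (rule Gamma_damping_power[OF A E mr(2), of "s_star S"]) blast
  show ?thesis
  \<comment> \<open>The threshold is the critical radius itself: every \<open>\<delta>\<close> below
    it leaves a positive radius and makes \<open>const_xi S \<delta>\<close> smaller than 1.\<close>
  proof (rule exI[of _ "s_star S"], intro conjI allI impI)
    show "0 < s_star S" by (rule ss(1))
    fix \<delta> R assume \<delta>: "0 < \<delta> \<and> \<delta> < s_star S"
    obtain bm where bm: "0 \<le> bm" "\<And>v. v \<in> H1_Gamma0 S \<Longrightarrow> grad_norm (Omega S) v \<le> s_star S \<Longrightarrow>
      (5 < exp_m S \<longrightarrow> v \<in> Lp (3/2 * (exp_m S - 1)) (mO S) \<and> Lp_norm (3/2 * (exp_m S - 1)) (mO S) v \<le> R) \<Longrightarrow>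
      (\<integral>\<^sup>+x. ennreal (\<bar>v x\<bar> powr (exp_m S + 1)) \<partial>mO S) \<le> ennreal (bm * (grad_norm (Omega S) v)\<^sup>2)"
      by (rule Omega_damping_power[OF A E mr(1), of "s_star S" R]) blast
    have c: "2 < const_c S" using assms(4,6) by (simp add: const_c_def)
    have xi: "const_xi S \<delta> < 1" using ss(2) \<delta> by simp
    obtain Cy where Cy: "0 < Cy" "0 < C_tilde S \<delta> Cy" "decay_K S \<delta> tr bm br \<le> C_tilde S \<delta> Cy"
      by (rule C_tilde_large[OF A xi c])
    have est: "total_energy S u ut w wt T \<le> C_tilde S \<delta> Cy * Phi S (dissipation S ut wt T)"
      if h: "u0 \<in> Lp (exp_m S + 1) (mO S)" "(u0, w0) \<in> W1_tilde S \<delta>" "potential_well_solution S u0 u1 w0 w1 u ut w wt"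
        "total_energy S u ut w wt 0 \<le> Lambda S (s_star S - \<delta>)"
        "5 < exp_m S \<longrightarrow> u \<in> Linf_Lp_ball (3/2 * (exp_m S - 1)) (mO S) R" and T: "time_T0 S \<le> T"
      for u0 u1 w0 w1 u ut w wt T
    proof -
      interpret well_solution S \<delta> u0 u1 w0 w1 u ut w wt
        using assms \<delta> h(1-4) by unfold_locales auto
      have gl: "grad_norm (Omega S) (u t) \<le> s_star S" "lap_norm (Gamma_plane S) (w t) \<le> s_star S" if "t \<in> {0..1}" for t
        using gr_la_bound[OF that] \<delta> by auto
      \<comment> \<open>The additional bound holds at almost every positive time and is restricted
        to the unit interval.\<close>
      have ball: "AE t in UT. 5 < exp_m S \<longrightarrow> u t \<in> Lp (3/2 * (exp_m S - 1)) (mO S) \<and> Lp_norm (3/2 * (exp_m S - 1)) (mO S) (u t) \<le> R"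
      proof (cases "5 < exp_m S")
        case True
        then have "AE t in lebesgue_on {0..}. u t \<in> Lp (3/2 * (exp_m S - 1)) (mO S) \<and> Lp_norm (3/2 * (exp_m S - 1)) (mO S) (u t) \<le> R"
          using h(5) by (simp add: Linf_Lp_ball_def)
        moreover have "AE t in UT. P t" if "AE t in lebesgue_on {0..}. P t" for P :: "real \<Rightarrow> bool"
          using that by (auto simp: AE_restrict_space_iff elim!: eventually_mono)
        ultimately show ?thesis by (auto elim!: eventually_mono)
      qed simp
      have mem: "AE t in UT. t \<in> {0..1}" by (rule AE_I2) simp
      interpret well_estimate S \<delta> u0 u1 w0 w1 u ut w wt tr bm br
      proof
        show "0 \<le> tr" "0 \<le> bm" "0 \<le> br" by (rule tr(1), rule bm(1), rule br(1))
        show "(Lp_norm 2 (mG S) (\<lambda>y. Gamma_trace S v y - Gamma_trace S v' y))\<^sup>2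
          \<le> tr * (Lp_norm 2 (mO S) (\<lambda>x. v x - v' x) * H1_norm (Omega S) (\<lambda>x. v x - v' x))"
          if "v \<in> H1_Gamma0 S" "v' \<in> H1_Gamma0 S" for v v' by (rule tr(2)[OF that])
        show "AE t in UT. (\<integral>\<^sup>+x. ennreal (\<bar>u t x\<bar> powr (exp_m S + 1)) \<partial>mO S) \<le> ennreal (bm * (gr t)\<^sup>2)"
          using ball mem
        proof eventually_elim
          case (elim t) show ?case by (rule bm(2)[OF spaces(1)[OF elim(2)] gl(1)[OF elim(2)] elim(1)])
        qed
        show "AE t in UT. (\<integral>\<^sup>+y. ennreal (\<bar>w t y\<bar> powr (exp_r S + 1)) \<partial>mG S) \<le> ennreal (br * (la t)\<^sup>2)"
          using mem
        proof eventually_elim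
          case (elim t) show ?case by (rule br(2)[OF spaces(3)[OF elim] gl(2)[OF elim]])
        qed
      qed
      have "1 \<le> time_T0 S" by (simp add: time_T0_def)
      then have T1: "1 \<le> T" using T by simp
      have "0 \<le> Phi S (dissipation S ut wt T)" using dissipation_mono(1)[of T T] T1 by (intro Phi_mono(1)[of _ "dissipation S ut wt T"]) auto
      from order_trans[OF energy_decay[OF T1] mult_right_mono[OF Cy(3) this]] show ?thesis .
    qed
    show "\<exists>Cy>0. 0 < C_tilde S \<delta> Cy \<and>
      (\<forall>u0 u1 w0 w1 u ut w wt.
         u0 \<in> H1_Gamma0 S \<and> u0 \<in> Lp (exp_m S + 1) (mO S) \<and> u1 \<in> Lp 2 (mO S) \<and>
         w0 \<in> H20_Gamma S \<and> w1 \<in> Lp 2 (mG S) \<and>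
         (u0, w0) \<in> W1_tilde S \<delta> \<and>
         potential_well_solution S u0 u1 w0 w1 u ut w wt \<and>
         total_energy S u ut w wt 0 \<le> Lambda S (s_star S - \<delta>) \<and>
         (exp_m S > 5 \<longrightarrow> u \<in> Linf_Lp_ball (3/2 * (exp_m S - 1)) (mO S) R)
       \<longrightarrow> (\<forall>T\<ge>time_T0 S.
              total_energy S u ut w wt T \<le> C_tilde S \<delta> Cy * Phi S (dissipation S ut wt T)))"
    proof (rule exI[of _ Cy], intro conjI allI impI)
      show "0 < Cy" "0 < C_tilde S \<delta> Cy" by (rule Cy(1), rule Cy(2))
      fix u0 u1 w0 w1 u ut w wt T
      assume h: "u0 \<in> H1_Gamma0 S \<and> u0 \<in> Lp (exp_m S + 1) (mO S) \<and> u1 \<in> Lp 2 (mO S) \<and>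
         w0 \<in> H20_Gamma S \<and> w1 \<in> Lp 2 (mG S) \<and>
         (u0, w0) \<in> W1_tilde S \<delta> \<and>
         potential_well_solution S u0 u1 w0 w1 u ut w wt \<and>
         total_energy S u ut w wt 0 \<le> Lambda S (s_star S - \<delta>) \<and>
         (exp_m S > 5 \<longrightarrow> u \<in> Linf_Lp_ball (3/2 * (exp_m S - 1)) (mO S) R)" and T: "time_T0 S \<le> T"
      show "total_energy S u ut w wt T \<le> C_tilde S \<delta> Cy * Phi S (dissipation S ut wt T)"
        by (rule est[OF _ _ _ _ _ T, of u0 w0 u1 w1]) (use h in blast)+
    qed
  qed
qed

end
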